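(* Let $\alpha\in(0,2)$, $d>\alpha$, let $W:\mathbb{R}^d\to[1,\infty)$ be measurable, $\mu(dx)=W(x)^{-1}dx$, and $L=-W(x)(-\Delta)^{\alpha/2}$. (i) Let $\Psi_1(r)=\sup_{|x|\ge r}\frac{|x|^\alpha}{W(x)}$, $\Psi_2(r)=\sup_{|x|\le r}W(x)^2$ and, for constants $c_1,c_2>0$, $$\beta_0(r)=c_1(1+r^{-d/\alpha})\,\Psi_2\big(\Psi_1^{-1}(r\wedge c_2)\big),\qquad r>0,$$ where $\Psi_1^{-1}(r):=\inf\{t>0:\Psi_1(t)\le r\}$. If $\lim_{r\to\infty}\Psi_1(r)=0$ and $$\int_s^\infty\frac{\beta_0^{-1}(r)}{r}\,dr<\infty$$ for large $s>0$, where $\beta_0^{-1}(r):=\inf\{t>0:\beta_0(t)\le r\}$, then the operator $L$ generates a compact semigroup (equivalently, has compact resolvent) on $L^2(\mathbb{R}^d;\mu)$. (ii) If $$\sup_{x\in\mathbb{R}^d}\frac{W(x)}{(1+|x|)^\alpha}<\infty,$$ then the semigroup (equivalently, the resolvent) generated by $L$ on $L^2(\mathbb{R}^d;\mu)$ is not compact.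
   Context: Let $D(f,g)=\frac12\int_{\mathbb{R}^d\times\mathbb{R}^d}(f(x)-f(y))(g(x)-g(y))\frac{c_{d,\alpha}}{|x-y|^{d+\alpha}}\,dx\,dy$ with domain $\mathscr{D}(D)=\{f\in L^2(\mathbb{R}^d;dx):D(f,f)<\infty\}$ be the Dirichlet form on $L^2(\mathbb{R}^d;dx)$ of the rotationally symmetric $\alpha$-stable process, whose generator is $-(-\Delta)^{\alpha/2}$ ($c_{d,\alpha}>0$ is the corresponding normalizing constant). Let $\mathscr{D}_e(D)$ be its extended Dirichlet space (the a.e. finite measurable functions that are a.e. limits of $D$-Cauchy sequences in $\mathscr{D}(D)$, with $D$ extended accordingly). The operator $L=-W(x)(-\Delta)^{\alpha/2}$ is the self-adjoint operator on $L^2(\mathbb{R}^d;\mu)$ that is the generator of the regular Dirichlet form $(D,\mathscr{D}(D^\mu))$ on $L^2(\mathbb{R}^d;\mu)$, where $\mathscr{D}(D^\mu)=\mathscr{D}_e(D)\cap L^2(\mathbb{R}^d;\mu)$; $C_c^\infty(\mathbb{R}^d)$ is a core. The associated process is the time change of the stable process $X$ by the inverse of $A_t=\int_0^tW(X_s)^{-1}ds$. The semigroup generated by $L$ is $P_t=e^{tL}$; it is called compact if $P_t$ is a compact operator on $L^2(\mathbb{R}^d;\mu)$ for every $t>0$. Here $a\wedge b=\min\{a,b\}$ and $\inf\emptyset=\infty$. *)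

theory Defs
  imports "HOL-Analysis.Analysis"
begin

subsection \<open>Operators on the real Hilbert space \<open>L\<^sup>2(M)\<close>\<close>

text \<open>
  Elements of \<open>L\<^sup>2(M)\<close> are represented by square-integrable measurable functions; identification of
  functions that agree almost everywhere is built into each notion below.
\<close>

definition L2 :: "'a measure \<Rightarrow> ('a \<Rightarrow> real) set" where
  "L2 M = {f. f \<in> borel_measurable M \<and> integrable M (\<lambda>x. (f x)\<^sup>2)}"

definition l2_inner :: "'a measure \<Rightarrow> ('a \<Rightarrow> real) \<Rightarrow> ('a \<Rightarrow> real) \<Rightarrow> real" where
  "l2_inner M f g = (LINT x|M. f x * g x)"

definition l2_norm :: "'a measure \<Rightarrow> ('a \<Rightarrow> real) \<Rightarrow> real" where
  "l2_norm M f = sqrt (l2_inner M f f)"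

text \<open>
  Linearity together with the norm bound forces \<^term>\<open>T\<close> to respect almost-everywhere equality.
\<close>

definition bounded_operator :: "'a measure \<Rightarrow> (('a \<Rightarrow> real) \<Rightarrow> 'a \<Rightarrow> real) \<Rightarrow> bool" where
  "bounded_operator M T \<longleftrightarrow>
     (\<forall>f\<in>L2 M. T f \<in> L2 M) \<and>
     (\<forall>f\<in>L2 M. \<forall>g\<in>L2 M. \<forall>a b. AE x in M. T (\<lambda>y. a * f y + b * g y) x = a * T f x + b * T g x) \<and>
     (\<exists>C. \<forall>f\<in>L2 M. l2_norm M (T f) \<le> C * l2_norm M f)"

definition compact_operator :: "'a measure \<Rightarrow> (('a \<Rightarrow> real) \<Rightarrow> 'a \<Rightarrow> real) \<Rightarrow> bool" where
  "compact_operator M T \<longleftrightarrow>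
     bounded_operator M T \<and>
     (\<forall>f :: nat \<Rightarrow> 'a \<Rightarrow> real.
        (\<forall>n. f n \<in> L2 M) \<and> (\<exists>C. \<forall>n. l2_norm M (f n) \<le> C) \<longrightarrow>
        (\<exists>g\<in>L2 M. \<exists>r :: nat \<Rightarrow> nat. strict_mono r \<and>
           (\<lambda>n. l2_norm M (\<lambda>x. T (f (r n)) x - g x)) \<longlonglongrightarrow> 0))"

text \<open>
  Unbounded operators are given by their graphs. \<open>P\<close> is the semigroup generated by \<open>L\<close>
  if it is a strongly continuous semigroup whose infinitesimal generator, including its domain, is \<open>L\<close>.
\<close>

definition generates_semigroup ::
  "'a measure \<Rightarrow> (('a \<Rightarrow> real) \<times> ('a \<Rightarrow> real)) set \<Rightarrow> (real \<Rightarrow> ('a \<Rightarrow> real) \<Rightarrow> 'a \<Rightarrow> real) \<Rightarrow> bool" where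
  "generates_semigroup M L P \<longleftrightarrow>
     (\<forall>t\<ge>0. bounded_operator M (P t)) \<and>
     (\<forall>f\<in>L2 M. AE x in M. P 0 f x = f x) \<and>
     (\<forall>s\<ge>0. \<forall>t\<ge>0. \<forall>f\<in>L2 M. AE x in M. P (s + t) f x = P s (P t f) x) \<and>
     (\<forall>f\<in>L2 M. ((\<lambda>t. l2_norm M (\<lambda>x. P t f x - f x)) \<longlongrightarrow> 0) (at_right 0)) \<and>
     L = {(f, g). f \<in> L2 M \<and> g \<in> L2 M \<and>
            ((\<lambda>t. l2_norm M (\<lambda>x. (P t f x - f x) / t - g x)) \<longlongrightarrow> 0) (at_right 0)}"

definition compact_semigroup ::
  "'a measure \<Rightarrow> (real \<Rightarrow> ('a \<Rightarrow> real) \<Rightarrow> 'a \<Rightarrow> real) \<Rightarrow> bool" where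
  "compact_semigroup M P \<longleftrightarrow> (\<forall>t>0. compact_operator M (P t))"

text \<open>\<open>R\<close> is the bounded two-sided inverse of \<open>l - L\<close>.\<close>

definition is_resolvent ::
  "'a measure \<Rightarrow> (('a \<Rightarrow> real) \<times> ('a \<Rightarrow> real)) set \<Rightarrow> real \<Rightarrow> (('a \<Rightarrow> real) \<Rightarrow> 'a \<Rightarrow> real) \<Rightarrow> bool" where
  "is_resolvent M L l R \<longleftrightarrow>
     bounded_operator M R \<and>
     (\<forall>f\<in>L2 M. (R f, \<lambda>x. l * R f x - f x) \<in> L) \<and>
     (\<forall>(u, g)\<in>L. AE x in M. R (\<lambda>y. l * u y - g y) x = u x)"

definition has_compact_resolvent ::
  "'a measure \<Rightarrow> (('a \<Rightarrow> real) \<times> ('a \<Rightarrow> real)) set \<Rightarrow> bool" where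
  "has_compact_resolvent M L \<longleftrightarrow> (\<exists>l R. is_resolvent M L l R \<and> compact_operator M R)"

text \<open>
  The operator \<open>L\<close> associated with a closed symmetric form \<open>(E, F)\<close> on \<open>L\<^sup>2(M)\<close>,
  with the sign convention \<open>E(u, v) = \<langle>- L u, v\<rangle>\<close>.
\<close>

definition form_generator ::
  "'a measure \<Rightarrow> ('a \<Rightarrow> real) set \<Rightarrow> (('a \<Rightarrow> real) \<Rightarrow> ('a \<Rightarrow> real) \<Rightarrow> real)
     \<Rightarrow> (('a \<Rightarrow> real) \<times> ('a \<Rightarrow> real)) set" where
  "form_generator M F E = {(u, f). u \<in> F \<and> f \<in> L2 M \<and> (\<forall>v\<in>F. E u v = - l2_inner M f v)}"


subsection \<open>The Dirichlet form of the rotationally symmetric stable process\<close>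

text \<open>
  The constant for which the generator of \<open>D\<close> on \<open>L\<^sup>2(dx)\<close> is exactly \<open>- (- \<Delta>)\<^bsup>\<alpha>/2\<^esup>\<close>, i.e. for which
  \<open>D(u, u) = \<integral> |\<xi>|\<^sup>\<alpha> |(F u)(\<xi>)|\<^sup>2 d\<xi>\<close> with \<open>F\<close> the unitary Fourier transform.
\<close>

definition stable_const :: "'a::euclidean_space itself \<Rightarrow> real \<Rightarrow> real" where
  "stable_const _ \<alpha> =
     \<alpha> * 2 powr (\<alpha> - 1) * Gamma ((real DIM('a) + \<alpha>) / 2) /
     (pi powr (real DIM('a) / 2) * Gamma (1 - \<alpha> / 2))"

definition stable_integrand ::
  "real \<Rightarrow> ('a::euclidean_space \<Rightarrow> real) \<Rightarrow> ('a \<Rightarrow> real) \<Rightarrow> 'a \<times> 'a \<Rightarrow> real" where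
  "stable_integrand \<alpha> f g = (\<lambda>(x, y). (f x - f y) * (g x - g y) *
     (stable_const TYPE('a) \<alpha> / norm (x - y) powr (real DIM('a) + \<alpha>)))"

definition stable_form ::
  "real \<Rightarrow> ('a::euclidean_space \<Rightarrow> real) \<Rightarrow> ('a \<Rightarrow> real) \<Rightarrow> real" where
  "stable_form \<alpha> f g = 1 / 2 * (LINT z|(lborel \<Otimes>\<^sub>M lborel). stable_integrand \<alpha> f g z)"

definition stable_dom :: "real \<Rightarrow> ('a::euclidean_space \<Rightarrow> real) set" where
  "stable_dom \<alpha> = {f \<in> L2 lborel. integrable (lborel \<Otimes>\<^sub>M lborel) (stable_integrand \<alpha> f f)}"

text \<open>\<open>un\<close> is an approximating sequence of \<open>u\<close> in the sense of the extended Dirichlet space.\<close>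

definition stable_approx ::
  "real \<Rightarrow> (nat \<Rightarrow> 'a::euclidean_space \<Rightarrow> real) \<Rightarrow> ('a \<Rightarrow> real) \<Rightarrow> bool" where
  "stable_approx \<alpha> un u \<longleftrightarrow>
     (\<forall>n. un n \<in> stable_dom \<alpha>) \<and>
     (\<forall>e>0. \<exists>N. \<forall>m\<ge>N. \<forall>n\<ge>N.
        stable_form \<alpha> (\<lambda>x. un m x - un n x) (\<lambda>x. un m x - un n x) < e) \<and>
     (AE x in lborel. (\<lambda>n. un n x) \<longlonglongrightarrow> u x)"

definition stable_ext_dom :: "real \<Rightarrow> ('a::euclidean_space \<Rightarrow> real) set" where
  "stable_ext_dom \<alpha> = {u \<in> borel_measurable lborel. \<exists>un. stable_approx \<alpha> un u}"

text \<open>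
  The extension of \<open>D\<close> to the extended Dirichlet space; for elements of that space the limit
  exists and does not depend on the approximating sequences.
\<close>

definition stable_ext_form ::
  "real \<Rightarrow> ('a::euclidean_space \<Rightarrow> real) \<Rightarrow> ('a \<Rightarrow> real) \<Rightarrow> real" where
  "stable_ext_form \<alpha> u v =
     (THE l. \<exists>un vn. stable_approx \<alpha> un u \<and> stable_approx \<alpha> vn v \<and>
        (\<lambda>n. stable_form \<alpha> (un n) (vn n)) \<longlonglongrightarrow> l)"


subsection \<open>The time-changed operator \<open>L = - W (- \<Delta>)\<^bsup>\<alpha>/2\<^esup>\<close>\<close>

definition weighted_measure :: "('a::euclidean_space \<Rightarrow> real) \<Rightarrow> 'a measure" where
  "weighted_measure W = density lborel (\<lambda>x. ennreal (1 / W x))"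

definition time_changed_operator ::
  "real \<Rightarrow> ('a::euclidean_space \<Rightarrow> real) \<Rightarrow> (('a \<Rightarrow> real) \<times> ('a \<Rightarrow> real)) set" where
  "time_changed_operator \<alpha> W =
     form_generator (weighted_measure W)
       (stable_ext_dom \<alpha> \<inter> L2 (weighted_measure W)) (stable_ext_form \<alpha>)"


subsection \<open>Rate functions\<close>

text \<open>
  All rate functions take values in \<open>[0, \<infinity>]\<close>, since the suprema may be infinite. In
  \<^typ>\<open>ennreal\<close> the infimum of the empty set is \<open>\<infinity>\<close>, as required.
\<close>

definition rate_inverse :: "(real \<Rightarrow> ennreal) \<Rightarrow> ennreal \<Rightarrow> ennreal" where
  "rate_inverse F r = Inf (ennreal ` {t. 0 < t \<and> F t \<le> r})"

definition Psi1 :: "real \<Rightarrow> ('a::euclidean_space \<Rightarrow> real) \<Rightarrow> real \<Rightarrow> ennreal" where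
  "Psi1 \<alpha> W r = (SUP x\<in>{x. norm x \<ge> r}. ennreal (norm x powr \<alpha> / W x))"

definition Psi2 :: "('a::euclidean_space \<Rightarrow> real) \<Rightarrow> ennreal \<Rightarrow> ennreal" where
  "Psi2 W r = (SUP x\<in>{x. ennreal (norm x) \<le> r}. ennreal ((W x)\<^sup>2))"

definition beta0 ::
  "real \<Rightarrow> ('a::euclidean_space \<Rightarrow> real) \<Rightarrow> real \<Rightarrow> real \<Rightarrow> real \<Rightarrow> ennreal" where
  "beta0 \<alpha> W c1 c2 r =
     ennreal (c1 * (1 + r powr (- (real DIM('a) / \<alpha>)))) *
     Psi2 W (rate_inverse (Psi1 \<alpha> W) (ennreal (min r c2)))"

end

theory Submission
  imports Defs
begin

text \<open>
  Everything is read off from the form \<open>D\<close> on \<open>L\<^sup>2(\<mu>)\<close>. By Fatou's lemma the extension of \<open>D\<close> to the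
  extended Dirichlet space is still the double integral, and the Hardy inequality
  \<open>\<integral> u\<^sup>2 |x|\<^bsup>-\<alpha>\<^esup> dx \<le> K D(u, u)\<close> (\<open>\<alpha> < d\<close>) makes that space complete, so \<open>D\<close> is a closed, densely
  defined form. Its semigroup is the limit of the backward Euler iterates \<open>(1 - (t / 2\<^sup>n) L)\<inverse>\<close> taken
  \<open>2\<^sup>n\<close> times, and every semigroup generated by \<open>L\<close> coincides with it. The energy of the iterates is at
  most \<open>\<parallel>f\<parallel>\<^sup>2 / (2 t)\<close>, so semigroup and resolvent are compact as soon as the form domain embeds
  compactly into \<open>L\<^sup>2(\<mu>)\<close>.

  (i) If \<open>|x|\<^sup>\<alpha> / W(x)\<close> tends to 0 at infinity, then the Hardy inequality makes the \<open>L\<^sup>2(\<mu>)\<close>-tails of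
  a set of bounded energy uniformly small, while on bounded sets replacing \<open>u\<close> by its averages over
  small cubes costs little in \<open>L\<^sup>2(dx)\<close>; hence the embedding is compact.

  (ii) If \<open>W(x) \<le> C (1 + |x|)\<^sup>\<alpha>\<close>, then bumps living on the annuli \<open>2\<^bsup>n+1\<^esup> \<le> |x| < 2\<^bsup>n+2\<^esup>\<close>,
  normalised in \<open>L\<^sup>2(\<mu>)\<close>, are orthonormal with bounded energy. Then
  \<open>\<langle>(1 - L)\<inverse> g, g\<rangle> \<ge> 1 / (1 + D(g, g))\<close> stays away from 0 along this weakly null sequence.
\<close>

subsection \<open>Closed forms and their resolvents\<close>

text \<open>Both claims quantify over every \<open>P\<close> that the operator generates, so a
  concrete semigroup is needed on which compactness can be tested, and a uniqueness proof that makes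
  \<open>P\<close> agree with it. Backward Euler products fit: they use nothing but solutions of the
  resolvent equation, which minimising a quadratic functional supplies; they contract, commute, and
  their energy can be followed step by step. Their errors are of second order only on the domain of
  the squared generator, hence the recurring density arguments. \<open>P\<close> is merely bounded
  at each time; Baire's theorem makes it locally bounded, and stability is then borrowed from the
  contraction \<open>Q\<close>. The Hardy inequality comes from comparing the masses of a function
  on neighbouring dyadic shells: going inwards, the weighted mass shrinks by a fixed factor below 1
  up to the energy of that pair of shells, and the errors sum. Completeness follows from it because
  closeness in energy becomes closeness almost everywhere. It also bounds the Lebesgue mass on
  bounded sets, where \<open>W\<close> may be unbounded.\<close>

lemma quadratic_nonneg_imp_zero:
  fixes c q :: real
  assumes "\<And>t. 0 \<le> 2 * t * c + t\<^sup>2 * q" "0 \<le> q"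
  shows "c = 0"
proof -
  \<comment> \<open>The test value is t = -d; the 1 in the denominator keeps the quotient meaningful
    when q = 0.\<close>
  define d where "d = c / (q + 1)"
  have c: "c = d * (q + 1)" using assms(2) by (simp add: d_def)
  have "0 \<le> 2 * (- d) * c + (- d)\<^sup>2 * q" by (rule assms)
  also have "\<dots> = - (d\<^sup>2 * (q + 2))" by (simp add: c power2_eq_square algebra_simps)
  finally have "d = 0" using assms(2) by (simp add: mult_le_0_iff)
  then show ?thesis by (simp add: c)
qed

text \<open>Kept free of any inner product because it serves three settings: abstract semidefinite
  forms, the stable form on functions, and integrals over a set of finite volume.\<close>

lemma discriminant_cauchy_schwarz:
  fixes a b c :: real
  assumes quad: "\<And>t. 0 \<le> a + 2 * t * b + t\<^sup>2 * c" and c: "0 \<le> c"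
  shows "b\<^sup>2 \<le> a * c"
proof (cases "c = 0")
  case True
  \<comment> \<open>For c = 0 the expression is affine in t, and at this t it would equal -1 if b
    were nonzero.\<close>
  then have "b = 0"
    using quad[of "- (a + 1) / (2 * b)"] by (cases "b = 0") (auto simp: field_simps)
  then show ?thesis using True by simp
next
  case False
  then have pos: "c > 0" using c by simp
  have "0 \<le> a + 2 * (- b / c) * b + (- b / c)\<^sup>2 * c" by (rule quad)
  also have "\<dots> = a - b\<^sup>2 / c"
    using pos by (simp add: field_simps power2_eq_square)
  finally show ?thesis using pos by (simp add: field_simps)
qed

text \<open>\<open>B\<close> is defined on the whole type but constrained only on \<open>V\<close>;
  this covers an unbounded form as well as its shifts by the inner product.\<close>

locale semi_inner =
  fixes V :: "'h::real_vector set" and B :: "'h \<Rightarrow> 'h \<Rightarrow> real"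
  assumes subspace: "subspace V"
    and add_left: "u \<in> V \<Longrightarrow> v \<in> V \<Longrightarrow> w \<in> V \<Longrightarrow> B (u + v) w = B u w + B v w"
    and scale_left: "u \<in> V \<Longrightarrow> w \<in> V \<Longrightarrow> B (c *\<^sub>R u) w = c * B u w"
    and sym: "u \<in> V \<Longrightarrow> v \<in> V \<Longrightarrow> B u v = B v u"
    and nonneg: "u \<in> V \<Longrightarrow> 0 \<le> B u u"
begin

lemma mem_add: "u \<in> V \<Longrightarrow> v \<in> V \<Longrightarrow> u + v \<in> V"
  and mem_scale: "u \<in> V \<Longrightarrow> c *\<^sub>R u \<in> V"
  and mem_diff: "u \<in> V \<Longrightarrow> v \<in> V \<Longrightarrow> u - v \<in> V"
  and mem_zero: "0 \<in> V"
  using subspace by (auto intro: subspace_add subspace_scale subspace_diff subspace_0)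

lemma diff_left:
  assumes "u \<in> V" "v \<in> V" "w \<in> V"
  shows "B (u - v) w = B u w - B v w"
  using add_left[of "u - v" v w] mem_diff assms by simp

lemma add_right: "u \<in> V \<Longrightarrow> v \<in> V \<Longrightarrow> w \<in> V \<Longrightarrow> B w (u + v) = B w u + B w v"
  and scale_right: "u \<in> V \<Longrightarrow> w \<in> V \<Longrightarrow> B w (c *\<^sub>R u) = c * B w u"
  and diff_right: "u \<in> V \<Longrightarrow> v \<in> V \<Longrightarrow> w \<in> V \<Longrightarrow> B w (u - v) = B w u - B w v"
  using sym add_left scale_left diff_left mem_add mem_scale mem_diff by metis+

lemma square_add:
  assumes "u \<in> V" "v \<in> V"
  shows "B (u + t *\<^sub>R v) (u + t *\<^sub>R v) = B u u + 2 * t * B u v + t\<^sup>2 * B v v"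
  using assms sym[of v u]
  by (simp add: add_left add_right scale_left scale_right mem_add mem_scale power2_eq_square algebra_simps)

lemma cauchy_schwarz:
  assumes "u \<in> V" "v \<in> V"
  shows "(B u v)\<^sup>2 \<le> B u u * B v v"
proof (rule discriminant_cauchy_schwarz)
  show "0 \<le> B u u + 2 * t * B u v + t\<^sup>2 * B v v" for t
    using square_add[OF assms, of t] nonneg[OF mem_add[OF assms(1) mem_scale[OF assms(2), of t]]] by simp
  show "0 \<le> B v v" using nonneg assms by simp
qed

lemma square_diff:
  assumes "u \<in> V" "v \<in> V"
  shows "B (u - v) (u - v) = B u u - 2 * B u v + B v v"
  using square_add[OF assms, of "-1"] by simp

end

text \<open>Closedness is required sequentially: a sequence that converges in norm and is Cauchy for
  \<open>E\<close> converges for \<open>E\<close> too. This is the shape in which Fatou's lemma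
  delivers it for the stable form.\<close>

locale closed_form = semi_inner V E
  for V :: "'h::{real_inner,banach} set" and E :: "'h \<Rightarrow> 'h \<Rightarrow> real" +
  assumes closed: "\<And>U u. (\<And>n. U n \<in> V) \<Longrightarrow> U \<longlonglongrightarrow> u \<Longrightarrow>
     (\<And>e. e > 0 \<Longrightarrow> \<exists>N. \<forall>m\<ge>N. \<forall>n\<ge>N. E (U m - U n) (U m - U n) < e) \<Longrightarrow>
     u \<in> V \<and> (\<lambda>n. E (U n - u) (U n - u)) \<longlonglongrightarrow> 0"
begin

lemma shifted_semi_inner:
  assumes "h \<ge> 0"
  shows "semi_inner V (\<lambda>u v. u \<bullet> v + h * E u v)"
  by unfold_locales
    (use assms subspace add_left scale_left sym nonneg in \<open>auto simp: inner_add_left algebra_simps inner_commute\<close>)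

text \<open>The equation is the Euler-Lagrange equation of \<open>\<Phi>\<close> v = B(v, v) - 2
  f.v. This functional is bounded below by -|f|^2, convexity makes a minimising sequence Cauchy for
  \<open>B\<close>, and closedness provides its limit inside \<open>V\<close>.\<close>

lemma resolvent_exists:
  assumes h: "h > 0"
  shows "\<exists>u\<in>V. \<forall>v\<in>V. u \<bullet> v + h * E u v = f \<bullet> v"
proof -
  define B where "B = (\<lambda>u v. u \<bullet> v + h * E u v)"
  interpret B: semi_inner V B unfolding B_def by (rule shifted_semi_inner) (use h in simp)
  define \<Phi> where "\<Phi> v = B v v - 2 * (f \<bullet> v)" for v
  have lower: "- (norm f)\<^sup>2 \<le> \<Phi> v" if "v \<in> V" for v
  proof -
    have "0 \<le> (v - f) \<bullet> (v - f)" by simp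
    also have "\<dots> = v \<bullet> v - 2 * (f \<bullet> v) + f \<bullet> f" by (simp add: inner_diff inner_commute)
    finally show ?thesis
      using mult_nonneg_nonneg[OF less_imp_le[OF h] nonneg[OF that]]
      unfolding \<Phi>_def B_def dot_square_norm by linarith
  qed
  have bdd: "bdd_below (\<Phi> ` V)" using lower by (auto intro!: bdd_belowI)
  define m where "m = Inf (\<Phi> ` V)"
  have m_le: "m \<le> \<Phi> v" if "v \<in> V" for v unfolding m_def using bdd that by (auto intro: cInf_lower)
  have "\<exists>u\<in>V. \<Phi> u < m + 1 / (real n + 1)" for n
  proof -
    have "\<exists>x\<in>\<Phi> ` V. x < m + 1 / (real n + 1)"
      unfolding m_def by (rule cInf_lessD) (use mem_zero in \<open>auto intro!: add_pos_nonneg\<close>)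
    then show ?thesis by auto
  qed
  then obtain U where UV: "\<And>n. U n \<in> V" and U: "\<And>n. \<Phi> (U n) < m + 1 / (real n + 1)"
    by metis
  \<comment> \<open>Parallelogram identity: the midpoint of two almost minimisers cannot fall below
    the infimum m, so the two are close to each other.\<close>
  have diff: "B (U i - U j) (U i - U j) \<le> 2 / (real i + 1) + 2 / (real j + 1)" for i j
  proof -
    have mid: "(1/2) *\<^sub>R (U i + U j) \<in> V" by (simp add: UV mem_add mem_scale)
    have "B (U i - U j) (U i - U j) = 2 * \<Phi> (U i) + 2 * \<Phi> (U j) - 4 * \<Phi> ((1/2) *\<^sub>R (U i + U j))"
      unfolding \<Phi>_def using B.sym[OF UV[of i] UV[of j]]
      by (simp add: B.scale_left B.scale_right B.add_left B.add_right B.diff_left B.diff_right UV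
          mem_add mem_scale mem_diff inner_add_right field_simps)
    also have "\<dots> \<le> 2 * (m + 1 / (real i + 1)) + 2 * (m + 1 / (real j + 1)) - 4 * m"
      using U[of i] U[of j] m_le[OF mid] by (smt (verit))
    finally show ?thesis by simp
  qed
  have cauchyB: "\<exists>N. \<forall>i\<ge>N. \<forall>j\<ge>N. B (U i - U j) (U i - U j) < e" if "e > 0" for e
  proof -
    obtain N :: nat where N: "4 / e < real N" using reals_Archimedean2 by blast
    have "B (U i - U j) (U i - U j) < e" if "i \<ge> N" "j \<ge> N" for i j
    proof -
      have "2 / (real k + 1) < e / 2" if "k \<ge> N" for k
      proof -
        have "4 / e < real k + 1" using N that by linarith
        then show ?thesis using \<open>e > 0\<close> by (simp add: field_simps)
      qed
      from this[OF \<open>i \<ge> N\<close>] this[OF \<open>j \<ge> N\<close>] diff[of i j] show ?thesis by linarith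
    qed
    then show ?thesis by blast
  qed
  have "Cauchy U"
  proof (rule metric_CauchyI)
    fix e :: real assume "e > 0"
    then obtain N where N: "\<And>i j. i \<ge> N \<Longrightarrow> j \<ge> N \<Longrightarrow> B (U i - U j) (U i - U j) < e\<^sup>2"
      using cauchyB[of "e\<^sup>2"] by (auto simp: zero_less_power)
    have "dist (U i) (U j) < e" if "i \<ge> N" "j \<ge> N" for i j
    proof -
      have "(norm (U i - U j))\<^sup>2 < e\<^sup>2"
        using N[OF that] nonneg[OF mem_diff[OF UV[of i] UV[of j]]] h
        unfolding B_def power2_norm_eq_inner
        by (meson add_increasing2 le_less_trans mult_nonneg_nonneg less_imp_le order_refl)
      then show ?thesis using \<open>e > 0\<close> by (simp add: dist_norm power_less_imp_less_base)
    qed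
    then show "\<exists>N. \<forall>i\<ge>N. \<forall>j\<ge>N. dist (U i) (U j) < e" by blast
  qed
  then obtain u where u: "U \<longlonglongrightarrow> u" using Cauchy_convergent_iff convergent_def by blast
  have "\<exists>N. \<forall>i\<ge>N. \<forall>j\<ge>N. E (U i - U j) (U i - U j) < e" if "e > 0" for e
  proof -
    obtain N where N: "\<And>i j. i \<ge> N \<Longrightarrow> j \<ge> N \<Longrightarrow> B (U i - U j) (U i - U j) < h * e"
      using cauchyB[of "h * e"] mult_pos_pos[OF h \<open>e > 0\<close>] by blast
    have "E (U i - U j) (U i - U j) < e" if "i \<ge> N" "j \<ge> N" for i j
    proof -
      have "h * E (U i - U j) (U i - U j) < h * e"
        using N[OF that] inner_ge_zero[of "U i - U j"] unfolding B_def by linarith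
      then show ?thesis using h by simp
    qed
    then show ?thesis by blast
  qed
  then have uV: "u \<in> V" and Eu: "(\<lambda>n. E (U n - u) (U n - u)) \<longlonglongrightarrow> 0"
    using closed[OF UV u] by auto
  have Bu: "(\<lambda>n. B (U n - u) (U n - u)) \<longlonglongrightarrow> 0"
  proof -
    have "(\<lambda>n. (U n - u) \<bullet> (U n - u) + h * E (U n - u) (U n - u)) \<longlonglongrightarrow> (u - u) \<bullet> (u - u) + h * 0"
      by (intro tendsto_intros u Eu)
    then show ?thesis by (simp add: B_def)
  qed
  have "B u v = f \<bullet> v" if v: "v \<in> V" for v
  proof -
    have "(\<lambda>n. (B (U n - u) v)\<^sup>2) \<longlonglongrightarrow> 0"
    proof (rule tendsto_sandwich[where f = "\<lambda>_. 0"])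
      show "(\<lambda>n. B (U n - u) (U n - u) * B v v) \<longlonglongrightarrow> 0" using tendsto_mult_right[OF Bu, of "B v v"] by simp
      show "\<forall>\<^sub>F n in sequentially. (B (U n - u) v)\<^sup>2 \<le> B (U n - u) (U n - u) * B v v"
        by (intro always_eventually allI B.cauchy_schwarz mem_diff UV uV v)
    qed auto
    then have "(\<lambda>n. B (U n - u) v) \<longlonglongrightarrow> 0" by (simp add: tendsto_null_power)
    then have "(\<lambda>n. B (U n) v - B u v) \<longlonglongrightarrow> 0" by (simp add: B.diff_left UV uV v)
    then have conv: "(\<lambda>n. B (U n) v) \<longlonglongrightarrow> B u v" by (simp add: LIM_zero_iff)
    \<comment> \<open>The almost minimality of \<open>U n\<close>, tested in direction v, survives
      the limit as nonnegativity of a quadratic in t without constant term; its linear coefficient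
      must vanish.\<close>
    have "0 \<le> 2 * t * (B u v - f \<bullet> v) + t\<^sup>2 * B v v" for t
    proof (rule LIMSEQ_le)
      show "(\<lambda>n. - (1 / (real n + 1))) \<longlonglongrightarrow> 0"
        using tendsto_minus[OF LIMSEQ_inverse_real_of_nat] by (simp add: inverse_eq_divide add.commute)
      show "(\<lambda>n. 2 * t * (B (U n) v - f \<bullet> v) + t\<^sup>2 * B v v) \<longlonglongrightarrow> 2 * t * (B u v - f \<bullet> v) + t\<^sup>2 * B v v"
        by (intro tendsto_intros conv)
      have "- (1 / (real n + 1)) \<le> 2 * t * (B (U n) v - f \<bullet> v) + t\<^sup>2 * B v v" for n
      proof -
        have "m \<le> \<Phi> (U n + t *\<^sub>R v)" by (intro m_le mem_add mem_scale UV v)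
        also have "\<dots> = \<Phi> (U n) + (2 * t * (B (U n) v - f \<bullet> v) + t\<^sup>2 * B v v)"
          unfolding \<Phi>_def B.square_add[OF UV v] by (simp add: inner_add_right algebra_simps)
        finally show ?thesis using U[of n] by linarith
      qed
      then show "\<exists>N. \<forall>n\<ge>N. - (1 / (real n + 1)) \<le> 2 * t * (B (U n) v - f \<bullet> v) + t\<^sup>2 * B v v" by blast
    qed
    then have "B u v - f \<bullet> v = 0" by (rule quadratic_nonneg_imp_zero) (rule B.nonneg[OF v])
    then show ?thesis by simp
  qed
  then show ?thesis using uV unfolding B_def by blast
qed

end

text \<open>Projection onto the closure of \<open>S\<close> is the resolvent of the zero form on
  that closure; what the projection leaves of f is orthogonal to \<open>S\<close>, hence 0.\<close>

lemma dense_if_orthogonal_trivial: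
  fixes S :: "'h::{real_inner,banach} set"
  assumes S: "subspace S" and triv: "\<And>f. (\<And>v. v \<in> S \<Longrightarrow> f \<bullet> v = 0) \<Longrightarrow> f = 0"
  shows "closure S = UNIV"
proof -
  interpret closed_form "closure S" "\<lambda>_ _. 0"
  proof unfold_locales
    show "subspace (closure S)"
      using S subspace_def closure_subset
    proof (intro subspaceI)
      show "0 \<in> closure S" using S closure_subset subspace_0 by blast
      fix x y assume "x \<in> closure S" "y \<in> closure S"
      then obtain X Y where XY: "\<And>n. X n \<in> S" "X \<longlonglongrightarrow> x" "\<And>n. Y n \<in> S" "Y \<longlonglongrightarrow> y"
        unfolding closure_sequential by metis
      have "(\<lambda>n. X n + Y n) \<longlonglongrightarrow> x + y" using XY by (intro tendsto_intros)
      moreover have "\<forall>n. X n + Y n \<in> S" using XY S subspace_add by blast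
      ultimately show "x + y \<in> closure S" unfolding closure_sequential by (intro exI[of _ "\<lambda>n. X n + Y n"]) simp
    next
      fix c x assume "x \<in> closure S"
      then obtain X where X: "\<And>n. X n \<in> S" "X \<longlonglongrightarrow> x"
        unfolding closure_sequential by metis
      have "(\<lambda>n. c *\<^sub>R X n) \<longlonglongrightarrow> c *\<^sub>R x" using X by (intro tendsto_intros)
      moreover have "\<forall>n. c *\<^sub>R X n \<in> S" using X S subspace_scale by blast
      ultimately show "c *\<^sub>R x \<in> closure S" unfolding closure_sequential by (intro exI[of _ "\<lambda>n. c *\<^sub>R X n"]) simp
    qed
    show "u \<in> closure S \<and> (\<lambda>n. 0) \<longlonglongrightarrow> (0::real)" if "\<And>n. U n \<in> closure S" "U \<longlonglongrightarrow> u" for U u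
      using closed_sequentially[OF closed_closure that] by simp
  qed auto
  show ?thesis
  proof (rule set_eqI, simp)
    fix f
    obtain u where u: "u \<in> closure S" "\<And>v. v \<in> closure S \<Longrightarrow> u \<bullet> v = f \<bullet> v"
      using resolvent_exists[of 1 f] by auto
    then have "f - u = 0" using subsetD[OF closure_subset[of S]]
      by (intro triv) (simp add: inner_diff_left u(2))
    then show "f \<in> closure S" using u by simp
  qed
qed

section \<open>Generated semigroups, compact maps and limits from dense sets\<close>

definition semigroup_generated_by ::
  "('h::real_normed_vector \<times> 'h) set \<Rightarrow> (real \<Rightarrow> 'h \<Rightarrow> 'h) \<Rightarrow> bool" where
  "semigroup_generated_by G Q \<longleftrightarrow>
     (\<forall>t\<ge>0. bounded_linear (Q t)) \<and> (\<forall>x. Q 0 x = x) \<and>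
     (\<forall>s\<ge>0. \<forall>t\<ge>0. \<forall>x. Q (s + t) x = Q s (Q t x)) \<and>
     (\<forall>x. ((\<lambda>t. Q t x) \<longlongrightarrow> x) (at_right 0)) \<and>
     G = {(x, y). ((\<lambda>t. (1 / t) *\<^sub>R (Q t x - x)) \<longlongrightarrow> y) (at_right 0)}"

definition compact_map :: "('h::real_normed_vector \<Rightarrow> 'h) \<Rightarrow> bool" where
  "compact_map T \<longleftrightarrow> (\<forall>f :: nat \<Rightarrow> 'h. bounded (range f) \<longrightarrow>
     (\<exists>g r. strict_mono (r :: nat \<Rightarrow> nat) \<and> (\<lambda>n. T (f (r n))) \<longlonglongrightarrow> g))"

lemma compact_map_of_range:
  fixes T :: "'h::real_normed_vector \<Rightarrow> 'h"
  assumes "\<And>B. \<exists>K. compact K \<and> (\<forall>f. norm f \<le> B \<longrightarrow> T f \<in> K)"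
  shows "compact_map T"
  unfolding compact_map_def
proof (intro allI impI)
  fix f :: "nat \<Rightarrow> 'h" assume "bounded (range f)"
  then obtain B where B: "\<And>n. norm (f n) \<le> B" unfolding bounded_iff by auto
  then obtain K where K: "compact K" "\<And>f. norm f \<le> B \<Longrightarrow> T f \<in> K" using assms by meson
  then have "\<forall>n. T (f n) \<in> K" using B by blast
  with K(1) obtain l r where "strict_mono r" "((\<lambda>n. T (f n)) \<circ> r) \<longlonglongrightarrow> l"
    unfolding compact_eq_seq_compact_metric seq_compact_def by metis
  then show "\<exists>g r. strict_mono r \<and> (\<lambda>n. T (f (r n))) \<longlonglongrightarrow> g" by (auto simp: comp_def)
qed

text \<open>Telescoping of a^n - b^n: commutation lets a - b act on x first, and contractivity
  removes the other factors. An error known only at good vectors x thus becomes an error of the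
  whole product at the same x.\<close>

lemma norm_funpow_diff_le:
  fixes a b :: "'h::real_normed_vector \<Rightarrow> 'h"
  assumes lin: "linear a" "linear b"
    and contr: "\<And>x. norm (a x) \<le> norm x" "\<And>x. norm (b x) \<le> norm x"
    and comm: "\<And>x. a (b x) = b (a x)"
  shows "norm ((a ^^ n) x - (b ^^ n) x) \<le> real n * norm (a x - b x)"
proof (induction n)
  case (Suc n)
  have contr_pow: "norm ((a ^^ n) y) \<le> norm y" for n y
    by (induction n) (auto intro: order_trans[OF contr(1)])
  have lin_pow: "(a ^^ n) (y - z) = (a ^^ n) y - (a ^^ n) z" for n y z
    by (induction n) (simp_all add: linear_diff[OF lin(1)])
  have comm_pow: "(a ^^ n) (b y) = b ((a ^^ n) y)" for n y
    by (induction n) (simp_all add: comm)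
  have "(a ^^ Suc n) x - (b ^^ Suc n) x = (a ^^ n) (a x - b x) + b ((a ^^ n) x - (b ^^ n) x)"
    by (simp add: lin_pow comm_pow linear_diff[OF lin(2)] funpow_swap1)
  also have "norm \<dots> \<le> norm ((a ^^ n) (a x - b x)) + norm (b ((a ^^ n) x - (b ^^ n) x))"
    by (rule norm_triangle_ineq)
  also have "\<dots> \<le> norm (a x - b x) + norm ((a ^^ n) x - (b ^^ n) x)"
    by (intro add_mono contr_pow contr)
  also have "\<dots> \<le> real (Suc n) * norm (a x - b x)"
    using Suc.IH by (simp add: algebra_simps)
  finally show ?case .
qed simp

lemma convergent_of_dense:
  fixes T :: "nat \<Rightarrow> 'h::real_normed_vector \<Rightarrow> 'k::banach"
  assumes lin: "\<And>n. linear (T n)" and bound: "\<And>n x. norm (T n x) \<le> norm x"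
    and dense: "closure S = UNIV" and conv: "\<And>x. x \<in> S \<Longrightarrow> convergent (\<lambda>n. T n x)"
  shows "convergent (\<lambda>n. T n x)"
proof -
  have "Cauchy (\<lambda>n. T n x)"
  proof (rule metric_CauchyI)
    fix e :: real assume e: "e > 0"
    have "x \<in> closure S" using dense by simp
    then obtain y where y: "y \<in> S" "dist y x < e / 3"
      using e unfolding closure_approachable by (metis divide_pos_pos zero_less_numeral)
    obtain N where N: "\<And>m n. m \<ge> N \<Longrightarrow> n \<ge> N \<Longrightarrow> dist (T m y) (T n y) < e / 3"
      using conv[OF y(1)] e unfolding convergent_eq_Cauchy Cauchy_def
      by (metis divide_pos_pos zero_less_numeral convergent_Cauchy Cauchy_def conv y(1))
    have close: "dist (T n x) (T n y) < e / 3" for n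
    proof -
      have "norm (T n x - T n y) \<le> norm (x - y)"
        using bound[of n "x - y"] by (simp add: linear_diff[OF lin])
      then show ?thesis using y(2) by (simp add: dist_norm norm_minus_commute)
    qed
    have "dist (T m x) (T n x) < e" if "m \<ge> N" "n \<ge> N" for m n
      using N[OF that] close[of m] close[of n] dist_triangle[of "T m x" "T n x" "T m y"]
        dist_triangle[of "T m y" "T n x" "T n y"] dist_commute[of "T n y" "T n x"]
      by linarith
    then show "\<exists>M. \<forall>m\<ge>M. \<forall>n\<ge>M. dist (T m x) (T n x) < e" by blast
  qed
  then show ?thesis by (rule Cauchy_convergent)
qed

lemma eq_of_dense:
  fixes A B :: "'h::real_normed_vector \<Rightarrow> 'k::real_normed_vector"
  assumes "bounded_linear A" "bounded_linear B" "closure S = UNIV" "\<And>x. x \<in> S \<Longrightarrow> A x = B x"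
  shows "A x = B x"
proof -
  have "closed {x. A x = B x}"
    using assms(1,2) by (intro closed_Collect_eq linear_continuous_on)
  then have "closure S \<subseteq> {x. A x = B x}" using assms(4) by (intro closure_minimal) auto
  then show ?thesis using assms(3) by auto
qed

lemma eventually_at_right_lt: "(c::real) > 0 \<Longrightarrow> \<forall>\<^sub>F h in at_right 0. h < c"
  by (rule order_tendstoD(2)[OF tendsto_ident_at])

lemma norm_add3_le:
  "norm a \<le> A \<Longrightarrow> norm b \<le> B \<Longrightarrow> norm (c :: 'z::real_normed_vector) \<le> C \<Longrightarrow> norm (a + b + c) \<le> A + B + C"
  by (intro norm_triangle_le add_mono)

lemma norm_scaleR_inverse_le:
  "t > 0 \<Longrightarrow> norm y \<le> t * c \<Longrightarrow> norm ((1 / t) *\<^sub>R (y :: 'z::real_normed_vector)) \<le> c"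
  by (simp add: divide_le_eq mult.commute)

text \<open>Density of \<open>V\<close> is stated as triviality of its orthogonal complement, the
  property that testing with bump functions verifies.\<close>

locale dense_closed_form = closed_form V E
  for V :: "'h::{real_inner,banach} set" and E :: "'h \<Rightarrow> 'h \<Rightarrow> real" +
  assumes total: "\<And>f. (\<And>v. v \<in> V \<Longrightarrow> f \<bullet> v = 0) \<Longrightarrow> f = 0"
begin

definition gen :: "('h \<times> 'h) set" where
  "gen = {(u, f). u \<in> V \<and> (\<forall>v\<in>V. E u v = - (f \<bullet> v))}"

text \<open>The backward Euler step \<open>(1 - h L)\<inverse>\<close>; for \<open>h = 0\<close> it is the identity although the
  defining equation is not solvable outside \<open>V\<close>.\<close>

definition J :: "real \<Rightarrow> 'h \<Rightarrow> 'h" where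
  "J h f = (if h \<le> 0 then f else THE u. u \<in> V \<and> (\<forall>v\<in>V. u \<bullet> v + h * E u v = f \<bullet> v))"

lemma resolvent_unique:
  assumes h: "h > 0" and u: "u \<in> V" "\<And>v. v \<in> V \<Longrightarrow> u \<bullet> v + h * E u v = f \<bullet> v"
    and w: "w \<in> V" "\<And>v. v \<in> V \<Longrightarrow> w \<bullet> v + h * E w v = f \<bullet> v"
  shows "u = w"
proof -
  have d: "u - w \<in> V" by (simp add: mem_diff u w)
  have "(u - w) \<bullet> (u - w) + h * E (u - w) (u - w) = 0"
    using u(2)[OF d] w(2)[OF d] by (simp add: diff_left u w d inner_diff_left algebra_simps)
  moreover have "h * E (u - w) (u - w) \<ge> 0" using h nonneg[OF d] by simp
  ultimately have "(u - w) \<bullet> (u - w) = 0" using inner_ge_zero[of "u - w"] by linarith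
  then show ?thesis by simp
qed

lemma J_mem: "h > 0 \<Longrightarrow> J h f \<in> V"
  and J_eq: "h > 0 \<Longrightarrow> v \<in> V \<Longrightarrow> J h f \<bullet> v + h * E (J h f) v = f \<bullet> v"
proof -
  have "J h f \<in> V \<and> (\<forall>v\<in>V. J h f \<bullet> v + h * E (J h f) v = f \<bullet> v)" if h: "h > 0"
  proof -
    have "\<exists>!u. u \<in> V \<and> (\<forall>v\<in>V. u \<bullet> v + h * E u v = f \<bullet> v)"
      using resolvent_exists[OF h, of f] resolvent_unique[OF h] by blast
    from theI'[OF this] show ?thesis using h by (simp add: J_def)
  qed
  then show "h > 0 \<Longrightarrow> J h f \<in> V" "h > 0 \<Longrightarrow> v \<in> V \<Longrightarrow> J h f \<bullet> v + h * E (J h f) v = f \<bullet> v"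
    by auto
qed

lemma J_unique:
  assumes "h > 0" "u \<in> V" "\<And>v. v \<in> V \<Longrightarrow> u \<bullet> v + h * E u v = f \<bullet> v"
  shows "J h f = u"
  by (rule resolvent_unique[OF assms(1) J_mem J_eq assms(2,3)]) (use assms in auto)

lemma J_zero [simp]: "J 0 f = f" by (simp add: J_def)

lemma linear_J: "linear (J h)"
proof (cases "h > 0")
  case True
  show ?thesis
  proof (rule linearI)
    show "J h (x + y) = J h x + J h y" for x y
      by (rule J_unique[OF True])
        (use J_eq[OF True, of _ x] J_eq[OF True, of _ y] in
          \<open>auto simp: mem_add J_mem True add_left inner_add_left algebra_simps\<close>)
    show "J h (c *\<^sub>R x) = c *\<^sub>R J h x" for c x
      by (rule J_unique[OF True])
        (use J_eq[OF True, of _ x] in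
          \<open>auto simp: mem_scale J_mem True scale_left distrib_left[symmetric] mult.left_commute[of h]\<close>)
  qed
qed (simp add: J_def[abs_def] linear_id[unfolded id_def])

lemmas J_diff = linear_diff[OF linear_J]
  and J_add = linear_add[OF linear_J]
  and J_scale = linear_scale[OF linear_J]

lemma norm_J_le: "norm (J h f) \<le> norm f"
proof (cases "h > 0")
  case True
  have "J h f \<bullet> J h f \<le> f \<bullet> J h f"
    using J_eq[OF True J_mem[OF True], of f f] nonneg[OF J_mem[OF True, of f]] True
    by (smt (verit) mult_nonneg_nonneg)
  also have "\<dots> \<le> norm f * norm (J h f)" by (rule norm_cauchy_schwarz)
  finally have "norm (J h f) * norm (J h f) \<le> norm f * norm (J h f)"
    by (simp add: dot_square_norm power2_eq_square)
  then show ?thesis by (cases "J h f = 0") (auto simp: mult_le_cancel_right)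
qed (simp add: J_def)

lemma bounded_linear_J: "bounded_linear (J h)"
  using linear_J norm_J_le
  by (intro bounded_linear_intro[of _ 1]) (auto simp: linear_add linear_scale)

lemma J_gen: "h > 0 \<Longrightarrow> (J h f, (1 / h) *\<^sub>R (J h f - f)) \<in> gen"
  unfolding gen_def using J_eq[of h _ f]
  by (auto simp: J_mem inner_diff_left field_simps)

lemma J_of_gen:
  assumes "h \<ge> 0" "(u, g) \<in> gen"
  shows "J h (u - h *\<^sub>R g) = u"
proof (cases "h = 0")
  case False
  then show ?thesis using assms
    by (intro J_unique) (auto simp: gen_def inner_diff_left)
qed simp

lemma gen_lincomb:
  assumes "(u, g) \<in> gen" "(v, k) \<in> gen"
  shows "(a *\<^sub>R u + b *\<^sub>R v, a *\<^sub>R g + b *\<^sub>R k) \<in> gen"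
  using assms unfolding gen_def
  by (auto simp: mem_add mem_scale add_left scale_left inner_add_left)

lemma gen_diff: "(u, g) \<in> gen \<Longrightarrow> (v, k) \<in> gen \<Longrightarrow> (u - v, g - k) \<in> gen"
  using gen_lincomb[of u g v k 1 "-1"] by simp

lemma gen_unique:
  assumes "(u, g) \<in> gen" "(u, k) \<in> gen"
  shows "g = k"
  using total[of "g - k"] assms by (auto simp: gen_def inner_diff_left)

text \<open>For h > 0, \<open>J_gen\<close> attaches (J h u - u) / h to \<open>J h u\<close>, and
  \<open>J_of_gen\<close> shows that this quotient equals \<open>J h g\<close>.\<close>

lemma gen_J:
  assumes "(u, g) \<in> gen" and h: "h \<ge> 0"
  shows "(J h u, J h g) \<in> gen"
proof (cases "h = 0")
  case False
  then have h: "h > 0" using h by simp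
  have "J h u - u = h *\<^sub>R J h g"
    using J_of_gen[OF less_imp_le[OF h] assms(1)] by (simp add: J_diff J_scale algebra_simps)
  then show ?thesis using J_gen[OF h, of u] h by simp
qed (use assms in simp)

lemma J_step:
  assumes "(u, g) \<in> gen" "h \<ge> 0"
  shows "J h u - u = h *\<^sub>R J h g"
  using J_of_gen[OF assms(2,1)] by (simp add: J_diff J_scale algebra_simps)

text \<open>By \<open>gen_J\<close>, \<open>J s (J t f)\<close> lies in the domain with a known
  image; \<open>J_of_gen\<close> with step t then recognises it as \<open>J t\<close> applied to
  \<open>J s f\<close>.\<close>

lemma J_commute:
  assumes "s \<ge> 0" "t \<ge> 0"
  shows "J s (J t f) = J t (J s f)"
proof (cases "t = 0")
  case False
  then have t: "t > 0" using assms by simp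
  have "J t (J s (J t f) - t *\<^sub>R J s ((1 / t) *\<^sub>R (J t f - f))) = J s (J t f)"
    by (rule J_of_gen[OF assms(2) gen_J[OF J_gen[OF t] assms(1)]])
  then show ?thesis using t by (simp add: J_scale J_diff)
qed simp

text \<open>The local error is \<open>J (s + t) - J s \<circ> J t = s t J (s + t) J s J t L\<^sup>2\<close> on the domain of \<open>L\<^sup>2\<close>.\<close>

lemma J_add_error:
  assumes "(u, g) \<in> gen" "(g, k) \<in> gen" "s \<ge> 0" "t \<ge> 0"
  shows "norm (J (s + t) u - J s (J t u)) \<le> s * t * norm k"
proof -
  have "J t ((u - s *\<^sub>R g) - t *\<^sub>R (g - s *\<^sub>R k)) = u - s *\<^sub>R g"
    using gen_lincomb[OF assms(1,2), of 1 "- s"] by (intro J_of_gen assms) simp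
  \<comment> \<open>This is (1 - t L)(1 - s L) u = (1 - (s + t) L) u + s t L^2 u.\<close>
  moreover have "(u - s *\<^sub>R g) - t *\<^sub>R (g - s *\<^sub>R k) = (u - (s + t) *\<^sub>R g) + (s * t) *\<^sub>R k"
    by (simp add: algebra_simps)
  ultimately have "u = J s (J t ((u - (s + t) *\<^sub>R g) + (s * t) *\<^sub>R k))"
    using J_of_gen[OF assms(3,1)] by simp
  then have "J (s + t) u = J (s + t) (J s (J t ((u - (s + t) *\<^sub>R g) + (s * t) *\<^sub>R k)))"
    by simp
  also have "\<dots> = J s (J t (J (s + t) (u - (s + t) *\<^sub>R g) + (s * t) *\<^sub>R J (s + t) k))"
    using assms(3,4) by (simp add: J_commute[of "s + t"] J_add J_scale)
  also have "J (s + t) (u - (s + t) *\<^sub>R g) = u"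
    by (intro J_of_gen assms) (use assms in simp)
  finally have "J (s + t) u - J s (J t u) = (s * t) *\<^sub>R J s (J t (J (s + t) k))"
    by (simp add: J_add J_scale)
  moreover have "norm (J s (J t (J (s + t) k))) \<le> norm k"
    using norm_J_le order_trans by metis
  ultimately show ?thesis using assms by (simp add: mult_left_mono)
qed

text \<open>If f is orthogonal to the domain, testing the resolvent equation with
  \<open>J 1 f\<close> itself forces \<open>J 1 f = 0\<close>; the equation then says that f is
  orthogonal to \<open>V\<close>.\<close>

lemma gen_domain_dense: "closure (fst ` gen) = UNIV"
proof (rule dense_if_orthogonal_trivial)
  show "subspace (fst ` gen)"
  proof (rule subspaceI)
    show "0 \<in> fst ` gen"
      using J_gen[of 1 0] by (force simp: linear_0[OF linear_J])
    show "x + y \<in> fst ` gen" if "x \<in> fst ` gen" "y \<in> fst ` gen" for x y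
      using that gen_lincomb[of x _ y _ 1 1] by force
    show "c *\<^sub>R x \<in> fst ` gen" if "x \<in> fst ` gen" for c x
      using that gen_lincomb[of x _ x _ c 0] by force
  qed
  fix f assume "\<And>v. v \<in> fst ` gen \<Longrightarrow> f \<bullet> v = 0"
  from this[of "J 1 f"] J_gen[of 1 f] have "f \<bullet> J 1 f = 0" by force
  then have "J 1 f \<bullet> J 1 f + E (J 1 f) (J 1 f) = 0"
    using J_eq[of 1 "J 1 f" f] J_mem[of 1] by simp
  then have "J 1 f \<bullet> J 1 f = 0"
    using nonneg[OF J_mem[of 1 f]] inner_ge_zero[of "J 1 f"] by linarith
  then have 0: "J 1 f = 0" by simp
  have "E 0 v = 0" if "v \<in> V" for v using scale_left[OF that that, of 0] by simp
  then show "f = 0" using J_eq[of 1 _ f] by (intro total) (simp add: 0)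
qed

lemma J_tendsto: "((\<lambda>h. J h x) \<longlongrightarrow> x) (at_right 0)"
proof (rule tendstoI)
  fix e :: real assume e: "e > 0"
  have "x \<in> closure (fst ` gen)" by (simp add: gen_domain_dense)
  then obtain u g where u: "(u, g) \<in> gen" "dist u x < e / 3"
    using e unfolding closure_approachable by (metis divide_pos_pos zero_less_numeral imageE prod.collapse)
  have "\<forall>\<^sub>F h in at_right (0::real). h < e / (3 * (norm g + 1))"
    using e by (intro eventually_at_right_less[THEN eventually_mono] order_tendstoD(2)[OF tendsto_ident_at])
      (auto intro!: divide_pos_pos add_nonneg_pos)
  then show "\<forall>\<^sub>F h in at_right 0. dist (J h x) x < e"
    using eventually_at_right_less[of 0]
  proof eventually_elim
    case (elim h)
    have "norm (J h u - u) \<le> h * norm g"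
      using J_step[OF u(1), of h] elim norm_J_le[of h g] by (simp add: mult_left_mono)
    also have "\<dots> \<le> h * (norm g + 1)" using elim by simp
    also have "\<dots> < e / 3"
    proof -
      have "0 < 3 * (norm g + 1)" by (simp add: add_nonneg_pos)
      with elim(1) have "h * (3 * (norm g + 1)) < e" by (simp only: pos_less_divide_eq)
      then show ?thesis by (simp add: algebra_simps)
    qed
    finally have "norm (J h u - u) < e / 3" .
    moreover have "norm (J h (x - u)) \<le> norm (x - u)" by (rule norm_J_le)
    moreover have "J h x - x = J h (x - u) + (J h u - u) + (u - x)" by (simp add: J_diff)
    then have "norm (J h x - x) \<le> norm (J h (x - u)) + norm (J h u - u) + norm (u - x)"
      by (metis norm_triangle_le norm_triangle_ineq add_right_mono)
    ultimately show ?case using u(2) by (simp add: dist_norm norm_minus_commute)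
  qed
qed

text \<open>The domain of the squared generator, where \<open>J_add_error\<close> gives second order
  errors; applying a resolvent twice maps every vector into it.\<close>

definition dom2 :: "'h set" where "dom2 = {u. \<exists>g k. (u, g) \<in> gen \<and> (g, k) \<in> gen}"

lemma JJ_tendsto: "((\<lambda>h. J h (J h x)) \<longlongrightarrow> x) (at_right 0)"
proof -
  have "((\<lambda>h. J h (J h x - x)) \<longlongrightarrow> 0) (at_right 0)"
  proof (rule Lim_null_comparison)
    show "\<forall>\<^sub>F h in at_right 0. norm (J h (J h x - x)) \<le> norm (J h x - x)"
      by (intro always_eventually allI norm_J_le)
    show "((\<lambda>h. norm (J h x - x)) \<longlongrightarrow> 0) (at_right 0)"
      using J_tendsto[of x] by (simp add: tendsto_norm_zero_iff LIM_zero_iff)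
  qed
  from tendsto_add[OF this J_tendsto[of x]] show ?thesis by (simp add: J_diff)
qed

lemma JJ_dom2:
  assumes "h > 0"
  obtains g k where "(J h (J h x), g) \<in> gen" "(g, k) \<in> gen"
proof -
  have 1: "(J h (J h x), (1 / h) *\<^sub>R (J h (J h x) - J h x)) \<in> gen" using J_gen[OF assms] .
  have 2: "(J h (J h x) - J h x, (1 / h) *\<^sub>R (J h (J h x) - J h x) - (1 / h) *\<^sub>R (J h x - x)) \<in> gen"
    by (rule gen_diff[OF 1 J_gen[OF assms, of x]])
  from that[OF 1] gen_lincomb[OF 2 2, of "1/h" 0] show ?thesis
    by (metis add.right_neutral scaleR_zero_left)
qed

lemma dom2_dense: "closure dom2 = UNIV"
proof -
  have "x \<in> closure dom2" for x
  proof (rule Lim_in_closed_set[OF closed_closure _ _ JJ_tendsto])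
    show "\<forall>\<^sub>F h in at_right 0. J h (J h x) \<in> closure dom2"
      using eventually_at_right_less[of 0]
    proof eventually_elim
      case (elim h)
      then have "J h (J h x) \<in> dom2" using JJ_dom2[of h x] unfolding dom2_def by blast
      then show ?case using closure_subset by blast
    qed
  qed simp
  then show ?thesis by blast
qed

subsection \<open>The semigroup of a closed form\<close>

lemma linear_J_funpow: "linear (J h ^^ n)"
proof (induction n)
  case (Suc n)
  then show ?case using linear_compose[OF Suc linear_J] by (simp add: comp_def)
qed (simp only: funpow.simps linear_id)

lemma norm_J_funpow_le: "norm ((J h ^^ n) x) \<le> norm x"
  by (induction n) (auto intro: order_trans[OF norm_J_le])

text \<open>The number of steps is a power of 2, so that passing from n to n + 1 replaces every
  factor \<open>J (h + h)\<close> by two factors \<open>J h\<close> and consecutive iterates can be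
  compared factor by factor.\<close>

definition euler :: "nat \<Rightarrow> real \<Rightarrow> 'h \<Rightarrow> 'h" where
  "euler n t = J (t / 2 ^ n) ^^ (2 ^ n)"

lemma linear_euler: "linear (euler n t)" unfolding euler_def by (rule linear_J_funpow)
lemma norm_euler_le: "norm (euler n t x) \<le> norm x" unfolding euler_def by (rule norm_J_funpow_le)
lemma euler_0 [simp]: "euler 0 t = J t" by (simp add: euler_def)

lemma linear_JJ: "linear (\<lambda>x. J s (J t x))"
  using linear_compose[OF linear_J linear_J] by (simp add: comp_def)

text \<open>Each of the 2^n factors contributes the error h^2 |k| of \<open>J_add_error\<close> with
  h = t / 2^(n+1), and 2^n h^2 = (t^2 / 4) 2^-n.\<close>

lemma norm_euler_diff:
  assumes "(u, g) \<in> gen" "(g, k) \<in> gen" "t \<ge> 0"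
  shows "norm (euler (Suc n) t u - euler n t u) \<le> t\<^sup>2 / 4 * norm k * (1 / 2) ^ n"
proof -
  define h where "h = t / 2 ^ Suc n"
  have h: "h \<ge> 0" "t / 2 ^ n = h + h" using assms(3) by (auto simp: h_def field_simps)
  have "euler (Suc n) t = (J h ^^ 2) ^^ (2 ^ n)"
    unfolding euler_def funpow_mult h_def by (simp add: mult.commute)
  also have "J h ^^ 2 = (\<lambda>x. J h (J h x))" by (simp add: numeral_2_eq_2 comp_def)
  finally have "norm (euler (Suc n) t u - euler n t u)
      = norm (((\<lambda>x. J h (J h x)) ^^ (2 ^ n)) u - (J (h + h) ^^ (2 ^ n)) u)"
    by (simp add: euler_def h)
  also have "\<dots> \<le> real (2 ^ n) * norm (J h (J h u) - J (h + h) u)"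
    by (intro norm_funpow_diff_le linear_JJ linear_J norm_J_le order_trans[OF norm_J_le norm_J_le])
      (use h in \<open>simp add: J_commute[of "2 * h" h]\<close>)
  also have "\<dots> \<le> real (2 ^ n) * (h * h * norm k)"
    using J_add_error[OF assms(1,2) h(1) h(1)] by (intro mult_left_mono) (simp_all add: norm_minus_commute)
  also have "\<dots> = t\<^sup>2 / 4 * norm k * (1 / 2) ^ n"
    by (simp add: h_def power2_eq_square power_one_over field_simps)
  finally show ?thesis .
qed

text \<open>Telescoping starts at \<open>euler 0 t = J t\<close>, and the geometric bounds add up to
  t^2 / 2. The quadratic order in t is what later identifies the generator of the limit.\<close>

lemma
  assumes "(u, g) \<in> gen" "(g, k) \<in> gen" "t \<ge> 0"
  shows convergent_euler_dom2: "convergent (\<lambda>n. euler n t u)"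
    and norm_lim_euler_diff: "norm (lim (\<lambda>n. euler n t u) - J t u) \<le> t\<^sup>2 / 2 * norm k"
proof -
  define d where "d n = euler (Suc n) t u - euler n t u" for n
  have bound: "norm (d n) \<le> t\<^sup>2 / 4 * norm k * (1 / 2) ^ n" for n
    unfolding d_def by (rule norm_euler_diff[OF assms])
  have geo: "(\<lambda>n. t\<^sup>2 / 4 * norm k * (1 / 2) ^ n) sums (t\<^sup>2 / 4 * norm k * 2)"
    by (rule sums_mult) (use geometric_sums[of "1/2::real"] in simp)
  have "summable (\<lambda>n. norm (d n))"
    by (rule summable_comparison_test[OF _ sums_summable[OF geo]]) (use bound in auto)
  then have "(\<lambda>n. sum d {..<n}) \<longlonglongrightarrow> suminf d"
    by (rule summable_LIMSEQ[OF summable_norm_cancel])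
  moreover have "sum d {..<n} = euler n t u - J t u" for n
    unfolding d_def by (subst sum_lessThan_telescope) simp
  ultimately have conv: "(\<lambda>n. euler n t u - J t u) \<longlonglongrightarrow> suminf d" by simp
  from tendsto_add[OF this tendsto_const[of "J t u"]]
  have lim: "(\<lambda>n. euler n t u) \<longlonglongrightarrow> suminf d + J t u" by simp
  then show "convergent (\<lambda>n. euler n t u)" by (auto simp: convergent_def)
  have "norm (suminf d) \<le> (\<Sum>n. norm (d n))" by (rule summable_norm[OF \<open>summable (\<lambda>n. norm (d n))\<close>])
  also have "\<dots> \<le> (\<Sum>n. t\<^sup>2 / 4 * norm k * (1 / 2) ^ n)"
    by (rule suminf_le[OF bound \<open>summable (\<lambda>n. norm (d n))\<close> sums_summable[OF geo]])
  also have "\<dots> = t\<^sup>2 / 4 * norm k * 2" by (rule sums_unique[OF geo, symmetric])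
  also have "\<dots> = t\<^sup>2 / 2 * norm k" by simp
  finally show "norm (lim (\<lambda>n. euler n t u) - J t u) \<le> t\<^sup>2 / 2 * norm k"
    using limI[OF lim] by simp
qed

definition Q :: "real \<Rightarrow> 'h \<Rightarrow> 'h" where
  "Q t x = lim (\<lambda>n. euler n t x)"

lemma euler_tendsto:
  assumes "t \<ge> 0"
  shows "(\<lambda>n. euler n t x) \<longlonglongrightarrow> Q t x"
  unfolding Q_def convergent_LIMSEQ_iff[symmetric]
  by (rule convergent_of_dense[OF linear_euler norm_euler_le dom2_dense])
    (use assms convergent_euler_dom2 in \<open>auto simp: dom2_def\<close>)

lemma Q_minus_J:
  assumes "(u, g) \<in> gen" "(g, k) \<in> gen" "t \<ge> 0"
  shows "norm (Q t u - J t u) \<le> t\<^sup>2 / 2 * norm k"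
  unfolding Q_def by (rule norm_lim_euler_diff[OF assms])

lemma norm_Q_le: "t \<ge> 0 \<Longrightarrow> norm (Q t x) \<le> norm x"
  by (rule LIMSEQ_le_const2[OF tendsto_norm[OF euler_tendsto]]) (auto intro: norm_euler_le)

lemma linear_Q:
  assumes "t \<ge> 0"
  shows "linear (Q t)"
proof (rule linearI)
  show "Q t (x + y) = Q t x + Q t y" for x y
    by (rule LIMSEQ_unique[OF euler_tendsto[OF assms]])
      (simp add: linear_add[OF linear_euler] tendsto_add euler_tendsto[OF assms])
  show "Q t (c *\<^sub>R x) = c *\<^sub>R Q t x" for c x
    by (rule LIMSEQ_unique[OF euler_tendsto[OF assms]])
      (simp add: linear_scale[OF linear_euler] tendsto_scaleR euler_tendsto[OF assms])
qed

lemma bounded_linear_Q: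
  assumes "t \<ge> 0"
  shows "bounded_linear (Q t)"
  using linear_Q[OF assms] norm_Q_le[OF assms]
  by (intro bounded_linear_intro[of _ 1]) (auto simp: linear_add linear_scale)

lemma Q_zero: "Q 0 x = x"
proof -
  have "(J 0 ^^ n) x = x" for n by (induction n) auto
  then show ?thesis by (simp add: Q_def euler_def)
qed

text \<open>Euler products obey the semigroup law only in the limit: with 2^n steps each factor has
  an error s t |k| / 4^n, and 2^n of them remain summably small.\<close>

lemma euler_add_error:
  assumes "(u, g) \<in> gen" "(g, k) \<in> gen" "s \<ge> 0" "t \<ge> 0"
  shows "norm (euler n (s + t) u - euler n s (euler n t u)) \<le> s * t * norm k * (1 / 2) ^ n"
proof -
  define N :: nat where "N = 2 ^ n"
  define a b where "a = s / real N" and "b = t / real N"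
  have ab: "a \<ge> 0" "b \<ge> 0" "(s + t) / 2 ^ n = a + b" "s / 2 ^ n = a" "t / 2 ^ n = b"
    using assms by (auto simp: a_def b_def N_def add_divide_distrib)
  have comm: "J b ((J a ^^ m) x) = (J a ^^ m) (J b x)" for m x
    by (induction m) (simp_all add: J_commute[OF ab(2,1)])
  have "((\<lambda>x. J a (J b x)) ^^ m) x = (J a ^^ m) ((J b ^^ m) x)" for m x
    by (induction m) (simp_all add: comm)
  then have "norm (euler n (s + t) u - euler n s (euler n t u))
      = norm ((J (a + b) ^^ N) u - ((\<lambda>x. J a (J b x)) ^^ N) u)"
    by (simp add: euler_def ab N_def)
  also have "\<dots> \<le> real N * norm (J (a + b) u - J a (J b u))"
    by (intro norm_funpow_diff_le linear_JJ linear_J norm_J_le order_trans[OF norm_J_le norm_J_le])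
      (use ab in \<open>simp add: J_commute[of "a + b" a] J_commute[of "a + b" b]\<close>)
  also have "\<dots> \<le> real N * (a * b * norm k)"
    by (intro mult_left_mono J_add_error[OF assms(1,2)] ab) simp
  also have "\<dots> = s * t * norm k * (1 / 2) ^ n"
    by (simp add: a_def b_def N_def power_one_over field_simps)
  finally show ?thesis .
qed

lemma Q_add:
  assumes s: "s \<ge> 0" and t: "t \<ge> 0"
  shows "Q (s + t) x = Q s (Q t x)"
proof (rule eq_of_dense[where A = "Q (s + t)" and B = "\<lambda>x. Q s (Q t x)", OF _ _ dom2_dense])
  show "bounded_linear (Q (s + t))" using s t by (intro bounded_linear_Q) simp
  show "bounded_linear (\<lambda>x. Q s (Q t x))"
    by (rule bounded_linear_compose[OF bounded_linear_Q[OF s] bounded_linear_Q[OF t]])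
  fix u assume "u \<in> dom2"
  then obtain g k where u: "(u, g) \<in> gen" "(g, k) \<in> gen" by (auto simp: dom2_def)
  have "(\<lambda>n. euler n s (euler n t u - Q t u)) \<longlonglongrightarrow> 0"
  proof (rule Lim_null_comparison)
    show "\<forall>\<^sub>F n in sequentially. norm (euler n s (euler n t u - Q t u)) \<le> norm (euler n t u - Q t u)"
      by (intro always_eventually allI norm_euler_le)
    show "(\<lambda>n. norm (euler n t u - Q t u)) \<longlonglongrightarrow> 0"
      using euler_tendsto[OF t, of u] by (simp add: tendsto_norm_zero_iff LIM_zero_iff)
  qed
  from tendsto_add[OF this euler_tendsto[OF s, of "Q t u"]]
  have 1: "(\<lambda>n. euler n s (euler n t u)) \<longlonglongrightarrow> Q s (Q t u)"
    by (simp add: linear_diff[OF linear_euler])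
  have "(\<lambda>n. euler n (s + t) u - euler n s (euler n t u)) \<longlonglongrightarrow> 0"
  proof (rule Lim_null_comparison)
    show "\<forall>\<^sub>F n in sequentially. norm (euler n (s + t) u - euler n s (euler n t u))
        \<le> s * t * norm k * (1 / 2) ^ n"
      by (intro always_eventually allI euler_add_error[OF u s t])
    show "(\<lambda>n. s * t * norm k * (1 / 2) ^ n) \<longlonglongrightarrow> 0"
      by (intro tendsto_mult_right_zero LIMSEQ_power_zero) simp
  qed
  from tendsto_add[OF this 1] have "(\<lambda>n. euler n (s + t) u) \<longlonglongrightarrow> Q s (Q t u)" by simp
  then show "Q (s + t) u = Q s (Q t u)"
    using LIMSEQ_unique[OF euler_tendsto[of "s + t" u]] s t by simp
qed

text \<open>The product is compared with powers of the identity as the second contraction; one step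
  moves u by at most h |g|.\<close>

lemma norm_Q_minus_id:
  assumes "(u, g) \<in> gen" "t \<ge> 0"
  shows "norm (Q t u - u) \<le> t * norm g"
proof (rule LIMSEQ_le_const2)
  show "(\<lambda>n. norm (euler n t u - u)) \<longlonglongrightarrow> norm (Q t u - u)"
    by (intro tendsto_intros euler_tendsto assms)
  have "norm (euler n t u - u) \<le> t * norm g" for n
  proof -
    define h where "h = t / 2 ^ n"
    have h: "h \<ge> 0" using assms by (simp add: h_def)
    have "((\<lambda>x. x) ^^ m) u = u" for m by (induction m) auto
    then have "norm (euler n t u - u) = norm ((J h ^^ (2 ^ n)) u - ((\<lambda>x. x) ^^ (2 ^ n)) u)"
      by (simp add: euler_def h_def)
    also have "\<dots> \<le> real (2 ^ n) * norm (J h u - u)"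
      by (intro norm_funpow_diff_le linear_J norm_J_le) (simp_all add: linear_id[unfolded id_def])
    also have "\<dots> \<le> real (2 ^ n) * (h * norm g)"
      using h norm_J_le[of h g] by (simp add: J_step[OF assms(1) h] mult_left_mono)
    also have "\<dots> = t * norm g" by (simp add: h_def)
    finally show ?thesis .
  qed
  then show "\<exists>N. \<forall>n\<ge>N. norm (euler n t u - u) \<le> t * norm g" by blast
qed

lemma Q_tendsto: "((\<lambda>t. Q t x) \<longlongrightarrow> x) (at_right 0)"
proof (rule tendstoI)
  fix e :: real assume e: "e > 0"
  have "x \<in> closure (fst ` gen)" by (simp add: gen_domain_dense)
  then obtain u g where u: "(u, g) \<in> gen" "dist u x < e / 3"
    using e unfolding closure_approachable by (metis divide_pos_pos zero_less_numeral imageE prod.collapse)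
  have g: "0 < 3 * (norm g + 1)" by (simp add: add_nonneg_pos)
  show "\<forall>\<^sub>F h in at_right 0. dist (Q h x) x < e"
    using eventually_at_right_less[of 0] eventually_at_right_lt[OF divide_pos_pos[OF e g]]
  proof eventually_elim
    case (elim h)
    have "norm (Q h u - u) \<le> h * norm g"
      using norm_Q_minus_id[OF u(1), of h] elim by simp
    also have "\<dots> < e / 3"
      using elim g by (simp add: pos_less_divide_eq algebra_simps)
    finally have "norm (Q h u - u) < e / 3" .
    moreover have "norm (Q h (x - u)) \<le> norm (x - u)" using elim by (intro norm_Q_le) simp
    moreover have "Q h x - x = Q h (x - u) + (Q h u - u) + (u - x)"
      using elim by (simp add: linear_diff[OF linear_Q])
    then have "norm (Q h x - x) \<le> norm (Q h (x - u)) + norm (Q h u - u) + norm (u - x)"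
      by (metis norm_triangle_le norm_triangle_ineq add_right_mono)
    ultimately show ?case using u(2) by (simp add: dist_norm norm_minus_commute)
  qed
qed

text \<open>Comparing \<open>Q\<close> with \<open>J\<close> to second order needs the squared
  generator, while u has only a first image g. So u is replaced by v = J h (J h u), whose image w is
  close to g; the quotient of u - v is bounded by |g - w| uniformly in t.\<close>

lemma Q_quotient_gen:
  assumes "(u, g) \<in> gen"
  shows "((\<lambda>t. (1 / t) *\<^sub>R (Q t u - u)) \<longlongrightarrow> g) (at_right 0)"
proof (rule tendstoI)
  fix e :: real assume e: "e > 0"
  have "\<forall>\<^sub>F h in at_right 0. dist (J h (J h g)) g < e / 3"
    using tendstoD[OF JJ_tendsto[of g], of "e / 3"] e by simp
  then have "\<forall>\<^sub>F h in at_right 0. dist (J h (J h g)) g < e / 3 \<and> h > 0"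
    using eventually_at_right_less[of 0] by eventually_elim simp
  then obtain h where h: "dist (J h (J h g)) g < e / 3" "h > 0"
    using eventually_happens trivial_limit_at_right_real by blast
  define v where "v = J h (J h u)"
  define w where "w = J h (J h g)"
  have vw: "(v, w) \<in> gen" unfolding v_def w_def using h assms by (intro gen_J) auto
  obtain w' k where "(v, w') \<in> gen" "(w', k) \<in> gen" using JJ_dom2[OF h(2), of u] v_def by metis
  then have wk: "(w, k) \<in> gen" using gen_unique[OF vw] by simp
  have k: "0 < 3 * (2 * norm k + 1)" by (simp add: add_nonneg_pos)
  show "\<forall>\<^sub>F t in at_right 0. dist ((1 / t) *\<^sub>R (Q t u - u)) g < e"
    using eventually_at_right_less[of 0] eventually_at_right_lt[OF divide_pos_pos[OF e k]]
  proof eventually_elim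
    case (elim t)
    have t: "t > 0" using elim by simp
    have 1: "norm ((1 / t) *\<^sub>R (Q t (u - v) - (u - v))) \<le> norm (g - w)"
      using norm_Q_minus_id[OF gen_diff[OF assms vw], of t] t by (intro norm_scaleR_inverse_le) auto
    have 2: "norm ((1 / t) *\<^sub>R (Q t v - v) - w) \<le> 2 * t * norm k"
    proof -
      have "(1 / t) *\<^sub>R (Q t v - v) - w = (1 / t) *\<^sub>R (Q t v - J t v) + (J t w - w)"
        using J_step[OF vw, of t] t by (simp add: algebra_simps)
      also have "norm \<dots> \<le> norm ((1 / t) *\<^sub>R (Q t v - J t v)) + norm (J t w - w)"
        by (rule norm_triangle_ineq)
      also have "\<dots> \<le> t * norm k + t * norm k"
      proof (rule add_mono)
        have "norm (Q t v - J t v) \<le> t\<^sup>2 / 2 * norm k" using Q_minus_J[OF vw wk] t by simp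
        also have "\<dots> \<le> t * (t * norm k)" using t by (simp add: power2_eq_square)
        finally show "norm ((1 / t) *\<^sub>R (Q t v - J t v)) \<le> t * norm k"
          using t by (intro norm_scaleR_inverse_le) auto
        show "norm (J t w - w) \<le> t * norm k"
          using J_step[OF wk, of t] t norm_J_le[of t k] by simp
      qed
      finally show ?thesis by simp
    qed
    have 3: "2 * t * norm k < e / 3"
      using elim k by (simp add: pos_less_divide_eq algebra_simps)
    have "(1 / t) *\<^sub>R (Q t u - u) - g
        = (1 / t) *\<^sub>R (Q t (u - v) - (u - v)) + ((1 / t) *\<^sub>R (Q t v - v) - w) + (w - g)"
      using t by (simp add: linear_diff[OF linear_Q] algebra_simps)
    then have "norm ((1 / t) *\<^sub>R (Q t u - u) - g) \<le> norm (g - w) + 2 * t * norm k + norm (w - g)"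
      by (simp only: norm_add3_le[OF 1 2 order_refl])
    then show ?case using 3 h(1) unfolding w_def[symmetric] by (simp add: dist_norm norm_minus_commute)
  qed
qed

text \<open>The generator of \<open>Q\<close> extends \<open>gen\<close>, and it cannot be larger:
  with w = J 1 (x - y) the difference z = x - w would satisfy L z = z for that extension, and a
  contraction semigroup forces z = 0.\<close>

lemma gen_of_Q_quotient:
  assumes lim: "((\<lambda>t. (1 / t) *\<^sub>R (Q t x - x)) \<longlongrightarrow> y) (at_right 0)"
  shows "(x, y) \<in> gen"
proof -
  define w where "w = J 1 (x - y)"
  have w: "(w, w - (x - y)) \<in> gen" using J_gen[of 1 "x - y"] by (simp add: w_def)
  define z where "z = x - w"
  have "((\<lambda>t. (1 / t) *\<^sub>R (Q t x - x) - (1 / t) *\<^sub>R (Q t w - w)) \<longlongrightarrow> y - (w - (x - y))) (at_right 0)"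
    by (intro tendsto_diff lim Q_quotient_gen w)
  moreover have "\<forall>\<^sub>F t in at_right 0. (1 / t) *\<^sub>R (Q t x - x) - (1 / t) *\<^sub>R (Q t w - w) = (1 / t) *\<^sub>R (Q t z - z)"
    using eventually_at_right_less[of 0]
    by eventually_elim (simp add: z_def linear_diff[OF linear_Q] algebra_simps)
  ultimately have "((\<lambda>t. (1 / t) *\<^sub>R (Q t z - z)) \<longlongrightarrow> y - (w - (x - y))) (at_right 0)"
    by (rule Lim_transform_eventually)
  then have "((\<lambda>t. (1 / t) *\<^sub>R (Q t z - z)) \<longlongrightarrow> z) (at_right 0)"
    by (simp add: z_def)
  then have "((\<lambda>t. (1 / t) *\<^sub>R (Q t z - z) \<bullet> z) \<longlongrightarrow> z \<bullet> z) (at_right 0)"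
    by (intro tendsto_intros)
  then have "z \<bullet> z \<le> 0"
  proof (rule tendsto_upperbound)
    show "\<forall>\<^sub>F t in at_right 0. (1 / t) *\<^sub>R (Q t z - z) \<bullet> z \<le> 0"
      using eventually_at_right_less[of 0]
    proof eventually_elim
      case (elim t)
      have "Q t z \<bullet> z \<le> norm (Q t z) * norm z" by (rule norm_cauchy_schwarz)
      also have "\<dots> \<le> norm z * norm z" using norm_Q_le[of t z] elim by (intro mult_right_mono) auto
      also have "\<dots> = z \<bullet> z" by (simp add: dot_square_norm power2_eq_square)
      finally show ?case using elim by (simp add: inner_diff_left divide_nonpos_pos)
    qed
  qed simp
  then have "z \<bullet> z = 0" using inner_ge_zero[of z] by linarith
  then have "z = 0" by simp
  then have "w = x" by (simp add: z_def)
  then show ?thesis using w by simp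
qed

theorem semigroup_generated_Q: "semigroup_generated_by gen Q"
  unfolding semigroup_generated_by_def
proof (intro conjI allI impI)
  show "gen = {(x, y). ((\<lambda>t. (1 / t) *\<^sub>R (Q t x - x)) \<longlongrightarrow> y) (at_right 0)}"
    using Q_quotient_gen gen_of_Q_quotient by auto
qed (simp_all add: bounded_linear_Q Q_zero Q_add Q_tendsto)

end

subsection \<open>Uniqueness and compactness of the semigroup\<close>

text \<open>Baire's theorem: the closed sets \<open>A N\<close> cover the space, so one of them
  contains a ball. A vector of length r is a difference of two points of that ball, whence the
  constant 2 N / r.\<close>

lemma uniform_boundedness:
  fixes T :: "nat \<Rightarrow> 'h::banach \<Rightarrow> 'k::real_normed_vector"
  assumes lin: "\<And>n. bounded_linear (T n)" and ptw: "\<And>x. bounded (range (\<lambda>n. T n x))"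
  shows "\<exists>C. \<forall>n x. norm (T n x) \<le> C * norm x"
proof -
  define A where "A N = {x. \<forall>n. norm (T n x) \<le> real N}" for N :: nat
  have closedA: "closed (A N)" for N
  proof -
    have "A N = (\<Inter>n. {x. norm (T n x) \<le> real N})" by (auto simp: A_def)
    moreover have "closed {x. norm (T n x) \<le> real N}" for n
      by (intro closed_Collect_le continuous_intros linear_continuous_on lin)
    ultimately show ?thesis by (simp add: closed_INT)
  qed
  have "\<Union>(range A) = UNIV"
  proof -
    have "\<exists>N. x \<in> A N" for x
    proof -
      obtain B where "\<And>n. norm (T n x) \<le> B" using ptw[of x] unfolding bounded_iff by auto
      moreover obtain N :: nat where "B \<le> real N" using real_arch_simple by blast
      ultimately have "x \<in> A N" unfolding A_def using order_trans by blast
      then show ?thesis ..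
    qed
    then show ?thesis by blast
  qed
  have "\<exists>N. interior (A N) \<noteq> {}"
  proof (rule ccontr)
    assume "\<not> ?thesis"
    then have "euclidean interior_of \<Union>(range A) = {}"
      by (intro Baire_category_alt) (use closedA in \<open>auto simp: completely_metrizable_space_euclidean\<close>)
    then show False using \<open>\<Union>(range A) = UNIV\<close> by simp
  qed
  then obtain N x where "x \<in> interior (A N)" by blast
  then obtain r where r: "r > 0" "cball x r \<subseteq> A N"
    by (meson open_interior open_contains_cball interior_subset order_trans)
  have "norm (T n y) \<le> (2 * real N / r) * norm y" for n y
  proof (cases "y = 0")
    case True
    then show ?thesis using linear_0[OF bounded_linear.linear[OF lin]] by simp
  next
    case False
    define z where "z = (r / norm y) *\<^sub>R y"
    have "x + z \<in> A N" "x \<in> A N" using r False by (auto simp: z_def dist_norm intro!: subsetD[OF r(2)])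
    then have "norm (T n (x + z)) \<le> real N" "norm (T n x) \<le> real N" by (auto simp: A_def)
    moreover have "T n z = T n (x + z) - T n x" by (simp add: linear_add[OF bounded_linear.linear[OF lin]])
    ultimately have "norm (T n z) \<le> 2 * real N" using norm_triangle_ineq4[of "T n (x + z)" "T n x"] by simp
    moreover have "norm (T n z) = r / norm y * norm (T n y)"
      using r by (simp add: z_def linear_scale[OF bounded_linear.linear[OF lin]])
    ultimately show ?thesis using False r by (simp add: field_simps)
  qed
  then show ?thesis by blast
qed

context
  fixes G and P :: "real \<Rightarrow> 'h::banach \<Rightarrow> 'h"
  assumes P: "semigroup_generated_by G P"
begin

lemma semigroup_bounded_linear: "t \<ge> 0 \<Longrightarrow> bounded_linear (P t)"
  and semigroup_zero: "P 0 x = x"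
  and semigroup_add: "s \<ge> 0 \<Longrightarrow> t \<ge> 0 \<Longrightarrow> P (s + t) x = P s (P t x)"
  and semigroup_tendsto: "((\<lambda>t. P t x) \<longlongrightarrow> x) (at_right 0)"
  and generator_iff: "(x, y) \<in> G \<longleftrightarrow> ((\<lambda>t. (1 / t) *\<^sub>R (P t x - x)) \<longlongrightarrow> y) (at_right 0)"
  using P unfolding semigroup_generated_by_def by auto

text \<open>Otherwise operators P (t n) with t n tending to 0 would have unbounded norms, although
  strong continuity at 0 makes them converge at every vector; this contradicts uniform
  boundedness.\<close>

lemma semigroup_locally_bounded_0:
  "\<exists>\<delta>>0. \<exists>C. \<forall>t. 0 < t \<longrightarrow> t < \<delta> \<longrightarrow> (\<forall>x. norm (P t x) \<le> C * norm x)"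
proof (rule ccontr)
  assume neg: "\<not> ?thesis"
  have "\<exists>t x. 0 < t \<and> t < 1 / (real n + 1) \<and> \<not> norm (P t x) \<le> real n * norm x" for n
  proof -
    have "0 < 1 / (real n + 1)" by (simp add: add_nonneg_pos)
    then show ?thesis using neg by blast
  qed
  then obtain t x where t: "\<And>n. 0 < t n" "\<And>n. t n < 1 / (real n + 1)"
      and x: "\<And>n. \<not> norm (P (t n) (x n)) \<le> real n * norm (x n)" by metis
  have "t \<longlonglongrightarrow> 0"
  proof (rule tendsto_sandwich[where f = "\<lambda>_. 0"])
    show "(\<lambda>n. 1 / (real n + 1)) \<longlonglongrightarrow> 0"
      using LIMSEQ_inverse_real_of_nat by (simp add: inverse_eq_divide add.commute)
  qed (use t in \<open>auto intro!: always_eventually less_imp_le\<close>)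
  moreover have "t n \<noteq> 0" for n using t(1)[of n] by simp
  ultimately have "filterlim t (at_right 0) sequentially"
    using t(1) by (simp add: filterlim_at)
  then have conv: "(\<lambda>n. P (t n) y) \<longlonglongrightarrow> y" for y
    by (rule filterlim_compose[OF semigroup_tendsto])
  have "\<exists>C. \<forall>n x. norm (P (t n) x) \<le> C * norm x"
    by (intro uniform_boundedness semigroup_bounded_linear less_imp_le t(1)
        convergent_imp_bounded[OF conv])
  then obtain C where C: "\<And>n x. norm (P (t n) x) \<le> C * norm x" by blast
  obtain n :: nat where "C \<le> real n" using real_arch_simple by blast
  then have "norm (P (t n) (x n)) \<le> real n * norm (x n)"
    using C[of n "x n"] mult_right_mono[of C "real n" "norm (x n)"] by simp
  then show False using x by blast
qed

text \<open>A time up to t is cut into equally many pieces shorter than \<open>\<delta>\<close>, and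
  the semigroup law multiplies the bound \<open>K\<close> of each piece. Since \<open>K\<close> is
  at least 1, the identity at time 0 is covered as well.\<close>

lemma semigroup_locally_bounded:
  "\<exists>C\<ge>0. \<forall>s. 0 \<le> s \<longrightarrow> s \<le> t \<longrightarrow> (\<forall>x. norm (P s x) \<le> C * norm x)"
proof -
  obtain \<delta> C where \<delta>: "\<delta> > 0" and C: "\<And>t x. 0 < t \<Longrightarrow> t < \<delta> \<Longrightarrow> norm (P t x) \<le> C * norm x"
    using semigroup_locally_bounded_0 by blast
  define K where "K = max 1 C"
  have K: "norm (P s x) \<le> K * norm x" if "0 \<le> s" "s < \<delta>" for s x
  proof (cases "s = 0")
    case True
    have "1 * norm x \<le> K * norm x" by (intro mult_right_mono) (auto simp: K_def)
    then show ?thesis by (simp add: True semigroup_zero)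
  next
    case False
    then have "norm (P s x) \<le> C * norm x" using that by (intro C) auto
    also have "\<dots> \<le> K * norm x" by (intro mult_right_mono) (auto simp: K_def)
    finally show ?thesis .
  qed
  have pow: "norm (P (real n * s) x) \<le> K ^ n * norm x" if "0 \<le> s" "s < \<delta>" for n s x
  proof (induction n)
    case (Suc n)
    have "P (real (Suc n) * s) x = P s (P (real n * s) x)"
      using semigroup_add[of s "real n * s" x] that by (simp add: algebra_simps)
    also have "norm \<dots> \<le> K * norm (P (real n * s) x)" by (rule K[OF that])
    also have "\<dots> \<le> K * (K ^ n * norm x)" using Suc by (intro mult_left_mono) (auto simp: K_def)
    finally show ?case by (simp add: mult.assoc)
  qed (simp add: semigroup_zero)
  obtain n :: nat where n: "t / \<delta> < real n" using reals_Archimedean2 by blast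
  have "norm (P s x) \<le> K ^ Suc n * norm x" if "0 \<le> s" "s \<le> t" for s x
  proof -
    have "t < real n * \<delta>" using n \<delta> by (simp add: divide_less_eq)
    then have "s / real (Suc n) < \<delta>" using that \<delta> by (simp add: divide_less_eq algebra_simps)
    moreover have "s = real (Suc n) * (s / real (Suc n))" by simp
    ultimately show ?thesis using pow[of "s / real (Suc n)" "Suc n" x] that by (metis divide_nonneg_nonneg of_nat_0_le_iff)
  qed
  moreover have "K ^ Suc n \<ge> 0" by (simp add: K_def)
  ultimately show ?thesis by blast
qed

lemma generator_semigroup:
  assumes "(u, g) \<in> G" "s \<ge> 0"
  shows "(P s u, P s g) \<in> G"
proof -
  have lin: "linear (P s)" using semigroup_bounded_linear[OF assms(2)] by (rule bounded_linear.linear)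
  have "((\<lambda>t. P s ((1 / t) *\<^sub>R (P t u - u))) \<longlongrightarrow> P s g) (at_right 0)"
    using assms by (intro bounded_linear.tendsto[OF semigroup_bounded_linear]) (auto simp: generator_iff)
  moreover have "\<forall>\<^sub>F t in at_right 0. P s ((1 / t) *\<^sub>R (P t u - u)) = (1 / t) *\<^sub>R (P t (P s u) - P s u)"
    using eventually_at_right_less[of 0]
  proof eventually_elim
    case (elim t)
    then show ?case using semigroup_add[of s t u] semigroup_add[of t s u] assms(2)
      by (simp add: linear_scale[OF lin] linear_diff[OF lin] add.commute)
  qed
  ultimately show ?thesis unfolding generator_iff by (rule Lim_transform_eventually)
qed

end

context dense_closed_form
begin

text \<open>The scheme of a convergence proof for a numerical method: replacing P h by Q h along the
  orbit of u costs o(h) uniformly in the time reached, and the contraction \<open>Q\<close>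
  propagates these errors without growth, so t / h of them add up to o(1). Orbits stay in the domain
  of the squared generator because P s commutes with its generator.\<close>

theorem semigroup_unique:
  assumes P: "semigroup_generated_by gen P" and t: "t \<ge> 0"
  shows "P t x = Q t x"
proof (rule eq_of_dense[where A = "P t" and B = "Q t", OF _ _ dom2_dense])
  show "bounded_linear (P t)" "bounded_linear (Q t)"
    using semigroup_bounded_linear[OF P] bounded_linear_Q t by auto
  fix u assume "u \<in> dom2"
  then obtain g k where ug: "(u, g) \<in> gen" and gk: "(g, k) \<in> gen" by (auto simp: dom2_def)
  obtain C where C: "C \<ge> 0" "\<And>s x. 0 \<le> s \<Longrightarrow> s \<le> t \<Longrightarrow> norm (P s x) \<le> C * norm x"
    using semigroup_locally_bounded[OF P, of t] by blast
  define \<epsilon> where "\<epsilon> h = norm ((1 / h) *\<^sub>R (P h u - u) - g)" for h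
  have local: "norm (P h (P s u) - Q h (P s u)) \<le> h * (C * \<epsilon> h + 2 * h * (C * norm k))"
    if "0 < h" "0 \<le> s" "s \<le> t" for h s
  proof -
    have lin: "linear (P s)" using semigroup_bounded_linear[OF P that(2)] by (rule bounded_linear.linear)
    define v w where "v = P s u" and "w = P s g"
    have vw: "(v, w) \<in> gen" and wk: "(w, P s k) \<in> gen"
      unfolding v_def w_def by (intro generator_semigroup[OF P] ug gk that(2))+
    have k: "norm (P s k) \<le> C * norm k" using C that by simp
    \<comment> \<open>The first order remainder commutes with P s, so its size at u alone controls
      it along the whole orbit; this makes the error uniform in s.\<close>
    have "P h v - v - h *\<^sub>R w = P s (P h u - u - h *\<^sub>R g)"
      using semigroup_add[OF P, of h s u] semigroup_add[OF P, of s h u] that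
      by (simp add: v_def w_def linear_scale[OF lin] linear_diff[OF lin] add.commute)
    also have "P h u - u - h *\<^sub>R g = h *\<^sub>R ((1 / h) *\<^sub>R (P h u - u) - g)"
      using that by (simp add: scaleR_diff_right)
    also have "norm (P s \<dots>) \<le> C * (h * \<epsilon> h)"
      using C(2)[OF that(2,3), of "h *\<^sub>R ((1 / h) *\<^sub>R (P h u - u) - g)"] that by (simp add: \<epsilon>_def)
    finally have 1: "norm (P h v - v - h *\<^sub>R w) \<le> C * (h * \<epsilon> h)" .
    have 2: "norm (J h v - Q h v) \<le> h * (h * norm (P s k))"
    proof -
      have "norm (J h v - Q h v) \<le> h\<^sup>2 / 2 * norm (P s k)"
        using Q_minus_J[OF vw wk, of h] that by (simp add: norm_minus_commute)
      also have "\<dots> \<le> h * (h * norm (P s k))" using that by (simp add: power2_eq_square)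
      finally show ?thesis .
    qed
    have 3: "norm (h *\<^sub>R w + v - J h v) \<le> h * (h * norm (P s k))"
    proof -
      have "h *\<^sub>R w + v - J h v = h *\<^sub>R (w - J h w)"
        using J_step[OF vw, of h] that by (simp add: scaleR_diff_right diff_eq_eq)
      also have "w - J h w = - (h *\<^sub>R J h (P s k))" using J_step[OF wk, of h] that by (simp add: algebra_simps)
      finally show ?thesis using that norm_J_le[of h "P s k"] by simp
    qed
    have "P h v - Q h v = (P h v - v - h *\<^sub>R w) + (h *\<^sub>R w + v - J h v) + (J h v - Q h v)" by simp
    also have "norm \<dots> \<le> C * (h * \<epsilon> h) + h * (h * norm (P s k)) + h * (h * norm (P s k))"
      by (rule norm_add3_le[OF 1 3 2])
    also have "\<dots> \<le> C * (h * \<epsilon> h) + h * (h * (C * norm k)) + h * (h * (C * norm k))"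
      using k that C(1) by (intro add_mono mult_left_mono) auto
    finally show ?thesis by (simp add: v_def algebra_simps)
  qed
  have global: "norm (P (real m * h) u - Q (real m * h) u) \<le> real m * c"
    if "0 < h" "real m * h \<le> t" and c: "\<And>s. 0 \<le> s \<Longrightarrow> s \<le> t \<Longrightarrow> norm (P h (P s u) - Q h (P s u)) \<le> c" for m h c
    using that(2)
  proof (induction m)
    case 0
    show ?case by (simp add: semigroup_zero[OF P] Q_zero)
  next
    case (Suc m)
    have m: "real m * h \<le> t" "real m * h \<ge> 0" using Suc.prems that(1) by (auto simp: algebra_simps)
    have "P (real (Suc m) * h) u - Q (real (Suc m) * h) u
      = (P h (P (real m * h) u) - Q h (P (real m * h) u)) + Q h (P (real m * h) u - Q (real m * h) u)"
      using semigroup_add[OF P, of h "real m * h" u] Q_add[of h "real m * h" u] that(1) m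
      by (simp add: linear_diff[OF linear_Q] algebra_simps)
    also have "norm \<dots> \<le> c + norm (P (real m * h) u - Q (real m * h) u)"
      by (intro norm_triangle_le add_mono c m norm_Q_le) (use that in simp)
    also have "\<dots> \<le> real (Suc m) * c" using Suc.IH[OF m(1)] by (simp add: algebra_simps)
    finally show ?case .
  qed
  have "norm (P t u - Q t u) \<le> 0"
  proof (cases "t = 0")
    case True
    then show ?thesis by (simp add: semigroup_zero[OF P] Q_zero)
  next
    case False
    then have tpos: "t > 0" using t by simp
    define h where "h n = t / real (Suc n)" for n
    have hpos: "h n > 0" for n using tpos by (simp add: h_def)
    have h0: "h \<longlonglongrightarrow> 0"
      using tendsto_mult_right[OF LIMSEQ_inverse_real_of_nat, of t] by (simp add: h_def[abs_def] divide_inverse mult.commute)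
    moreover have "h n \<noteq> 0" for n using hpos[of n] by simp
    ultimately have hr: "filterlim h (at_right 0) sequentially"
      using hpos by (simp add: filterlim_at)
    have "((\<lambda>h. (1 / h) *\<^sub>R (P h u - u)) \<longlongrightarrow> g) (at_right 0)"
      using ug by (simp add: generator_iff[OF P])
    then have "(\<epsilon> \<longlongrightarrow> 0) (at_right 0)"
      unfolding \<epsilon>_def[abs_def] by (intro tendsto_norm_zero LIM_zero)
    then have \<epsilon>0: "(\<lambda>n. \<epsilon> (h n)) \<longlonglongrightarrow> 0" by (rule filterlim_compose[OF _ hr])
    show ?thesis
    proof (rule LIMSEQ_le_const)
      have "(\<lambda>n. t * (C * \<epsilon> (h n) + 2 * h n * (C * norm k))) \<longlonglongrightarrow> t * (C * 0 + 2 * 0 * (C * norm k))"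
        by (intro tendsto_intros \<epsilon>0 h0)
      then show "(\<lambda>n. t * (C * \<epsilon> (h n) + 2 * h n * (C * norm k))) \<longlonglongrightarrow> 0" by simp
      have "norm (P t u - Q t u) \<le> t * (C * \<epsilon> (h n) + 2 * h n * (C * norm k))" for n
      proof -
        have nt: "real (Suc n) * h n = t" by (simp add: h_def)
        have "norm (P (real (Suc n) * h n) u - Q (real (Suc n) * h n) u)
            \<le> real (Suc n) * (h n * (C * \<epsilon> (h n) + 2 * h n * (C * norm k)))"
          by (rule global[OF hpos]) (use nt local[OF hpos] in auto)
        also have "\<dots> = (real (Suc n) * h n) * (C * \<epsilon> (h n) + 2 * h n * (C * norm k))" by (simp only: mult.assoc)
        finally show ?thesis by (simp only: nt)
      qed
      then show "\<exists>N. \<forall>n\<ge>N. norm (P t u - Q t u) \<le> t * (C * \<epsilon> (h n) + 2 * h n * (C * norm k))" by blast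
    qed
  qed
  then show "P t u = Q t u" by simp
qed

text \<open>Testing the resolvent equation with w and with j = J h w gives |w - j|^2 = h (E(j, w) -
  E(j, j)), hence E(j, j) is at most E(j, w); nonnegativity of E(w - j, w - j) does the
  rest.\<close>

lemma energy_J_le:
  assumes h: "h > 0" and w: "w \<in> V"
  shows "E (J h w) (J h w) \<le> E w w"
proof -
  let ?j = "J h w"
  have jV: "?j \<in> V" by (rule J_mem[OF h])
  have 1: "?j \<bullet> ?j + h * E ?j ?j = w \<bullet> ?j" by (rule J_eq[OF h jV])
  have 2: "?j \<bullet> w + h * E ?j w = w \<bullet> w" by (rule J_eq[OF h w])
  have "0 \<le> (w - ?j) \<bullet> (w - ?j)" by simp
  also have "\<dots> = h * (E ?j w - E ?j ?j)"
    using 1 2 by (simp add: inner_diff_left inner_diff_right inner_commute algebra_simps)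
  finally have le: "E ?j ?j \<le> E ?j w" using h by (simp add: zero_le_mult_iff)
  have "0 \<le> E (w - ?j) (w - ?j)" by (intro nonneg mem_diff w jV)
  also have "\<dots> = E w w - 2 * E ?j w + E ?j ?j" using sym[OF w jV] by (simp add: square_diff w jV)
  finally show ?thesis using le by simp
qed

text \<open>Discrete dissipation: one step lowers the squared norm by at least 2 h times the new
  energy. As energies decrease along the iteration, n steps account for n times the last
  energy.\<close>

lemma energy_J_funpow:
  assumes h: "h > 0"
  shows "(norm ((J h ^^ n) u))\<^sup>2 + 2 * h * real n * E ((J h ^^ n) u) ((J h ^^ n) u) \<le> (norm u)\<^sup>2"
proof (induction n)
  case (Suc n)
  define w where "w = (J h ^^ n) u"
  let ?j = "J h w"
  have jV: "?j \<in> V" by (rule J_mem[OF h])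
  have 1: "?j \<bullet> ?j + h * E ?j ?j = w \<bullet> ?j" by (rule J_eq[OF h jV])
  have "0 \<le> (w - ?j) \<bullet> (w - ?j)" by simp
  then have 2: "(norm ?j)\<^sup>2 + 2 * h * E ?j ?j \<le> (norm w)\<^sup>2"
    using 1 by (simp add: inner_diff_left inner_diff_right inner_commute power2_norm_eq_inner)
  have 3: "2 * h * real n * E ?j ?j \<le> 2 * h * real n * E w w"
  proof (cases n)
    \<comment> \<open>Only after one step is w known to lie in \<open>V\<close>; for n = 0 the
      factor n makes the inequality trivial.\<close>
    case (Suc m)
    then have "w \<in> V" using J_mem[OF h] by (simp add: w_def)
    then show ?thesis using energy_J_le[OF h] h by (intro mult_left_mono) auto
  qed simp
  have "(norm ?j)\<^sup>2 + 2 * h * real (Suc n) * E ?j ?j \<le> (norm w)\<^sup>2 + 2 * h * real n * E w w"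
    using 2 3 by (simp add: algebra_simps)
  also have "\<dots> \<le> (norm u)\<^sup>2" using Suc by (simp add: w_def)
  finally show ?case by (simp add: w_def)
qed simp

lemma euler_energy:
  assumes t: "t > 0"
  shows "euler n t u \<in> V" "E (euler n t u) (euler n t u) \<le> (norm u)\<^sup>2 / (2 * t)"
proof -
  define h where "h = t / 2 ^ n"
  have h: "h > 0" "t = h * real (2 ^ n)" using t by (auto simp: h_def)
  obtain m where m: "2 ^ n = Suc m" by (metis not0_implies_Suc power_not_zero zero_neq_numeral)
  show "euler n t u \<in> V" using J_mem[OF h(1)] by (simp add: euler_def h_def[symmetric] m)
  have "2 * t * E (euler n t u) (euler n t u) = 2 * h * real (2 ^ n) * E ((J h ^^ (2 ^ n)) u) ((J h ^^ (2 ^ n)) u)"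
    using h(2) by (simp add: euler_def h_def[symmetric])
  also have "\<dots> \<le> (norm u)\<^sup>2" using energy_J_funpow[OF h(1), of "2 ^ n" u] zero_le_power2[of "norm ((J h ^^ (2 ^ n)) u)"] by linarith
  finally show "E (euler n t u) (euler n t u) \<le> (norm u)\<^sup>2 / (2 * t)" using t by (simp add: field_simps)
qed

definition compactly_embedded :: bool where
  "compactly_embedded \<longleftrightarrow> (\<forall>C. compact (closure {v \<in> V. v \<bullet> v + E v v \<le> C}))"

lemma compact_J:
  assumes compactly_embedded
  shows "compact_map (J 1)"
proof (rule compact_map_of_range, intro exI conjI allI impI)
  fix B
  show "compact (closure {v \<in> V. v \<bullet> v + E v v \<le> B\<^sup>2})" using assms by (simp add: compactly_embedded_def)
  fix f :: 'h assume f: "norm f \<le> B"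
  have "J 1 f \<bullet> J 1 f + E (J 1 f) (J 1 f) = f \<bullet> J 1 f" using J_eq[of 1 "J 1 f" f] J_mem[of 1 f] by simp
  also have "\<dots> \<le> norm f * norm (J 1 f)" by (rule norm_cauchy_schwarz)
  also have "\<dots> \<le> B * B" using f norm_J_le[of 1 f] order_trans[OF norm_ge_zero f] by (intro mult_mono) auto
  finally show "J 1 f \<in> closure {v \<in> V. v \<bullet> v + E v v \<le> B\<^sup>2}"
    using J_mem[of 1 f] by (intro subsetD[OF closure_subset]) (simp add: power2_eq_square)
qed

lemma compact_Q:
  assumes compactly_embedded and t: "t > 0"
  shows "compact_map (Q t)"
proof (rule compact_map_of_range, intro exI conjI allI impI)
  fix B
  let ?K = "closure {v \<in> V. v \<bullet> v + E v v \<le> B\<^sup>2 + B\<^sup>2 / (2 * t)}"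
  show "compact ?K" using assms by (simp add: compactly_embedded_def)
  fix f :: 'h assume f: "norm f \<le> B"
  have f2: "(norm f)\<^sup>2 \<le> B\<^sup>2" using f by (simp add: power_mono)
  \<comment> \<open>The energy bound is available for the Euler iterates only; their limit stays in
    the closed set.\<close>
  show "Q t f \<in> ?K"
  proof (rule closed_sequentially[OF closed_closure _ euler_tendsto])
    fix n
    have "euler n t f \<bullet> euler n t f \<le> B\<^sup>2"
      using norm_euler_le[of n t f] f by (simp add: dot_square_norm power_mono)
    moreover have "E (euler n t f) (euler n t f) \<le> B\<^sup>2 / (2 * t)"
      using euler_energy(2)[OF t, of n f] divide_right_mono[OF f2, of "2 * t"] t by simp
    ultimately show "euler n t f \<in> ?K"
      using euler_energy(1)[OF t] by (intro subsetD[OF closure_subset]) simp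
  qed (use t in simp)
qed

end

section \<open>Weakly null sequences as an obstruction to compactness\<close>

lemma orthonormal_weakly_null:
  fixes g :: "nat \<Rightarrow> 'h::real_inner"
  assumes "\<And>n. g n \<bullet> g n = 1" "\<And>m n. m \<noteq> n \<Longrightarrow> g m \<bullet> g n = 0"
  shows "(\<lambda>n. x \<bullet> g n) \<longlonglongrightarrow> 0"
proof -
  have bessel: "(\<Sum>n<N. (x \<bullet> g n)\<^sup>2) \<le> x \<bullet> x" for N
  proof -
    let ?p = "\<Sum>n<N. (x \<bullet> g n) *\<^sub>R g n"
    have xp: "x \<bullet> ?p = (\<Sum>n<N. (x \<bullet> g n)\<^sup>2)" by (simp add: inner_sum_right power2_eq_square)
    have "?p \<bullet> ?p = (\<Sum>n<N. \<Sum>m<N. (x \<bullet> g n) * (x \<bullet> g m) * (g m \<bullet> g n))"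
      by (simp add: inner_sum_right inner_sum_left sum_distrib_left mult.assoc mult.left_commute)
    also have "\<dots> = (\<Sum>n<N. \<Sum>m<N. if n = m then (x \<bullet> g n)\<^sup>2 else 0)"
      by (intro sum.cong refl) (auto simp: assms power2_eq_square)
    also have "\<dots> = (\<Sum>n<N. (x \<bullet> g n)\<^sup>2)" by simp
    finally have pp: "?p \<bullet> ?p = (\<Sum>n<N. (x \<bullet> g n)\<^sup>2)" .
    have "0 \<le> (x - ?p) \<bullet> (x - ?p)" by simp
    also have "\<dots> = x \<bullet> x - 2 * (x \<bullet> ?p) + ?p \<bullet> ?p"
      by (simp add: inner_diff_left inner_diff_right inner_commute del: inner_sum_right inner_sum_left)
    finally show ?thesis unfolding xp pp by simp
  qed
  have "summable (\<lambda>n. (x \<bullet> g n)\<^sup>2)"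
    by (rule bounded_imp_summable[of _ "x \<bullet> x"]) (use bessel[of "Suc _"] in \<open>auto simp: lessThan_Suc_atMost\<close>)
  then have "(\<lambda>n. (x \<bullet> g n)\<^sup>2) \<longlonglongrightarrow> 0" by (rule summable_LIMSEQ_zero)
  then show ?thesis by (simp add: tendsto_null_power)
qed

text \<open>Along a subsequence the images converge in norm to some y; against a bounded weakly null
  sequence, both the error and y pair to 0.\<close>

lemma compact_map_weakly_null:
  fixes T :: "'h::real_inner \<Rightarrow> 'h"
  assumes "compact_map T" and x: "\<And>n. norm (x n) \<le> C"
    and g: "\<And>n. norm (g n) \<le> 1" and weak: "\<And>y. (\<lambda>n. y \<bullet> g n) \<longlonglongrightarrow> 0"
  shows "\<exists>r :: nat \<Rightarrow> nat. (\<lambda>n. T (x (r n)) \<bullet> g (r n)) \<longlonglongrightarrow> 0"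
proof -
  have "bounded (range x)" unfolding bounded_iff using x by auto
  then obtain y r where r: "strict_mono (r :: nat \<Rightarrow> nat)" "(\<lambda>n. T (x (r n))) \<longlonglongrightarrow> y"
    using assms(1) unfolding compact_map_def by metis
  have "(\<lambda>n. (T (x (r n)) - y) \<bullet> g (r n)) \<longlonglongrightarrow> 0"
  proof (rule Lim_null_comparison)
    show "(\<lambda>n. norm (T (x (r n)) - y)) \<longlonglongrightarrow> 0"
      using r(2) by (simp add: tendsto_norm_zero_iff LIM_zero_iff)
    have "norm ((T (x (r n)) - y) \<bullet> g (r n)) \<le> norm (T (x (r n)) - y)" for n
      using Cauchy_Schwarz_ineq2[of "T (x (r n)) - y" "g (r n)"]
        mult_left_mono[OF g[of "r n"], of "norm (T (x (r n)) - y)"] by simp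
    then show "\<forall>\<^sub>F n in sequentially. norm ((T (x (r n)) - y) \<bullet> g (r n)) \<le> norm (T (x (r n)) - y)" by simp
  qed
  moreover have "(\<lambda>n. y \<bullet> g (r n)) \<longlonglongrightarrow> 0"
    using LIMSEQ_subseq_LIMSEQ[OF weak r(1)] by (simp add: comp_def)
  ultimately have "(\<lambda>n. (T (x (r n)) - y) \<bullet> g (r n) + y \<bullet> g (r n)) \<longlonglongrightarrow> 0 + 0"
    by (rule tendsto_add)
  then show ?thesis by (auto simp: inner_diff_left)
qed

context dense_closed_form
begin

text \<open>Cauchy-Schwarz for the shifted form u.v + E(u, v) between j = J 1 g and g: by the
  resolvent equation the mixed term is g.g = 1 and the square of j is j.g.\<close>

lemma J_lower_bound:
  assumes "g \<in> V" "g \<bullet> g = 1" "E g g \<le> C"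
  shows "1 / (1 + C) \<le> J 1 g \<bullet> g"
proof -
  interpret B: semi_inner V "\<lambda>u v. u \<bullet> v + 1 * E u v" by (rule shifted_semi_inner) simp
  have jV: "J 1 g \<in> V" by (rule J_mem) simp
  have C: "1 + C > 0" using nonneg[OF assms(1)] assms(3) by linarith
  have "1 = (J 1 g \<bullet> g + 1 * E (J 1 g) g)\<^sup>2" using J_eq[of 1 g g] assms by simp
  also have "\<dots> \<le> (J 1 g \<bullet> J 1 g + 1 * E (J 1 g) (J 1 g)) * (g \<bullet> g + 1 * E g g)"
    by (rule B.cauchy_schwarz[OF jV assms(1)])
  also have "\<dots> = (J 1 g \<bullet> g) * (1 + E g g)"
    using J_eq[of 1 "J 1 g" g] jV assms by (simp add: inner_commute)
  also have "\<dots> \<le> (J 1 g \<bullet> g) * (1 + C)"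
  proof (rule mult_left_mono)
    show "0 \<le> J 1 g \<bullet> g" using J_eq[of 1 "J 1 g" g] jV B.nonneg[OF jV] by (simp add: inner_commute)
  qed (use assms in simp)
  finally show ?thesis using C by (simp add: field_simps)
qed

context
  fixes g :: "nat \<Rightarrow> 'h" and C :: real
  assumes gV: "\<And>n. g n \<in> V" and g1: "\<And>n. g n \<bullet> g n = 1"
    and orth: "\<And>m n. m \<noteq> n \<Longrightarrow> g m \<bullet> g n = 0" and gE: "\<And>n. E (g n) (g n) \<le> C"
begin

text \<open>Common core of both negative results. The vectors \<open>J 1 (g n)\<close> pair with
  \<open>g n\<close> to at least 1 / (1 + C); a compact map reproducing them within a smaller error
  c would contradict \<open>compact_map_weakly_null\<close>.\<close>

lemma no_compact_approximation:
  assumes T: "compact_map T" and x: "\<And>n. norm (x n) \<le> B"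
    and c: "c < 1 / (1 + C)" and close: "\<And>n. norm (T (x n) - J 1 (g n)) \<le> c"
  shows False
proof -
  have n1: "norm (g n) = 1" for n using g1 by (simp add: norm_eq_sqrt_inner)
  obtain r :: "nat \<Rightarrow> nat" where r: "(\<lambda>n. T (x (r n)) \<bullet> g (r n)) \<longlonglongrightarrow> 0"
    using compact_map_weakly_null[OF T x, of g] n1 orthonormal_weakly_null[OF g1 orth] by fastforce
  have "1 / (1 + C) - c \<le> T (x n) \<bullet> g n" for n
  proof -
    have "- ((T (x n) - J 1 (g n)) \<bullet> g n) \<le> c * 1"
      using Cauchy_Schwarz_ineq2[of "T (x n) - J 1 (g n)" "g n"] close[of n] n1[of n] by simp
    then show ?thesis using J_lower_bound[OF gV g1 gE, of n] by (simp add: inner_diff_left)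
  qed
  then have "1 / (1 + C) - c \<le> 0" by (intro LIMSEQ_le_const[OF r]) auto
  then show False using c by simp
qed

lemma C_pos: "0 < 1 / (1 + C)"
proof -
  have "0 \<le> C" using nonneg[OF gV] gE order_trans by blast
  then show ?thesis by simp
qed

lemma not_compact_Q: "\<exists>t>0. \<not> compact_map (Q t)"
proof (rule ccontr)
  define p where "p = 1 / (1 + C)"
  \<comment> \<open>On the vectors \<open>J 1 (g n)\<close> the generator is bounded by 2, so
    \<open>Q t\<close> moves them by at most 2 t = p / 2, which is below the threshold p.\<close>
  define t where "t = p / 4"
  have p: "p > 0" unfolding p_def by (rule C_pos)
  then have t: "t > 0" by (simp add: t_def)
  have n1: "norm (g n) = 1" for n using g1 by (simp add: norm_eq_sqrt_inner)
  assume "\<not> ?thesis"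
  then have T: "compact_map (Q t)" using t by blast
  show False
  proof (rule no_compact_approximation[OF T])
    show "norm (J 1 (g n)) \<le> 1" for n using norm_J_le[of 1 "g n"] by (simp add: n1)
    show "norm (Q t (J 1 (g n)) - J 1 (g n)) \<le> t * 2" for n
    proof -
      have "norm (Q t (J 1 (g n)) - J 1 (g n)) \<le> t * norm ((1 / 1) *\<^sub>R (J 1 (g n) - g n))"
        using norm_Q_minus_id[OF J_gen[of 1 "g n"], of t] t by simp
      also have "\<dots> \<le> t * 2"
        using norm_triangle_ineq4[of "J 1 (g n)" "g n"] norm_J_le[of 1 "g n"] n1[of n] t
        by (intro mult_left_mono) auto
      finally show ?thesis .
    qed
    show "t * 2 < 1 / (1 + C)" unfolding p_def[symmetric] t_def using p by simp
  qed
qed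

text \<open>Whatever the spectral parameter l, \<open>R\<close> sends the bounded sequence l u - k
  with u = J 1 (g n) and k = u - g n back to u exactly, so the approximation error is 0.\<close>

lemma not_compact_resolvent:
  assumes "\<And>u k. (u, k) \<in> gen \<Longrightarrow> R (l *\<^sub>R u - k) = u"
  shows "\<not> compact_map R"
proof
  assume T: "compact_map R"
  have n1: "norm (g n) = 1" for n using g1 by (simp add: norm_eq_sqrt_inner)
  show False
  proof (rule no_compact_approximation[OF T])
    show "norm (l *\<^sub>R J 1 (g n) - (1 / 1) *\<^sub>R (J 1 (g n) - g n)) \<le> \<bar>l\<bar> + 2" for n
    proof -
      have "norm (l *\<^sub>R J 1 (g n)) \<le> \<bar>l\<bar>" using norm_J_le[of 1 "g n"] by (simp add: n1 mult_left_le)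
      moreover have "norm (J 1 (g n) - g n) \<le> 2"
        using norm_triangle_ineq4[of "J 1 (g n)" "g n"] norm_J_le[of 1 "g n"] by (simp add: n1)
      ultimately show ?thesis using norm_triangle_ineq4[of "l *\<^sub>R J 1 (g n)" "J 1 (g n) - g n"] by simp
    qed
    show "norm (R (l *\<^sub>R J 1 (g n) - (1 / 1) *\<^sub>R (J 1 (g n) - g n)) - J 1 (g n)) \<le> 0" for n
      using assms[OF J_gen[of 1 "g n"]] by simp
    show "0 < 1 / (1 + C)" by (rule C_pos)
  qed
qed

end

end

subsection \<open>The Hilbert space of square-integrable functions\<close>

lemma L2_D: "f \<in> L2 M \<Longrightarrow> f \<in> borel_measurable M" "f \<in> L2 M \<Longrightarrow> integrable M (\<lambda>x. (f x)\<^sup>2)"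
  by (auto simp: L2_def)

lemma L2_integrable_mult:
  assumes "f \<in> L2 M" "g \<in> L2 M"
  shows "integrable M (\<lambda>x. f x * g x)"
proof (rule Bochner_Integration.integrable_bound)
  show "integrable M (\<lambda>x. (f x)\<^sup>2 + (g x)\<^sup>2)" using assms by (simp add: L2_def)
  show "(\<lambda>x. f x * g x) \<in> borel_measurable M" using assms by (auto simp: L2_def)
  have "\<bar>a * b\<bar> \<le> a\<^sup>2 + b\<^sup>2" for a b :: real
  proof -
    have "2 * \<bar>a * b\<bar> \<le> a\<^sup>2 + b\<^sup>2"
      using sum_squares_bound[of "\<bar>a\<bar>" "\<bar>b\<bar>"] by (simp add: abs_mult mult.assoc)
    then show ?thesis using abs_ge_zero[of "a * b"] by linarith
  qed
  then show "AE x in M. norm (f x * g x) \<le> norm ((f x)\<^sup>2 + (g x)\<^sup>2)" by simp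
qed

lemma L2_lincomb:
  assumes "f \<in> L2 M" "g \<in> L2 M"
  shows "(\<lambda>x. a * f x + b * g x) \<in> L2 M"
proof -
  have "integrable M (\<lambda>x. a\<^sup>2 * (f x)\<^sup>2 + 2 * a * b * (f x * g x) + b\<^sup>2 * (g x)\<^sup>2)"
    using assms L2_integrable_mult[OF assms] by (auto simp: L2_def)
  then have "integrable M (\<lambda>x. (a * f x + b * g x)\<^sup>2)"
    by (simp add: power2_eq_square algebra_simps)
  then show ?thesis using assms by (auto simp: L2_def)
qed

lemma L2_add: "f \<in> L2 M \<Longrightarrow> g \<in> L2 M \<Longrightarrow> (\<lambda>x. f x + g x) \<in> L2 M"
  using L2_lincomb[of f M g 1 1] by simp

lemma L2_diff: "f \<in> L2 M \<Longrightarrow> g \<in> L2 M \<Longrightarrow> (\<lambda>x. f x - g x) \<in> L2 M"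
  using L2_lincomb[of f M g 1 "-1"] by simp

lemma L2_scale: "f \<in> L2 M \<Longrightarrow> (\<lambda>x. c * f x) \<in> L2 M"
  using L2_lincomb[of f M f c 0] by simp

lemma L2_zero: "(\<lambda>_. 0) \<in> L2 M" by (simp add: L2_def)

lemma L2_iff_nn_integral:
  "f \<in> borel_measurable M \<Longrightarrow> f \<in> L2 M \<longleftrightarrow> (\<integral>\<^sup>+x. ennreal ((f x)\<^sup>2) \<partial>M) < \<infinity>"
  by (auto simp: L2_def integrable_iff_bounded)

lemma l2_inner_self_nn:
  "f \<in> L2 M \<Longrightarrow> ennreal (l2_inner M f f) = (\<integral>\<^sup>+x. ennreal ((f x)\<^sup>2) \<partial>M)"
  by (simp add: l2_inner_def L2_def nn_integral_eq_integral power2_eq_square)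

text \<open>The sum of the squares has finite integral, hence is finite almost everywhere, and its
  terms tend to 0 there.\<close>

lemma AE_tendsto_zero_of_square_sums:
  fixes d :: "nat \<Rightarrow> 'a \<Rightarrow> real"
  assumes [measurable]: "\<And>n. d n \<in> borel_measurable M"
    and fin: "(\<Sum>n. \<integral>\<^sup>+x. ennreal ((d n x)\<^sup>2) \<partial>M) < \<infinity>"
  shows "AE x in M. (\<lambda>n. d n x) \<longlonglongrightarrow> 0"
proof -
  have "(\<integral>\<^sup>+x. (\<Sum>n. ennreal ((d n x)\<^sup>2)) \<partial>M) < \<infinity>"
    using fin by (simp add: nn_integral_suminf)
  then have "AE x in M. (\<Sum>n. ennreal ((d n x)\<^sup>2)) \<noteq> \<infinity>"
    by (intro nn_integral_noteq_infinite) auto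
  then show ?thesis
  proof eventually_elim
    case (elim x)
    then have "summable (\<lambda>n. (d n x)\<^sup>2)"
      by (intro summable_suminf_not_top) (auto simp: top_unique)
    then have "(\<lambda>n. (d n x)\<^sup>2) \<longlonglongrightarrow> 0" by (rule summable_LIMSEQ_zero)
    then show ?case by (simp add: tendsto_null_power)
  qed
qed

text \<open>Weighting the increments of a rapidly converging subsequence with powers of 2
  gives almost everywhere convergence without Minkowski's inequality for series.\<close>

lemma L2_complete:
  fixes f :: "nat \<Rightarrow> 'a \<Rightarrow> real"
  assumes f: "\<And>n. f n \<in> L2 M"
    and cauchy: "\<And>e. e > 0 \<Longrightarrow> \<exists>N. \<forall>m\<ge>N. \<forall>n\<ge>N. l2_inner M (\<lambda>x. f m x - f n x) (\<lambda>x. f m x - f n x) < e"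
  shows "\<exists>g\<in>L2 M. \<exists>r. strict_mono (r :: nat \<Rightarrow> nat) \<and> (AE x in M. (\<lambda>n. f (r n) x) \<longlonglongrightarrow> g x) \<and>
    (\<lambda>n. l2_inner M (\<lambda>x. f n x - g x) (\<lambda>x. f n x - g x)) \<longlonglongrightarrow> 0"
proof -
  have meas[measurable]: "f n \<in> borel_measurable M" for n using f by (rule L2_D)
  define Dq where "Dq m n = l2_inner M (\<lambda>x. f m x - f n x) (\<lambda>x. f m x - f n x)" for m n
  have Dq: "ennreal (Dq m n) = (\<integral>\<^sup>+x. ennreal ((f m x - f n x)\<^sup>2) \<partial>M)" for m n
    unfolding Dq_def by (rule l2_inner_self_nn[OF L2_diff[OF f f]])
  \<comment> \<open>With squared distances below 8^-k, increments multiplied by 2^k still have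
    square integrals below 4^k 8^-k = 2^-k, which is summable.\<close>
  have "\<exists>r. \<forall>k. (\<forall>m\<ge>r k. \<forall>n\<ge>r k. Dq m n < (1/8) ^ k) \<and> r k < r (Suc k)"
  proof (intro dependent_nat_choice)
    show "\<exists>x. \<forall>m\<ge>x. \<forall>n\<ge>x. Dq m n < (1/8) ^ 0" using cauchy[of 1] by (simp add: Dq_def)
    fix x k
    obtain N where N: "\<forall>m\<ge>N. \<forall>n\<ge>N. Dq m n < (1/8) ^ Suc k" using cauchy[of "(1/8) ^ Suc k"] by (auto simp: Dq_def)
    then show "\<exists>y. (\<forall>m\<ge>y. \<forall>n\<ge>y. Dq m n < (1/8) ^ Suc k) \<and> x < y"
      by (intro exI[of _ "max N (Suc x)"]) auto
  qed
  then obtain r where r: "\<And>k m n. m \<ge> r k \<Longrightarrow> n \<ge> r k \<Longrightarrow> Dq m n < (1/8) ^ k" "\<And>k. r k < r (Suc k)"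
    by metis
  have mono: "strict_mono r" using r(2) by (simp add: strict_mono_Suc_iff)
  define d where "d k x = 2 ^ k * (f (r (Suc k)) x - f (r k) x)" for k x
  have dk: "(\<integral>\<^sup>+x. ennreal ((d k x)\<^sup>2) \<partial>M) \<le> ennreal ((1/2) ^ k)" for k
  proof -
    have "(\<integral>\<^sup>+x. ennreal ((d k x)\<^sup>2) \<partial>M) = (\<integral>\<^sup>+x. ennreal (4 ^ k) * ennreal ((f (r (Suc k)) x - f (r k) x)\<^sup>2) \<partial>M)"
    proof -
      have "(2 ^ k)\<^sup>2 = (4 :: real) ^ k" by (simp add: power2_eq_square power_mult_distrib[symmetric])
      then show ?thesis by (simp add: d_def power_mult_distrib ennreal_mult')
    qed
    also have "\<dots> = ennreal (4 ^ k) * ennreal (Dq (r (Suc k)) (r k))"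
      by (simp add: nn_integral_cmult Dq)
    also have "\<dots> \<le> ennreal (4 ^ k) * ennreal ((1/8) ^ k)"
      using r(1)[of k "r (Suc k)" "r k"] r(2)[of k] by (intro mult_left_mono ennreal_leI) auto
    also have "\<dots> = ennreal ((1/2) ^ k)"
      by (simp add: ennreal_mult'[symmetric] power_mult_distrib[symmetric])
    finally show ?thesis .
  qed
  have "(\<Sum>k. \<integral>\<^sup>+x. ennreal ((d k x)\<^sup>2) \<partial>M) \<le> (\<Sum>k. ennreal ((1/2) ^ k))"
    by (intro suminf_le dk) auto
  also have "\<dots> = ennreal (\<Sum>k. (1/2) ^ k)"
    by (rule suminf_ennreal2) (auto simp: summable_geometric)
  also have "\<dots> < \<infinity>" by simp
  finally have "AE x in M. (\<lambda>k. d k x) \<longlonglongrightarrow> 0"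
    by (intro AE_tendsto_zero_of_square_sums) (auto simp: d_def)
  then have conv: "AE x in M. convergent (\<lambda>k. f (r k) x)"
  proof eventually_elim
    case (elim x)
    obtain N where N: "\<And>k. k \<ge> N \<Longrightarrow> \<bar>d k x\<bar> < 1"
      using LIMSEQ_D[OF elim, of 1] by auto
    have "summable (\<lambda>k. f (r (Suc k)) x - f (r k) x)"
    proof (rule summable_comparison_test)
      have "norm (f (r (Suc k)) x - f (r k) x) \<le> (1/2) ^ k" if "k \<ge> N" for k
      proof -
        have "2 ^ k * \<bar>f (r (Suc k)) x - f (r k) x\<bar> < 1"
          using N[OF that] unfolding d_def abs_mult by simp
        then show ?thesis by (simp add: power_one_over field_simps)
      qed
      then show "\<exists>N. \<forall>k\<ge>N. norm (f (r (Suc k)) x - f (r k) x) \<le> (1/2) ^ k" by blast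
    qed (simp add: summable_geometric)
    then have "(\<lambda>n. \<Sum>k<n. f (r (Suc k)) x - f (r k) x) \<longlonglongrightarrow> (\<Sum>k. f (r (Suc k)) x - f (r k) x)"
      by (rule summable_LIMSEQ)
    then have "(\<lambda>n. f (r n) x - f (r 0) x) \<longlonglongrightarrow> (\<Sum>k. f (r (Suc k)) x - f (r k) x)"
      by (simp add: sum_lessThan_telescope[of "\<lambda>k. f (r k) x"])
    from tendsto_add[OF this tendsto_const[of "f (r 0) x"]] show ?case
      by (auto simp: convergent_def)
  qed
  define g where "g x = lim (\<lambda>k. f (r k) x)" for x
  have gm[measurable]: "g \<in> borel_measurable M"
    unfolding g_def[abs_def] by (rule borel_measurable_lim_metric) simp
  have lim: "AE x in M. (\<lambda>k. f (r k) x) \<longlonglongrightarrow> g x"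
    using conv by eventually_elim (simp add: g_def convergent_LIMSEQ_iff)
  \<comment> \<open>Letting the second index run along the subsequence turns a Cauchy estimate into
    an estimate of the distance to g.\<close>
  have fatou: "(\<integral>\<^sup>+x. ennreal ((f n x - g x)\<^sup>2) \<partial>M) \<le> ennreal c"
    if c: "\<And>m. m \<ge> N \<Longrightarrow> Dq n m \<le> c" for n c N
  proof -
    have "(\<integral>\<^sup>+x. ennreal ((f n x - g x)\<^sup>2) \<partial>M) = (\<integral>\<^sup>+x. liminf (\<lambda>k. ennreal ((f n x - f (r k) x)\<^sup>2)) \<partial>M)"
    proof (rule nn_integral_cong_AE, use lim in eventually_elim)
      case (elim x)
      have "(\<lambda>k. ennreal ((f n x - f (r k) x)\<^sup>2)) \<longlonglongrightarrow> ennreal ((f n x - g x)\<^sup>2)"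
        by (intro tendsto_intros elim)
      then show ?case by (intro lim_imp_Liminf[symmetric]) auto
    qed
    also have "\<dots> \<le> liminf (\<lambda>k. \<integral>\<^sup>+x. ennreal ((f n x - f (r k) x)\<^sup>2) \<partial>M)"
      by (intro nn_integral_liminf) simp
    also have "\<dots> = liminf (\<lambda>k. ennreal (Dq n (r k)))" by (simp add: Dq)
    also have "\<dots> \<le> liminf (\<lambda>k. ennreal c)"
    proof (rule Liminf_mono, rule eventually_sequentiallyI[of N])
      fix k assume "k \<ge> N"
      then have "r k \<ge> N" using seq_suble[OF mono, of k] by simp
      then show "ennreal (Dq n (r k)) \<le> ennreal c" by (intro ennreal_leI c)
    qed
    also have "\<dots> = ennreal c" by (simp add: Liminf_const)
    finally show ?thesis .
  qed
  obtain N0 where N0: "\<And>m n. m \<ge> N0 \<Longrightarrow> n \<ge> N0 \<Longrightarrow> Dq m n < 1" using cauchy[of 1] by (auto simp: Dq_def)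
  have "(\<integral>\<^sup>+x. ennreal ((f N0 x - g x)\<^sup>2) \<partial>M) \<le> ennreal 1"
    by (rule fatou[of N0]) (use N0[of N0] in \<open>auto intro: less_imp_le\<close>)
  then have "(\<lambda>x. f N0 x - g x) \<in> L2 M"
    by (subst L2_iff_nn_integral) (auto intro: le_less_trans)
  from L2_diff[OF f[of N0] this] have g: "g \<in> L2 M" by simp
  have "(\<lambda>n. l2_inner M (\<lambda>x. f n x - g x) (\<lambda>x. f n x - g x)) \<longlonglongrightarrow> 0"
  proof (rule LIMSEQ_I)
    fix e :: real assume e: "e > 0"
    then obtain N where N: "\<And>m n. m \<ge> N \<Longrightarrow> n \<ge> N \<Longrightarrow> Dq m n < e / 2"
      using cauchy[of "e / 2"] by (auto simp: Dq_def)
    have "norm (l2_inner M (\<lambda>x. f n x - g x) (\<lambda>x. f n x - g x) - 0) < e" if "n \<ge> N" for n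
    proof -
      have "ennreal (l2_inner M (\<lambda>x. f n x - g x) (\<lambda>x. f n x - g x)) \<le> ennreal (e / 2)"
        unfolding l2_inner_self_nn[OF L2_diff[OF f g]]
        by (rule fatou[of N]) (use N that in \<open>auto intro: less_imp_le\<close>)
      then have "l2_inner M (\<lambda>x. f n x - g x) (\<lambda>x. f n x - g x) \<le> e / 2"
        using e by (simp add: ennreal_le_iff)
      moreover have "0 \<le> l2_inner M (\<lambda>x. f n x - g x) (\<lambda>x. f n x - g x)"
        by (simp add: l2_inner_def)
      ultimately show ?thesis using e by simp
    qed
    then show "\<exists>N. \<forall>n\<ge>N. norm (l2_inner M (\<lambda>x. f n x - g x) (\<lambda>x. f n x - g x) - 0) < e" by blast
  qed
  with g mono lim show ?thesis by blast
qed

section \<open>The Hilbert space of classes of square-integrable functions\<close>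

lemma AE_eq_trans: "AE x in M. f x = g x \<Longrightarrow> AE x in M. g x = h x \<Longrightarrow> AE x in M. f x = h x"
  by (erule (1) eventually_elim2) simp

lemma AE_eq_map2:
  "AE x in M. f x = f' x \<Longrightarrow> AE x in M. g x = g' x \<Longrightarrow> AE x in M. F (f x) (g x) = F (f' x) (g' x)"
  by (erule (1) eventually_elim2) simp

\<comment> \<open>The relation is partial: only square-integrable functions are related even to
  themselves. Lebesgue measure is fixed because a type cannot depend on the weight
  \<open>W\<close>.\<close>
quotient_type (overloaded) 'a l2 = "'a::euclidean_space \<Rightarrow> real" /
  partial: "\<lambda>f g. f \<in> L2 lborel \<and> g \<in> L2 lborel \<and> (AE x in lborel. f x = g x)"
proof (rule part_equivpI)
  show "\<exists>f :: 'a \<Rightarrow> real. f \<in> L2 lborel \<and> f \<in> L2 lborel \<and> (AE x in lborel. f x = f x)"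
    using L2_zero by auto
  show "symp (\<lambda>f g :: 'a \<Rightarrow> real. f \<in> L2 lborel \<and> g \<in> L2 lborel \<and> (AE x in lborel. f x = g x))"
    by (intro sympI) (auto simp: eq_commute)
  show "transp (\<lambda>f g :: 'a \<Rightarrow> real. f \<in> L2 lborel \<and> g \<in> L2 lborel \<and> (AE x in lborel. f x = g x))"
    by (intro transpI) (auto dest: AE_eq_trans)
qed

instantiation l2 :: (euclidean_space) real_vector
begin

lift_definition zero_l2 :: "'a l2" is "\<lambda>_. 0" by (simp add: L2_zero)

lift_definition plus_l2 :: "'a l2 \<Rightarrow> 'a l2 \<Rightarrow> 'a l2" is "\<lambda>f g x. f x + g x"
  by (intro conjI L2_add AE_eq_map2[where F = "(+)"]) auto

lift_definition minus_l2 :: "'a l2 \<Rightarrow> 'a l2 \<Rightarrow> 'a l2" is "\<lambda>f g x. f x - g x"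
  by (intro conjI L2_diff AE_eq_map2[where F = "(-)"]) auto

lift_definition uminus_l2 :: "'a l2 \<Rightarrow> 'a l2" is "\<lambda>f x. - f x"
  using L2_scale[where c = "-1"] by auto

lift_definition scaleR_l2 :: "real \<Rightarrow> 'a l2 \<Rightarrow> 'a l2" is "\<lambda>c f x. c * f x"
  using L2_scale by auto

instance
proof
  fix x y z :: "'a l2" and a b :: real
  show "x + y + z = x + (y + z)"
    by transfer (auto simp: add.assoc intro: L2_add)
  show "x + y = y + x" by transfer (auto simp: add.commute intro: L2_add)
  show "0 + x = x" by transfer auto
  show "- x + x = 0" by transfer (auto simp: L2_zero)
  show "x - y = x + - y" by transfer (auto intro: L2_diff)
  show "a *\<^sub>R (x + y) = a *\<^sub>R x + a *\<^sub>R y"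
    by transfer (auto simp: distrib_left intro!: L2_add L2_scale)
  show "(a + b) *\<^sub>R x = a *\<^sub>R x + b *\<^sub>R x"
    by transfer (auto simp: distrib_right intro!: L2_add L2_scale)
  show "a *\<^sub>R b *\<^sub>R x = (a * b) *\<^sub>R x"
    by transfer (auto simp: mult.assoc intro!: L2_scale)
  show "1 *\<^sub>R x = x" by transfer auto
qed

end

instantiation l2 :: (euclidean_space) real_inner
begin

lift_definition inner_l2 :: "'a l2 \<Rightarrow> 'a l2 \<Rightarrow> real" is "l2_inner lborel"
proof -
  fix f1 f2 g1 g2 :: "'a \<Rightarrow> real"
  assume f: "f1 \<in> L2 lborel \<and> f2 \<in> L2 lborel \<and> (AE x in lborel. f1 x = f2 x)"
    and g: "g1 \<in> L2 lborel \<and> g2 \<in> L2 lborel \<and> (AE x in lborel. g1 x = g2 x)"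
  have [measurable]: "f1 \<in> borel_measurable borel" "f2 \<in> borel_measurable borel"
      "g1 \<in> borel_measurable borel" "g2 \<in> borel_measurable borel"
    using f g by (auto simp: L2_def)
  have "AE x in lborel. f1 x * g1 x = f2 x * g2 x"
    using f g by (intro AE_eq_map2[where F = "(*)"]) auto
  then show "l2_inner lborel f1 g1 = l2_inner lborel f2 g2"
    unfolding l2_inner_def by (intro integral_cong_AE) auto
qed

definition norm_l2 :: "'a l2 \<Rightarrow> real" where "norm_l2 x = sqrt (x \<bullet> x)"
definition dist_l2 :: "'a l2 \<Rightarrow> 'a l2 \<Rightarrow> real" where "dist_l2 x y = norm (x - y)"
definition sgn_l2 :: "'a l2 \<Rightarrow> 'a l2" where "sgn_l2 x = x /\<^sub>R norm x"
definition uniformity_l2 :: "('a l2 \<times> 'a l2) filter"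
  where "uniformity_l2 = (INF e\<in>{0 <..}. principal {(x, y). dist x y < e})"
definition open_l2 :: "'a l2 set \<Rightarrow> bool"
  where "open_l2 U = (\<forall>x\<in>U. eventually (\<lambda>(x', y). x' = x \<longrightarrow> y \<in> U) uniformity)"

instance
proof
  fix x y z :: "'a l2" and r :: real
  show "dist x y = norm (x - y)" by (rule dist_l2_def)
  show "sgn x = x /\<^sub>R norm x" by (rule sgn_l2_def)
  show "uniformity = (INF e\<in>{0 <..}. principal {(x::'a l2, y). dist x y < e})" by (rule uniformity_l2_def)
  show "open U = (\<forall>x\<in>U. \<forall>\<^sub>F (x', y) in uniformity. x' = x \<longrightarrow> y \<in> U)" for U :: "'a l2 set"
    by (rule open_l2_def)
  show "norm x = sqrt (x \<bullet> x)" by (rule norm_l2_def)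
  show "x \<bullet> y = y \<bullet> x" by transfer (simp add: l2_inner_def mult.commute)
  show "(x + y) \<bullet> z = x \<bullet> z + y \<bullet> z"
    by transfer (auto simp: l2_inner_def distrib_right L2_integrable_mult intro!: Bochner_Integration.integral_add)
  show "r *\<^sub>R x \<bullet> y = r * (x \<bullet> y)" by transfer (simp add: l2_inner_def mult.assoc)
  show "0 \<le> x \<bullet> x" by transfer (simp add: l2_inner_def)
  show "(x \<bullet> x = 0) = (x = 0)"
  proof transfer
    fix f :: "'a \<Rightarrow> real"
    assume f: "f \<in> L2 lborel \<and> f \<in> L2 lborel \<and> (AE x in lborel. f x = f x)"
    have "(LINT x|lborel. f x * f x) = 0 \<longleftrightarrow> (AE x in lborel. f x * f x = 0)"
      by (intro integral_nonneg_eq_0_iff_AE L2_integrable_mult) (use f in auto)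
    then show "(l2_inner lborel f f = 0) =
        (f \<in> L2 lborel \<and> (\<lambda>_. 0) \<in> L2 lborel \<and> (AE x in lborel. f x = 0))"
      using f by (simp add: l2_inner_def L2_zero)
  qed
qed

end

lemma abs_l2_inner:
  assumes "f \<in> L2 lborel" "g \<in> L2 lborel"
  shows "abs_l2 f \<bullet> abs_l2 g = l2_inner lborel f g"
  by (rule inner_l2.abs_eq) (use assms in auto)

lemma abs_l2_diff:
  assumes "f \<in> L2 lborel" "g \<in> L2 lborel"
  shows "abs_l2 f - abs_l2 g = abs_l2 (\<lambda>x. f x - g x)"
  by (rule minus_l2.abs_eq) (use assms in auto)

lemma abs_l2_surj: "\<exists>f\<in>L2 lborel. abs_l2 f = x"
proof (induction x)
  fix f :: "'a \<Rightarrow> real"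
  assume "f \<in> L2 lborel \<and> f \<in> L2 lborel \<and> (AE x in lborel. f x = f x)"
  then show "\<exists>g\<in>L2 lborel. abs_l2 g = abs_l2 f" by (intro bexI[of _ f]) simp_all
qed

instance l2 :: (euclidean_space) banach
proof
  fix X :: "nat \<Rightarrow> 'a l2" assume X: "Cauchy X"
  have "\<forall>n. \<exists>f. f \<in> L2 lborel \<and> X n = abs_l2 f"
  proof
    show "\<exists>f. f \<in> L2 lborel \<and> X n = abs_l2 f" for n using abs_l2_surj[of "X n"] by force
  qed
  from choice[OF this] obtain f where f: "\<And>n. f n \<in> L2 lborel" "\<And>n. X n = abs_l2 (f n)" by blast
  have "\<exists>N. \<forall>m\<ge>N. \<forall>n\<ge>N. l2_inner lborel (\<lambda>x. f m x - f n x) (\<lambda>x. f m x - f n x) < e" if "e > 0" for e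
  proof -
    obtain N where N: "\<And>m n. m \<ge> N \<Longrightarrow> n \<ge> N \<Longrightarrow> norm (X m - X n) < sqrt e"
      using X \<open>e > 0\<close> unfolding Cauchy_def dist_norm by (meson real_sqrt_gt_zero)
    have "l2_inner lborel (\<lambda>x. f m x - f n x) (\<lambda>x. f m x - f n x) < e" if "m \<ge> N" "n \<ge> N" for m n
      using N[OF that] by (simp add: f abs_l2_diff norm_eq_sqrt_inner abs_l2_inner L2_diff)
    then show ?thesis by blast
  qed
  from L2_complete[OF f(1) this] obtain g where g: "g \<in> L2 lborel"
      "(\<lambda>n. l2_inner lborel (\<lambda>x. f n x - g x) (\<lambda>x. f n x - g x)) \<longlonglongrightarrow> 0" by blast
  have "(\<lambda>n. norm (X n - abs_l2 g)) \<longlonglongrightarrow> 0"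
    using tendsto_real_sqrt[OF g(2)] by (simp add: f g abs_l2_diff norm_eq_sqrt_inner abs_l2_inner L2_diff)
  then have "X \<longlonglongrightarrow> abs_l2 g" by (simp add: tendsto_norm_zero_iff LIM_zero_iff)
  then show "convergent X" by (auto simp: convergent_def)
qed

section \<open>Transfer of operators, semigroups and forms to a Hilbert space\<close>

lemma
  assumes "bounded_operator M T"
  shows bounded_operator_L2: "\<And>f. f \<in> L2 M \<Longrightarrow> T f \<in> L2 M"
    and bounded_operator_lincomb: "\<And>f g a b. f \<in> L2 M \<Longrightarrow> g \<in> L2 M \<Longrightarrow>
      AE x in M. T (\<lambda>y. a * f y + b * g y) x = a * T f x + b * T g x"
    and bounded_operator_bound: "\<exists>C. \<forall>f\<in>L2 M. l2_norm M (T f) \<le> C * l2_norm M f"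
  using assms unfolding bounded_operator_def by blast+

text \<open>An isometry of L2(M) onto a Hilbert space, given on representatives; that it identifies
  exactly the functions equal almost everywhere follows from the isometry
  (\<open>\<Phi>_eq_iff\<close>).\<close>

locale l2_model =
  fixes M :: "'a measure" and \<Phi> :: "('a \<Rightarrow> real) \<Rightarrow> 'h::{real_inner,banach}"
  assumes \<Phi>_lincomb: "f \<in> L2 M \<Longrightarrow> g \<in> L2 M \<Longrightarrow> \<Phi> (\<lambda>x. a * f x + b * g x) = a *\<^sub>R \<Phi> f + b *\<^sub>R \<Phi> g"
    and \<Phi>_inner: "f \<in> L2 M \<Longrightarrow> g \<in> L2 M \<Longrightarrow> \<Phi> f \<bullet> \<Phi> g = l2_inner M f g"
    and \<Phi>_surj: "\<exists>f\<in>L2 M. \<Phi> f = x"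
begin

definition rep :: "'h \<Rightarrow> 'a \<Rightarrow> real" where "rep x = (SOME f. f \<in> L2 M \<and> \<Phi> f = x)"

lemma rep_L2: "rep x \<in> L2 M" and \<Phi>_rep: "\<Phi> (rep x) = x"
  using someI_ex[of "\<lambda>f. f \<in> L2 M \<and> \<Phi> f = x"] \<Phi>_surj[of x] unfolding rep_def by auto

lemma \<Phi>_diff: "f \<in> L2 M \<Longrightarrow> g \<in> L2 M \<Longrightarrow> \<Phi> (\<lambda>x. f x - g x) = \<Phi> f - \<Phi> g"
  using \<Phi>_lincomb[of f g 1 "-1"] by simp

lemma \<Phi>_scale: "f \<in> L2 M \<Longrightarrow> \<Phi> (\<lambda>x. c * f x) = c *\<^sub>R \<Phi> f"
  using \<Phi>_lincomb[of f f c 0] by simp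

lemma \<Phi>_zero: "\<Phi> (\<lambda>_. 0) = 0"
  using \<Phi>_scale[OF L2_zero, of 0] by simp

lemma l2_norm_\<Phi>: "f \<in> L2 M \<Longrightarrow> l2_norm M f = norm (\<Phi> f)"
  by (simp add: l2_norm_def norm_eq_sqrt_inner \<Phi>_inner)

lemma \<Phi>_eq_iff:
  assumes "f \<in> L2 M" "g \<in> L2 M"
  shows "\<Phi> f = \<Phi> g \<longleftrightarrow> (AE x in M. f x = g x)"
proof -
  have d: "(\<lambda>x. f x - g x) \<in> L2 M" using L2_diff assms by blast
  have "\<Phi> f = \<Phi> g \<longleftrightarrow> \<Phi> (\<lambda>x. f x - g x) \<bullet> \<Phi> (\<lambda>x. f x - g x) = 0"
    using assms by (simp add: \<Phi>_diff)
  also have "\<dots> \<longleftrightarrow> (LINT x|M. (f x - g x) * (f x - g x)) = 0"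
    by (simp only: \<Phi>_inner[OF d d] l2_inner_def)
  also have "\<dots> \<longleftrightarrow> (AE x in M. (f x - g x) * (f x - g x) = 0)"
    by (intro integral_nonneg_eq_0_iff_AE L2_integrable_mult d) simp
  finally show ?thesis by simp
qed

definition lift :: "(('a \<Rightarrow> real) \<Rightarrow> 'a \<Rightarrow> real) \<Rightarrow> 'h \<Rightarrow> 'h" where
  "lift T x = \<Phi> (T (rep x))"

definition lower :: "('h \<Rightarrow> 'h) \<Rightarrow> ('a \<Rightarrow> real) \<Rightarrow> 'a \<Rightarrow> real" where
  "lower S f = rep (S (\<Phi> f))"

text \<open>The representative chosen in \<open>lift\<close> does not matter: the difference of two
  representatives has norm 0, and linearity together with the norm bound carries this over to
  \<open>T\<close>.\<close>

lemma lift_\<Phi>: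
  assumes T: "bounded_operator M T" and f: "f \<in> L2 M"
  shows "lift T (\<Phi> f) = \<Phi> (T f)"
proof -
  define g where "g = rep (\<Phi> f)"
  have g: "g \<in> L2 M" "\<Phi> g = \<Phi> f" by (simp_all add: g_def rep_L2 \<Phi>_rep)
  note TL = bounded_operator_L2[OF T]
  obtain C where C: "\<And>h. h \<in> L2 M \<Longrightarrow> l2_norm M (T h) \<le> C * l2_norm M h"
    using bounded_operator_bound[OF T] by blast
  have d: "(\<lambda>x. 1 * g x + - 1 * f x) \<in> L2 M" by (rule L2_lincomb[OF g(1) f])
  have "AE x in M. T (\<lambda>x. 1 * g x + - 1 * f x) x = 1 * T g x + - 1 * T f x"
    by (rule bounded_operator_lincomb[OF T g(1) f])
  then have "\<Phi> (T (\<lambda>x. 1 * g x + - 1 * f x)) = \<Phi> (\<lambda>x. 1 * T g x + - 1 * T f x)"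
    by (rule iffD2[OF \<Phi>_eq_iff[OF TL[OF d] L2_lincomb[OF TL[OF g(1)] TL[OF f]]]])
  also have "\<dots> = \<Phi> (T g) - \<Phi> (T f)" using \<Phi>_lincomb[OF TL[OF g(1)] TL[OF f], of 1 "-1"] by simp
  finally have eq: "\<Phi> (T g) - \<Phi> (T f) = \<Phi> (T (\<lambda>x. 1 * g x + - 1 * f x))" ..
  have "norm (\<Phi> (T (\<lambda>x. 1 * g x + - 1 * f x))) \<le> C * norm (\<Phi> (\<lambda>x. 1 * g x + - 1 * f x))"
    using C[OF d] by (simp only: l2_norm_\<Phi> d TL)
  also have "\<Phi> (\<lambda>x. 1 * g x + - 1 * f x) = 0" using \<Phi>_lincomb[OF g(1) f, of 1 "-1"] g(2) by simp
  finally have "\<Phi> (T g) = \<Phi> (T f)" using eq by simp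
  then show ?thesis by (simp add: lift_def g_def)
qed

lemma bounded_linear_lift:
  assumes T: "bounded_operator M T"
  shows "bounded_linear (lift T)"
proof -
  note TL = bounded_operator_L2[OF T]
  obtain C where C: "\<And>h. h \<in> L2 M \<Longrightarrow> l2_norm M (T h) \<le> C * l2_norm M h"
    using bounded_operator_bound[OF T] by blast
  have comb: "lift T (a *\<^sub>R x + b *\<^sub>R y) = a *\<^sub>R lift T x + b *\<^sub>R lift T y" for a b x y
  proof -
    have "lift T (a *\<^sub>R x + b *\<^sub>R y) = lift T (\<Phi> (\<lambda>z. a * rep x z + b * rep y z))"
      by (simp add: \<Phi>_lincomb rep_L2 \<Phi>_rep)
    also have "\<dots> = \<Phi> (T (\<lambda>z. a * rep x z + b * rep y z))"
      by (rule lift_\<Phi>[OF T L2_lincomb[OF rep_L2 rep_L2]])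
    also have "\<dots> = \<Phi> (\<lambda>z. a * T (rep x) z + b * T (rep y) z)"
    proof -
      have "AE z in M. T (\<lambda>z. a * rep x z + b * rep y z) z = a * T (rep x) z + b * T (rep y) z"
        by (rule bounded_operator_lincomb[OF T rep_L2 rep_L2])
      then show ?thesis by (simp add: \<Phi>_eq_iff TL L2_lincomb rep_L2)
    qed
    also have "\<dots> = a *\<^sub>R lift T x + b *\<^sub>R lift T y" by (simp add: \<Phi>_lincomb TL rep_L2 lift_def)
    finally show ?thesis .
  qed
  show ?thesis
  proof (rule bounded_linear_intro)
    show "lift T (x + y) = lift T x + lift T y" for x y using comb[of 1 x 1 y] by simp
    show "lift T (r *\<^sub>R x) = r *\<^sub>R lift T x" for r x using comb[of r x 0 x] by simp
    show "norm (lift T x) \<le> norm x * C" for x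
      using C[OF rep_L2[of x]] by (simp add: l2_norm_\<Phi> rep_L2 TL \<Phi>_rep lift_def mult.commute)
  qed
qed

lemma bounded_operator_lower:
  assumes S: "bounded_linear S"
  shows "bounded_operator M (lower S)"
  unfolding bounded_operator_def
proof (intro conjI ballI allI)
  show "lower S f \<in> L2 M" for f by (simp add: lower_def rep_L2)
  fix f g a b assume f: "f \<in> L2 M" "g \<in> L2 M"
  have "\<Phi> (lower S (\<lambda>y. a * f y + b * g y)) = \<Phi> (\<lambda>x. a * lower S f x + b * lower S g x)"
    using linear_add[OF bounded_linear.linear[OF S]] linear_scale[OF bounded_linear.linear[OF S]] f
    by (simp add: lower_def \<Phi>_rep rep_L2 \<Phi>_lincomb)
  then show "AE x in M. lower S (\<lambda>y. a * f y + b * g y) x = a * lower S f x + b * lower S g x"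
    by (subst \<Phi>_eq_iff[symmetric]) (simp_all add: lower_def rep_L2 L2_lincomb)
next
  obtain K where "\<And>x. norm (S x) \<le> norm x * K" using bounded_linear.bounded[OF S] by blast
  then have "\<forall>f\<in>L2 M. l2_norm M (lower S f) \<le> K * l2_norm M f"
    by (simp add: l2_norm_\<Phi> lower_def rep_L2 \<Phi>_rep mult.commute)
  then show "\<exists>C. \<forall>f\<in>L2 M. l2_norm M (lower S f) \<le> C * l2_norm M f" ..
qed

lemma \<Phi>_lower: "\<Phi> (lower S f) = S (\<Phi> f)"
  by (simp add: lower_def \<Phi>_rep)

lemma lower_L2: "lower S f \<in> L2 M"
  by (simp add: lower_def rep_L2)

lemma compact_operator_iff:
  assumes T: "bounded_operator M T"
  shows "compact_operator M T \<longleftrightarrow> compact_map (lift T)"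
proof -
  note TL = bounded_operator_L2[OF T]
  have conv: "(\<lambda>n. l2_norm M (\<lambda>x. T (f (r n)) x - g x)) \<longlonglongrightarrow> 0 \<longleftrightarrow> (\<lambda>n. lift T (\<Phi> (f (r n)))) \<longlonglongrightarrow> \<Phi> g"
    if "\<And>n. f n \<in> L2 M" "g \<in> L2 M" for f g and r :: "nat \<Rightarrow> nat"
    using that by (simp add: l2_norm_\<Phi> L2_diff TL \<Phi>_diff lift_\<Phi>[OF T] tendsto_norm_zero_iff LIM_zero_iff)
  show ?thesis
  proof
    assume C: "compact_operator M T"
    show "compact_map (lift T)"
      unfolding compact_map_def
    proof (intro allI impI)
      fix F :: "nat \<Rightarrow> 'h" assume "bounded (range F)"
      then obtain B where B: "\<And>n. norm (F n) \<le> B" unfolding bounded_iff by auto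
      have "\<forall>n. l2_norm M (rep (F n)) \<le> B" using B by (simp add: l2_norm_\<Phi> rep_L2 \<Phi>_rep)
      moreover have "\<forall>n. rep (F n) \<in> L2 M" by (simp add: rep_L2)
      ultimately obtain g r where g: "g \<in> L2 M" "strict_mono (r :: nat \<Rightarrow> nat)"
          "(\<lambda>n. l2_norm M (\<lambda>x. T (rep (F (r n))) x - g x)) \<longlonglongrightarrow> 0"
        using C[unfolded compact_operator_def, THEN conjunct2, THEN spec[of _ "\<lambda>n. rep (F n)"]] by blast
      then have "(\<lambda>n. lift T (F (r n))) \<longlonglongrightarrow> \<Phi> g"
        using conv[of "\<lambda>n. rep (F n)" g r] by (simp add: rep_L2 \<Phi>_rep)
      then show "\<exists>g r. strict_mono (r :: nat \<Rightarrow> nat) \<and> (\<lambda>n. lift T (F (r n))) \<longlonglongrightarrow> g" using g(2) by blast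
    qed
  next
    assume C: "compact_map (lift T)"
    show "compact_operator M T"
      unfolding compact_operator_def
    proof (intro conjI T allI impI)
      fix f :: "nat \<Rightarrow> 'a \<Rightarrow> real"
      assume f: "(\<forall>n. f n \<in> L2 M) \<and> (\<exists>C. \<forall>n. l2_norm M (f n) \<le> C)"
      then obtain B where B: "\<forall>n. l2_norm M (f n) \<le> B" by blast
      have "norm (\<Phi> (f n)) \<le> B" for n using B f by (simp add: l2_norm_\<Phi>[symmetric])
      then have "bounded (range (\<lambda>n. \<Phi> (f n)))" by (intro boundedI[of _ B]) auto
      then obtain y r where r: "strict_mono (r :: nat \<Rightarrow> nat)" "(\<lambda>n. lift T (\<Phi> (f (r n)))) \<longlonglongrightarrow> y"
        using C unfolding compact_map_def by meson
      then have "(\<lambda>n. l2_norm M (\<lambda>x. T (f (r n)) x - rep y x)) \<longlonglongrightarrow> 0"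
        using f by (subst conv) (auto simp: rep_L2 \<Phi>_rep)
      then show "\<exists>g\<in>L2 M. \<exists>r. strict_mono (r :: nat \<Rightarrow> nat) \<and>
          (\<lambda>n. l2_norm M (\<lambda>x. T (f (r n)) x - g x)) \<longlonglongrightarrow> 0"
        using r(1) rep_L2 by blast
    qed
  qed
qed

lemma generates_semigroup_lift:
  assumes gen: "generates_semigroup M L P"
    and L: "\<And>u f. (u, f) \<in> L \<longleftrightarrow> u \<in> L2 M \<and> f \<in> L2 M \<and> (\<Phi> u, \<Phi> f) \<in> G"
  shows "semigroup_generated_by G (\<lambda>t. lift (P t))"
proof -
  have B: "bounded_operator M (P t)" if "t \<ge> 0" for t using gen that by (simp add: generates_semigroup_def)
  have PL: "P t f \<in> L2 M" if "t \<ge> 0" "f \<in> L2 M" for t f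
    by (rule bounded_operator_L2[OF B[OF that(1)] that(2)])
  have lim_iff: "((\<lambda>t. (1 / t) *\<^sub>R (lift (P t) x - x)) \<longlongrightarrow> y) (at_right 0) \<longleftrightarrow> (x, y) \<in> G" for x y
  proof -
    have "(x, y) \<in> G \<longleftrightarrow> (rep x, rep y) \<in> L" by (simp add: L rep_L2 \<Phi>_rep)
    also have "\<dots> \<longleftrightarrow> ((\<lambda>t. l2_norm M (\<lambda>z. (P t (rep x) z - rep x z) / t - rep y z)) \<longlongrightarrow> 0) (at_right 0)"
      using gen rep_L2 unfolding generates_semigroup_def by auto
    also have "\<dots> \<longleftrightarrow> ((\<lambda>t. norm ((1 / t) *\<^sub>R (lift (P t) x - x) - y)) \<longlongrightarrow> 0) (at_right 0)"
    proof (rule tendsto_cong)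
      show "\<forall>\<^sub>F t in at_right 0. l2_norm M (\<lambda>z. (P t (rep x) z - rep x z) / t - rep y z)
          = norm ((1 / t) *\<^sub>R (lift (P t) x - x) - y)"
        using eventually_at_right_less[of 0]
      proof eventually_elim
        case (elim t)
        have Pt: "P t (rep x) \<in> L2 M" using elim by (intro PL rep_L2) simp
        have q: "(\<lambda>z. (1 / t) * (P t (rep x) z - rep x z)) \<in> L2 M" by (intro L2_scale L2_diff Pt rep_L2)
        have "\<Phi> (\<lambda>z. (1 / t) * (P t (rep x) z - rep x z) - rep y z) = (1 / t) *\<^sub>R (lift (P t) x - x) - y"
          by (subst \<Phi>_diff[OF q rep_L2], subst \<Phi>_scale[OF L2_diff[OF Pt rep_L2]], subst \<Phi>_diff[OF Pt rep_L2])
            (simp add: \<Phi>_rep lift_def)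
        then show ?case by (simp add: l2_norm_\<Phi>[OF L2_diff[OF q rep_L2], simplified])
      qed
    qed
    finally show ?thesis by (simp add: tendsto_norm_zero_iff LIM_zero_iff)
  qed
  show ?thesis
    unfolding semigroup_generated_by_def
  proof (intro conjI allI impI)
    show "bounded_linear (lift (P t))" if "t \<ge> 0" for t by (rule bounded_linear_lift[OF B[OF that]])
    show "lift (P 0) x = x" for x
    proof -
      have "AE z in M. P 0 (rep x) z = rep x z" using gen rep_L2 by (simp add: generates_semigroup_def)
      then have "\<Phi> (P 0 (rep x)) = \<Phi> (rep x)" by (simp add: \<Phi>_eq_iff PL rep_L2)
      then show ?thesis by (simp add: lift_def \<Phi>_rep)
    qed
    show "lift (P (s + t)) x = lift (P s) (lift (P t) x)" if st: "s \<ge> 0" "t \<ge> 0" for s t x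
    proof -
      have "AE z in M. P (s + t) (rep x) z = P s (P t (rep x)) z"
        using gen rep_L2 st by (simp add: generates_semigroup_def)
      then have "\<Phi> (P (s + t) (rep x)) = \<Phi> (P s (P t (rep x)))" using st by (simp add: \<Phi>_eq_iff PL rep_L2)
      then show ?thesis
        using lift_\<Phi>[OF B[OF st(1)] PL[OF st(2) rep_L2], of x] by (simp add: lift_def)
    qed
    show "((\<lambda>t. lift (P t) x) \<longlongrightarrow> x) (at_right 0)" for x
    proof -
      have "((\<lambda>t. l2_norm M (\<lambda>z. P t (rep x) z - rep x z)) \<longlongrightarrow> 0) (at_right 0)"
        using gen rep_L2 by (simp add: generates_semigroup_def)
      moreover have "\<forall>\<^sub>F t in at_right 0. l2_norm M (\<lambda>z. P t (rep x) z - rep x z) = norm (lift (P t) x - x)"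
        using eventually_at_right_less[of 0]
        by eventually_elim (simp add: l2_norm_\<Phi> L2_diff PL rep_L2 \<Phi>_diff \<Phi>_rep lift_def)
      ultimately have "((\<lambda>t. norm (lift (P t) x - x)) \<longlongrightarrow> 0) (at_right 0)"
        by (rule Lim_transform_eventually)
      then show ?thesis by (simp add: tendsto_norm_zero_iff LIM_zero_iff)
    qed
    show "G = {(x, y). ((\<lambda>t. (1 / t) *\<^sub>R (lift (P t) x - x)) \<longlongrightarrow> y) (at_right 0)}"
      using lim_iff by auto
  qed
qed

lemma generates_semigroup_lower:
  assumes gen: "semigroup_generated_by G Q"
    and L: "\<And>u f. (u, f) \<in> L \<longleftrightarrow> u \<in> L2 M \<and> f \<in> L2 M \<and> (\<Phi> u, \<Phi> f) \<in> G"
  shows "generates_semigroup M L (\<lambda>t. lower (Q t))"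
proof -
  have lim_iff: "((\<lambda>t. l2_norm M (\<lambda>z. (lower (Q t) f z - f z) / t - g z)) \<longlongrightarrow> 0) (at_right 0) \<longleftrightarrow> (\<Phi> f, \<Phi> g) \<in> G"
    if f: "f \<in> L2 M" and g: "g \<in> L2 M" for f g
  proof -
    have "l2_norm M (\<lambda>z. (lower (Q t) f z - f z) / t - g z) = norm ((1 / t) *\<^sub>R (Q t (\<Phi> f) - \<Phi> f) - \<Phi> g)" for t
    proof -
      have q: "(\<lambda>z. (1 / t) * (lower (Q t) f z - f z)) \<in> L2 M" by (intro L2_scale L2_diff lower_L2 f)
      have "\<Phi> (\<lambda>z. (1 / t) * (lower (Q t) f z - f z) - g z) = (1 / t) *\<^sub>R (Q t (\<Phi> f) - \<Phi> f) - \<Phi> g"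
        by (subst \<Phi>_diff[OF q g], subst \<Phi>_scale[OF L2_diff[OF lower_L2 f]], subst \<Phi>_diff[OF lower_L2 f])
          (simp add: \<Phi>_lower)
      then show ?thesis by (simp add: l2_norm_\<Phi>[OF L2_diff[OF q g], simplified])
    qed
    then show ?thesis using gen
      by (simp add: tendsto_norm_zero_iff LIM_zero_iff semigroup_generated_by_def)
  qed
  show ?thesis
    unfolding generates_semigroup_def
  proof (intro conjI allI ballI impI)
    show "bounded_operator M (lower (Q t))" if "t \<ge> 0" for t
      using gen that by (intro bounded_operator_lower) (simp add: semigroup_generated_by_def)
    show "AE x in M. lower (Q 0) f x = f x" if "f \<in> L2 M" for f
      using gen that by (subst \<Phi>_eq_iff[symmetric]) (simp_all add: lower_L2 \<Phi>_lower semigroup_generated_by_def)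
    show "AE x in M. lower (Q (s + t)) f x = lower (Q s) (lower (Q t) f) x" if "s \<ge> 0" "t \<ge> 0" for s t f
      using gen that by (subst \<Phi>_eq_iff[symmetric]) (simp_all add: lower_L2 \<Phi>_lower semigroup_generated_by_def)
    show "((\<lambda>t. l2_norm M (\<lambda>x. lower (Q t) f x - f x)) \<longlongrightarrow> 0) (at_right 0)" if "f \<in> L2 M" for f
      using gen that
      by (simp add: l2_norm_\<Phi> L2_diff lower_L2 \<Phi>_diff \<Phi>_lower tendsto_norm_zero_iff LIM_zero_iff semigroup_generated_by_def)
    show "L = {(f, g). f \<in> L2 M \<and> g \<in> L2 M \<and>
        ((\<lambda>t. l2_norm M (\<lambda>x. (lower (Q t) f x - f x) / t - g x)) \<longlongrightarrow> 0) (at_right 0)}"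
      using lim_iff L by auto
  qed
qed

end

text \<open>The properties of a form on functions that make its image under \<open>\<Phi>\<close> a
  dense closed form. \<open>F_cong\<close> and \<open>E_cong\<close> express that domain and form
  depend on classes only.\<close>

locale l2_form = l2_model M \<Phi>
  for M :: "'a measure" and \<Phi> :: "('a \<Rightarrow> real) \<Rightarrow> 'h::{real_inner,banach}" +
  fixes F :: "('a \<Rightarrow> real) set" and E :: "('a \<Rightarrow> real) \<Rightarrow> ('a \<Rightarrow> real) \<Rightarrow> real"
  assumes F_L2: "f \<in> F \<Longrightarrow> f \<in> L2 M"
    and F_zero: "(\<lambda>_. 0) \<in> F"
    and F_lincomb: "f \<in> F \<Longrightarrow> g \<in> F \<Longrightarrow> (\<lambda>x. a * f x + b * g x) \<in> F"
    and F_cong: "f \<in> F \<Longrightarrow> g \<in> L2 M \<Longrightarrow> AE x in M. f x = g x \<Longrightarrow> g \<in> F"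
    and E_cong: "f \<in> F \<Longrightarrow> g \<in> F \<Longrightarrow> h \<in> F \<Longrightarrow> AE x in M. f x = g x \<Longrightarrow> E f h = E g h"
    and E_lincomb: "f \<in> F \<Longrightarrow> g \<in> F \<Longrightarrow> h \<in> F \<Longrightarrow> E (\<lambda>x. a * f x + b * g x) h = a * E f h + b * E g h"
    and E_sym: "f \<in> F \<Longrightarrow> g \<in> F \<Longrightarrow> E f g = E g f"
    and E_nonneg: "f \<in> F \<Longrightarrow> 0 \<le> E f f"
    and E_closed: "\<And>U u. (\<And>n. U n \<in> F) \<Longrightarrow> u \<in> L2 M \<Longrightarrow>
       (\<lambda>n. l2_inner M (\<lambda>x. U n x - u x) (\<lambda>x. U n x - u x)) \<longlonglongrightarrow> 0 \<Longrightarrow>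
       (\<And>e. e > 0 \<Longrightarrow> \<exists>N. \<forall>m\<ge>N. \<forall>n\<ge>N. E (\<lambda>x. U m x - U n x) (\<lambda>x. U m x - U n x) < e) \<Longrightarrow>
       u \<in> F \<and> (\<lambda>n. E (\<lambda>x. U n x - u x) (\<lambda>x. U n x - u x)) \<longlonglongrightarrow> 0"
    and F_total: "\<And>f. f \<in> L2 M \<Longrightarrow> (\<And>v. v \<in> F \<Longrightarrow> l2_inner M f v = 0) \<Longrightarrow> AE x in M. f x = 0"
begin

definition EH :: "'h \<Rightarrow> 'h \<Rightarrow> real" where "EH x y = E (rep x) (rep y)"

lemma rep_\<Phi>_AE: "f \<in> L2 M \<Longrightarrow> AE x in M. f x = rep (\<Phi> f) x"
  by (subst \<Phi>_eq_iff[symmetric]) (simp_all add: rep_L2 \<Phi>_rep)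

lemma rep_\<Phi>_F: "f \<in> F \<Longrightarrow> rep (\<Phi> f) \<in> F"
  by (rule F_cong[OF _ rep_L2 rep_\<Phi>_AE]) (auto intro: F_L2)

lemma EH_\<Phi>: "f \<in> F \<Longrightarrow> g \<in> F \<Longrightarrow> EH (\<Phi> f) (\<Phi> g) = E f g"
proof -
  assume f: "f \<in> F" and g: "g \<in> F"
  have "E f g = E (rep (\<Phi> f)) g"
    by (intro E_cong f g rep_\<Phi>_F rep_\<Phi>_AE F_L2)
  also have "\<dots> = E g (rep (\<Phi> f))" by (intro E_sym f g rep_\<Phi>_F)
  also have "\<dots> = E (rep (\<Phi> g)) (rep (\<Phi> f))"
    by (intro E_cong f g rep_\<Phi>_F rep_\<Phi>_AE F_L2)
  also have "\<dots> = E (rep (\<Phi> f)) (rep (\<Phi> g))" by (intro E_sym f g rep_\<Phi>_F)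
  finally show "EH (\<Phi> f) (\<Phi> g) = E f g" by (simp add: EH_def)
qed

lemma F_diff: "f \<in> F \<Longrightarrow> g \<in> F \<Longrightarrow> (\<lambda>x. f x - g x) \<in> F"
  using F_lincomb[of f g 1 "-1"] by simp

lemma \<Phi>_mem_iff:
  assumes "f \<in> L2 M"
  shows "\<Phi> f \<in> \<Phi> ` F \<longleftrightarrow> f \<in> F"
proof
  assume "\<Phi> f \<in> \<Phi> ` F"
  then obtain g where g: "g \<in> F" "\<Phi> g = \<Phi> f" by auto
  then have "AE x in M. g x = f x" using \<Phi>_eq_iff[OF F_L2[OF g(1)] assms] by simp
  then show "f \<in> F" using F_cong g(1) assms by blast
qed simp

sublocale H: dense_closed_form "\<Phi> ` F" EH
proof unfold_locales
  have comb: "a *\<^sub>R \<Phi> f + b *\<^sub>R \<Phi> g = \<Phi> (\<lambda>x. a * f x + b * g x)" if "f \<in> F" "g \<in> F" for a b f g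
    using that by (simp add: \<Phi>_lincomb F_L2)
  show "subspace (\<Phi> ` F)"
  proof (rule subspaceI)
    show "0 \<in> \<Phi> ` F" using F_zero \<Phi>_zero by (metis imageI)
    fix x y c assume "x \<in> \<Phi> ` F" "y \<in> \<Phi> ` F"
    then obtain f g where "f \<in> F" "g \<in> F" "x = \<Phi> f" "y = \<Phi> g" by blast
    then show "x + y \<in> \<Phi> ` F" using comb[of f g 1 1] F_lincomb[of f g 1 1] by simp
  next
    fix x c assume "x \<in> \<Phi> ` F"
    then obtain f where "f \<in> F" "x = \<Phi> f" by auto
    then show "c *\<^sub>R x \<in> \<Phi> ` F" using comb[of f f c 0] F_lincomb[of f f c 0] by simp
  qed
  fix u v w assume "u \<in> \<Phi> ` F" "v \<in> \<Phi> ` F" "w \<in> \<Phi> ` F"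
  then obtain f g h where fgh: "f \<in> F" "g \<in> F" "h \<in> F" "u = \<Phi> f" "v = \<Phi> g" "w = \<Phi> h" by blast
  show "EH (u + v) w = EH u w + EH v w"
    using comb[of f g 1 1] F_lincomb[of f g 1 1] E_lincomb[of f g h 1 1] fgh by (simp add: EH_\<Phi>)
next
  fix u w c assume "u \<in> \<Phi> ` F" "w \<in> \<Phi> ` F"
  then obtain f h where fh: "f \<in> F" "h \<in> F" "u = \<Phi> f" "w = \<Phi> h" by auto
  show "EH (c *\<^sub>R u) w = c * EH u w"
    using \<Phi>_lincomb[of f f c 0] F_lincomb[of f f c 0] E_lincomb[of f f h c 0] fh F_L2[of f]
    by (simp add: EH_\<Phi> \<Phi>_scale[symmetric])
next
  fix u v assume "u \<in> \<Phi> ` F" "v \<in> \<Phi> ` F"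
  then obtain f g where fg: "f \<in> F" "g \<in> F" "u = \<Phi> f" "v = \<Phi> g" by blast
  show "EH u v = EH v u" unfolding fg(3,4) EH_\<Phi>[OF fg(1,2)] EH_\<Phi>[OF fg(2,1)] by (rule E_sym[OF fg(1,2)])
next
  fix u assume "u \<in> \<Phi> ` F"
  then obtain f where f: "f \<in> F" "u = \<Phi> f" by blast
  show "0 \<le> EH u u" unfolding f(2) EH_\<Phi>[OF f(1,1)] by (rule E_nonneg[OF f(1)])
next
  fix U u
  assume U: "\<And>n. U n \<in> \<Phi> ` F" "U \<longlonglongrightarrow> u"
    and cauchy: "\<And>e. e > 0 \<Longrightarrow> \<exists>N. \<forall>m\<ge>N. \<forall>n\<ge>N. EH (U m - U n) (U m - U n) < e"
  have "\<forall>n. \<exists>f. f \<in> F \<and> U n = \<Phi> f" using U(1) by blast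
  from choice[OF this] obtain f where f: "\<And>n. f n \<in> F" "\<And>n. U n = \<Phi> (f n)" by blast
  define g where "g = rep u"
  have g: "g \<in> L2 M" "u = \<Phi> g" by (simp_all add: g_def rep_L2 \<Phi>_rep)
  have "(\<lambda>n. (U n - u) \<bullet> (U n - u)) \<longlonglongrightarrow> (u - u) \<bullet> (u - u)" by (intro tendsto_intros U)
  then have "(\<lambda>n. l2_inner M (\<lambda>x. f n x - g x) (\<lambda>x. f n x - g x)) \<longlonglongrightarrow> 0"
    by (simp add: f g \<Phi>_diff[symmetric] F_L2 \<Phi>_inner L2_diff)
  moreover have "\<exists>N. \<forall>m\<ge>N. \<forall>n\<ge>N. E (\<lambda>x. f m x - f n x) (\<lambda>x. f m x - f n x) < e" if "e > 0" for e
    using cauchy[OF that] by (simp add: f \<Phi>_diff[symmetric] F_L2 EH_\<Phi> F_diff)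
  ultimately have lim: "g \<in> F \<and> (\<lambda>n. E (\<lambda>x. f n x - g x) (\<lambda>x. f n x - g x)) \<longlonglongrightarrow> 0"
    using E_closed[of f g] f(1) g(1) by blast
  then have gF: "g \<in> F" ..
  have "EH (U n - u) (U n - u) = E (\<lambda>x. f n x - g x) (\<lambda>x. f n x - g x)" for n
    unfolding f(2) g(2) \<Phi>_diff[OF F_L2[OF f(1)] g(1), symmetric]
    by (intro EH_\<Phi> F_diff f(1) gF)
  then show "u \<in> \<Phi> ` F \<and> (\<lambda>n. EH (U n - u) (U n - u)) \<longlonglongrightarrow> 0"
    using lim g(2) by simp
next
  fix x assume "\<And>v. v \<in> \<Phi> ` F \<Longrightarrow> x \<bullet> v = 0"
  then have "l2_inner M (rep x) v = 0" if "v \<in> F" for v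
    using that \<Phi>_inner[OF rep_L2[of x] F_L2[OF that]] by (simp add: \<Phi>_rep)
  then have "AE z in M. rep x z = 0" by (intro F_total rep_L2)
  then have "\<Phi> (rep x) = \<Phi> (\<lambda>_. 0)" by (simp add: \<Phi>_eq_iff rep_L2 L2_zero)
  then show "x = 0" by (simp add: \<Phi>_rep \<Phi>_zero)
qed

lemma generator_\<Phi>:
  "(u, f) \<in> form_generator M F E \<longleftrightarrow> u \<in> L2 M \<and> f \<in> L2 M \<and> (\<Phi> u, \<Phi> f) \<in> H.gen"
proof -
  have "(\<Phi> u, \<Phi> f) \<in> H.gen \<longleftrightarrow> u \<in> F \<and> (\<forall>v\<in>F. E u v = - l2_inner M f v)" if "u \<in> L2 M" "f \<in> L2 M"
  proof -
    have "(\<Phi> u, \<Phi> f) \<in> H.gen \<longleftrightarrow> u \<in> F \<and> (\<forall>v\<in>F. EH (\<Phi> u) (\<Phi> v) = - (\<Phi> f \<bullet> \<Phi> v))"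
      by (simp add: H.gen_def \<Phi>_mem_iff that)
    also have "\<dots> \<longleftrightarrow> u \<in> F \<and> (\<forall>v\<in>F. E u v = - l2_inner M f v)"
      using that by (auto simp: EH_\<Phi> \<Phi>_inner F_L2)
    finally show ?thesis .
  qed
  then show ?thesis by (auto simp: form_generator_def F_L2)
qed

theorem semigroup_exists: "\<exists>P. generates_semigroup M (form_generator M F E) P"
  using generates_semigroup_lower[OF H.semigroup_generated_Q generator_\<Phi>] by blast

lemma lift_semigroup:
  assumes "generates_semigroup M (form_generator M F E) P" "t \<ge> 0"
  shows "lift (P t) = H.Q t"
  using H.semigroup_unique[OF generates_semigroup_lift[OF assms(1) generator_\<Phi>] assms(2)] by (rule ext)

lemma compact_semigroup_iff:
  assumes P: "generates_semigroup M (form_generator M F E) P"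
  shows "compact_semigroup M P \<longleftrightarrow> (\<forall>t>0. compact_map (H.Q t))"
proof -
  have "compact_operator M (P t) \<longleftrightarrow> compact_map (H.Q t)" if "t > 0" for t
  proof -
    have "bounded_operator M (P t)" using P that by (simp add: generates_semigroup_def)
    then show ?thesis using compact_operator_iff lift_semigroup[OF P, of t] that by simp
  qed
  then show ?thesis by (simp add: compact_semigroup_def)
qed

lemma is_resolvent_J: "is_resolvent M (form_generator M F E) 1 (lower (H.J 1))"
  unfolding is_resolvent_def
proof (intro conjI ballI)
  show "bounded_operator M (lower (H.J 1))" by (intro bounded_operator_lower H.bounded_linear_J)
  show "(lower (H.J 1) f, \<lambda>x. 1 * lower (H.J 1) f x - f x) \<in> form_generator M F E" if "f \<in> L2 M" for f
    using H.J_gen[of 1 "\<Phi> f"] that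
    by (simp add: generator_\<Phi> lower_L2 L2_diff \<Phi>_lower \<Phi>_diff)
  fix ug assume "ug \<in> form_generator M F E"
  then obtain u g where ug: "ug = (u, g)" "(u, g) \<in> form_generator M F E" by (cases ug) auto
  then have L: "u \<in> L2 M" "g \<in> L2 M" "(\<Phi> u, \<Phi> g) \<in> H.gen" by (simp_all add: generator_\<Phi>)
  have "\<Phi> (lower (H.J 1) (\<lambda>y. u y - g y)) = \<Phi> u"
    using H.J_of_gen[of 1 "\<Phi> u" "\<Phi> g"] L by (simp add: \<Phi>_lower \<Phi>_diff)
  then have "AE x in M. lower (H.J 1) (\<lambda>y. u y - g y) x = u x"
    using \<Phi>_eq_iff[OF lower_L2 L(1)] by simp
  then show "case ug of (u, g) \<Rightarrow> AE x in M. lower (H.J 1) (\<lambda>y. 1 * u y - g y) x = u x"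
    by (simp add: ug)
qed

lemma lift_lower: "lift (lower S) = S"
  by (rule ext) (simp add: lift_def \<Phi>_lower \<Phi>_rep)

theorem compact_if_compactly_embedded:
  assumes emb: "\<And>C. compact (closure (\<Phi> ` {f \<in> F. l2_inner M f f + E f f \<le> C}))"
    and P: "generates_semigroup M (form_generator M F E) P"
  shows "compact_semigroup M P \<and> has_compact_resolvent M (form_generator M F E)"
proof -
  have "{v \<in> \<Phi> ` F. v \<bullet> v + EH v v \<le> C} = \<Phi> ` {f \<in> F. l2_inner M f f + E f f \<le> C}" for C
    by (auto simp: \<Phi>_inner F_L2 EH_\<Phi>)
  then have ce: "H.compactly_embedded" using emb by (simp add: H.compactly_embedded_def)
  have "compact_operator M (lower (H.J 1))"
    using compact_operator_iff[OF bounded_operator_lower[OF H.bounded_linear_J]] H.compact_J[OF ce]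
    by (simp add: lift_lower)
  then show ?thesis
    using is_resolvent_J H.compact_Q[OF ce] compact_semigroup_iff[OF P]
    unfolding has_compact_resolvent_def by blast
qed

theorem not_compact_if_orthonormal:
  assumes g: "\<And>n::nat. g n \<in> F" "\<And>n. l2_inner M (g n) (g n) = 1"
      "\<And>m n. m \<noteq> n \<Longrightarrow> l2_inner M (g m) (g n) = 0" "\<And>n. E (g n) (g n) \<le> C"
    and P: "generates_semigroup M (form_generator M F E) P"
  shows "\<not> compact_semigroup M P \<and> \<not> has_compact_resolvent M (form_generator M F E)"
proof -
  have gH: "\<Phi> (g n) \<in> \<Phi> ` F" "\<Phi> (g n) \<bullet> \<Phi> (g n) = 1" "EH (\<Phi> (g n)) (\<Phi> (g n)) \<le> C" for n
    using g by (auto simp: \<Phi>_inner F_L2 EH_\<Phi>)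
  have gO: "\<Phi> (g m) \<bullet> \<Phi> (g n) = 0" if "m \<noteq> n" for m n using g that by (simp add: \<Phi>_inner F_L2)
  have "\<not> compact_operator M R" if R: "is_resolvent M (form_generator M F E) l R" for l R
  proof -
    have B: "bounded_operator M R" using R by (simp add: is_resolvent_def)
    note RL = bounded_operator_L2[OF B]
    have "lift R (l *\<^sub>R x - y) = x" if xy: "(x, y) \<in> H.gen" for x y
    proof -
      have "(rep x, rep y) \<in> form_generator M F E" using xy by (simp add: generator_\<Phi> rep_L2 \<Phi>_rep)
      then have AE: "AE z in M. R (\<lambda>z. l * rep x z - rep y z) z = rep x z"
        using R unfolding is_resolvent_def by auto
      have L: "(\<lambda>z. l * rep x z - rep y z) \<in> L2 M" by (intro L2_diff L2_scale rep_L2)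
      have "l *\<^sub>R x - y = \<Phi> (\<lambda>z. l * rep x z - rep y z)"
        by (simp add: \<Phi>_diff \<Phi>_scale L2_scale rep_L2 \<Phi>_rep)
      then have "lift R (l *\<^sub>R x - y) = \<Phi> (R (\<lambda>z. l * rep x z - rep y z))" using lift_\<Phi>[OF B L] by simp
      also have "\<dots> = \<Phi> (rep x)" using AE \<Phi>_eq_iff[OF RL[OF L] rep_L2] by simp
      finally show ?thesis by (simp add: \<Phi>_rep)
    qed
    then show ?thesis
      using H.not_compact_resolvent[of "\<lambda>n. \<Phi> (g n)" C "lift R" l, OF gH(1,2) gO gH(3)] compact_operator_iff[OF B] by simp
  qed
  moreover have "\<not> compact_semigroup M P"
  proof -
    obtain t where "t > 0" "\<not> compact_map (H.Q t)"
      using H.not_compact_Q[of "\<lambda>n. \<Phi> (g n)" C, OF gH(1,2) gO gH(3)] by blast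
    then show ?thesis unfolding compact_semigroup_iff[OF P] by blast
  qed
  ultimately show ?thesis unfolding has_compact_resolvent_def by blast
qed

end

subsection \<open>The energy of the stable process\<close>

lemma stable_const_pos:
  assumes "0 < \<alpha>" "\<alpha> < 2"
  shows "stable_const TYPE('a::euclidean_space) \<alpha> > 0"
  unfolding stable_const_def using assms
  by (intro divide_pos_pos mult_pos_pos Gamma_real_pos) auto

lemma stable_integrand_measurable [measurable]:
  fixes f g :: "'a::euclidean_space \<Rightarrow> real"
  assumes [measurable]: "f \<in> borel_measurable borel" "g \<in> borel_measurable borel"
  shows "stable_integrand \<alpha> f g \<in> borel_measurable (lborel \<Otimes>\<^sub>M lborel)"
  unfolding stable_integrand_def by measurable

text \<open>Takes values in [0, infinity] and omits the factor 1/2, so that where finite it is twice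
  \<open>stable_form\<close> (\<open>energy_eq_form\<close>). Fatou and Tonelli apply to it before
  integrability is known.\<close>

definition energy :: "real \<Rightarrow> ('a::euclidean_space \<Rightarrow> real) \<Rightarrow> ennreal" where
  "energy \<alpha> f = (\<integral>\<^sup>+z. ennreal (stable_integrand \<alpha> f f z) \<partial>(lborel \<Otimes>\<^sub>M lborel))"

text \<open>Without the condition of \<open>stable_dom\<close> that f lie in L2(dx), which elements
  of the extended Dirichlet space may violate.\<close>

definition finite_energy :: "real \<Rightarrow> ('a::euclidean_space \<Rightarrow> real) set" where
  "finite_energy \<alpha> = {f \<in> borel_measurable borel. energy \<alpha> f < \<infinity>}"

lemma stable_integrand_commute: "stable_integrand \<alpha> f g = stable_integrand \<alpha> g f"
  by (auto simp: stable_integrand_def fun_eq_iff)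

lemma stable_integrand_lincomb:
  "stable_integrand \<alpha> (\<lambda>x. a * f x + b * g x) h z = a * stable_integrand \<alpha> f h z + b * stable_integrand \<alpha> g h z"
  by (cases z) (simp add: stable_integrand_def algebra_simps add_divide_distrib diff_divide_distrib)

lemma AE_lborel_pair:
  fixes P :: "'a::euclidean_space \<Rightarrow> bool"
  assumes "AE x in lborel. P x"
  shows "AE z in (lborel \<Otimes>\<^sub>M lborel). P (fst z) \<and> P (snd (z :: 'a \<times> 'a))"
proof -
  obtain N where N: "N \<in> null_sets lborel" "{x. \<not> P x} \<subseteq> N"
    using assms by (auto elim!: AE_E simp: null_sets_def)
  have [measurable]: "N \<in> sets lborel" using N(1) by auto
  have "N \<times> UNIV \<in> null_sets (lborel \<Otimes>\<^sub>M (lborel :: 'a measure))"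
    using N(1) lborel.emeasure_pair_measure_Times[of N lborel "UNIV :: 'a set"]
    by (auto simp: null_sets_def intro!: pair_measureI)
  moreover have "UNIV \<times> N \<in> null_sets ((lborel :: 'a measure) \<Otimes>\<^sub>M lborel)"
    using N(1) lborel.emeasure_pair_measure_Times[of "UNIV :: 'a set" lborel N]
    by (auto simp: null_sets_def intro!: pair_measureI)
  ultimately have "N \<times> UNIV \<union> UNIV \<times> N \<in> null_sets ((lborel :: 'a measure) \<Otimes>\<^sub>M lborel)" by (rule null_sets.Un)
  then show ?thesis by (rule AE_I') (use N(2) in auto)
qed

lemma energy_fatou:
  fixes un :: "nat \<Rightarrow> 'a::euclidean_space \<Rightarrow> real"
  assumes [measurable]: "\<And>n. un n \<in> borel_measurable borel"
    and lim: "AE x in lborel. (\<lambda>n. un n x) \<longlonglongrightarrow> u x"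
    and bound: "\<And>n. n \<ge> N \<Longrightarrow> energy \<alpha> (un n) \<le> c"
  shows "energy \<alpha> u \<le> c"
proof -
  have "energy \<alpha> u = (\<integral>\<^sup>+z. liminf (\<lambda>n. ennreal (stable_integrand \<alpha> (un n) (un n) z)) \<partial>(lborel \<Otimes>\<^sub>M lborel))"
    unfolding energy_def
  proof (rule nn_integral_cong_AE, use AE_lborel_pair[OF lim] in eventually_elim)
    case (elim z)
    have "(\<lambda>n. stable_integrand \<alpha> (un n) (un n) z) \<longlonglongrightarrow> stable_integrand \<alpha> u u z"
      unfolding stable_integrand_def split_beta by (intro tendsto_intros) (use elim in auto)
    then have "(\<lambda>n. ennreal (stable_integrand \<alpha> (un n) (un n) z)) \<longlonglongrightarrow> ennreal (stable_integrand \<alpha> u u z)"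
      by (intro tendsto_intros)
    then show ?case by (intro lim_imp_Liminf[symmetric]) auto
  qed
  also have "\<dots> \<le> liminf (\<lambda>n. energy \<alpha> (un n))"
    unfolding energy_def by (intro nn_integral_liminf) simp
  also have "\<dots> \<le> liminf (\<lambda>n. c)"
    by (rule Liminf_mono, rule eventually_sequentiallyI[of N]) (rule bound)
  also have "\<dots> = c" by (simp add: Liminf_const)
  finally show ?thesis .
qed

locale stable_exponent =
  fixes \<alpha> :: real and T :: "'a::euclidean_space itself"
  assumes \<alpha>_pos: "0 < \<alpha>" and \<alpha>_less_2: "\<alpha> < 2" and \<alpha>_less_DIM: "\<alpha> < real DIM('a)"
begin

definition c\<^sub>\<alpha> :: real where "c\<^sub>\<alpha> = stable_const TYPE('a) \<alpha>"

lemma c_pos: "c\<^sub>\<alpha> > 0"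
  unfolding c\<^sub>\<alpha>_def using stable_const_pos \<alpha>_pos \<alpha>_less_2 by blast

lemma kernel_nonneg: "0 \<le> c\<^sub>\<alpha> / norm (x - y :: 'a) powr (real DIM('a) + \<alpha>)"
  using c_pos by simp

lemma stable_integrand_eq:
  "stable_integrand \<alpha> f g (x, y :: 'a) =
     (f x - f y) * (g x - g y) * (c\<^sub>\<alpha> / norm (x - y) powr (real DIM('a) + \<alpha>))"
  by (simp add: stable_integrand_def c\<^sub>\<alpha>_def)

lemma stable_integrand_nonneg: "0 \<le> stable_integrand \<alpha> f f (z :: 'a \<times> 'a)"
  by (cases z) (simp only: stable_integrand_eq mult_nonneg_nonneg zero_le_square kernel_nonneg)

lemma stable_integrand_abs_le:
  "\<bar>stable_integrand \<alpha> f g z\<bar> \<le> stable_integrand \<alpha> f f z + stable_integrand \<alpha> g g (z :: 'a \<times> 'a)"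
proof (cases z)
  case (Pair x y)
  let ?k = "c\<^sub>\<alpha> / norm (x - y) powr (real DIM('a) + \<alpha>)"
  define a b where "a = f x - f y" and "b = g x - g y"
  have "2 * \<bar>a * b\<bar> \<le> a * a + b * b"
    using sum_squares_bound[of "\<bar>a\<bar>" "\<bar>b\<bar>"] by (simp add: abs_mult mult.assoc power2_eq_square)
  then have "\<bar>a * b\<bar> \<le> a * a + b * b" using abs_ge_zero[of "a * b"] by linarith
  then have "\<bar>a * b\<bar> * ?k \<le> (a * a + b * b) * ?k" by (intro mult_right_mono kernel_nonneg)
  moreover have "\<bar>a * b * ?k\<bar> = \<bar>a * b\<bar> * ?k"
    by (subst abs_mult) (simp only: abs_of_nonneg[OF kernel_nonneg])
  ultimately show ?thesis by (simp only: Pair stable_integrand_eq a_def[symmetric] b_def[symmetric] distrib_right)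
qed

lemma stable_integrand_lincomb_le:
  "stable_integrand \<alpha> (\<lambda>x. a * f x + b * g x) (\<lambda>x. a * f x + b * g x) z
     \<le> 2 * a\<^sup>2 * stable_integrand \<alpha> f f z + 2 * b\<^sup>2 * stable_integrand \<alpha> g g (z :: 'a \<times> 'a)"
proof (cases z)
  case (Pair x y)
  let ?k = "c\<^sub>\<alpha> / norm (x - y) powr (real DIM('a) + \<alpha>)"
  define p q where "p = f x - f y" and "q = g x - g y"
  have "2 * ((a * p) * (b * q)) \<le> (a * p)\<^sup>2 + (b * q)\<^sup>2"
    using sum_squares_bound[of "a * p" "b * q"] by (simp add: mult.assoc)
  then have "(a * p + b * q) * (a * p + b * q) \<le> 2 * a\<^sup>2 * (p * p) + 2 * b\<^sup>2 * (q * q)"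
    by (simp add: power2_eq_square algebra_simps)
  then have "(a * p + b * q) * (a * p + b * q) * ?k \<le> (2 * a\<^sup>2 * (p * p) + 2 * b\<^sup>2 * (q * q)) * ?k"
    by (intro mult_right_mono kernel_nonneg)
  moreover have "a * f x + b * g x - (a * f y + b * g y) = a * p + b * q" by (simp add: p_def q_def algebra_simps)
  ultimately show ?thesis
    by (simp only: Pair stable_integrand_eq p_def[symmetric] q_def[symmetric] distrib_right mult.assoc)
qed

lemma finite_energy_measurable: "f \<in> finite_energy \<alpha> \<Longrightarrow> (f :: 'a \<Rightarrow> real) \<in> borel_measurable borel"
  by (simp add: finite_energy_def)

lemma energy_lincomb_le:
  assumes [measurable]: "f \<in> borel_measurable borel" "g \<in> borel_measurable borel"
  shows "energy \<alpha> (\<lambda>x. a * f x + b * g x) \<le> ennreal (2 * a\<^sup>2) * energy \<alpha> f + ennreal (2 * b\<^sup>2) * energy \<alpha> (g :: 'a \<Rightarrow> real)"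
proof -
  have "energy \<alpha> (\<lambda>x. a * f x + b * g x) \<le>
    (\<integral>\<^sup>+z. ennreal (2 * a\<^sup>2) * ennreal (stable_integrand \<alpha> f f z) + ennreal (2 * b\<^sup>2) * ennreal (stable_integrand \<alpha> g g z) \<partial>(lborel \<Otimes>\<^sub>M lborel))"
    unfolding energy_def
  proof (rule nn_integral_mono)
    fix z :: "'a \<times> 'a"
    have "ennreal (stable_integrand \<alpha> (\<lambda>x. a * f x + b * g x) (\<lambda>x. a * f x + b * g x) z)
        \<le> ennreal (2 * a\<^sup>2 * stable_integrand \<alpha> f f z + 2 * b\<^sup>2 * stable_integrand \<alpha> g g z)"
      by (intro ennreal_leI stable_integrand_lincomb_le)
    also have "\<dots> = ennreal (2 * a\<^sup>2) * ennreal (stable_integrand \<alpha> f f z) + ennreal (2 * b\<^sup>2) * ennreal (stable_integrand \<alpha> g g z)"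
      by (simp add: ennreal_plus ennreal_mult stable_integrand_nonneg)
    finally show "ennreal (stable_integrand \<alpha> (\<lambda>x. a * f x + b * g x) (\<lambda>x. a * f x + b * g x) z) \<le> \<dots>" .
  qed
  also have "\<dots> = ennreal (2 * a\<^sup>2) * energy \<alpha> f + ennreal (2 * b\<^sup>2) * energy \<alpha> g"
    unfolding energy_def by (subst nn_integral_add; (subst nn_integral_cmult)?; (subst nn_integral_cmult)?) simp_all
  finally show ?thesis .
qed

lemma finite_energy_lincomb:
  assumes "f \<in> finite_energy \<alpha>" "g \<in> finite_energy \<alpha>"
  shows "(\<lambda>x. a * f x + b * g x) \<in> (finite_energy \<alpha> :: ('a \<Rightarrow> real) set)"
proof -
  have [measurable]: "f \<in> borel_measurable borel" "g \<in> borel_measurable borel"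
    using assms by (auto simp: finite_energy_def)
  have "ennreal (2 * a\<^sup>2) * energy \<alpha> f + ennreal (2 * b\<^sup>2) * energy \<alpha> g < \<infinity>"
    using assms by (auto simp: finite_energy_def ennreal_mult_less_top)
  then show ?thesis using energy_lincomb_le[of f g a b] by (auto simp: finite_energy_def intro: le_less_trans)
qed

lemma finite_energy_diff:
  "f \<in> finite_energy \<alpha> \<Longrightarrow> g \<in> finite_energy \<alpha> \<Longrightarrow> (\<lambda>x. f x - g x) \<in> (finite_energy \<alpha> :: ('a \<Rightarrow> real) set)"
  using finite_energy_lincomb[of f g 1 "-1"] by simp

lemma integrable_stable_integrand_self_iff:
  assumes [measurable]: "f \<in> borel_measurable borel"
  shows "integrable (lborel \<Otimes>\<^sub>M lborel) (stable_integrand \<alpha> f f) \<longleftrightarrow> energy \<alpha> (f :: 'a \<Rightarrow> real) < \<infinity>"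
  by (simp add: integrable_iff_bounded energy_def stable_integrand_nonneg)

lemma integrable_stable_integrand:
  assumes "f \<in> finite_energy \<alpha>" "g \<in> finite_energy \<alpha>"
  shows "integrable (lborel \<Otimes>\<^sub>M lborel) (stable_integrand \<alpha> f (g :: 'a \<Rightarrow> real))"
proof (rule Bochner_Integration.integrable_bound)
  have [measurable]: "f \<in> borel_measurable borel" "g \<in> borel_measurable borel"
    using assms by (auto simp: finite_energy_def)
  show "integrable (lborel \<Otimes>\<^sub>M lborel) (\<lambda>z. stable_integrand \<alpha> f f z + stable_integrand \<alpha> g g z)"
    using assms by (intro Bochner_Integration.integrable_add) (auto simp: integrable_stable_integrand_self_iff finite_energy_def)
  show "stable_integrand \<alpha> f g \<in> borel_measurable (lborel \<Otimes>\<^sub>M lborel)" by measurable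
  show "AE z in lborel \<Otimes>\<^sub>M lborel. norm (stable_integrand \<alpha> f g z) \<le> norm (stable_integrand \<alpha> f f z + stable_integrand \<alpha> g g z)"
    by (intro AE_I2) (use stable_integrand_abs_le stable_integrand_nonneg in \<open>simp add: add_nonneg_nonneg\<close>)
qed

lemma energy_eq_form:
  assumes "f \<in> (finite_energy \<alpha> :: ('a \<Rightarrow> real) set)"
  shows "energy \<alpha> f = ennreal (2 * stable_form \<alpha> f f)"
  unfolding energy_def stable_form_def
  by (subst nn_integral_eq_integral) (auto simp: integrable_stable_integrand assms stable_integrand_nonneg)

lemma stable_form_nonneg: "0 \<le> stable_form \<alpha> f (f :: 'a \<Rightarrow> real)"
  by (simp add: stable_form_def stable_integrand_nonneg)

lemma stable_form_sym: "stable_form \<alpha> f g = stable_form \<alpha> g f"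
  by (simp add: stable_form_def stable_integrand_commute[of \<alpha> f g])

lemma stable_form_lincomb:
  assumes "f \<in> finite_energy \<alpha>" "g \<in> finite_energy \<alpha>" "h \<in> finite_energy \<alpha>"
  shows "stable_form \<alpha> (\<lambda>x. a * f x + b * g x) h = a * stable_form \<alpha> f h + b * stable_form \<alpha> g (h :: 'a \<Rightarrow> real)"
proof -
  have "stable_integrand \<alpha> (\<lambda>x. a * f x + b * g x) h = (\<lambda>z. a * stable_integrand \<alpha> f h z + b * stable_integrand \<alpha> g h z)"
    by (rule ext) (rule stable_integrand_lincomb)
  then show ?thesis using assms by (simp add: stable_form_def integrable_stable_integrand algebra_simps)
qed

lemma stable_form_diff:
  assumes "f \<in> finite_energy \<alpha>" "g \<in> finite_energy \<alpha>" "h \<in> finite_energy \<alpha>"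
  shows "stable_form \<alpha> (\<lambda>x. f x - g x) h = stable_form \<alpha> f h - stable_form \<alpha> g (h :: 'a \<Rightarrow> real)"
  using stable_form_lincomb[OF assms, of 1 "-1"] by simp

lemma stable_form_cauchy_schwarz:
  assumes f: "f \<in> finite_energy \<alpha>" and g: "g \<in> finite_energy \<alpha>"
  shows "(stable_form \<alpha> f g)\<^sup>2 \<le> stable_form \<alpha> f f * stable_form \<alpha> g (g :: 'a \<Rightarrow> real)"
proof (rule discriminant_cauchy_schwarz)
  fix t
  have fg: "(\<lambda>x. 1 * f x + t * g x) \<in> finite_energy \<alpha>" by (rule finite_energy_lincomb[OF f g])
  have "stable_form \<alpha> (\<lambda>x. 1 * f x + t * g x) (\<lambda>x. 1 * f x + t * g x)
      = stable_form \<alpha> f f + 2 * t * stable_form \<alpha> f g + t\<^sup>2 * stable_form \<alpha> g g"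
    unfolding stable_form_lincomb[OF f g fg]
    unfolding stable_form_sym[of f "\<lambda>x. 1 * f x + t * g x"] stable_form_sym[of g "\<lambda>x. 1 * f x + t * g x"]
      stable_form_lincomb[OF f g f] stable_form_lincomb[OF f g g] stable_form_sym[of g f]
    by (simp add: power2_eq_square algebra_simps)
  then show "0 \<le> stable_form \<alpha> f f + 2 * t * stable_form \<alpha> f g + t\<^sup>2 * stable_form \<alpha> g g"
    using stable_form_nonneg[of "\<lambda>x. 1 * f x + t * g x"] by simp
qed (rule stable_form_nonneg)

lemma stable_dom_iff:
  "(f :: 'a \<Rightarrow> real) \<in> stable_dom \<alpha> \<longleftrightarrow> f \<in> L2 lborel \<and> f \<in> finite_energy \<alpha>"
  by (auto simp: stable_dom_def finite_energy_def integrable_stable_integrand_self_iff L2_def)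

text \<open>For fixed n, Fatou's lemma applied to un n - un (r m) as m grows passes the Cauchy bound
  on to un n - u. Asking for almost everywhere convergence along a subsequence only is deliberate:
  that is what convergence in L2 provides.\<close>

lemma finite_energy_cauchy_limit:
  assumes fin: "\<And>n. un n \<in> finite_energy \<alpha>" and um[measurable]: "u \<in> borel_measurable borel"
    and r: "strict_mono (r :: nat \<Rightarrow> nat)" and lim: "AE x in lborel. (\<lambda>n. un (r n) x) \<longlonglongrightarrow> (u :: 'a \<Rightarrow> real) x"
    and cauchy: "\<And>e. e > 0 \<Longrightarrow> \<exists>N. \<forall>m\<ge>N. \<forall>n\<ge>N. stable_form \<alpha> (\<lambda>x. un m x - un n x) (\<lambda>x. un m x - un n x) < e"
  shows "u \<in> finite_energy \<alpha>" "(\<lambda>n. stable_form \<alpha> (\<lambda>x. un n x - u x) (\<lambda>x. un n x - u x)) \<longlonglongrightarrow> 0"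
proof -
  have [measurable]: "un n \<in> borel_measurable borel" for n using fin by (rule finite_energy_measurable)
  have close: "energy \<alpha> (\<lambda>x. un n x - u x) \<le> ennreal (2 * e)"
    if N: "\<And>m. m \<ge> N \<Longrightarrow> stable_form \<alpha> (\<lambda>x. un n x - un m x) (\<lambda>x. un n x - un m x) < e" for n e N
  proof (rule energy_fatou[where un = "\<lambda>m x. un n x - un (r m) x" and N = N])
    show "AE x in lborel. (\<lambda>m. un n x - un (r m) x) \<longlonglongrightarrow> un n x - u x"
      using lim by eventually_elim (intro tendsto_intros)
    show "energy \<alpha> (\<lambda>x. un n x - un (r m) x) \<le> ennreal (2 * e)" if "m \<ge> N" for m
      using N[of "r m"] seq_suble[OF r, of m] that
      by (subst energy_eq_form[OF finite_energy_diff[OF fin fin]]) (auto intro!: ennreal_leI)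
  qed measurable
  obtain N where "\<forall>m\<ge>N. \<forall>n\<ge>N. stable_form \<alpha> (\<lambda>x. un m x - un n x) (\<lambda>x. un m x - un n x) < 1"
    using cauchy[of 1] by auto
  then have "energy \<alpha> (\<lambda>x. un N x - u x) \<le> ennreal (2 * 1)" by (intro close[of N]) simp
  then have "(\<lambda>x. un N x - u x) \<in> finite_energy \<alpha>" by (auto simp: finite_energy_def intro: le_less_trans)
  from finite_energy_diff[OF fin[of N] this] show ufin: "u \<in> finite_energy \<alpha>" by simp
  show "(\<lambda>n. stable_form \<alpha> (\<lambda>x. un n x - u x) (\<lambda>x. un n x - u x)) \<longlonglongrightarrow> 0"
  proof (rule LIMSEQ_I)
    fix e :: real assume e: "e > 0"
    obtain N where N: "\<And>m n. m \<ge> N \<Longrightarrow> n \<ge> N \<Longrightarrow> stable_form \<alpha> (\<lambda>x. un m x - un n x) (\<lambda>x. un m x - un n x) < e / 2"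
      using cauchy[of "e / 2"] e by auto
    have "norm (stable_form \<alpha> (\<lambda>x. un n x - u x) (\<lambda>x. un n x - u x) - 0) < e" if "n \<ge> N" for n
    proof -
      have "energy \<alpha> (\<lambda>x. un n x - u x) \<le> ennreal (2 * (e / 2))"
        by (rule close[of N]) (rule N[OF that])
      then have "2 * stable_form \<alpha> (\<lambda>x. un n x - u x) (\<lambda>x. un n x - u x) \<le> 2 * (e / 2)"
        unfolding energy_eq_form[OF finite_energy_diff[OF fin ufin]] using e by (subst (asm) ennreal_le_iff) auto
      then show ?thesis using e stable_form_nonneg[of "\<lambda>x. un n x - u x"] by simp
    qed
    then show "\<exists>N. \<forall>n\<ge>N. norm (stable_form \<alpha> (\<lambda>x. un n x - u x) (\<lambda>x. un n x - u x) - 0) < e" by blast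
  qed
qed

section \<open>The extended Dirichlet space and its form\<close>

lemma stable_approx_energy:
  assumes ap: "stable_approx \<alpha> un (u :: 'a \<Rightarrow> real)" and u: "u \<in> borel_measurable borel"
  shows "u \<in> finite_energy \<alpha>" "(\<lambda>n. stable_form \<alpha> (\<lambda>x. un n x - u x) (\<lambda>x. un n x - u x)) \<longlonglongrightarrow> 0"
proof -
  have "un n \<in> finite_energy \<alpha>" for n using ap by (simp add: stable_approx_def stable_dom_iff)
  moreover have "strict_mono (\<lambda>n::nat. n)" by (simp add: strict_mono_def)
  ultimately show "u \<in> finite_energy \<alpha>" "(\<lambda>n. stable_form \<alpha> (\<lambda>x. un n x - u x) (\<lambda>x. un n x - u x)) \<longlonglongrightarrow> 0"
    using finite_energy_cauchy_limit[of un u "\<lambda>n. n"] u ap by (auto simp: stable_approx_def)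
qed

lemma stable_form_tendsto:
  assumes fin: "\<And>n. un n \<in> finite_energy \<alpha>" "\<And>n. vn n \<in> finite_energy \<alpha>"
      "u \<in> finite_energy \<alpha>" "v \<in> (finite_energy \<alpha> :: ('a \<Rightarrow> real) set)"
    and u: "(\<lambda>n. stable_form \<alpha> (\<lambda>x. un n x - u x) (\<lambda>x. un n x - u x)) \<longlonglongrightarrow> 0"
    and v: "(\<lambda>n. stable_form \<alpha> (\<lambda>x. vn n x - v x) (\<lambda>x. vn n x - v x)) \<longlonglongrightarrow> 0"
  shows "(\<lambda>n. stable_form \<alpha> (un n) (vn n)) \<longlonglongrightarrow> stable_form \<alpha> u v"
proof -
  have small: "(\<lambda>n. stable_form \<alpha> (fn n) (gn n)) \<longlonglongrightarrow> 0"
    if "\<And>n. fn n \<in> finite_energy \<alpha>" "\<And>n. gn n \<in> (finite_energy \<alpha> :: ('a \<Rightarrow> real) set)"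
      and lim: "(\<lambda>n. stable_form \<alpha> (fn n) (fn n) * stable_form \<alpha> (gn n) (gn n)) \<longlonglongrightarrow> 0" for fn gn
  proof -
    have "(\<lambda>n. (stable_form \<alpha> (fn n) (gn n))\<^sup>2) \<longlonglongrightarrow> 0"
      by (rule tendsto_sandwich[OF _ _ tendsto_const lim])
        (auto intro!: always_eventually stable_form_cauchy_schwarz that)
    then show ?thesis by (simp add: tendsto_null_power)
  qed
  have un_d: "(\<lambda>x. un n x - u x) \<in> finite_energy \<alpha>" and vn_d: "(\<lambda>x. vn n x - v x) \<in> finite_energy \<alpha>" for n
    by (intro finite_energy_diff fin)+
  have 1: "(\<lambda>n. stable_form \<alpha> (\<lambda>x. un n x - u x) (\<lambda>x. vn n x - v x)) \<longlonglongrightarrow> 0"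
    using tendsto_mult[OF u v] by (intro small un_d vn_d) simp
  have 2: "(\<lambda>n. stable_form \<alpha> (\<lambda>x. un n x - u x) v) \<longlonglongrightarrow> 0"
    using tendsto_mult[OF u tendsto_const[of "stable_form \<alpha> v v"]] by (intro small un_d fin) simp
  have 3: "(\<lambda>n. stable_form \<alpha> (\<lambda>x. vn n x - v x) u) \<longlonglongrightarrow> 0"
    using tendsto_mult[OF v tendsto_const[of "stable_form \<alpha> u u"]] by (intro small vn_d fin) simp
  have eq: "stable_form \<alpha> (un n) (vn n) = stable_form \<alpha> (\<lambda>x. un n x - u x) (\<lambda>x. vn n x - v x)
      + stable_form \<alpha> (\<lambda>x. un n x - u x) v + stable_form \<alpha> (\<lambda>x. vn n x - v x) u + stable_form \<alpha> u v" for n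
    unfolding stable_form_diff[OF fin(1,3) vn_d] stable_form_sym[of "un n" "\<lambda>x. vn n x - v x"]
      stable_form_sym[of u "\<lambda>x. vn n x - v x"] stable_form_diff[OF fin(2,4,1)] stable_form_diff[OF fin(2,4,3)]
      stable_form_diff[OF fin(1,3,4)]
    using stable_form_sym[of v "un n"] stable_form_sym[of "vn n" "un n"] stable_form_sym[of v u] by simp
  show ?thesis unfolding eq using tendsto_add[OF tendsto_add[OF tendsto_add[OF 1 2] 3] tendsto_const[of "stable_form \<alpha> u v"]]
    by simp
qed

lemma stable_ext_dom_finite_energy: "u \<in> stable_ext_dom \<alpha> \<Longrightarrow> (u :: 'a \<Rightarrow> real) \<in> finite_energy \<alpha>"
  using stable_approx_energy(1) by (auto simp: stable_ext_dom_def)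

text \<open>Approximating sequences converge in energy to their limits, so all of them lead to the
  same value and the definite description is resolved.\<close>

lemma stable_ext_form_eq:
  assumes u: "u \<in> stable_ext_dom \<alpha>" and v: "v \<in> stable_ext_dom \<alpha>"
  shows "stable_ext_form \<alpha> u v = stable_form \<alpha> u (v :: 'a \<Rightarrow> real)"
proof -
  have conv: "(\<lambda>n. stable_form \<alpha> (un n) (vn n)) \<longlonglongrightarrow> stable_form \<alpha> u v"
    if "stable_approx \<alpha> un u" "stable_approx \<alpha> vn v" for un vn
  proof (rule stable_form_tendsto)
    show "un n \<in> finite_energy \<alpha>" "vn n \<in> finite_energy \<alpha>" for n
      using that by (simp_all add: stable_approx_def stable_dom_iff)
  qed (use that u v stable_approx_energy in \<open>auto simp: stable_ext_dom_def\<close>)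
  obtain un vn where "stable_approx \<alpha> un u" "stable_approx \<alpha> vn v"
    using u v by (auto simp: stable_ext_dom_def)
  then show ?thesis
    unfolding stable_ext_form_def using conv by (intro the_equality) (auto intro: LIMSEQ_unique)
qed

lemma stable_dom_lincomb:
  "f \<in> stable_dom \<alpha> \<Longrightarrow> g \<in> stable_dom \<alpha> \<Longrightarrow> (\<lambda>x. a * f x + b * g x) \<in> (stable_dom \<alpha> :: ('a \<Rightarrow> real) set)"
  using L2_lincomb finite_energy_lincomb by (auto simp: stable_dom_iff)

lemma stable_form_lincomb_le:
  assumes f: "f \<in> finite_energy \<alpha>" and g: "g \<in> (finite_energy \<alpha> :: ('a \<Rightarrow> real) set)"
  shows "stable_form \<alpha> (\<lambda>x. a * f x + b * g x) (\<lambda>x. a * f x + b * g x)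
    \<le> 2 * a\<^sup>2 * stable_form \<alpha> f f + 2 * b\<^sup>2 * stable_form \<alpha> g g"
proof -
  have "(LINT z|(lborel \<Otimes>\<^sub>M lborel). stable_integrand \<alpha> (\<lambda>x. a * f x + b * g x) (\<lambda>x. a * f x + b * g x) z)
    \<le> (LINT z|(lborel \<Otimes>\<^sub>M lborel). 2 * a\<^sup>2 * stable_integrand \<alpha> f f z + 2 * b\<^sup>2 * stable_integrand \<alpha> g g z)"
    by (intro integral_mono integrable_stable_integrand finite_energy_lincomb f g stable_integrand_lincomb_le
        Bochner_Integration.integrable_add integrable_mult_right)
  then show ?thesis using f g by (simp add: stable_form_def integrable_stable_integrand)
qed

lemma stable_ext_dom_lincomb:
  assumes u: "u \<in> stable_ext_dom \<alpha>" and v: "v \<in> stable_ext_dom \<alpha>"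
  shows "(\<lambda>x. a * u x + b * v x) \<in> (stable_ext_dom \<alpha> :: ('a \<Rightarrow> real) set)"
proof -
  obtain un vn where un: "stable_approx \<alpha> un u" and vn: "stable_approx \<alpha> vn v"
    using u v by (auto simp: stable_ext_dom_def)
  have dom: "un n \<in> stable_dom \<alpha>" "vn n \<in> stable_dom \<alpha>" for n using un vn by (simp_all add: stable_approx_def)
  have "stable_approx \<alpha> (\<lambda>n x. a * un n x + b * vn n x) (\<lambda>x. a * u x + b * v x)"
    unfolding stable_approx_def
  proof (intro conjI allI impI)
    show "(\<lambda>x. a * un n x + b * vn n x) \<in> stable_dom \<alpha>" for n by (intro stable_dom_lincomb dom)
    have "AE x in lborel. (\<lambda>n. un n x) \<longlonglongrightarrow> u x" "AE x in lborel. (\<lambda>n. vn n x) \<longlonglongrightarrow> v x"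
      using un vn by (auto simp: stable_approx_def)
    then show "AE x in lborel. (\<lambda>n. a * un n x + b * vn n x) \<longlonglongrightarrow> a * u x + b * v x"
      by eventually_elim (intro tendsto_intros)
    fix e :: real assume e: "e > 0"
    \<comment> \<open>The form of a combination costs the factors 2 a^2 and 2 b^2; adding 1 keeps
      the denominator positive for a = b = 0.\<close>
    define e' where "e' = e / (2 * a\<^sup>2 + 2 * b\<^sup>2 + 1)"
    have den: "2 * a\<^sup>2 + 2 * b\<^sup>2 + 1 > 0" by (simp add: add_nonneg_pos)
    then have e': "e' > 0" using e by (simp add: e'_def)
    obtain N1 where N1: "\<And>m n. m \<ge> N1 \<Longrightarrow> n \<ge> N1 \<Longrightarrow> stable_form \<alpha> (\<lambda>x. un m x - un n x) (\<lambda>x. un m x - un n x) < e'"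
      using un e' unfolding stable_approx_def by blast
    obtain N2 where N2: "\<And>m n. m \<ge> N2 \<Longrightarrow> n \<ge> N2 \<Longrightarrow> stable_form \<alpha> (\<lambda>x. vn m x - vn n x) (\<lambda>x. vn m x - vn n x) < e'"
      using vn e' unfolding stable_approx_def by blast
    have "stable_form \<alpha> (\<lambda>x. a * un m x + b * vn m x - (a * un n x + b * vn n x))
        (\<lambda>x. a * un m x + b * vn m x - (a * un n x + b * vn n x)) < e"
      if "m \<ge> max N1 N2" "n \<ge> max N1 N2" for m n
    proof -
      let ?f = "\<lambda>x. un m x - un n x" and ?g = "\<lambda>x. vn m x - vn n x"
      have fg: "?f \<in> finite_energy \<alpha>" "?g \<in> finite_energy \<alpha>"
        using dom by (auto intro!: finite_energy_diff simp: stable_dom_iff)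
      have "(\<lambda>x. a * un m x + b * vn m x - (a * un n x + b * vn n x)) = (\<lambda>x. a * ?f x + b * ?g x)"
        by (simp add: algebra_simps)
      then have "stable_form \<alpha> (\<lambda>x. a * un m x + b * vn m x - (a * un n x + b * vn n x))
          (\<lambda>x. a * un m x + b * vn m x - (a * un n x + b * vn n x))
          \<le> 2 * a\<^sup>2 * stable_form \<alpha> ?f ?f + 2 * b\<^sup>2 * stable_form \<alpha> ?g ?g"
        using stable_form_lincomb_le[OF fg, of a b] by simp
      also have "\<dots> \<le> 2 * a\<^sup>2 * e' + 2 * b\<^sup>2 * e'"
        using N1[of m n] N2[of m n] that by (intro add_mono mult_left_mono) auto
      also have "\<dots> < (2 * a\<^sup>2 + 2 * b\<^sup>2 + 1) * e'" using e' by (simp add: algebra_simps)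
      also have "\<dots> = e" using den by (simp add: e'_def)
      finally show ?thesis .
    qed
    then show "\<exists>N. \<forall>m\<ge>N. \<forall>n\<ge>N. stable_form \<alpha> (\<lambda>x. a * un m x + b * vn m x - (a * un n x + b * vn n x))
        (\<lambda>x. a * un m x + b * vn m x - (a * un n x + b * vn n x)) < e" by blast
  qed
  then show ?thesis using u v by (auto simp: stable_ext_dom_def)
qed

lemma stable_dom_subset_ext: "f \<in> stable_dom \<alpha> \<Longrightarrow> f \<in> (stable_ext_dom \<alpha> :: ('a \<Rightarrow> real) set)"
proof -
  assume f: "f \<in> stable_dom \<alpha>"
  have "stable_form \<alpha> (\<lambda>x. 0) (\<lambda>x::'a. 0) = 0" by (simp add: stable_form_def stable_integrand_def split_beta)
  then have "stable_approx \<alpha> (\<lambda>n. f) f" using f by (simp add: stable_approx_def)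
  then show ?thesis using f by (auto simp: stable_ext_dom_def stable_dom_def L2_def)
qed

lemma stable_ext_dom_cong:
  assumes "u \<in> stable_ext_dom \<alpha>" "v \<in> borel_measurable borel" "AE x in lborel. u x = v x"
  shows "v \<in> (stable_ext_dom \<alpha> :: ('a \<Rightarrow> real) set)"
proof -
  obtain un where un: "stable_approx \<alpha> un u" using assms by (auto simp: stable_ext_dom_def)
  then have "AE x in lborel. (\<lambda>n. un n x) \<longlonglongrightarrow> u x" by (simp add: stable_approx_def)
  with assms(3) have "AE x in lborel. (\<lambda>n. un n x) \<longlonglongrightarrow> v x" by eventually_elim simp
  then have "stable_approx \<alpha> un v" using un by (simp add: stable_approx_def)
  then show ?thesis using assms(2) by (auto simp: stable_ext_dom_def)
qed

end

subsection \<open>The Hardy inequality\<close>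

lemma nn_integral_lborel_affine:
  fixes f :: "'a::euclidean_space \<Rightarrow> ennreal"
  assumes [measurable]: "f \<in> borel_measurable borel" and c: "c \<noteq> 0"
  shows "(\<integral>\<^sup>+x. f x \<partial>lborel) = ennreal (\<bar>c\<bar> ^ DIM('a)) * (\<integral>\<^sup>+x. f (t + c *\<^sub>R x) \<partial>lborel)"
proof -
  have [measurable]: "(\<lambda>x::'a. t + c *\<^sub>R x) \<in> borel_measurable borel" by measurable
  show ?thesis
    by (subst lborel_affine[OF c, of t]) (simp add: nn_integral_density nn_integral_distr nn_integral_cmult)
qed

text \<open>Young's inequality with the factor of b^2 as close to 1 as desired, at the expense of 1
  / e on the difference; the factor 2 of the simplest version could destroy the contraction between
  shells.\<close>

lemma square_le_shifted_square:
  fixes a b e :: real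
  assumes "e > 0"
  shows "a\<^sup>2 \<le> (1 + e) * b\<^sup>2 + (1 + 1 / e) * (a - b)\<^sup>2"
proof -
  have "(1 + e) * b\<^sup>2 + (1 + 1 / e) * (a - b)\<^sup>2 - a\<^sup>2 = (e * b - (a - b))\<^sup>2 / e"
    using assms by (simp add: power2_eq_square field_simps)
  moreover have "0 \<le> (e * b - (a - b))\<^sup>2 / e" using assms by simp
  ultimately show ?thesis by linarith
qed

text \<open>Half-open, so that the shells of radii \<open>\<rho> * 2 ^ k\<close> partition the
  complement of the open ball of radius \<open>\<rho>\<close>.\<close>

definition shell :: "real \<Rightarrow> 'a::euclidean_space set" where
  "shell r = {x. r \<le> norm x \<and> norm x < 2 * r}"

lemma shell_measurable [measurable]: "shell r \<in> sets borel"
  unfolding shell_def by measurable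

lemma emeasure_shell_scale:
  assumes "r > 0"
  shows "emeasure lborel (shell r :: 'a::euclidean_space set) = ennreal (r ^ DIM('a)) * emeasure lborel (shell 1 :: 'a set)"
proof -
  have "emeasure lborel (shell r :: 'a set) = (\<integral>\<^sup>+x. indicator (shell r :: 'a set) x \<partial>lborel)" by simp
  also have "\<dots> = ennreal (\<bar>r\<bar> ^ DIM('a)) * (\<integral>\<^sup>+x. indicator (shell r :: 'a set) (0 + r *\<^sub>R x) \<partial>lborel)"
    using assms by (intro nn_integral_lborel_affine) auto
  also have "(\<lambda>x. indicator (shell r :: 'a set) (0 + r *\<^sub>R x) :: ennreal) = indicator (shell 1)"
    using assms by (auto simp: shell_def indicator_def fun_eq_iff)
  finally show ?thesis using assms by simp
qed

definition shell_volume :: "'a::euclidean_space itself \<Rightarrow> real" where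
  "shell_volume _ = measure lborel (shell 1 :: 'a set)"

lemma bounded_shell: "bounded (shell r :: 'a::euclidean_space set)"
  by (rule bounded_subset[OF bounded_cball[of 0 "2 * r"]]) (auto simp: shell_def)

lemma shell_volume_pos: "shell_volume TYPE('a::euclidean_space) > 0"
proof -
  obtain b :: 'a where b: "b \<in> Basis" using nonempty_Basis by blast
  have "ball ((3/2) *\<^sub>R b) (1/2) \<subseteq> shell 1"
  proof
    fix x assume "x \<in> ball ((3/2) *\<^sub>R b) (1/2)"
    then have "norm (x - (3/2) *\<^sub>R b) < 1/2" by (simp add: dist_norm norm_minus_commute)
    moreover have "norm ((3/2) *\<^sub>R b) = 3/2" using b by simp
    ultimately show "x \<in> shell 1"
      using norm_triangle_ineq2[of "(3/2) *\<^sub>R b" x] norm_triangle_ineq2[of x "(3/2) *\<^sub>R b"]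
      by (simp add: shell_def norm_minus_commute)
  qed
  then have "measure lborel (ball ((3/2) *\<^sub>R b) (1/2)) \<le> measure lborel (shell 1 :: 'a set)"
    using emeasure_bounded_finite[OF bounded_shell[of 1, where 'a = 'a]]
    by (intro measure_mono_fmeasurable) (auto simp: fmeasurable_def)
  moreover have "measure lborel (ball ((3/2) *\<^sub>R b) (1/2)) > 0" by (simp add: content_ball_pos)
  ultimately show ?thesis unfolding shell_volume_def by (rule order.strict_trans2[rotated])
qed

lemma emeasure_shell:
  assumes "r > 0"
  shows "emeasure lborel (shell r :: 'a::euclidean_space set) = ennreal (r ^ DIM('a) * shell_volume TYPE('a))"
proof -
  have "emeasure lborel (shell 1 :: 'a set) = ennreal (shell_volume TYPE('a))"
    unfolding shell_volume_def
    using emeasure_bounded_finite[OF bounded_shell[of 1, where 'a = 'a]]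
    by (intro emeasure_eq_ennreal_measure) auto
  then show ?thesis using emeasure_shell_scale[OF assms, where 'a = 'a] assms shell_volume_pos[where 'a = 'a]
    by (simp add: ennreal_mult')
qed

lemma shell_cover:
  assumes "\<rho> > 0" "norm x \<ge> \<rho>"
  shows "\<exists>k. x \<in> shell (\<rho> * 2 ^ k)"
proof -
  have ex: "\<exists>n. norm x < \<rho> * 2 ^ n"
  proof -
    obtain n where "norm x / \<rho> < 2 ^ n" using real_arch_pow[of 2 "norm x / \<rho>"] by auto
    then show ?thesis using assms(1) by (auto simp: divide_less_eq mult.commute)
  qed
  define n where "n = (LEAST n. norm x < \<rho> * 2 ^ n)"
  have n: "norm x < \<rho> * 2 ^ n" unfolding n_def by (rule LeastI_ex[OF ex])
  have "n \<noteq> 0" using n assms(2) by (intro notI) simp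
  then obtain k where k: "n = Suc k" by (cases n) auto
  have "\<not> norm x < \<rho> * 2 ^ k"
    by (rule not_less_Least) (use k n_def in simp)
  then have "x \<in> shell (\<rho> * 2 ^ k)" using n k by (simp add: shell_def)
  then show ?thesis ..
qed

lemma shell_disjoint:
  assumes "\<rho> > 0" "j \<noteq> k"
  shows "shell (\<rho> * 2 ^ j) \<inter> shell (\<rho> * 2 ^ k) = {}"
proof -
  have "shell (\<rho> * 2 ^ j) \<inter> shell (\<rho> * 2 ^ k) = {}" if "j < k" for j k
  proof -
    have "(2::real) ^ Suc j \<le> 2 ^ k" using that by (intro power_increasing) auto
    then have "2 * (\<rho> * 2 ^ j) \<le> \<rho> * 2 ^ k" using assms(1) mult_left_mono[of "2 * 2 ^ j" "2 ^ k" \<rho>] by simp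
    then show ?thesis by (auto simp: shell_def)
  qed
  then show ?thesis using assms(2) by (metis Int_commute nat_neq_iff)
qed

section \<open>Masses on neighbouring dyadic shells\<close>

context stable_exponent
begin

definition annular_mass :: "('a \<Rightarrow> real) \<Rightarrow> real \<Rightarrow> ennreal" where
  "annular_mass f r = (\<integral>\<^sup>+x. ennreal ((f x)\<^sup>2) * indicator (shell r) x \<partial>lborel)"

text \<open>Only pairs from two neighbouring shells are counted: for distinct dyadic radii these
  product sets are disjoint, so the contributions add up to at most \<open>energy\<close>.\<close>

definition annular_energy :: "('a \<Rightarrow> real) \<Rightarrow> real \<Rightarrow> ennreal" where
  "annular_energy f r = (\<integral>\<^sup>+z. ennreal (stable_integrand \<alpha> f f z) * indicator (shell r \<times> shell (2 * r)) z \<partial>(lborel \<Otimes>\<^sub>M lborel))"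

lemma annular_mass_le: "annular_mass f r \<le> (\<integral>\<^sup>+x. ennreal ((f x)\<^sup>2) \<partial>lborel)"
  unfolding annular_mass_def by (intro nn_integral_mono) (auto simp: indicator_def)

lemma annular_energy_le: "annular_energy f r \<le> energy \<alpha> f"
  unfolding annular_energy_def energy_def by (intro nn_integral_mono) (auto simp: indicator_def)

text \<open>\<open>square_le_shifted_square\<close> is integrated over x in \<open>shell r\<close>
  and y in \<open>shell (2 * r)\<close>. There |x - y| is below 8 r (6 r would do), so the squared
  increment is at most (8 r)^(d + \<alpha>) / \<open>c\<^sub>\<alpha>\<close> times the integrand of
  the form.\<close>

lemma annular_step:
  assumes [measurable]: "f \<in> borel_measurable borel" and r: "r > 0" and e: "e > 0"
  shows "emeasure lborel (shell (2 * r) :: 'a set) * annular_mass f r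
    \<le> ennreal (1 + e) * (emeasure lborel (shell r :: 'a set) * annular_mass f (2 * r))
      + ennreal ((1 + 1 / e) * ((8 * r) powr (real DIM('a) + \<alpha>) / c\<^sub>\<alpha>)) * annular_energy f r"
proof -
  define p where "p = real DIM('a) + \<alpha>"
  have p: "p > 0" using \<alpha>_pos by (simp add: p_def add_nonneg_pos)
  define C1 where "C1 = (1 + 1 / e) * ((8 * r) powr p / c\<^sub>\<alpha>)"
  have C1: "0 \<le> C1" using e c_pos by (simp add: C1_def)
  define S :: "('a \<times> 'a) set" where "S = shell r \<times> shell (2 * r)"
  have [measurable]: "S \<in> sets (lborel \<Otimes>\<^sub>M lborel)" unfolding S_def by measurable
  have "emeasure lborel (shell (2 * r) :: 'a set) * annular_mass f r
    = (\<integral>\<^sup>+x. \<integral>\<^sup>+y. (ennreal ((f x)\<^sup>2) * indicator (shell r) x) * indicator (shell (2 * r)) y \<partial>(lborel :: 'a measure) \<partial>(lborel :: 'a measure))"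
    unfolding annular_mass_def by (simp add: nn_integral_cmult nn_integral_multc mult.commute)
  also have "\<dots> = (\<integral>\<^sup>+z. (ennreal ((f (fst z))\<^sup>2) * indicator (shell r) (fst z)) * indicator (shell (2 * r)) (snd z) \<partial>((lborel :: 'a measure) \<Otimes>\<^sub>M (lborel :: 'a measure)))"
    by (subst lborel.nn_integral_fst[symmetric]) simp_all
  also have "\<dots> = (\<integral>\<^sup>+z. ennreal ((f (fst z))\<^sup>2) * indicator S z \<partial>(lborel \<Otimes>\<^sub>M lborel))"
    by (intro nn_integral_cong) (auto simp: S_def indicator_def)
  also have "\<dots> \<le> (\<integral>\<^sup>+z. ennreal (1 + e) * (ennreal ((f (snd z))\<^sup>2) * indicator S z)
      + ennreal C1 * (ennreal (stable_integrand \<alpha> f f z) * indicator S z) \<partial>(lborel \<Otimes>\<^sub>M lborel))"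
  proof (rule nn_integral_mono)
    fix z :: "'a \<times> 'a"
    show "ennreal ((f (fst z))\<^sup>2) * indicator S z \<le> ennreal (1 + e) * (ennreal ((f (snd z))\<^sup>2) * indicator S z)
      + ennreal C1 * (ennreal (stable_integrand \<alpha> f f z) * indicator S z)"
    proof (cases "z \<in> S")
      case True
      obtain x y where z: "z = (x, y)" by (cases z)
      have xy: "r \<le> norm x" "norm x < 2 * r" "2 * r \<le> norm y" "norm y < 4 * r"
        using True by (auto simp: z S_def shell_def)
      have dist: "norm (x - y) \<le> 8 * r" "norm (x - y) > 0"
        using norm_triangle_ineq4[of x y] xy by auto
      have "(f x - f y)\<^sup>2 = stable_integrand \<alpha> f f z * (norm (x - y) powr p / c\<^sub>\<alpha>)"
        using dist(2) c_pos by (simp add: z stable_integrand_eq p_def power2_eq_square)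
      also have "\<dots> \<le> stable_integrand \<alpha> f f z * ((8 * r) powr p / c\<^sub>\<alpha>)"
        using dist p c_pos by (intro mult_left_mono divide_right_mono powr_mono2 stable_integrand_nonneg) auto
      finally have diff: "(f x - f y)\<^sup>2 \<le> stable_integrand \<alpha> f f z * ((8 * r) powr p / c\<^sub>\<alpha>)" .
      have "(f x)\<^sup>2 \<le> (1 + e) * (f y)\<^sup>2 + (1 + 1 / e) * (f x - f y)\<^sup>2"
        by (rule square_le_shifted_square[OF e])
      also have "\<dots> \<le> (1 + e) * (f y)\<^sup>2 + (1 + 1 / e) * (stable_integrand \<alpha> f f z * ((8 * r) powr p / c\<^sub>\<alpha>))"
        using diff e by (intro add_left_mono mult_left_mono) auto
      finally have "ennreal ((f x)\<^sup>2) \<le> ennreal ((1 + e) * (f y)\<^sup>2 + C1 * stable_integrand \<alpha> f f z)"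
        by (intro ennreal_leI) (simp only: C1_def ac_simps)
      also have "\<dots> = ennreal (1 + e) * ennreal ((f y)\<^sup>2) + ennreal C1 * ennreal (stable_integrand \<alpha> f f z)"
        using e C1 stable_integrand_nonneg[of f z]
        by (simp only: ennreal_plus ennreal_mult mult_nonneg_nonneg zero_le_power2 add_nonneg_nonneg less_imp_le zero_le_one)
      finally show ?thesis using True by (simp add: z)
    qed simp
  qed
  also have "\<dots> = ennreal (1 + e) * (\<integral>\<^sup>+z. ennreal ((f (snd z))\<^sup>2) * indicator S z \<partial>(lborel \<Otimes>\<^sub>M lborel))
      + ennreal C1 * annular_energy f r"
    unfolding annular_energy_def S_def[symmetric]
    by (subst nn_integral_add; (subst nn_integral_cmult)?; (subst nn_integral_cmult)?) simp_all
  also have "(\<integral>\<^sup>+z. ennreal ((f (snd z))\<^sup>2) * indicator S z \<partial>(lborel \<Otimes>\<^sub>M lborel))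
    = (\<integral>\<^sup>+z. indicator (shell r) (fst z) * (ennreal ((f (snd z))\<^sup>2) * indicator (shell (2 * r)) (snd z)) \<partial>((lborel :: 'a measure) \<Otimes>\<^sub>M (lborel :: 'a measure)))"
    by (intro nn_integral_cong) (auto simp: S_def indicator_def)
  also have "\<dots> = (\<integral>\<^sup>+x. \<integral>\<^sup>+y. indicator (shell r) x * (ennreal ((f y)\<^sup>2) * indicator (shell (2 * r)) y) \<partial>(lborel :: 'a measure) \<partial>(lborel :: 'a measure))"
    by (subst lborel.nn_integral_fst[symmetric]) simp_all
  also have "\<dots> = emeasure lborel (shell r :: 'a set) * annular_mass f (2 * r)"
    unfolding annular_mass_def by (simp add: nn_integral_cmult nn_integral_multc)
  finally show ?thesis by (simp only: p_def C1_def)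
qed

text \<open>This is where \<open>\<alpha> < d\<close> enters.\<close>

lemma annular_contraction:
  "\<exists>q K. 0 < q \<and> q < 1 \<and> 0 < K \<and> (\<forall>f\<in>stable_dom \<alpha>. \<forall>r>0.
     r powr - \<alpha> * enn2real (annular_mass f r)
       \<le> q * ((2 * r) powr - \<alpha> * enn2real (annular_mass f (2 * r))) + K * enn2real (annular_energy f r))"
proof -
  define d where "d = real DIM('a)"
  define v where "v = shell_volume TYPE('a)"
  have v: "v > 0" unfolding v_def by (rule shell_volume_pos)
  \<comment> \<open>Ideal contraction factor: the larger shell has 2^d times the volume, and
    r^-\<alpha> is 2^\<alpha> times (2 r)^-\<alpha>.\<close>
  define \<theta> where "\<theta> = 2 powr (\<alpha> - d)"
  have \<theta>: "0 < \<theta>" "\<theta> < 1" using \<alpha>_less_DIM by (auto simp: \<theta>_def d_def powr_less_one)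
  \<comment> \<open>Chosen to spend half of the gap below 1: (1 + e) \<open>\<theta>\<close> is the
    midpoint of \<open>\<theta>\<close> and 1.\<close>
  define e where "e = (1 - \<theta>) / (2 * \<theta>)"
  have e: "e > 0" using \<theta> by (simp add: e_def)
  have q: "(1 + e) * \<theta> = (1 + \<theta>) / 2" using \<theta> by (simp add: e_def field_simps)
  define K where "K = (1 + 1 / e) * (8 powr (d + \<alpha>) / c\<^sub>\<alpha>) / (2 powr d * v)"
  have K: "K > 0" using e c_pos v by (auto simp: K_def intro!: mult_pos_pos divide_pos_pos add_pos_pos)
  have "r powr - \<alpha> * enn2real (annular_mass f r)
       \<le> (1 + \<theta>) / 2 * ((2 * r) powr - \<alpha> * enn2real (annular_mass f (2 * r))) + K * enn2real (annular_energy f r)"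
    if f: "f \<in> stable_dom \<alpha>" and r: "r > 0" for f r
  proof -
    have fm[measurable]: "f \<in> borel_measurable borel" using f by (simp add: stable_dom_iff finite_energy_def)
    have "(\<integral>\<^sup>+x. ennreal ((f x)\<^sup>2) \<partial>lborel) < \<infinity>"
      using f L2_iff_nn_integral[of f lborel] by (simp add: stable_dom_iff)
    then have "annular_mass f s < \<infinity>" for s by (rule le_less_trans[OF annular_mass_le])
    then have mass: "annular_mass f s = ennreal (enn2real (annular_mass f s))" for s by simp
    have "energy \<alpha> f < \<infinity>" using f by (simp add: stable_dom_iff finite_energy_def)
    then have "annular_energy f r < \<infinity>" by (rule le_less_trans[OF annular_energy_le])
    then have en: "annular_energy f r = ennreal (enn2real (annular_energy f r))" by simp
    define i j w where "i = enn2real (annular_mass f r)" and "j = enn2real (annular_mass f (2 * r))"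
      and "w = enn2real (annular_energy f r)"
    have nn: "0 \<le> i" "0 \<le> j" "0 \<le> w" by (simp_all add: i_def j_def w_def)
    define A1 A2 A3 where "A1 = (2 * r) ^ DIM('a) * v" and "A2 = r ^ DIM('a) * v"
      and "A3 = (1 + 1 / e) * ((8 * r) powr (d + \<alpha>) / c\<^sub>\<alpha>)"
    have A: "0 \<le> A1" "0 \<le> A2" "0 \<le> A3" "0 \<le> 1 + e" using r v e c_pos by (auto simp: A1_def A2_def A3_def)
    have "ennreal A1 * ennreal i \<le> ennreal (1 + e) * (ennreal A2 * ennreal j) + ennreal A3 * ennreal w"
      using annular_step[OF fm r e]
      unfolding emeasure_shell[OF r] emeasure_shell[OF mult_pos_pos[OF zero_less_numeral r]]
      unfolding i_def j_def w_def mass[symmetric] en[symmetric] A1_def A2_def A3_def v_def d_def .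
    then have "ennreal (A1 * i) \<le> ennreal ((1 + e) * (A2 * j) + A3 * w)"
      using A nn by (simp only: ennreal_plus ennreal_mult mult_nonneg_nonneg)
    then have main: "(2 * r) ^ DIM('a) * v * i \<le> (1 + e) * (r ^ DIM('a) * v * j) + (1 + 1 / e) * ((8 * r) powr (d + \<alpha>) / c\<^sub>\<alpha>) * w"
    proof (subst (asm) ennreal_le_iff)
      show "0 \<le> (1 + e) * (A2 * j) + A3 * w" using A nn by simp
    qed (simp only: A1_def A2_def A3_def)
    have pw: "(2 * r) ^ DIM('a) = 2 powr d * r powr d" "r ^ DIM('a) = r powr d"
      "(8 * r) powr (d + \<alpha>) = 8 powr (d + \<alpha>) * (r powr d * r powr \<alpha>)" "(2 * r) powr - \<alpha> = 2 powr - \<alpha> * r powr - \<alpha>"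
    proof -
      show "(2 * r) ^ DIM('a) = 2 powr d * r powr d" "r ^ DIM('a) = r powr d"
        using r by (simp_all add: d_def powr_realpow power_mult_distrib)
      show "(8 * r) powr (d + \<alpha>) = 8 powr (d + \<alpha>) * (r powr d * r powr \<alpha>)" "(2 * r) powr - \<alpha> = 2 powr - \<alpha> * r powr - \<alpha>"
        using r by (simp_all only: powr_mult powr_add[of r])
    qed
    define R where "R = r powr d"
    have R: "R > 0" using r by (simp add: R_def)
    define D2 where "D2 = 2 powr d"
    have D2: "D2 > 0" by (simp add: D2_def)
    have "D2 * R * v * i \<le> (1 + e) * (R * v * j) + (1 + 1 / e) * (8 powr (d + \<alpha>) * (R * r powr \<alpha>) / c\<^sub>\<alpha>) * w"
      using main unfolding pw R_def[symmetric] D2_def[symmetric] .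
    also have "\<dots> = (D2 * R * v) * ((1 + e) * j / D2 + K * r powr \<alpha> * w)"
    proof -
      define G where "G = (1 + 1 / e) * (8 powr (d + \<alpha>) / c\<^sub>\<alpha>)"
      have G: "K * (D2 * v) = G" using D2 v by (simp add: K_def G_def D2_def[symmetric])
      have "(1 + 1 / e) * (8 powr (d + \<alpha>) * (R * r powr \<alpha>) / c\<^sub>\<alpha>) * w = G * (R * r powr \<alpha> * w)"
        by (simp add: G_def)
      also have "\<dots> = (D2 * R * v) * (K * r powr \<alpha> * w)" unfolding G[symmetric] by (simp only: ac_simps)
      finally show ?thesis using D2 by (simp add: distrib_left)
    qed
    finally have "i \<le> (1 + e) * j / D2 + K * r powr \<alpha> * w"
      using D2 R v by (subst (asm) mult_le_cancel_left_pos) auto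
    then have "r powr - \<alpha> * i \<le> r powr - \<alpha> * ((1 + e) * j / D2 + K * r powr \<alpha> * w)"
      by (intro mult_left_mono) auto
    also have "\<dots> = ((1 + e) * (2 powr \<alpha> / D2)) * (2 powr - \<alpha> * r powr - \<alpha> * j) + K * (r powr - \<alpha> * r powr \<alpha>) * w"
    proof -
      define P where "P = 2 powr \<alpha>"
      have "P > 0" "2 powr - \<alpha> = 1 / P" by (simp_all add: P_def powr_minus divide_inverse)
      then show ?thesis unfolding P_def[symmetric] using D2 by (simp add: distrib_left)
    qed
    also have "2 powr \<alpha> / D2 = \<theta>" by (simp add: D2_def \<theta>_def powr_diff)
    also have "r powr - \<alpha> * r powr \<alpha> = 1" using r by (simp add: powr_minus)
    finally show ?thesis by (simp add: pw q i_def j_def w_def)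
  qed
  moreover have "0 < (1 + \<theta>) / 2" "(1 + \<theta>) / 2 < 1" using \<theta> by auto
  ultimately show ?thesis using K by blast
qed

lemma sum_annular_energy_le:
  assumes [measurable]: "f \<in> borel_measurable borel" and \<rho>: "\<rho> > 0"
  shows "(\<Sum>k<N. annular_energy f (\<rho> * 2 ^ k)) \<le> energy \<alpha> (f :: 'a \<Rightarrow> real)"
proof -
  let ?S = "\<lambda>k. (shell (\<rho> * 2 ^ k) :: 'a set) \<times> (shell (2 * (\<rho> * 2 ^ k)) :: 'a set)"
  have [measurable]: "?S k \<in> sets (lborel \<Otimes>\<^sub>M lborel)" for k by measurable
  have disj: "disjoint_family_on ?S {..<N}"
    unfolding disjoint_family_on_def
  proof (intro ballI impI)
    fix j k :: nat assume "j \<noteq> k"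
    from shell_disjoint[OF \<rho> this, where 'a = 'a] show "?S j \<inter> ?S k = {}"
      by (simp add: Times_Int_Times)
  qed
  have "(\<Sum>k<N. annular_energy f (\<rho> * 2 ^ k)) = (\<integral>\<^sup>+z. (\<Sum>k<N. ennreal (stable_integrand \<alpha> f f z) * indicator (?S k) z) \<partial>(lborel \<Otimes>\<^sub>M lborel))"
    unfolding annular_energy_def by (subst nn_integral_sum) simp_all
  also have "\<dots> \<le> energy \<alpha> f"
    unfolding energy_def
  proof (rule nn_integral_mono)
    fix z :: "'a \<times> 'a"
    have "(\<Sum>k<N. ennreal (stable_integrand \<alpha> f f z) * indicator (?S k) z)
        = ennreal (stable_integrand \<alpha> f f z) * indicator (\<Union>k<N. ?S k) z"
      by (subst indicator_UN_disjoint[OF _ disj]) (simp_all add: sum_distrib_left)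
    also have "\<dots> \<le> ennreal (stable_integrand \<alpha> f f z)" by (auto simp: indicator_def)
    finally show "(\<Sum>k<N. ennreal (stable_integrand \<alpha> f f z) * indicator (?S k) z) \<le> ennreal (stable_integrand \<alpha> f f z)" .
  qed
  finally show ?thesis .
qed

text \<open>Summing the contraction leaves q times the shifted sum on the right, which is absorbed
  on the left. The boundary term of the outermost shell tends to 0, since the mass is bounded by the
  L2 norm while the weight decays geometrically; the constant K / (1 - q) therefore involves neither
  that norm nor \<open>\<rho>\<close>.\<close>

lemma hardy_sum:
  "\<exists>K>0. \<forall>f\<in>stable_dom \<alpha>. \<forall>\<rho>>0. \<forall>N.
     (\<Sum>k<N. (\<rho> * 2 ^ k) powr - \<alpha> * enn2real (annular_mass f (\<rho> * 2 ^ k))) \<le> K * enn2real (energy \<alpha> f)"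
proof -
  obtain q K where q: "0 < q" "q < 1" and K: "0 < K" and step: "\<And>f r. f \<in> stable_dom \<alpha> \<Longrightarrow> r > 0 \<Longrightarrow>
     r powr - \<alpha> * enn2real (annular_mass f r)
       \<le> q * ((2 * r) powr - \<alpha> * enn2real (annular_mass f (2 * r))) + K * enn2real (annular_energy f r)"
    using annular_contraction by blast
  have "(\<Sum>k<N. (\<rho> * 2 ^ k) powr - \<alpha> * enn2real (annular_mass f (\<rho> * 2 ^ k))) \<le> K / (1 - q) * enn2real (energy \<alpha> f)"
    if f: "f \<in> stable_dom \<alpha>" and \<rho>: "\<rho> > 0" for f \<rho> N
  proof -
    have fm[measurable]: "f \<in> borel_measurable borel" using f by (simp add: stable_dom_iff finite_energy_def)
    define h where "h k = (\<rho> * 2 ^ k) powr - \<alpha> * enn2real (annular_mass f (\<rho> * 2 ^ k))" for k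
    define w where "w k = enn2real (annular_energy f (\<rho> * 2 ^ k))" for k
    define e where "e = enn2real (energy \<alpha> f)"
    define F where "F = enn2real (\<integral>\<^sup>+x. ennreal ((f x)\<^sup>2) \<partial>lborel)"
    have h0: "h k \<ge> 0" for k by (simp add: h_def)
    have fin: "energy \<alpha> f < \<infinity>" using f by (simp add: stable_dom_iff finite_energy_def)
    have fin2: "(\<integral>\<^sup>+x. ennreal ((f x)\<^sup>2) \<partial>lborel) < \<infinity>"
      using f L2_iff_nn_integral[of f lborel] by (simp add: stable_dom_iff)
    have hw: "h k \<le> q * h (Suc k) + K * w k" for k
      using step[OF f, of "\<rho> * 2 ^ k"] \<rho> by (simp add: h_def w_def mult.left_commute)
    have sumw: "(\<Sum>k<M. w k) \<le> e" for M
    proof -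
      have "annular_energy f (\<rho> * 2 ^ k) < \<infinity>" for k
        by (rule le_less_trans[OF annular_energy_le fin])
      then have "ennreal (\<Sum>k<M. w k) = (\<Sum>k<M. annular_energy f (\<rho> * 2 ^ k))"
        by (subst sum_ennreal[symmetric]) (simp_all add: w_def)
      also have "\<dots> \<le> ennreal e" using sum_annular_energy_le[OF fm \<rho>] fin by (simp add: e_def)
      finally show ?thesis by (subst (asm) ennreal_le_iff) (simp_all add: e_def)
    qed
    have hM: "h M \<le> F * (\<rho> powr - \<alpha> * (2 powr - \<alpha>) ^ M)" for M
    proof -
      have "enn2real (annular_mass f (\<rho> * 2 ^ M)) \<le> F"
        unfolding F_def using fin2 by (intro enn2real_mono annular_mass_le) simp
      moreover have "(\<rho> * 2 ^ M) powr - \<alpha> = \<rho> powr - \<alpha> * (2 powr - \<alpha>) ^ M"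
        using \<rho> by (simp add: powr_mult powr_power powr_realpow[symmetric] powr_powr mult.commute)
      ultimately show ?thesis unfolding h_def by (subst mult.commute) (simp add: mult_right_mono)
    qed
    have bound: "(1 - q) * (\<Sum>k<N. h k) \<le> F * (\<rho> powr - \<alpha> * (2 powr - \<alpha>) ^ M) + K * e" if "M \<ge> N" for M
    proof -
      have "(\<Sum>k<M. h k) \<le> q * (\<Sum>k<M. h (Suc k)) + K * (\<Sum>k<M. w k)"
        by (simp add: sum_distrib_left sum.distrib[symmetric] sum_mono hw)
      also have "(\<Sum>k<M. h (Suc k)) = (\<Sum>k<M. h k) + h M - h 0"
        using sum.lessThan_Suc_shift[of h M] sum.lessThan_Suc[of h M] by simp
      also have "q * ((\<Sum>k<M. h k) + h M - h 0) \<le> q * (\<Sum>k<M. h k) + 1 * h M"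
      proof -
        have "q * h M \<le> 1 * h M" using q h0[of M] by (intro mult_right_mono) auto
        moreover have "0 \<le> q * h 0" using q h0[of 0] by simp
        ultimately show ?thesis unfolding right_diff_distrib distrib_left by linarith
      qed
      finally have "(1 - q) * (\<Sum>k<M. h k) \<le> h M + K * (\<Sum>k<M. w k)" by (simp add: algebra_simps)
      also have "\<dots> \<le> F * (\<rho> powr - \<alpha> * (2 powr - \<alpha>) ^ M) + K * e"
        using hM[of M] sumw[of M] K by (intro add_mono mult_left_mono) auto
      finally have "(1 - q) * (\<Sum>k<M. h k) \<le> F * (\<rho> powr - \<alpha> * (2 powr - \<alpha>) ^ M) + K * e" .
      moreover have "(\<Sum>k<N. h k) \<le> (\<Sum>k<M. h k)" using that h0 by (intro sum_mono2) auto
      then have "(1 - q) * (\<Sum>k<N. h k) \<le> (1 - q) * (\<Sum>k<M. h k)" using q by (intro mult_left_mono) auto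
      ultimately show ?thesis by linarith
    qed
    have "(1 - q) * (\<Sum>k<N. h k) \<le> F * (\<rho> powr - \<alpha> * 0) + K * e"
    proof (rule LIMSEQ_le_const)
      have "norm (2 powr - \<alpha>) < 1" using \<alpha>_pos by (simp add: powr_less_one)
      then have "(\<lambda>M. (2 powr - \<alpha>) ^ M) \<longlonglongrightarrow> 0" by (rule LIMSEQ_power_zero)
      then show "(\<lambda>M. F * (\<rho> powr - \<alpha> * (2 powr - \<alpha>) ^ M) + K * e) \<longlonglongrightarrow> F * (\<rho> powr - \<alpha> * 0) + K * e"
        by (intro tendsto_add tendsto_mult tendsto_const)
    qed (use bound in blast)
    then have "(\<Sum>k<N. h k) \<le> K * e / (1 - q)" using q by (simp add: field_simps)
    then show ?thesis by (simp add: h_def e_def)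
  qed
  moreover have "K / (1 - q) > 0" using K q by simp
  ultimately show ?thesis by blast
qed

text \<open>On a shell the weight is bounded by its value at the inner radius, which gives the
  estimate outside each ball of radius \<open>\<rho>\<close>; the constant is independent of
  \<open>\<rho>\<close>, and Fatou's lemma lets \<open>\<rho>\<close> tend to 0.\<close>

lemma hardy_stable_dom:
  "\<exists>K>0. \<forall>f\<in>stable_dom \<alpha>. (\<integral>\<^sup>+x. ennreal ((f x)\<^sup>2 * norm (x :: 'a) powr - \<alpha>) \<partial>lborel) \<le> ennreal K * energy \<alpha> f"
proof -
  obtain K where K: "K > 0" and sum: "\<And>f \<rho> N. f \<in> stable_dom \<alpha> \<Longrightarrow> \<rho> > 0 \<Longrightarrow>
     (\<Sum>k<N. (\<rho> * 2 ^ k) powr - \<alpha> * enn2real (annular_mass f (\<rho> * 2 ^ k))) \<le> K * enn2real (energy \<alpha> f)"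
    using hardy_sum by blast
  have "(\<integral>\<^sup>+x. ennreal ((f x)\<^sup>2 * norm (x :: 'a) powr - \<alpha>) \<partial>lborel) \<le> ennreal K * energy \<alpha> f"
    if f: "f \<in> stable_dom \<alpha>" for f
  proof -
    have fm[measurable]: "f \<in> borel_measurable borel" using f by (simp add: stable_dom_iff finite_energy_def)
    have fin: "energy \<alpha> f < \<infinity>" using f by (simp add: stable_dom_iff finite_energy_def)
    have fin2: "(\<integral>\<^sup>+x. ennreal ((f x)\<^sup>2) \<partial>lborel) < \<infinity>"
      using f L2_iff_nn_integral[of f lborel] by (simp add: stable_dom_iff)
    define g where "g x = ennreal ((f x)\<^sup>2 * norm x powr - \<alpha>)" for x
    have [measurable]: "g \<in> borel_measurable borel" unfolding g_def by measurable
    have outer: "(\<integral>\<^sup>+x. g x * indicator {x. \<rho> \<le> norm x} x \<partial>lborel) \<le> ennreal K * energy \<alpha> f" if \<rho>: "\<rho> > 0" for \<rho>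
    proof -
      have massfin: "annular_mass f r < \<infinity>" for r
        by (rule le_less_trans[OF annular_mass_le fin2])
      let ?t = "\<lambda>k x. ennreal ((\<rho> * 2 ^ k) powr - \<alpha>) * (ennreal ((f x)\<^sup>2) * indicator (shell (\<rho> * 2 ^ k)) x)"
      have "(\<integral>\<^sup>+x. g x * indicator {x. \<rho> \<le> norm x} x \<partial>lborel) \<le> (\<integral>\<^sup>+x. (\<Sum>k. ?t k x) \<partial>lborel)"
      proof (rule nn_integral_mono)
        fix x :: 'a
        show "g x * indicator {x. \<rho> \<le> norm x} x \<le> (\<Sum>k. ?t k x)"
        proof (cases "\<rho> \<le> norm x")
          case True
          then obtain k where k: "x \<in> shell (\<rho> * 2 ^ k)" using shell_cover[OF \<rho>] by blast
          have "norm x powr - \<alpha> \<le> (\<rho> * 2 ^ k) powr - \<alpha>"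
            using k \<rho> \<alpha>_pos by (intro powr_mono2') (auto simp: shell_def)
          then have "(f x)\<^sup>2 * norm x powr - \<alpha> \<le> (\<rho> * 2 ^ k) powr - \<alpha> * (f x)\<^sup>2"
            by (subst mult.commute) (rule mult_right_mono, auto)
          then have "g x \<le> ?t k x"
            using k by (simp add: g_def ennreal_mult'[symmetric] ennreal_leI)
          also have "\<dots> = sum (\<lambda>k. ?t k x) {k}" by simp
          also have "\<dots> \<le> (\<Sum>k. ?t k x)" by (intro sum_le_suminf) auto
          finally show ?thesis using True by simp
        qed simp
      qed
      also have "\<dots> = (\<Sum>k. ennreal ((\<rho> * 2 ^ k) powr - \<alpha>) * annular_mass f (\<rho> * 2 ^ k))"
        by (simp add: nn_integral_suminf nn_integral_cmult annular_mass_def)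
      also have "\<dots> \<le> ennreal K * energy \<alpha> f"
      proof (rule suminf_le_const)
        fix N
        have "(\<Sum>k<N. ennreal ((\<rho> * 2 ^ k) powr - \<alpha>) * annular_mass f (\<rho> * 2 ^ k))
          = (\<Sum>k<N. ennreal ((\<rho> * 2 ^ k) powr - \<alpha> * enn2real (annular_mass f (\<rho> * 2 ^ k))))"
          using massfin by (intro sum.cong refl) (simp add: ennreal_mult)
        also have "\<dots> = ennreal (\<Sum>k<N. (\<rho> * 2 ^ k) powr - \<alpha> * enn2real (annular_mass f (\<rho> * 2 ^ k)))"
          by (intro sum_ennreal) simp
        also have "\<dots> \<le> ennreal (K * enn2real (energy \<alpha> f))" by (intro ennreal_leI sum f \<rho>)
        also have "\<dots> = ennreal K * energy \<alpha> f" using fin K by (simp add: ennreal_mult)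
        finally show "(\<Sum>k<N. ennreal ((\<rho> * 2 ^ k) powr - \<alpha>) * annular_mass f (\<rho> * 2 ^ k)) \<le> ennreal K * energy \<alpha> f" .
      qed simp
      finally show ?thesis .
    qed
    have "(\<integral>\<^sup>+x. g x \<partial>lborel) = (\<integral>\<^sup>+x. liminf (\<lambda>n. g x * indicator {x. inverse (real (Suc n)) \<le> norm x} x) \<partial>lborel)"
    proof (rule nn_integral_cong)
      fix x :: 'a
      have "(\<lambda>n. g x * indicator {x. inverse (real (Suc n)) \<le> norm x} x) \<longlonglongrightarrow> g x"
      proof (cases "x = 0")
        \<comment> \<open>\<open>0 powr - \<alpha>\<close> is 0 by convention, so the origin carries
          no weight.\<close>
        case True
        then show ?thesis by (simp add: g_def)
      next
        case False
        have "\<forall>\<^sub>F n in sequentially. inverse (real (Suc n)) < norm x"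
          using order_tendstoD(2)[OF LIMSEQ_inverse_real_of_nat, of "norm x"] False by simp
        then have "\<forall>\<^sub>F n in sequentially. g x * indicator {x. inverse (real (Suc n)) \<le> norm x} x = g x"
          by eventually_elim simp
        then show ?thesis by (rule tendsto_eventually)
      qed
      then show "g x = liminf (\<lambda>n. g x * indicator {x. inverse (real (Suc n)) \<le> norm x} x)"
        by (intro lim_imp_Liminf[symmetric]) auto
    qed
    also have "\<dots> \<le> liminf (\<lambda>n. \<integral>\<^sup>+x. g x * indicator {x. inverse (real (Suc n)) \<le> norm x} x \<partial>lborel)"
      by (intro nn_integral_liminf) simp
    also have "\<dots> \<le> liminf (\<lambda>n. ennreal K * energy \<alpha> f)"
      by (intro Liminf_mono always_eventually allI outer) simp
    also have "\<dots> = ennreal K * energy \<alpha> f" by (simp add: Liminf_const)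
    finally show ?thesis by (simp add: g_def)
  qed
  then show ?thesis using K by blast
qed

text \<open>Fatou's lemma on the left and convergence of the forms on the right carry the estimate
  to the extended space; the constant doubles because \<open>energy\<close> is twice the
  form.\<close>

theorem hardy:
  "\<exists>K>0. \<forall>u\<in>stable_ext_dom \<alpha>. (\<integral>\<^sup>+x. ennreal ((u x)\<^sup>2 * norm (x :: 'a) powr - \<alpha>) \<partial>lborel) \<le> ennreal (K * stable_form \<alpha> u u)"
proof -
  obtain K where K: "K > 0" and hd: "\<And>f. f \<in> stable_dom \<alpha> \<Longrightarrow>
      (\<integral>\<^sup>+x. ennreal ((f x)\<^sup>2 * norm (x :: 'a) powr - \<alpha>) \<partial>lborel) \<le> ennreal K * energy \<alpha> f"
    using hardy_stable_dom by blast
  have "(\<integral>\<^sup>+x. ennreal ((u x)\<^sup>2 * norm (x :: 'a) powr - \<alpha>) \<partial>lborel) \<le> ennreal (2 * K * stable_form \<alpha> u u)"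
    if u: "u \<in> stable_ext_dom \<alpha>" for u
  proof -
    obtain un where un: "stable_approx \<alpha> un u" and um[measurable]: "u \<in> borel_measurable borel"
      using u by (auto simp: stable_ext_dom_def)
    have dom: "un n \<in> stable_dom \<alpha>" for n using un by (simp add: stable_approx_def)
    have fe: "un n \<in> finite_energy \<alpha>" for n using dom by (simp add: stable_dom_iff)
    have [measurable]: "un n \<in> borel_measurable borel" for n by (rule finite_energy_measurable[OF fe])
    have lim: "AE x in lborel. (\<lambda>n. un n x) \<longlonglongrightarrow> u x" using un by (simp add: stable_approx_def)
    have form: "(\<lambda>n. stable_form \<alpha> (un n) (un n)) \<longlonglongrightarrow> stable_form \<alpha> u u"
      using stable_approx_energy[OF un um] fe by (intro stable_form_tendsto) auto
    have "(\<integral>\<^sup>+x. ennreal ((u x)\<^sup>2 * norm (x :: 'a) powr - \<alpha>) \<partial>lborel)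
        = (\<integral>\<^sup>+x. liminf (\<lambda>n. ennreal ((un n x)\<^sup>2 * norm (x :: 'a) powr - \<alpha>)) \<partial>lborel)"
    proof (rule nn_integral_cong_AE, use lim in eventually_elim)
      case (elim x)
      have "(\<lambda>n. ennreal ((un n x)\<^sup>2 * norm x powr - \<alpha>)) \<longlonglongrightarrow> ennreal ((u x)\<^sup>2 * norm x powr - \<alpha>)"
        by (intro tendsto_ennrealI tendsto_mult tendsto_power elim tendsto_const)
      then show ?case by (intro lim_imp_Liminf[symmetric]) auto
    qed
    also have "\<dots> \<le> liminf (\<lambda>n. \<integral>\<^sup>+x. ennreal ((un n x)\<^sup>2 * norm (x :: 'a) powr - \<alpha>) \<partial>lborel)"
      by (intro nn_integral_liminf) simp
    also have "\<dots> \<le> liminf (\<lambda>n. ennreal (2 * K * stable_form \<alpha> (un n) (un n)))"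
    proof (intro Liminf_mono always_eventually allI)
      show "(\<integral>\<^sup>+x. ennreal ((un n x)\<^sup>2 * norm (x :: 'a) powr - \<alpha>) \<partial>lborel) \<le> ennreal (2 * K * stable_form \<alpha> (un n) (un n))" for n
        using hd[OF dom, of n] K stable_form_nonneg[of "un n"]
        by (simp add: energy_eq_form[OF fe] ennreal_mult'[symmetric] ac_simps)
    qed
    also have "\<dots> = ennreal (2 * K * stable_form \<alpha> u u)"
      by (intro lim_imp_Liminf tendsto_ennrealI tendsto_mult_left form) simp
    finally show ?thesis .
  qed
  moreover have "2 * K > 0" using K by simp
  ultimately show ?thesis by blast
qed

end

subsection \<open>The weighted space\<close>

locale weighted_stable = stable_exponent \<alpha> T
  for \<alpha> :: real and T :: "'a::euclidean_space itself" +
  fixes W :: "'a \<Rightarrow> real"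
  assumes W_measurable [measurable]: "W \<in> borel_measurable borel" and W_ge_1: "1 \<le> W x"
begin

lemma W_pos: "0 < W x"
  using W_ge_1[of x] by linarith

definition \<mu> :: "'a measure" where "\<mu> = weighted_measure W"

lemma sets_\<mu> [measurable_cong]: "sets \<mu> = sets borel"
  by (simp add: \<mu>_def weighted_measure_def)

lemma measurable_\<mu>: "borel_measurable \<mu> = borel_measurable borel"
  by (rule measurable_cong_sets) (simp_all add: sets_\<mu>)

lemma AE_\<mu>_iff: "(AE x in \<mu>. P x) \<longleftrightarrow> (AE x in lborel. P x)"
  unfolding \<mu>_def weighted_measure_def by (subst AE_density) (simp_all add: W_pos)

lemma nn_integral_\<mu>:
  assumes [measurable]: "f \<in> borel_measurable borel"
  shows "(\<integral>\<^sup>+x. f x \<partial>\<mu>) = (\<integral>\<^sup>+x. ennreal (1 / W x) * f x \<partial>lborel)"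
  unfolding \<mu>_def weighted_measure_def by (rule nn_integral_density) simp_all

lemma L2_\<mu>_measurable: "f \<in> L2 \<mu> \<Longrightarrow> f \<in> borel_measurable borel"
  using L2_D(1)[of f \<mu>] by (simp add: measurable_\<mu>)

lemma integrable_\<mu>_iff:
  fixes f :: "'a \<Rightarrow> real"
  assumes [measurable]: "f \<in> borel_measurable borel"
  shows "integrable \<mu> f \<longleftrightarrow> integrable lborel (\<lambda>x. f x / W x)"
proof -
  have "integrable \<mu> f \<longleftrightarrow> integrable lborel (\<lambda>x. (1 / W x) *\<^sub>R f x)"
    unfolding \<mu>_def weighted_measure_def
    by (intro integrable_density) (auto simp: W_pos less_imp_le)
  then show ?thesis by simp
qed

lemma integral_\<mu>:
  fixes f :: "'a \<Rightarrow> real"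
  assumes [measurable]: "f \<in> borel_measurable borel"
  shows "(LINT x|\<mu>. f x) = (LINT x|lborel. f x / W x)"
proof -
  have "(LINT x|\<mu>. f x) = (LINT x|lborel. (1 / W x) *\<^sub>R f x)"
    unfolding \<mu>_def weighted_measure_def
    by (intro integral_density) (auto simp: W_pos less_imp_le)
  then show ?thesis by simp
qed

lemma L2_lborel_subset_\<mu>: "f \<in> L2 lborel \<Longrightarrow> f \<in> L2 \<mu>"
proof -
  assume f: "f \<in> L2 lborel"
  then have [measurable]: "f \<in> borel_measurable borel" using L2_D(1)[OF f] by simp
  have "integrable lborel (\<lambda>x. (f x)\<^sup>2 / W x)"
  proof (rule Bochner_Integration.integrable_bound[OF L2_D(2)[OF f]])
    have "(f x)\<^sup>2 / W x \<le> (f x)\<^sup>2 / 1" for x by (intro divide_left_mono W_ge_1) (auto simp: W_pos)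
    then show "AE x in lborel. norm ((f x)\<^sup>2 / W x) \<le> norm ((f x)\<^sup>2)" using W_pos by (simp add: less_imp_le abs_of_pos)
  qed measurable
  then show ?thesis by (simp add: L2_def measurable_\<mu> integrable_\<mu>_iff)
qed

lemma sqrt_W: "sqrt (W x) * sqrt (W x) = W x" "sqrt (W x) > 0" "(sqrt (W x))\<^sup>2 = W x"
  using W_pos[of x] by simp_all

lemma L2_\<mu>_iff: "f \<in> L2 \<mu> \<longleftrightarrow> f \<in> borel_measurable borel \<and> (\<lambda>x. f x / sqrt (W x)) \<in> L2 lborel"
  by (auto simp: L2_def measurable_\<mu> integrable_\<mu>_iff power_divide sqrt_W)

text \<open>Division by sqrt W turns the density 1 / W into Lebesgue measure, so the same space of
  classes models L2(mu) for every weight.\<close>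

definition \<Phi> :: "('a \<Rightarrow> real) \<Rightarrow> 'a l2" where "\<Phi> f = abs_l2 (\<lambda>x. f x / sqrt (W x))"

sublocale l2_model \<mu> \<Phi>
proof
  fix f g a b assume f: "f \<in> L2 \<mu>" and g: "g \<in> L2 \<mu>"
  have [measurable]: "f \<in> borel_measurable borel" "g \<in> borel_measurable borel" using f g by (auto simp: L2_\<mu>_iff)
  let ?f = "\<lambda>x. f x / sqrt (W x)" and ?g = "\<lambda>x. g x / sqrt (W x)"
  have fg: "?f \<in> L2 lborel" "?g \<in> L2 lborel" using f g by (auto simp: L2_\<mu>_iff)
  have "\<Phi> (\<lambda>x. a * f x + b * g x) = abs_l2 (\<lambda>x. a * ?f x + b * ?g x)"
    by (simp add: \<Phi>_def add_divide_distrib)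
  also have "\<dots> = abs_l2 (\<lambda>x. a * ?f x) + abs_l2 (\<lambda>x. b * ?g x)"
    using L2_scale[OF fg(1), of a] L2_scale[OF fg(2), of b] by (intro plus_l2.abs_eq[symmetric]) simp_all
  also have "\<dots> = a *\<^sub>R \<Phi> f + b *\<^sub>R \<Phi> g"
    unfolding \<Phi>_def by (subst (1 2) scaleR_l2.abs_eq) (simp_all add: fg)
  finally show "\<Phi> (\<lambda>x. a * f x + b * g x) = a *\<^sub>R \<Phi> f + b *\<^sub>R \<Phi> g" .
  have "\<Phi> f \<bullet> \<Phi> g = (LINT x|lborel. ?f x * ?g x)"
    unfolding \<Phi>_def by (simp add: abs_l2_inner fg l2_inner_def)
  also have "\<dots> = l2_inner \<mu> f g"
    unfolding l2_inner_def by (subst integral_\<mu>) (simp_all add: abs_of_pos W_pos)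
  finally show "\<Phi> f \<bullet> \<Phi> g = l2_inner \<mu> f g" .
next
  fix x :: "'a l2"
  obtain h where h: "h \<in> L2 lborel" "abs_l2 h = x" using abs_l2_surj by blast
  have "(\<lambda>x. h x * sqrt (W x) / sqrt (W x)) = h" using sqrt_W(2) by (simp add: less_imp_neq[THEN not_sym])
  moreover have "h \<in> borel_measurable borel" using L2_D(1)[OF h(1)] by simp
  ultimately show "\<exists>f\<in>L2 \<mu>. \<Phi> f = x"
    using h by (intro bexI[of _ "\<lambda>x. h x * sqrt (W x)"]) (auto simp: \<Phi>_def L2_\<mu>_iff)
qed

definition F :: "('a \<Rightarrow> real) set" where "F = stable_ext_dom \<alpha> \<inter> L2 \<mu>"

lemma stable_dom_subset_F: "f \<in> stable_dom \<alpha> \<Longrightarrow> f \<in> F"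
  using stable_dom_subset_ext L2_lborel_subset_\<mu> by (auto simp: F_def stable_dom_iff)

lemma F_finite_energy: "f \<in> F \<Longrightarrow> f \<in> finite_energy \<alpha>"
  using stable_ext_dom_finite_energy by (auto simp: F_def)

lemma ext_form_F: "f \<in> F \<Longrightarrow> g \<in> F \<Longrightarrow> stable_ext_form \<alpha> f g = stable_form \<alpha> f g"
  by (auto simp: F_def stable_ext_form_eq)

lemma stable_form_cong_AE:
  assumes [measurable]: "f \<in> borel_measurable borel" "g \<in> borel_measurable borel" "h \<in> borel_measurable borel"
    and eq: "AE x in lborel. f x = g (x :: 'a)"
  shows "stable_form \<alpha> f h = stable_form \<alpha> g h"
proof -
  have "AE z in (lborel :: 'a measure) \<Otimes>\<^sub>M lborel. stable_integrand \<alpha> f h z = stable_integrand \<alpha> g h z"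
    using AE_lborel_pair[OF eq] by eventually_elim (auto simp: stable_integrand_def split_beta)
  then show ?thesis unfolding stable_form_def by (subst integral_cong_AE) simp_all
qed

lemma AE_lborel_nonzero: "AE x in lborel. (x :: 'a) \<noteq> 0"
  by (rule AE_I'[of "{0}"]) (auto simp: null_sets_def)

lemma close_stable_dom:
  assumes u: "u \<in> (stable_ext_dom \<alpha> :: ('a \<Rightarrow> real) set)" and e: "e > 0"
  shows "\<exists>v\<in>stable_dom \<alpha>. stable_form \<alpha> (\<lambda>x. v x - u x) (\<lambda>x. v x - u x) < e"
proof -
  obtain un where un: "stable_approx \<alpha> un u" and um: "u \<in> borel_measurable borel"
    using u by (auto simp: stable_ext_dom_def)
  have "\<forall>\<^sub>F n in sequentially. stable_form \<alpha> (\<lambda>x. un n x - u x) (\<lambda>x. un n x - u x) < e"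
    by (rule order_tendstoD(2)[OF stable_approx_energy(2)[OF un um] e])
  then obtain n where "stable_form \<alpha> (\<lambda>x. un n x - u x) (\<lambda>x. un n x - u x) < e"
    using eventually_happens by fastforce
  then show ?thesis using un by (auto simp: stable_approx_def)
qed

text \<open>By the Hardy inequality, approximants from \<^term>\<open>stable_dom \<alpha>\<close> that are close in energy
  inherit the almost everywhere limit.\<close>

lemma stable_ext_dom_limit:
  assumes U: "\<And>n. U n \<in> stable_ext_dom \<alpha>" and um: "u \<in> borel_measurable borel"
    and lim: "AE x in lborel. (\<lambda>n. U n x) \<longlonglongrightarrow> u (x :: 'a)"
    and cauchy: "\<And>e. e > 0 \<Longrightarrow> \<exists>N. \<forall>m\<ge>N. \<forall>n\<ge>N. stable_form \<alpha> (\<lambda>x. U m x - U n x) (\<lambda>x. U m x - U n x) < e"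
  shows "u \<in> stable_ext_dom \<alpha>"
proof -
  have "\<exists>v\<in>stable_dom \<alpha>. stable_form \<alpha> (\<lambda>x. v x - U n x) (\<lambda>x. v x - U n x) < (1/2) ^ n" for n
    by (rule close_stable_dom[OF U]) simp
  then obtain v where v: "\<And>n. v n \<in> stable_dom \<alpha>"
    and vU: "\<And>n. stable_form \<alpha> (\<lambda>x. v n x - U n x) (\<lambda>x. v n x - U n x) < (1/2) ^ n" by metis
  have fin: "v n \<in> finite_energy \<alpha>" "U n \<in> finite_energy \<alpha>" for n
    using v stable_ext_dom_finite_energy[OF U] by (auto simp: stable_dom_iff)
  have [measurable]: "v n \<in> borel_measurable borel" "U n \<in> borel_measurable borel" for n
    using fin finite_energy_measurable by auto
  obtain K where K: "K > 0" and hd: "\<And>w. w \<in> stable_ext_dom \<alpha> \<Longrightarrow>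
      (\<integral>\<^sup>+x. ennreal ((w x)\<^sup>2 * norm (x :: 'a) powr - \<alpha>) \<partial>lborel) \<le> ennreal (K * stable_form \<alpha> w w)"
    using hardy by blast
  have ext: "(\<lambda>x. v n x - U n x) \<in> stable_ext_dom \<alpha>" for n
    using stable_ext_dom_lincomb[OF stable_dom_subset_ext[OF v[of n]] U[of n], of 1 "-1"] by simp
  \<comment> \<open>The differences carry the square root of the Hardy weight, so that the Hardy
    inequality makes their square integrals summable; away from the origin the weight can be divided
    out again.\<close>
  define d where "d n x = (v n x - U n x) * norm x powr (- \<alpha> / 2)" for n and x :: 'a
  have [measurable]: "d n \<in> borel_measurable borel" for n unfolding d_def by measurable
  have d2: "(d n x)\<^sup>2 = (v n x - U n x)\<^sup>2 * norm x powr - \<alpha>" for n x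
  proof -
    have "(norm x powr (- \<alpha> / 2))\<^sup>2 = norm x powr - \<alpha>"
      unfolding power2_eq_square powr_add[symmetric] by simp
    then show ?thesis unfolding d_def power_mult_distrib by (simp only:)
  qed
  have "(\<Sum>n. \<integral>\<^sup>+x. ennreal ((d n x)\<^sup>2) \<partial>lborel) \<le> (\<Sum>n. ennreal (K * (1/2) ^ n))"
  proof (rule suminf_le)
    fix n
    have "(\<integral>\<^sup>+x. ennreal ((d n x)\<^sup>2) \<partial>lborel) \<le> ennreal (K * stable_form \<alpha> (\<lambda>x. v n x - U n x) (\<lambda>x. v n x - U n x))"
      unfolding d2 by (rule hd[OF ext])
    also have "\<dots> \<le> ennreal (K * (1/2) ^ n)"
      using K vU[of n] by (intro ennreal_leI mult_left_mono) auto
    finally show "(\<integral>\<^sup>+x. ennreal ((d n x)\<^sup>2) \<partial>lborel) \<le> ennreal (K * (1/2) ^ n)" .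
  qed auto
  also have "\<dots> = ennreal (\<Sum>n. K * (1/2) ^ n)"
    by (rule suminf_ennreal2) (use K in \<open>auto simp: summable_geometric intro!: summable_mult\<close>)
  also have "\<dots> < \<infinity>" by simp
  finally have "AE x in lborel. (\<lambda>n. d n x) \<longlonglongrightarrow> 0"
    by (rule AE_tendsto_zero_of_square_sums[rotated]) simp
  then have vlim: "AE x in lborel. (\<lambda>n. v n x) \<longlonglongrightarrow> u x"
    using lim AE_lborel_nonzero
  proof eventually_elim
    case (elim x)
    have "(\<lambda>n. d n x * norm x powr (\<alpha> / 2)) \<longlonglongrightarrow> 0 * norm x powr (\<alpha> / 2)"
      by (intro tendsto_mult elim tendsto_const)
    moreover have "d n x * norm x powr (\<alpha> / 2) = v n x - U n x" for n
      using elim(3) by (simp add: d_def mult.assoc powr_add[symmetric])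
    ultimately have "(\<lambda>n. v n x - U n x) \<longlonglongrightarrow> 0" by simp
    from tendsto_add[OF this elim(2)] show ?case by simp
  qed
  have "stable_approx \<alpha> v u"
    unfolding stable_approx_def
  proof (intro conjI allI impI v vlim)
    fix e :: real assume e: "e > 0"
    \<comment> \<open>Splitting v m - v n into three differences by applying (a + b)^2 <= 2 a^2 + 2
      b^2 twice costs the factors 2, 4 and 4; ten times e / 12 is below e.\<close>
    obtain N1 where N1: "\<And>m n. m \<ge> N1 \<Longrightarrow> n \<ge> N1 \<Longrightarrow> stable_form \<alpha> (\<lambda>x. U m x - U n x) (\<lambda>x. U m x - U n x) < e / 12"
      using cauchy[of "e / 12"] e by auto
    obtain N2 :: nat where N2: "(1/2) ^ N2 < e / 12"
      using real_arch_pow_inv[of "e / 12" "1/2"] e by auto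
    have small: "stable_form \<alpha> (\<lambda>x. v n x - U n x) (\<lambda>x. v n x - U n x) < e / 12" if "n \<ge> N2" for n
    proof -
      have "(1/2 :: real) ^ n \<le> (1/2) ^ N2" by (rule power_decreasing[OF that]) auto
      then show ?thesis using vU[of n] N2 by linarith
    qed
    have "stable_form \<alpha> (\<lambda>x. v m x - v n x) (\<lambda>x. v m x - v n x) < e"
      if mn: "m \<ge> max N1 N2" "n \<ge> max N1 N2" for m n
    proof -
      let ?A = "\<lambda>x. v m x - U m x" and ?B = "\<lambda>x. U m x - U n x" and ?C = "\<lambda>x. v n x - U n x"
      let ?BC = "\<lambda>x. 1 * ?B x + - 1 * ?C x"
      have ABC: "?A \<in> finite_energy \<alpha>" "?B \<in> finite_energy \<alpha>" "?C \<in> finite_energy \<alpha>"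
        by (intro finite_energy_diff fin)+
      have BC: "?BC \<in> finite_energy \<alpha>" by (rule finite_energy_lincomb[OF ABC(2,3)])
      have "(\<lambda>x. v m x - v n x) = (\<lambda>x. 1 * ?A x + 1 * ?BC x)" by auto
      then have "stable_form \<alpha> (\<lambda>x. v m x - v n x) (\<lambda>x. v m x - v n x)
          \<le> 2 * stable_form \<alpha> ?A ?A + 2 * stable_form \<alpha> ?BC ?BC"
        using stable_form_lincomb_le[OF ABC(1) BC, of 1 1] by simp
      also have "stable_form \<alpha> ?BC ?BC \<le> 2 * stable_form \<alpha> ?B ?B + 2 * stable_form \<alpha> ?C ?C"
        using stable_form_lincomb_le[OF ABC(2,3), of 1 "-1"] by simp
      finally show ?thesis using small[of m] small[of n] N1[of m n] mn e by simp
    qed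
    then show "\<exists>N. \<forall>m\<ge>N. \<forall>n\<ge>N. stable_form \<alpha> (\<lambda>x. v m x - v n x) (\<lambda>x. v m x - v n x) < e" by blast
  qed
  then show ?thesis using um by (auto simp: stable_ext_dom_def)
qed

lemma F_diff_mem: "f \<in> F \<Longrightarrow> g \<in> F \<Longrightarrow> (\<lambda>x. f x - g x) \<in> F"
  using stable_ext_dom_lincomb[of f g 1 "-1"] L2_diff by (auto simp: F_def)

text \<open>Convergence in L2(mu) yields a subsequence converging mu-almost everywhere, and mu has
  the null sets of Lebesgue measure because \<open>W\<close> is positive;
  \<open>stable_ext_dom_limit\<close> then applies along that subsequence.\<close>

lemma F_closed:
  assumes U: "\<And>n. U n \<in> F" and u: "u \<in> L2 \<mu>"
    and conv: "(\<lambda>n. l2_inner \<mu> (\<lambda>x. U n x - u x) (\<lambda>x. U n x - u x)) \<longlonglongrightarrow> 0"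
    and cauchy: "\<And>e. e > 0 \<Longrightarrow> \<exists>N. \<forall>m\<ge>N. \<forall>n\<ge>N. stable_form \<alpha> (\<lambda>x. U m x - U n x) (\<lambda>x. U m x - U n x) < e"
  shows "u \<in> F" "(\<lambda>n. stable_form \<alpha> (\<lambda>x. U n x - u x) (\<lambda>x. U n x - u x)) \<longlonglongrightarrow> 0"
proof -
  have UL: "U n \<in> L2 \<mu>" "U n \<in> stable_ext_dom \<alpha>" for n using U by (auto simp: F_def)
  have um: "u \<in> borel_measurable borel" by (rule L2_\<mu>_measurable[OF u])
  have "\<exists>r :: nat \<Rightarrow> nat. strict_mono r \<and> (AE x in \<mu>. (\<lambda>n. (U (r n) x - u x) * (U (r n) x - u x)) \<longlonglongrightarrow> 0)"
  proof (rule tendsto_L1_AE_subseq)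
    show "integrable \<mu> (\<lambda>x. (U n x - u x) * (U n x - u x))" for n
      by (intro L2_integrable_mult L2_diff UL u)
    show "(\<lambda>n. LINT x|\<mu>. norm ((U n x - u x) * (U n x - u x))) \<longlonglongrightarrow> 0"
      using conv by (simp add: l2_inner_def)
  qed
  then obtain r where r: "strict_mono (r :: nat \<Rightarrow> nat)"
    and "AE x in lborel. (\<lambda>n. (U (r n) x - u x) * (U (r n) x - u x)) \<longlonglongrightarrow> 0"
    unfolding AE_\<mu>_iff by blast
  from this(2) have lim: "AE x in lborel. (\<lambda>n. U (r n) x) \<longlonglongrightarrow> u x"
  proof eventually_elim
    case (elim x)
    then have "(\<lambda>n. (U (r n) x - u x)\<^sup>2) \<longlonglongrightarrow> 0" by (simp add: power2_eq_square)
    then have "(\<lambda>n. U (r n) x - u x) \<longlonglongrightarrow> 0" by (simp add: tendsto_null_power)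
    then show ?case by (simp add: LIM_zero_iff)
  qed
  have "u \<in> stable_ext_dom \<alpha>"
  proof (rule stable_ext_dom_limit[of "\<lambda>n. U (r n)", OF UL(2) um lim])
    fix e :: real assume "e > 0"
    then obtain N where N: "\<And>m n. m \<ge> N \<Longrightarrow> n \<ge> N \<Longrightarrow> stable_form \<alpha> (\<lambda>x. U m x - U n x) (\<lambda>x. U m x - U n x) < e"
      using cauchy by blast
    have "r m \<ge> N" if "m \<ge> N" for m using seq_suble[OF r, of m] that by simp
    then show "\<exists>N. \<forall>m\<ge>N. \<forall>n\<ge>N. stable_form \<alpha> (\<lambda>x. U (r m) x - U (r n) x) (\<lambda>x. U (r m) x - U (r n) x) < e"
      using N by blast
  qed
  then show "u \<in> F" using u by (simp add: F_def)
  show "(\<lambda>n. stable_form \<alpha> (\<lambda>x. U n x - u x) (\<lambda>x. U n x - u x)) \<longlonglongrightarrow> 0"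
    by (rule finite_energy_cauchy_limit(2)[OF F_finite_energy[OF U] um r lim cauchy])
qed

end

subsection \<open>Bump functions and density of the form domain\<close>

lemma ennreal_term_le_suminf: "f k \<le> (\<Sum>k. f k :: ennreal)"
  using sum_le_suminf[of f "{k}"] by simp

lemma power_powr_swap:
  assumes "0 < (a::real)"
  shows "(a ^ n) powr b = (a powr b) ^ n"
proof -
  have "(a ^ n) powr b = (a powr real n) powr b" using assms by (simp add: powr_realpow)
  also have "\<dots> = (a powr b) powr real n" by (simp add: powr_powr mult.commute)
  also have "\<dots> = (a powr b) ^ n" using assms by (simp add: powr_realpow)
  finally show ?thesis .
qed

lemma small_shell_cover:
  assumes "0 < norm x" "norm x < 1"
  shows "\<exists>k. x \<in> shell (1 / 2 ^ Suc k)"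
proof -
  have ex: "\<exists>n. 1 / 2 ^ n \<le> norm x"
    using real_arch_pow_inv[of "norm x" "1/2"] assms(1) by (auto simp: power_one_over intro: less_imp_le)
  define n where "n = (LEAST n. 1 / 2 ^ n \<le> norm x)"
  have n: "1 / 2 ^ n \<le> norm x" unfolding n_def by (rule LeastI_ex[OF ex])
  have "n \<noteq> 0" using n assms(2) by (intro notI) simp
  then obtain k where k: "n = Suc k" by (cases n) auto
  have "\<not> 1 / 2 ^ k \<le> norm x"
    by (rule not_less_Least) (use k n_def in simp)
  then have "x \<in> shell (1 / 2 ^ Suc k)" using n k by (simp add: shell_def)
  then show ?thesis ..
qed

context stable_exponent
begin

text \<open>Up to a factor 4 this dominates (f x - f y)^2 times the kernel, with z = x - y, for
  every f that is bounded by 1 and has Lipschitz constant 1 / \<open>\<rho>\<close>.\<close>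

definition levy_density :: "real \<Rightarrow> 'a \<Rightarrow> real" where
  "levy_density \<rho> z = min 1 ((norm z / \<rho>)\<^sup>2) * (c\<^sub>\<alpha> / norm z powr (real DIM('a) + \<alpha>))"

lemma levy_density_measurable [measurable]: "levy_density \<rho> \<in> borel_measurable borel"
  unfolding levy_density_def by measurable

lemma levy_density_nonneg: "0 \<le> levy_density \<rho> z"
  unfolding levy_density_def using c_pos by (intro mult_nonneg_nonneg) auto

text \<open>Dyadic shells contribute a geometric series of ratio 2^-\<alpha> outside the unit ball
  and one of ratio 2^(\<alpha> - 2) inside it, where the quadratic factor tames the kernel.\<close>

lemma nn_integral_levy_density_finite: "(\<integral>\<^sup>+z. ennreal (levy_density 1 z) \<partial>lborel) < \<infinity>"
proof -
  define p where "p = real DIM('a) + \<alpha>"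
  define v where "v = shell_volume TYPE('a)"
  have v: "v > 0" unfolding v_def by (rule shell_volume_pos)
  have p: "p > 0" using \<alpha>_pos by (simp add: p_def add_nonneg_pos)
  let ?A = "\<lambda>k::nat. ennreal (c\<^sub>\<alpha> / (2 ^ k) powr p)"
  let ?B = "\<lambda>k::nat. ennreal ((2 / 2 ^ Suc k)\<^sup>2 * (c\<^sub>\<alpha> / (1 / 2 ^ Suc k) powr p))"
  have "(\<integral>\<^sup>+z. ennreal (levy_density 1 z) \<partial>lborel)
    \<le> (\<integral>\<^sup>+z. (\<Sum>k. ?A k * indicator (shell (2 ^ k)) z) + (\<Sum>k. ?B k * indicator (shell (1 / 2 ^ Suc k)) z) \<partial>(lborel :: 'a measure))"
  proof (rule nn_integral_mono)
    fix z :: 'a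
    consider "z = 0" | "norm z \<ge> 1" | "0 < norm z" "norm z < 1" by fastforce
    then show "ennreal (levy_density 1 z)
      \<le> (\<Sum>k. ?A k * indicator (shell (2 ^ k)) z) + (\<Sum>k. ?B k * indicator (shell (1 / 2 ^ Suc k)) z)"
    proof cases
      case 1
      then show ?thesis by (simp add: levy_density_def)
    next
      case 2
      then obtain k where k: "z \<in> shell (2 ^ k)" using shell_cover[of 1 z] by auto
      have "levy_density 1 z \<le> 1 * (c\<^sub>\<alpha> / (2 ^ k) powr p)"
        unfolding levy_density_def p_def[symmetric]
      proof (rule mult_mono)
        show "c\<^sub>\<alpha> / norm z powr p \<le> c\<^sub>\<alpha> / (2 ^ k) powr p"
        proof (intro divide_left_mono powr_mono2 mult_pos_pos)
          show "0 < norm z powr p" using \<open>norm z \<ge> 1\<close> by auto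
        qed (use k p c_pos in \<open>auto simp: shell_def\<close>)
      qed (use c_pos in auto)
      then have "ennreal (levy_density 1 z) \<le> ?A k * indicator (shell (2 ^ k)) z"
        using k by (simp add: ennreal_leI)
      also have "\<dots> \<le> (\<Sum>k. ?A k * indicator (shell (2 ^ k)) z)"
        by (rule ennreal_term_le_suminf[where f = "\<lambda>k. ?A k * indicator (shell (2 ^ k)) z"])
      also have "\<dots> \<le> \<dots> + (\<Sum>k. ?B k * indicator (shell (1 / 2 ^ Suc k)) z)" by simp
      finally show ?thesis .
    next
      case 3
      then obtain k where k: "z \<in> shell (1 / 2 ^ Suc k)" using small_shell_cover by blast
      have "levy_density 1 z \<le> (2 / 2 ^ Suc k)\<^sup>2 * (c\<^sub>\<alpha> / (1 / 2 ^ Suc k) powr p)"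
        unfolding levy_density_def p_def[symmetric]
      proof (rule mult_mono)
        have "(norm z)\<^sup>2 \<le> (2 / 2 ^ Suc k)\<^sup>2" using k by (intro power_mono) (auto simp: shell_def)
        then show "min 1 ((norm z / 1)\<^sup>2) \<le> (2 / 2 ^ Suc k)\<^sup>2" by (simp add: min.coboundedI2)
        show "c\<^sub>\<alpha> / norm z powr p \<le> c\<^sub>\<alpha> / (1 / 2 ^ Suc k) powr p"
          using k p c_pos 3 by (intro divide_left_mono powr_mono2 mult_pos_pos) (auto simp: shell_def)
      qed (use c_pos in auto)
      then have "ennreal (levy_density 1 z) \<le> ?B k * indicator (shell (1 / 2 ^ Suc k)) z"
        using k by (simp add: ennreal_leI)
      also have "\<dots> \<le> (\<Sum>k. ?B k * indicator (shell (1 / 2 ^ Suc k)) z)"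
        by (rule ennreal_term_le_suminf[where f = "\<lambda>k. ?B k * indicator (shell (1 / 2 ^ Suc k)) z"])
      also have "\<dots> \<le> (\<Sum>k. ?A k * indicator (shell (2 ^ k)) z) + \<dots>" by simp
      finally show ?thesis .
    qed
  qed
  also have "\<dots> = (\<Sum>k. ?A k * emeasure lborel (shell (2 ^ k) :: 'a set))
      + (\<Sum>k. ?B k * emeasure lborel (shell (1 / 2 ^ Suc k) :: 'a set))"
    by (subst nn_integral_add) (simp_all add: nn_integral_suminf nn_integral_cmult)
  also have "(\<Sum>k. ?A k * emeasure lborel (shell (2 ^ k) :: 'a set)) = (\<Sum>k. ennreal (c\<^sub>\<alpha> * v * (2 powr - \<alpha>) ^ k))"
  proof (rule suminf_cong)
    fix k :: nat
    have "(2 ^ k) powr p = (2 ^ k) ^ DIM('a) * ((2 :: real) powr \<alpha>) ^ k"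
      using power_powr_swap[of 2 k \<alpha>] by (simp add: p_def powr_add powr_realpow)
    then have "c\<^sub>\<alpha> / (2 ^ k) powr p * ((2 ^ k) ^ DIM('a) * v) = c\<^sub>\<alpha> * v * (2 powr - \<alpha>) ^ k"
      by (simp add: powr_minus power_inverse field_simps)
    then show "?A k * emeasure lborel (shell (2 ^ k) :: 'a set) = ennreal (c\<^sub>\<alpha> * v * (2 powr - \<alpha>) ^ k)"
      using v c_pos by (simp add: emeasure_shell v_def[symmetric] ennreal_mult[symmetric])
  qed
  also have "(\<Sum>k. ?B k * emeasure lborel (shell (1 / 2 ^ Suc k) :: 'a set)) = (\<Sum>k. ennreal (4 * c\<^sub>\<alpha> * v * (2 powr (\<alpha> - 2)) ^ Suc k))"
  proof (rule suminf_cong)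
    fix k :: nat
    define q where "q = 1 / (2::real) ^ Suc k"
    have q: "q > 0" by (simp add: q_def)
    have qa: "q powr \<alpha> > 0" "q powr p = q ^ DIM('a) * q powr \<alpha>" using q by (simp_all add: p_def powr_add powr_realpow)
    have "(2 powr (\<alpha> - 2)) ^ Suc k = q\<^sup>2 / q powr \<alpha>"
    proof -
      have q': "q = (1 / 2) ^ Suc k" by (simp add: q_def power_one_over del: power_Suc)
      have "q\<^sup>2 = (1 / 4) ^ Suc k" unfolding q' power2_eq_square power_mult_distrib[symmetric] by simp
      moreover have "q powr \<alpha> = ((1 / 2) powr \<alpha>) ^ Suc k" unfolding q' by (rule power_powr_swap) simp
      moreover have "(1 / 4) / (1 / 2) powr \<alpha> = 2 powr (\<alpha> - 2)" by (simp add: powr_divide powr_diff)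
      ultimately show ?thesis by (simp only: power_divide[symmetric])
    qed
    moreover have "(2 * q)\<^sup>2 * (c\<^sub>\<alpha> / q powr p) * (q ^ DIM('a) * v) = 4 * c\<^sub>\<alpha> * v * (q\<^sup>2 / q powr \<alpha>)"
      using q qa by (simp add: field_simps power2_eq_square)
    ultimately have "(2 * q)\<^sup>2 * (c\<^sub>\<alpha> / q powr p) * (q ^ DIM('a) * v) = 4 * c\<^sub>\<alpha> * v * (2 powr (\<alpha> - 2)) ^ Suc k"
      by simp
    moreover have "?B k = ennreal ((2 * q)\<^sup>2 * (c\<^sub>\<alpha> / q powr p))" by (simp add: q_def)
    moreover have "emeasure lborel (shell (1 / 2 ^ Suc k) :: 'a set) = ennreal (q ^ DIM('a) * v)"
      using emeasure_shell[OF q, where 'a = 'a] by (simp only: q_def v_def)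
    ultimately show "?B k * emeasure lborel (shell (1 / 2 ^ Suc k) :: 'a set) = ennreal (4 * c\<^sub>\<alpha> * v * (2 powr (\<alpha> - 2)) ^ Suc k)"
      using q v c_pos by (simp add: ennreal_mult[symmetric])
  qed
  also have "(\<Sum>k. ennreal (c\<^sub>\<alpha> * v * (2 powr - \<alpha>) ^ k)) = ennreal (\<Sum>k. c\<^sub>\<alpha> * v * (2 powr - \<alpha>) ^ k)"
    using c_pos v \<alpha>_pos by (intro suminf_ennreal2 summable_mult summable_geometric) (auto simp: powr_less_one)
  also have "(\<Sum>k. ennreal (4 * c\<^sub>\<alpha> * v * (2 powr (\<alpha> - 2)) ^ Suc k)) = ennreal (\<Sum>k. 4 * c\<^sub>\<alpha> * v * (2 powr (\<alpha> - 2)) ^ Suc k)"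
  proof (rule suminf_ennreal2)
    have "summable (\<lambda>k. (2 powr (\<alpha> - 2)) ^ k)"
      using \<alpha>_less_2 by (intro summable_geometric) (simp add: powr_less_one)
    then show "summable (\<lambda>k. 4 * c\<^sub>\<alpha> * v * (2 powr (\<alpha> - 2)) ^ Suc k)"
      by (intro summable_mult) (simp only: summable_Suc_iff)
  qed (use c_pos v in auto)
  finally show ?thesis by (rule le_less_trans) simp
qed

definition levy_mass :: real where
  "levy_mass = enn2real (\<integral>\<^sup>+z. ennreal (levy_density 1 z) \<partial>lborel)"

lemma nn_integral_levy_density:
  assumes \<rho>: "\<rho> > 0"
  shows "(\<integral>\<^sup>+z. ennreal (levy_density \<rho> z) \<partial>lborel) = ennreal (\<rho> powr - \<alpha> * levy_mass)"
proof -
  have scale: "levy_density \<rho> (0 + \<rho> *\<^sub>R z) = \<rho> powr - (real DIM('a) + \<alpha>) * levy_density 1 z" for z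
  proof -
    define p where "p = real DIM('a) + \<alpha>"
    have 1: "norm (0 + \<rho> *\<^sub>R z) / \<rho> = norm z / 1" using \<rho> by simp
    have 2: "c\<^sub>\<alpha> / norm (0 + \<rho> *\<^sub>R z) powr p = \<rho> powr - p * (c\<^sub>\<alpha> / norm z powr p)"
      using \<rho> by (simp add: powr_mult powr_minus divide_inverse)
    show ?thesis unfolding levy_density_def p_def[symmetric] 1 2 by (simp only: ac_simps)
  qed
  have "(\<integral>\<^sup>+z. ennreal (levy_density \<rho> z) \<partial>lborel)
      = ennreal (\<bar>\<rho>\<bar> ^ DIM('a)) * (\<integral>\<^sup>+z. ennreal (levy_density \<rho> (0 + \<rho> *\<^sub>R z)) \<partial>lborel)"
    using \<rho> by (intro nn_integral_lborel_affine) auto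
  also have "\<dots> = ennreal (\<rho> ^ DIM('a)) * (ennreal (\<rho> powr - (real DIM('a) + \<alpha>)) * (\<integral>\<^sup>+z. ennreal (levy_density 1 z) \<partial>lborel))"
    unfolding scale using \<rho> by (simp add: ennreal_mult levy_density_nonneg nn_integral_cmult)
  also have "(\<integral>\<^sup>+z. ennreal (levy_density 1 z) \<partial>lborel) = ennreal levy_mass"
    unfolding levy_mass_def using nn_integral_levy_density_finite by simp
  also have "ennreal (\<rho> ^ DIM('a)) * (ennreal (\<rho> powr - (real DIM('a) + \<alpha>)) * ennreal levy_mass)
      = ennreal ((\<rho> ^ DIM('a) * \<rho> powr - (real DIM('a) + \<alpha>)) * levy_mass)"
    using \<rho> by (simp add: ennreal_mult[symmetric] levy_mass_def mult.assoc)
  also have "\<rho> ^ DIM('a) * \<rho> powr - (real DIM('a) + \<alpha>) = \<rho> powr - \<alpha>"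
    using \<rho> by (simp add: powr_realpow[symmetric] powr_add[symmetric])
  finally show ?thesis .
qed

lemma nn_integral_reflect_translate:
  assumes [measurable]: "g \<in> borel_measurable borel"
  shows "(\<integral>\<^sup>+y. g (x - y) \<partial>lborel) = (\<integral>\<^sup>+z. g (z :: 'a) \<partial>lborel)"
  using nn_integral_lborel_affine[OF assms, of "-1" x] by simp

text \<open>Only pairs with a point in \<open>B\<close> contribute; integrating out the other point
  leaves the total mass of \<open>levy_density \<rho>\<close>. The constant 8 is 4, the bound for
  squared increments, times 2 for which of the two points lies in \<open>B\<close>.\<close>

lemma bump_energy_le:
  fixes f :: "'a \<Rightarrow> real"
  assumes [measurable]: "f \<in> borel_measurable borel" and \<rho>: "\<rho> > 0"
    and bound: "\<And>x. \<bar>f x\<bar> \<le> 1" and lip: "\<And>x y. \<bar>f x - f y\<bar> \<le> norm (x - y) / \<rho>"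
    and B[measurable]: "B \<in> sets borel" and supp: "\<And>x. x \<notin> B \<Longrightarrow> f x = 0"
  shows "energy \<alpha> f \<le> ennreal (8 * \<rho> powr - \<alpha> * levy_mass) * emeasure lborel B"
proof -
  let ?l = "\<lambda>x y. ennreal (levy_density \<rho> (x - y))"
  have l_swap: "levy_density \<rho> (x - y) = levy_density \<rho> (y - x)" for x y
    by (simp add: levy_density_def norm_minus_commute)
  have "energy \<alpha> f \<le> (\<integral>\<^sup>+z. ennreal 4 * (indicator B (fst z) * ?l (fst z) (snd z)) + ennreal 4 * (indicator B (snd z) * ?l (fst z) (snd z)) \<partial>((lborel :: 'a measure) \<Otimes>\<^sub>M (lborel :: 'a measure)))"
    unfolding energy_def
  proof (rule nn_integral_mono)
    fix z :: "'a \<times> 'a"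
    obtain x y where z: "z = (x, y)" by (cases z)
    show "ennreal (stable_integrand \<alpha> f f z) \<le> ennreal 4 * (indicator B (fst z) * ?l (fst z) (snd z)) + ennreal 4 * (indicator B (snd z) * ?l (fst z) (snd z))"
    proof (cases "x \<in> B \<or> y \<in> B")
      case False
      then show ?thesis by (simp add: z stable_integrand_eq supp)
    next
      case True
      have "(f x - f y)\<^sup>2 \<le> 4 * min 1 ((norm (x - y) / \<rho>)\<^sup>2)"
      proof -
        have "\<bar>f x - f y\<bar> \<le> 2" using bound[of x] bound[of y] by linarith
        then have "\<bar>f x - f y\<bar>\<^sup>2 \<le> 2\<^sup>2" by (intro power_mono) auto
        moreover have "\<bar>f x - f y\<bar>\<^sup>2 \<le> (norm (x - y) / \<rho>)\<^sup>2" using lip by (intro power_mono) auto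
        moreover define X where "X = (norm (x - y) / \<rho>)\<^sup>2"
        moreover have "0 \<le> X" by (simp add: X_def)
        ultimately show ?thesis unfolding power2_abs X_def[symmetric] by (cases "1 \<le> X") auto
      qed
      then have "stable_integrand \<alpha> f f z \<le> 4 * levy_density \<rho> (x - y)"
        unfolding z stable_integrand_eq levy_density_def power2_eq_square[symmetric, of "f x - f y"] mult.assoc[symmetric]
        by (intro mult_right_mono kernel_nonneg)
      then have "ennreal (stable_integrand \<alpha> f f z) \<le> ennreal 4 * ?l x y"
        by (subst ennreal_mult[symmetric]) (auto simp: levy_density_nonneg intro: ennreal_leI)
      also have "\<dots> \<le> ennreal 4 * (indicator B x * ?l x y) + ennreal 4 * (indicator B y * ?l x y)"
        using True by (auto simp: indicator_def)
      finally show ?thesis by (simp add: z)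
    qed
  qed
  also have "\<dots> = ennreal 4 * (\<integral>\<^sup>+z. indicator B (fst z) * ?l (fst z) (snd z) \<partial>((lborel :: 'a measure) \<Otimes>\<^sub>M (lborel :: 'a measure)))
      + ennreal 4 * (\<integral>\<^sup>+z. indicator B (snd z) * ?l (fst z) (snd z) \<partial>((lborel :: 'a measure) \<Otimes>\<^sub>M (lborel :: 'a measure)))"
    by (subst nn_integral_add; (subst nn_integral_cmult)?; (subst nn_integral_cmult)?) simp_all
  also have "(\<integral>\<^sup>+z. indicator B (fst z) * ?l (fst z) (snd z) \<partial>((lborel :: 'a measure) \<Otimes>\<^sub>M (lborel :: 'a measure)))
      = (\<integral>\<^sup>+x. \<integral>\<^sup>+y. indicator B x * ?l x y \<partial>(lborel :: 'a measure) \<partial>(lborel :: 'a measure))"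
    by (subst lborel.nn_integral_fst[symmetric]) simp_all
  also have "\<dots> = (\<integral>\<^sup>+x. indicator B x * (\<integral>\<^sup>+z. ennreal (levy_density \<rho> z) \<partial>(lborel :: 'a measure)) \<partial>(lborel :: 'a measure))"
    by (simp add: nn_integral_cmult nn_integral_reflect_translate[of "\<lambda>z. ennreal (levy_density \<rho> z)"])
  also have "\<dots> = emeasure lborel B * ennreal (\<rho> powr - \<alpha> * levy_mass)"
    by (simp add: nn_integral_multc nn_integral_levy_density[OF \<rho>])
  also have "(\<integral>\<^sup>+z. indicator B (snd z) * ?l (fst z) (snd z) \<partial>((lborel :: 'a measure) \<Otimes>\<^sub>M (lborel :: 'a measure)))
      = (\<integral>\<^sup>+y. \<integral>\<^sup>+x. indicator B y * ?l y x \<partial>(lborel :: 'a measure) \<partial>(lborel :: 'a measure))"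
    by (subst lborel_pair.nn_integral_snd[symmetric]) (simp_all add: l_swap)
  also have "\<dots> = (\<integral>\<^sup>+y. indicator B y * (\<integral>\<^sup>+z. ennreal (levy_density \<rho> z) \<partial>(lborel :: 'a measure)) \<partial>(lborel :: 'a measure))"
    by (simp add: nn_integral_cmult nn_integral_reflect_translate[of "\<lambda>z. ennreal (levy_density \<rho> z)"])
  also have "\<dots> = emeasure lborel B * ennreal (\<rho> powr - \<alpha> * levy_mass)"
    by (simp add: nn_integral_multc nn_integral_levy_density[OF \<rho>])
  also have "ennreal 4 * (emeasure lborel B * ennreal (\<rho> powr - \<alpha> * levy_mass)) + ennreal 4 * (emeasure lborel B * ennreal (\<rho> powr - \<alpha> * levy_mass))
      = ennreal (8 * \<rho> powr - \<alpha> * levy_mass) * emeasure lborel B"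
  proof -
    define t where "t = \<rho> powr - \<alpha> * levy_mass"
    have t: "t \<ge> 0" by (simp add: t_def levy_mass_def)
    have "ennreal (8 * t) = ennreal 4 * ennreal t + ennreal 4 * ennreal t"
    proof -
      have "ennreal (8 * t) = ennreal (4 * t + 4 * t)" by simp
      also have "\<dots> = ennreal (4 * t) + ennreal (4 * t)" using t by (intro ennreal_plus) auto
      also have "ennreal (4 * t) = ennreal 4 * ennreal t" using t by (intro ennreal_mult) auto
      finally show ?thesis .
    qed
    then show ?thesis unfolding mult.assoc t_def[symmetric] by (simp only: distrib_right distrib_left ac_simps)
  qed
  finally show ?thesis .
qed

lemma bump_stable_dom:
  fixes f :: "'a \<Rightarrow> real"
  assumes m[measurable]: "f \<in> borel_measurable borel" and \<rho>: "\<rho> > 0"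
    and bound: "\<And>x. \<bar>f x\<bar> \<le> 1" and lip: "\<And>x y. \<bar>f x - f y\<bar> \<le> norm (x - y) / \<rho>"
    and B: "bounded B" "B \<in> sets borel" and supp: "\<And>x. x \<notin> B \<Longrightarrow> f x = 0"
  shows "f \<in> stable_dom \<alpha>"
proof -
  have fin: "emeasure lborel B < \<infinity>" using B emeasure_bounded_finite by auto
  have [measurable]: "B \<in> sets borel" by fact
  have "(\<integral>\<^sup>+x. ennreal ((f x)\<^sup>2) \<partial>lborel) \<le> (\<integral>\<^sup>+x. indicator B x \<partial>lborel)"
  proof (rule nn_integral_mono)
    fix x
    have "(f x)\<^sup>2 \<le> 1" using power_mono[OF bound[of x], of 2] by simp
    then show "ennreal ((f x)\<^sup>2) \<le> indicator B x" using supp[of x] by (cases "x \<in> B") (auto intro: ennreal_leI)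
  qed
  also have "\<dots> = emeasure lborel B" by simp
  finally have "f \<in> L2 lborel" using fin by (subst L2_iff_nn_integral) (auto intro: le_less_trans)
  moreover have "energy \<alpha> f < \<infinity>"
    by (rule le_less_trans[OF bump_energy_le[OF m \<rho> bound lip B(2) supp]])
      (use fin in \<open>auto simp: ennreal_mult_less_top\<close>)
  ultimately show ?thesis by (simp add: stable_dom_iff finite_energy_def)
qed

end

context weighted_stable
begin

text \<open>With g = f / W, the functions min(1, (k + 1) dist(x, V^c)) lie in \<open>F\<close> and
  tend boundedly to the indicator of a bounded open V, so g integrates to 0 over V. Open sets are
  stable under intersection, which extends this to Borel subsets of a ball; the sets where g has one
  sign then give g = 0.\<close>

lemma F_total:
  assumes f: "f \<in> L2 \<mu>" and orth: "\<And>v. v \<in> F \<Longrightarrow> l2_inner \<mu> f v = 0"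
  shows "AE x in \<mu>. f x = 0"
proof -
  have [measurable]: "f \<in> borel_measurable borel" by (rule L2_\<mu>_measurable[OF f])
  define g where "g x = f x / W x" for x
  have [measurable]: "g \<in> borel_measurable borel" unfolding g_def by measurable
  have "AE x in lborel. x \<in> ball 0 R \<longrightarrow> g x = 0" for R
  proof -
    let ?B = "ball (0::'a) R"
    have [measurable]: "?B \<in> sets borel" by simp
    have bounded_B: "emeasure lborel ?B < \<infinity>" by (rule emeasure_bounded_finite) simp
    have int: "integrable lborel (\<lambda>x. g x * indicator ?B x)"
    proof (rule Bochner_Integration.integrable_bound)
      show "integrable lborel (\<lambda>x. (f x)\<^sup>2 / W x + indicator ?B x :: real)"
        using L2_D(2)[OF f] bounded_B by (intro Bochner_Integration.integrable_add) (simp_all add: integrable_\<mu>_iff)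
      have "\<bar>g x\<bar> \<le> (f x)\<^sup>2 / W x + 1" for x
      proof -
        have "\<bar>f x\<bar> \<le> (f x)\<^sup>2 + 1"
          using sum_squares_bound[of "\<bar>f x\<bar>" 1] by simp
        then have "\<bar>f x\<bar> / W x \<le> ((f x)\<^sup>2 + 1) / W x" by (intro divide_right_mono) (auto simp: W_pos less_imp_le)
        also have "\<dots> \<le> (f x)\<^sup>2 / W x + 1" using W_ge_1[of x] by (simp add: add_divide_distrib divide_le_eq)
        finally show ?thesis using W_pos[of x] by (simp add: g_def)
      qed
      then have "norm (g x * indicator ?B x) \<le> norm ((f x)\<^sup>2 / W x + indicator ?B x)" for x
        using W_pos[of x] by (auto simp: indicator_def abs_mult intro: order_trans)
      then show "AE x in lborel. norm (g x * indicator ?B x) \<le> norm ((f x)\<^sup>2 / W x + indicator ?B x)" by simp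
    qed measurable
    have "open": "(LINT x|lborel. g x * indicator (U \<inter> ?B) x) = 0" if "open U" for U
    proof (cases "U \<inter> ?B = {}")
      case True
      then show ?thesis by simp
    next
      case False
      let ?V = "U \<inter> ?B"
      have V: "open ?V" using that by auto
      have compl: "closed (- ?V)" using V by (rule closed_Compl)
      \<comment> \<open>\<open>infdist\<close> to the empty set is 0 by definition, so positivity of
        the distance inside V requires a nonempty complement.\<close>
      have ne: "- ?V \<noteq> {}"
      proof -
        obtain b :: 'a where "b \<in> Basis" using nonempty_Basis by blast
        then have "(\<bar>R\<bar> + 1) *\<^sub>R b \<notin> ?B" by simp
        then show ?thesis by blast
      qed
      define \<phi> where "\<phi> k x = min 1 (real (Suc k) * infdist x (- ?V))" for k and x :: 'a
      have [measurable]: "\<phi> k \<in> borel_measurable borel" for k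
        unfolding \<phi>_def by (intro borel_measurable_continuous_onI continuous_intros)
      have \<phi>01: "0 \<le> \<phi> k x" "\<phi> k x \<le> 1" for k x by (auto simp: \<phi>_def infdist_nonneg)
      have \<phi>0: "\<phi> k x = 0" if "x \<notin> ?V" for k x using that by (simp add: \<phi>_def)
      have "\<phi> k \<in> F" for k
      proof (rule stable_dom_subset_F[OF bump_stable_dom[where \<rho> = "1 / real (Suc k)" and B = ?V]])
        show "\<bar>\<phi> k x - \<phi> k y\<bar> \<le> norm (x - y) / (1 / real (Suc k))" for x y
        proof -
          have "\<bar>infdist x (- ?V) - infdist y (- ?V)\<bar> \<le> norm (x - y)"
            using infdist_triangle_abs[of x "- ?V" y] by (simp add: dist_norm)
          then have "real (Suc k) * \<bar>infdist x (- ?V) - infdist y (- ?V)\<bar> \<le> real (Suc k) * norm (x - y)"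
            by (rule mult_left_mono) simp
          then have "\<bar>real (Suc k) * infdist x (- ?V) - real (Suc k) * infdist y (- ?V)\<bar> \<le> real (Suc k) * norm (x - y)"
            by (simp add: right_diff_distrib[symmetric] abs_mult del: of_nat_Suc)
          then show ?thesis unfolding \<phi>_def by (simp add: mult.commute)
        qed
        show "\<bar>\<phi> k x\<bar> \<le> 1" for x using \<phi>01[of k x] by simp
        show "bounded ?V" by (rule bounded_subset[OF bounded_ball]) auto
        show "?V \<in> sets borel" using V by auto
      qed (simp_all add: \<phi>0)
      then have zero: "(LINT x|lborel. g x * \<phi> k x) = 0" for k
        using orth[of "\<phi> k"] by (simp add: l2_inner_def integral_\<mu> g_def)
      have "(\<lambda>k. LINT x|lborel. g x * \<phi> k x) \<longlonglongrightarrow> (LINT x|lborel. g x * indicator ?V x)"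
      proof (rule integral_dominated_convergence)
        show "integrable lborel (\<lambda>x. \<bar>g x * indicator ?B x\<bar>)" using int by (rule integrable_abs)
        have [measurable]: "?V \<in> sets borel" using V by (rule borel_open)
        show "(\<lambda>x. g x * indicator ?V x) \<in> borel_measurable lborel" by measurable
        show "AE x in lborel. norm (g x * \<phi> k x) \<le> \<bar>g x * indicator ?B x\<bar>" for k
        proof (rule AE_I2)
          fix x
          show "norm (g x * \<phi> k x) \<le> \<bar>g x * indicator ?B x\<bar>"
            using \<phi>01[of k x] \<phi>0[of x k] by (cases "x \<in> ?V") (auto simp: abs_mult intro: mult_left_le)
        qed
        show "AE x in lborel. (\<lambda>k. g x * \<phi> k x) \<longlonglongrightarrow> g x * indicator ?V x"
        proof (rule AE_I2)
          fix x
          have "(\<lambda>k. \<phi> k x) \<longlonglongrightarrow> indicator ?V x"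
          proof (cases "x \<in> ?V")
            case True
            then have pos: "infdist x (- ?V) > 0"
              using in_closed_iff_infdist_zero[OF compl ne, of x] infdist_nonneg[of x "- ?V"] by (auto simp: less_le)
            obtain N where N: "1 / infdist x (- ?V) < real N" using reals_Archimedean2 by blast
            have "\<phi> k x = 1" if "k \<ge> N" for k
            proof -
              have "1 / infdist x (- ?V) \<le> real (Suc k)" using N that by simp
              then have "1 \<le> real (Suc k) * infdist x (- ?V)" using pos by (simp add: divide_le_eq)
              then show ?thesis by (simp add: \<phi>_def)
            qed
            then have "\<forall>\<^sub>F k in sequentially. \<phi> k x = indicator ?V x"
              using True by (intro eventually_sequentiallyI[of N]) simp
            then show ?thesis by (rule tendsto_eventually)
          next
            case False
            then show ?thesis by (simp add: \<phi>0)
          qed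
          then show "(\<lambda>k. g x * \<phi> k x) \<longlonglongrightarrow> g x * indicator ?V x" by (rule tendsto_mult_left)
        qed
      qed measurable
      then have "(\<lambda>k :: nat. 0) \<longlonglongrightarrow> (LINT x|lborel. g x * indicator ?V x)" unfolding zero .
      from LIMSEQ_unique[OF this tendsto_const] show ?thesis .
    qed
    have borel: "(LINT x|lborel. g x * indicator (A \<inter> ?B) x) = 0" if "A \<in> sets borel" for A
    proof -
      have mem: "A \<in> sigma_sets UNIV {S. open S}" using that by (simp add: borel_def)
      have stable: "Int_stable {S :: 'a set. open S}" by (auto simp: Int_stable_def)
      have subset: "{S :: 'a set. open S} \<subseteq> Pow UNIV" by simp
      from stable subset mem show ?thesis
      proof (induction rule: sigma_sets_induct_disjoint)
        case (basic A)
        then show ?case using "open" by simp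
      next
        case empty
        show ?case by simp
      next
        case (compl A)
        then have [measurable]: "A \<in> sets borel" by (simp add: borel_def)
        have split: "g x * indicator ((UNIV - A) \<inter> ?B) x = g x * indicator (UNIV \<inter> ?B) x - g x * indicator (A \<inter> ?B) x" for x
          by (auto simp: indicator_def)
        have "integrable lborel (\<lambda>x. g x * indicator (A \<inter> ?B) x)"
          by (rule Bochner_Integration.integrable_bound[OF int]) (auto simp: indicator_def)
        then show ?case unfolding split using int "open"[OF open_UNIV] compl.IH
          by (subst Bochner_Integration.integral_diff) simp_all
      next
        case (union A)
        then have [measurable]: "A i \<in> sets borel" for i by (auto simp: borel_def)
        have eq: "g x * indicator (S \<inter> ?B) x = indicator S x *\<^sub>R (g x * indicator ?B x)" for S x
          by (auto simp: indicator_def)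
        have set_int: "set_integrable lborel (\<Union>i. A i) (\<lambda>x. g x * indicator ?B x)"
          unfolding set_integrable_def
          by (rule Bochner_Integration.integrable_bound[OF int]) (auto simp: indicator_def)
        have "(LINT x|lborel. g x * indicator ((\<Union>i. A i) \<inter> ?B) x) = (LINT x:(\<Union>i. A i)|lborel. g x * indicator ?B x)"
          unfolding set_lebesgue_integral_def eq ..
        also have "\<dots> = (\<Sum>i. LINT x:A i|lborel. g x * indicator ?B x)"
          using union.hyps(1) by (intro lebesgue_integral_countable_add set_int) (auto simp: disjoint_family_on_def)
        also have "\<dots> = (\<Sum>i. 0)"
          using union.IH unfolding set_lebesgue_integral_def eq by simp
        finally show ?case by simp
      qed
    qed
    have sign: "AE x in lborel. x \<in> A \<longrightarrow> x \<in> ?B \<longrightarrow> g x = 0"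
      if [measurable]: "A \<in> sets borel" and sgn: "\<And>x. x \<in> A \<Longrightarrow> 0 \<le> s * g x" and s: "s \<noteq> 0" for A s
    proof -
      have i: "integrable lborel (\<lambda>x. s * (g x * indicator (A \<inter> ?B) x))"
        by (intro integrable_mult_right Bochner_Integration.integrable_bound[OF int]) (auto simp: indicator_def)
      have "(LINT x|lborel. s * (g x * indicator (A \<inter> ?B) x)) = 0" using borel[of A] by simp
      then have "AE x in lborel. s * (g x * indicator (A \<inter> ?B) x) = 0"
        by (subst (asm) integral_nonneg_eq_0_iff_AE[OF i]) (use sgn in \<open>auto simp: indicator_def\<close>)
      then show ?thesis by eventually_elim (use s in \<open>auto simp: indicator_def\<close>)
    qed
    have "AE x in lborel. x \<in> {x. 0 \<le> g x} \<longrightarrow> x \<in> ?B \<longrightarrow> g x = 0"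
      by (rule sign[where s = 1]) auto
    moreover have "AE x in lborel. x \<in> {x. g x \<le> 0} \<longrightarrow> x \<in> ?B \<longrightarrow> g x = 0"
      by (rule sign[where s = "-1"]) auto
    ultimately show ?thesis
    proof eventually_elim
      case (elim x)
      then show ?case using linear[of 0 "g x"] by blast
    qed
  qed
  then have "AE x in lborel. \<forall>n::nat. x \<in> ball 0 (real n) \<longrightarrow> g x = 0"
    unfolding AE_all_countable by blast
  then have "AE x in lborel. f x = 0"
  proof eventually_elim
    case (elim x)
    obtain n :: nat where "norm x < real n" using reals_Archimedean2 by blast
    then have "g x = 0" using elim by auto
    then show ?case using W_pos[of x] by (simp add: g_def)
  qed
  then show ?thesis by (simp add: AE_\<mu>_iff)
qed

sublocale l2_form \<mu> \<Phi> F "stable_ext_form \<alpha>"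
proof
  have meas: "f \<in> borel_measurable borel" if "f \<in> F" for f
    using that by (auto simp: F_def stable_ext_dom_def)
  show "f \<in> L2 \<mu>" if "f \<in> F" for f using that by (simp add: F_def)
  show zero: "(\<lambda>_. 0) \<in> F"
    by (intro stable_dom_subset_F) (simp add: stable_dom_iff L2_zero finite_energy_def energy_def stable_integrand_def split_beta)
  show comb: "(\<lambda>x. a * f x + b * g x) \<in> F" if "f \<in> F" "g \<in> F" for f g a b
    using that stable_ext_dom_lincomb L2_lincomb by (auto simp: F_def)
  show "g \<in> F" if "f \<in> F" "g \<in> L2 \<mu>" "AE x in \<mu>. f x = g x" for f g
    using that stable_ext_dom_cong[of f g] L2_\<mu>_measurable[of g] by (auto simp: F_def AE_\<mu>_iff)
  show "stable_ext_form \<alpha> f h = stable_ext_form \<alpha> g h"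
    if "f \<in> F" "g \<in> F" "h \<in> F" "AE x in \<mu>. f x = g x" for f g h
    using that meas stable_form_cong_AE[of f g h] by (simp add: ext_form_F AE_\<mu>_iff)
  show "stable_ext_form \<alpha> (\<lambda>x. a * f x + b * g x) h = a * stable_ext_form \<alpha> f h + b * stable_ext_form \<alpha> g h"
    if "f \<in> F" "g \<in> F" "h \<in> F" for f g h a b
    using that comb[OF that(1,2)] stable_form_lincomb[of f g h a b] by (simp add: ext_form_F F_finite_energy)
  show "stable_ext_form \<alpha> f g = stable_ext_form \<alpha> g f" if "f \<in> F" "g \<in> F" for f g
    using that by (simp add: ext_form_F stable_form_sym[of f g])
  show "0 \<le> stable_ext_form \<alpha> f f" if "f \<in> F" for f
    using that by (simp add: ext_form_F stable_form_nonneg)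
  show "AE x in \<mu>. f x = 0" if "f \<in> L2 \<mu>" "\<And>v. v \<in> F \<Longrightarrow> l2_inner \<mu> f v = 0" for f
    using that by (rule F_total)
  fix U u
  assume U: "\<And>n. U n \<in> F" and u: "u \<in> L2 \<mu>"
    and conv: "(\<lambda>n. l2_inner \<mu> (\<lambda>x. U n x - u x) (\<lambda>x. U n x - u x)) \<longlonglongrightarrow> 0"
    and cauchy: "\<And>e. e > 0 \<Longrightarrow> \<exists>N. \<forall>m\<ge>N. \<forall>n\<ge>N. stable_ext_form \<alpha> (\<lambda>x. U m x - U n x) (\<lambda>x. U m x - U n x) < e"
  have "\<exists>N. \<forall>m\<ge>N. \<forall>n\<ge>N. stable_form \<alpha> (\<lambda>x. U m x - U n x) (\<lambda>x. U m x - U n x) < e" if "e > 0" for e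
    using cauchy[OF that] by (simp add: ext_form_F F_diff_mem U)
  note lim = F_closed[OF U u conv this]
  have "stable_ext_form \<alpha> (\<lambda>x. U n x - u x) (\<lambda>x. U n x - u x) = stable_form \<alpha> (\<lambda>x. U n x - u x) (\<lambda>x. U n x - u x)" for n
    by (intro ext_form_F F_diff_mem U lim(1))
  then show "u \<in> F \<and> (\<lambda>n. stable_ext_form \<alpha> (\<lambda>x. U n x - u x) (\<lambda>x. U n x - u x)) \<longlonglongrightarrow> 0"
    using lim by simp
qed

lemma time_changed_operator_eq: "time_changed_operator \<alpha> W = form_generator \<mu> F (stable_ext_form \<alpha>)"
  by (simp add: time_changed_operator_def \<mu>_def F_def)

end

subsection \<open>Compactness of the embedding\<close>

text \<open>Total boundedness allows the approximating compact set to depend on e; here it will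
  consist of step functions on a finite grid with bounded coefficients.\<close>

lemma compact_closure_if_approximable:
  fixes S :: "'h::complete_space set"
  assumes approx: "\<And>e. e > 0 \<Longrightarrow> \<exists>C. compact C \<and> (\<forall>x\<in>S. \<exists>y\<in>C. dist x y \<le> e)"
  shows "compact (closure S)"
  unfolding compact_eq_totally_bounded
proof (intro conjI allI impI)
  show "complete (closure S)" by (simp add: complete_eq_closed)
  fix e :: real assume e: "e > 0"
  obtain C where C: "compact C" "\<And>x. x \<in> S \<Longrightarrow> \<exists>y\<in>C. dist x y \<le> e / 4" using approx[of "e / 4"] e by auto
  obtain k where k: "finite k" "C \<subseteq> (\<Union>x\<in>k. ball x (e / 4))"
    using C(1) e unfolding compact_eq_totally_bounded by (meson divide_pos_pos zero_less_numeral)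
  have "closure S \<subseteq> (\<Union>x\<in>k. cball x (e / 2))"
  proof (rule closure_minimal)
    show "closed (\<Union>x\<in>k. cball x (e / 2))" using k(1) by (intro closed_UN) auto
    show "S \<subseteq> (\<Union>x\<in>k. cball x (e / 2))"
    proof
      fix x assume "x \<in> S"
      then obtain y where y: "y \<in> C" "dist x y \<le> e / 4" using C(2) by blast
      then obtain z where z: "z \<in> k" "dist z y < e / 4" using k(2) by auto
      then have "dist z x \<le> e / 2" using y dist_triangle[of z x y] dist_commute[of x y] by linarith
      then show "x \<in> (\<Union>x\<in>k. cball x (e / 2))" using z by auto
    qed
  qed
  also have "\<dots> \<subseteq> (\<Union>x\<in>k. ball x e)" using e by auto
  finally show "\<exists>k. finite k \<and> closure S \<subseteq> (\<Union>x\<in>k. ball x e)" using k(1) by blast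
qed

lemma compact_bounded_combinations:
  fixes e :: "'q \<Rightarrow> 'h::real_normed_vector"
  assumes "finite G"
  shows "compact {\<Sum>q\<in>G. c q *\<^sub>R e q | c. \<forall>q\<in>G. \<bar>c q\<bar> \<le> (M::real)}"
  using assms
proof (induction G rule: finite_induct)
  case empty
  have "{\<Sum>q\<in>{}. c q *\<^sub>R e q | c. \<forall>q\<in>{}. \<bar>c q\<bar> \<le> M} = {0}" by auto
  then show ?case by (simp only: compact_sing)
next
  case (insert p G)
  let ?S = "{\<Sum>q\<in>G. c q *\<^sub>R e q | c. \<forall>q\<in>G. \<bar>c q\<bar> \<le> M}"
  have line: "compact ((\<lambda>t. t *\<^sub>R e p) ` {- M..M})"
    by (intro compact_continuous_image continuous_intros) simp
  have "{\<Sum>q\<in>insert p G. c q *\<^sub>R e q | c. \<forall>q\<in>insert p G. \<bar>c q\<bar> \<le> M}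
      = {x + y | x y. x \<in> (\<lambda>t. t *\<^sub>R e p) ` {- M..M} \<and> y \<in> ?S}" (is "?L = ?R")
  proof
    show "?L \<subseteq> ?R"
    proof
      fix z assume "z \<in> ?L"
      then obtain c where c: "z = (\<Sum>q\<in>insert p G. c q *\<^sub>R e q)" "\<forall>q\<in>insert p G. \<bar>c q\<bar> \<le> M" by auto
      then have "z = c p *\<^sub>R e p + (\<Sum>q\<in>G. c q *\<^sub>R e q)" using insert.hyps by simp
      moreover have "c p \<in> {- M..M}" using c(2) by (auto simp: abs_le_iff)
      ultimately show "z \<in> ?R" using c(2) by blast
    qed
    show "?R \<subseteq> ?L"
    proof
      fix z assume "z \<in> ?R"
      then obtain t c where tc: "z = t *\<^sub>R e p + (\<Sum>q\<in>G. c q *\<^sub>R e q)" "t \<in> {- M..M}" "\<forall>q\<in>G. \<bar>c q\<bar> \<le> M" by auto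
      have "(\<Sum>q\<in>G. (c(p := t)) q *\<^sub>R e q) = (\<Sum>q\<in>G. c q *\<^sub>R e q)"
        using insert.hyps by (intro sum.cong) auto
      then have "z = (\<Sum>q\<in>insert p G. (c(p := t)) q *\<^sub>R e q)" using tc insert.hyps by simp
      moreover have "\<forall>q\<in>insert p G. \<bar>(c(p := t)) q\<bar> \<le> M" using tc by (auto simp: abs_le_iff)
      ultimately show "z \<in> ?L" by blast
    qed
  qed
  then show ?case using compact_sums[OF line insert.IH] by (simp only:)
qed

section \<open>Lattice cubes and averages over them\<close>

definition grid_point :: "real \<Rightarrow> 'a::euclidean_space \<Rightarrow> 'a" where
  "grid_point \<delta> x = (\<Sum>b\<in>Basis. (\<delta> * of_int \<lfloor>(x \<bullet> b) / \<delta>\<rfloor>) *\<^sub>R b)"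

text \<open>A half-open cube with lower corner q. Corners produced by \<open>grid_point\<close>,
  which rounds every coordinate down to a multiple of \<open>\<delta>\<close>, give disjoint cubes
  covering the space.\<close>

definition cell :: "real \<Rightarrow> 'a::euclidean_space \<Rightarrow> 'a set" where
  "cell \<delta> q = {x. \<forall>b\<in>Basis. q \<bullet> b \<le> x \<bullet> b \<and> x \<bullet> b < q \<bullet> b + \<delta>}"

lemma cell_measurable [measurable]: "cell \<delta> q \<in> sets borel"
proof -
  have "{x. q \<bullet> b \<le> x \<bullet> b \<and> x \<bullet> b < q \<bullet> b + \<delta>} \<in> sets borel" for b by measurable
  moreover have "cell \<delta> q = (\<Inter>b\<in>Basis. {x. q \<bullet> b \<le> x \<bullet> b \<and> x \<bullet> b < q \<bullet> b + \<delta>})" by (auto simp: cell_def)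
  ultimately show ?thesis by (simp add: sets.countable_INT'' countable_finite sets.finite_INT)
qed

lemma mem_cell_grid_point: "\<delta> > 0 \<Longrightarrow> x \<in> cell \<delta> (grid_point \<delta> x)"
  unfolding cell_def grid_point_def
proof (safe)
  fix b :: 'a assume \<delta>: "\<delta> > 0" and b: "b \<in> Basis"
  have fl: "of_int \<lfloor>(x \<bullet> b) / \<delta>\<rfloor> \<le> (x \<bullet> b) / \<delta>" "(x \<bullet> b) / \<delta> < of_int \<lfloor>(x \<bullet> b) / \<delta>\<rfloor> + 1" by linarith+
  have "\<delta> * of_int \<lfloor>(x \<bullet> b) / \<delta>\<rfloor> \<le> x \<bullet> b" "x \<bullet> b < \<delta> * of_int \<lfloor>(x \<bullet> b) / \<delta>\<rfloor> + \<delta>"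
    using mult_left_mono[OF fl(1), of \<delta>] mult_strict_left_mono[OF fl(2) \<delta>] \<delta>
    by (simp_all add: distrib_left)
  then show "(\<Sum>b\<in>Basis. (\<delta> * of_int \<lfloor>(x \<bullet> b) / \<delta>\<rfloor>) *\<^sub>R b) \<bullet> b \<le> x \<bullet> b"
    "x \<bullet> b < (\<Sum>b\<in>Basis. (\<delta> * of_int \<lfloor>(x \<bullet> b) / \<delta>\<rfloor>) *\<^sub>R b) \<bullet> b + \<delta>"
    using b by simp_all
qed

lemma cell_eq_grid_point:
  assumes \<delta>: "\<delta> > 0" and x: "x \<in> cell \<delta> (grid_point \<delta> y)"
  shows "grid_point \<delta> x = grid_point \<delta> y"
proof -
  have "\<lfloor>(x \<bullet> b) / \<delta>\<rfloor> = \<lfloor>(y \<bullet> b) / \<delta>\<rfloor>" if b: "b \<in> Basis" for b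
  proof (rule floor_unique)
    have "grid_point \<delta> y \<bullet> b = \<delta> * of_int \<lfloor>(y \<bullet> b) / \<delta>\<rfloor>" using b by (simp add: grid_point_def)
    then have "\<delta> * of_int \<lfloor>(y \<bullet> b) / \<delta>\<rfloor> \<le> x \<bullet> b" "x \<bullet> b < \<delta> * of_int \<lfloor>(y \<bullet> b) / \<delta>\<rfloor> + \<delta>"
      using x b by (auto simp: cell_def)
    then show "of_int \<lfloor>(y \<bullet> b) / \<delta>\<rfloor> \<le> (x \<bullet> b) / \<delta>" "(x \<bullet> b) / \<delta> < of_int \<lfloor>(y \<bullet> b) / \<delta>\<rfloor> + 1"
      using \<delta> by (simp_all add: field_simps)
  qed
  then show ?thesis by (simp add: grid_point_def)
qed

lemma cells_disjoint:
  assumes \<delta>: "\<delta> > 0" and "p \<in> range (grid_point \<delta>)" "q \<in> range (grid_point \<delta>)" "p \<noteq> q"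
  shows "cell \<delta> p \<inter> cell \<delta> q = {}"
proof (rule ccontr)
  assume "\<not> ?thesis"
  then obtain x where "x \<in> cell \<delta> p" "x \<in> cell \<delta> q" by blast
  moreover obtain y z where "p = grid_point \<delta> y" "q = grid_point \<delta> z" using assms(2,3) by blast
  ultimately show False using cell_eq_grid_point[OF \<delta>, of x] \<open>p \<noteq> q\<close> by metis
qed

lemma finite_grid_points:
  assumes \<delta>: "\<delta> > 0"
  shows "finite (grid_point \<delta> ` cball (0::'a::euclidean_space) R)"
proof -
  define N where "N = \<lceil>R / \<delta>\<rceil> + 1"
  have "grid_point \<delta> ` cball 0 R \<subseteq> (\<lambda>h. \<Sum>b\<in>Basis. (\<delta> * of_int (h b)) *\<^sub>R b) ` (PiE (Basis :: 'a set) (\<lambda>_. {- N..N}))"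
  proof
    fix q assume "q \<in> grid_point \<delta> ` cball (0::'a) R"
    then obtain x :: 'a where x: "norm x \<le> R" "q = grid_point \<delta> x" by auto
    define h where "h = restrict (\<lambda>b. \<lfloor>(x \<bullet> b) / \<delta>\<rfloor>) Basis"
    have "h b \<in> {- N..N}" if b: "b \<in> Basis" for b
    proof -
      have "\<bar>x \<bullet> b\<bar> \<le> R" using Basis_le_norm[OF b, of x] x by linarith
      then have "- (R / \<delta>) \<le> (x \<bullet> b) / \<delta>" "(x \<bullet> b) / \<delta> \<le> R / \<delta>"
        using \<delta> by (simp_all add: abs_le_iff field_simps)
      then have "- N \<le> \<lfloor>(x \<bullet> b) / \<delta>\<rfloor>" "\<lfloor>(x \<bullet> b) / \<delta>\<rfloor> \<le> N" unfolding N_def by linarith+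
      then show ?thesis using b by (simp add: h_def)
    qed
    then have "h \<in> PiE Basis (\<lambda>_. {- N..N})" by (auto simp: h_def)
    moreover have "q = (\<Sum>b\<in>Basis. (\<delta> * of_int (h b)) *\<^sub>R b)" by (simp add: x grid_point_def h_def)
    ultimately show "q \<in> (\<lambda>h. \<Sum>b\<in>Basis. (\<delta> * of_int (h b)) *\<^sub>R b) ` (PiE (Basis :: 'a set) (\<lambda>_. {- N..N}))" by blast
  qed
  then show ?thesis by (rule finite_subset) (intro finite_imageI finite_PiE, auto)
qed

lemma cell_bounds:
  fixes q :: "'a::euclidean_space"
  assumes \<delta>: "\<delta> > 0"
  shows "bounded (cell \<delta> q)" "ennreal (\<delta> ^ DIM('a)) \<le> emeasure lborel (cell \<delta> q)"
    and "\<And>x y. x \<in> cell \<delta> q \<Longrightarrow> y \<in> cell \<delta> q \<Longrightarrow> norm (x - y) \<le> real DIM('a) * \<delta>"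
proof -
  let ?u = "q + \<delta> *\<^sub>R One"
  have u: "?u \<bullet> b = q \<bullet> b + \<delta>" if "b \<in> Basis" for b using that by (simp add: inner_add_left)
  have "cell \<delta> q \<subseteq> cbox q ?u" by (auto simp: cell_def mem_box u less_imp_le)
  then show "bounded (cell \<delta> q)" by (rule bounded_subset[OF bounded_cbox])
  have "emeasure lborel (box q ?u) = ennreal (\<Prod>b\<in>Basis. (?u - q) \<bullet> b)"
    using \<delta> by (subst emeasure_lborel_box) (auto simp: u)
  also have "(\<Prod>b\<in>(Basis :: 'a set). (?u - q) \<bullet> b) = (\<Prod>b\<in>(Basis :: 'a set). \<delta>)" by (intro prod.cong) simp_all
  finally have "ennreal (\<delta> ^ DIM('a)) = emeasure lborel (box q ?u)" by simp
  also have "\<dots> \<le> emeasure lborel (cell \<delta> q)"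
    by (rule emeasure_mono) (auto simp: cell_def mem_box u less_imp_le)
  finally show "ennreal (\<delta> ^ DIM('a)) \<le> emeasure lborel (cell \<delta> q)" .
  fix x y assume xy: "x \<in> cell \<delta> q" "y \<in> cell \<delta> q"
  have "norm (x - y) \<le> (\<Sum>b\<in>Basis. \<bar>(x - y) \<bullet> b\<bar>)" by (rule norm_le_l1)
  also have "\<dots> \<le> (\<Sum>b\<in>(Basis :: 'a set). \<delta>)"
  proof (rule sum_mono)
    fix b :: 'a assume "b \<in> Basis"
    then have "q \<bullet> b \<le> x \<bullet> b" "x \<bullet> b < q \<bullet> b + \<delta>" "q \<bullet> b \<le> y \<bullet> b" "y \<bullet> b < q \<bullet> b + \<delta>"
      using xy by (auto simp: cell_def)
    then show "\<bar>(x - y) \<bullet> b\<bar> \<le> \<delta>" by (simp add: inner_diff_left abs_le_iff)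
  qed
  finally show "norm (x - y) \<le> real DIM('a) * \<delta>" by simp
qed

text \<open>A Poincare inequality without derivatives: v x - a is the average over y in
  \<open>Q\<close> of v x - v y, and Cauchy-Schwarz in y bounds its square by the average of the
  squares.\<close>

lemma average_deviation_le:
  fixes v :: "'a::euclidean_space \<Rightarrow> real"
  assumes [measurable]: "v \<in> borel_measurable borel" "Q \<in> sets borel"
    and vol: "emeasure lborel Q = ennreal m" "m > 0"
    and v2: "(\<integral>\<^sup>+x. ennreal ((v x)\<^sup>2) * indicator Q x \<partial>lborel) < \<infinity>"
  defines "a \<equiv> (LINT x|lborel. v x * indicator Q x) / m"
  shows "(\<integral>\<^sup>+x. ennreal ((v x - a)\<^sup>2) * indicator Q x \<partial>lborel)
      \<le> ennreal (1 / m) * (\<integral>\<^sup>+x. \<integral>\<^sup>+y. ennreal ((v x - v y)\<^sup>2) * indicator (Q \<times> Q) (x, y) \<partial>lborel \<partial>lborel)"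
    and "a\<^sup>2 * m \<le> enn2real (\<integral>\<^sup>+x. ennreal ((v x)\<^sup>2) * indicator Q x \<partial>lborel)"
proof -
  have Q1: "integrable lborel (indicator Q :: 'a \<Rightarrow> real)" using vol by simp
  have mQ: "measure lborel Q = m" using vol by (simp add: measure_def)
  have eq2: "ennreal ((v x)\<^sup>2) * indicator Q x = ennreal ((v x)\<^sup>2 * indicator Q x)" for x
    by (auto simp: indicator_def)
  have V2: "integrable lborel (\<lambda>x. (v x)\<^sup>2 * indicator Q x)"
    using v2 unfolding eq2 by (simp add: integrable_iff_bounded abs_mult)
  have V1: "integrable lborel (\<lambda>x. v x * indicator Q x)"
  proof (rule Bochner_Integration.integrable_bound)
    show "integrable lborel (\<lambda>x. (v x)\<^sup>2 * indicator Q x + indicator Q x)" using V2 Q1 by (rule Bochner_Integration.integrable_add)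
    have "\<bar>v x\<bar> \<le> (v x)\<^sup>2 + 1" for x using sum_squares_bound[of "\<bar>v x\<bar>" 1] by simp
    then show "AE x in lborel. norm (v x * indicator Q x) \<le> norm ((v x)\<^sup>2 * indicator Q x + indicator Q x)"
      by (auto simp: indicator_def)
  qed measurable
  \<comment> \<open>The number s stands for a value v x; s = 0 gives the bound on the average
    itself.\<close>
  have cs: "(LINT y|lborel. (s - v y) * indicator Q y)\<^sup>2 \<le> (LINT y|lborel. (s - v y)\<^sup>2 * indicator Q y) * m"
    and ints: "integrable lborel (\<lambda>y. (s - v y)\<^sup>2 * indicator Q y)"
    and ints1: "(LINT y|lborel. (s - v y) * indicator Q y) = m * (s - a)" for s
  proof -
    have i1: "integrable lborel (\<lambda>y. s * indicator Q y - v y * indicator Q y)"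
      by (intro Bochner_Integration.integrable_diff integrable_mult_right Q1 V1)
    then have I1: "integrable lborel (\<lambda>y. (s - v y) * indicator Q y)" by (simp add: left_diff_distrib)
    have "integrable lborel (\<lambda>y. s\<^sup>2 * indicator Q y - 2 * s * (v y * indicator Q y) + (v y)\<^sup>2 * indicator Q y)"
      by (intro Bochner_Integration.integrable_add Bochner_Integration.integrable_diff integrable_mult_right Q1 V1 V2)
    then show I2: "integrable lborel (\<lambda>y. (s - v y)\<^sup>2 * indicator Q y)"
      by (simp add: power2_eq_square algebra_simps)
    show "(LINT y|lborel. (s - v y) * indicator Q y)\<^sup>2 \<le> (LINT y|lborel. (s - v y)\<^sup>2 * indicator Q y) * m"
    proof (rule discriminant_cauchy_schwarz)
      fix t
      have eq: "((s - v y) + t)\<^sup>2 * indicator Q y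
          = (s - v y)\<^sup>2 * indicator Q y + (2 * t) * ((s - v y) * indicator Q y) + t\<^sup>2 * indicator Q y" for y
        by (simp add: power2_eq_square algebra_simps)
      have "0 \<le> (LINT y|lborel. ((s - v y) + t)\<^sup>2 * indicator Q y)" by simp
      also have "\<dots> = (LINT y|lborel. (s - v y)\<^sup>2 * indicator Q y) + 2 * t * (LINT y|lborel. (s - v y) * indicator Q y) + t\<^sup>2 * m"
        unfolding eq using I1 I2 Q1 by (simp add: mQ)
      finally show "0 \<le> (LINT y|lborel. (s - v y)\<^sup>2 * indicator Q y) + 2 * t * (LINT y|lborel. (s - v y) * indicator Q y) + t\<^sup>2 * m" .
    qed (use vol in simp)
    have "(LINT y|lborel. (s - v y) * indicator Q y) = (LINT y|lborel. s * indicator Q y - v y * indicator Q y)"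
      by (simp add: left_diff_distrib)
    also have "\<dots> = s * m - a * m" using Q1 V1 vol(2) by (simp add: mQ a_def)
    finally show "(LINT y|lborel. (s - v y) * indicator Q y) = m * (s - a)" by (simp add: algebra_simps)
  qed
  have pt: "ennreal ((s - a)\<^sup>2) \<le> ennreal (1 / m) * (\<integral>\<^sup>+y. ennreal ((s - v y)\<^sup>2) * indicator Q y \<partial>lborel)" for s
  proof -
    have "(m * (s - a))\<^sup>2 \<le> (LINT y|lborel. (s - v y)\<^sup>2 * indicator Q y) * m" using cs[of s] by (simp only: ints1)
    then have "m * (m * (s - a)\<^sup>2) \<le> m * (LINT y|lborel. (s - v y)\<^sup>2 * indicator Q y)"
      by (simp add: power2_eq_square ac_simps)
    then have "m * (s - a)\<^sup>2 \<le> (LINT y|lborel. (s - v y)\<^sup>2 * indicator Q y)" using vol(2) by simp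
    then have "(s - a)\<^sup>2 \<le> (1 / m) * (LINT y|lborel. (s - v y)\<^sup>2 * indicator Q y)"
      using vol(2) by (simp add: field_simps)
    then have "ennreal ((s - a)\<^sup>2) \<le> ennreal ((1 / m) * (LINT y|lborel. (s - v y)\<^sup>2 * indicator Q y))"
      by (rule ennreal_leI)
    also have "\<dots> = ennreal (1 / m) * ennreal (LINT y|lborel. (s - v y)\<^sup>2 * indicator Q y)"
      using vol(2) by (intro ennreal_mult) auto
    also have "ennreal (LINT y|lborel. (s - v y)\<^sup>2 * indicator Q y) = (\<integral>\<^sup>+y. ennreal ((s - v y)\<^sup>2 * indicator Q y) \<partial>lborel)"
      by (rule nn_integral_eq_integral[OF ints, symmetric]) simp
    also have "\<dots> = (\<integral>\<^sup>+y. ennreal ((s - v y)\<^sup>2) * indicator Q y \<partial>lborel)"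
      by (intro nn_integral_cong) (auto simp: indicator_def)
    finally show ?thesis .
  qed
  have "(\<integral>\<^sup>+x. ennreal ((v x - a)\<^sup>2) * indicator Q x \<partial>lborel)
      \<le> (\<integral>\<^sup>+x. ennreal (1 / m) * (\<integral>\<^sup>+y. ennreal ((v x - v y)\<^sup>2) * indicator (Q \<times> Q) (x, y) \<partial>lborel) \<partial>lborel)"
  proof (rule nn_integral_mono)
    fix x
    show "ennreal ((v x - a)\<^sup>2) * indicator Q x
      \<le> ennreal (1 / m) * (\<integral>\<^sup>+y. ennreal ((v x - v y)\<^sup>2) * indicator (Q \<times> Q) (x, y) \<partial>lborel)"
    proof (cases "x \<in> Q")
      case True
      then have "indicator (Q \<times> Q) (x, y) = (indicator Q y :: ennreal)" for y by (simp add: indicator_def)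
      then show ?thesis using True pt[of "v x"] by simp
    qed simp
  qed
  also have "\<dots> = ennreal (1 / m) * (\<integral>\<^sup>+x. \<integral>\<^sup>+y. ennreal ((v x - v y)\<^sup>2) * indicator (Q \<times> Q) (x, y) \<partial>lborel \<partial>lborel)"
    by (rule nn_integral_cmult) measurable
  finally show "(\<integral>\<^sup>+x. ennreal ((v x - a)\<^sup>2) * indicator Q x \<partial>lborel)
      \<le> ennreal (1 / m) * (\<integral>\<^sup>+x. \<integral>\<^sup>+y. ennreal ((v x - v y)\<^sup>2) * indicator (Q \<times> Q) (x, y) \<partial>lborel \<partial>lborel)" .
  have "(m * (0 - a))\<^sup>2 \<le> (LINT y|lborel. (0 - v y)\<^sup>2 * indicator Q y) * m" using cs[of 0] by (simp only: ints1)
  then have "m * (a\<^sup>2 * m) \<le> m * (LINT y|lborel. (v y)\<^sup>2 * indicator Q y)" by (simp add: power2_eq_square ac_simps)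
  then have "a\<^sup>2 * m \<le> (LINT y|lborel. (v y)\<^sup>2 * indicator Q y)" using vol(2) by simp
  also have "\<dots> = enn2real (\<integral>\<^sup>+x. ennreal ((v x)\<^sup>2) * indicator Q x \<partial>lborel)"
    unfolding eq2 by (simp add: integral_eq_nn_integral)
  finally show "a\<^sup>2 * m \<le> enn2real (\<integral>\<^sup>+x. ennreal ((v x)\<^sup>2) * indicator Q x \<partial>lborel)" .
qed

context stable_exponent
begin

text \<open>Within a set of diameter at most l the kernel is at least
  \<open>c\<^sub>\<alpha>\<close> / l^(d + \<alpha>), and the products of disjoint sets with
  themselves are disjoint, so the local double integrals add up to at most a multiple of the
  energy.\<close>

lemma local_energy_bound:
  fixes v :: "'a \<Rightarrow> real"
  assumes [measurable]: "v \<in> borel_measurable borel" and G: "finite G"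
    and Q[measurable]: "\<And>q. q \<in> G \<Longrightarrow> Q q \<in> sets borel"
    and disj: "\<And>p q. p \<in> G \<Longrightarrow> q \<in> G \<Longrightarrow> p \<noteq> q \<Longrightarrow> Q p \<inter> Q q = {}"
    and diam: "\<And>q x y. q \<in> G \<Longrightarrow> x \<in> Q q \<Longrightarrow> y \<in> Q q \<Longrightarrow> norm (x - y) \<le> l"
  shows "(\<Sum>q\<in>G. \<integral>\<^sup>+x. \<integral>\<^sup>+y. ennreal ((v x - v y)\<^sup>2) * indicator (Q q \<times> Q q) (x, y) \<partial>lborel \<partial>lborel)
    \<le> ennreal (l powr (real DIM('a) + \<alpha>) / c\<^sub>\<alpha>) * energy \<alpha> v"
proof -
  define p where "p = real DIM('a) + \<alpha>"
  have p: "p > 0" using \<alpha>_pos by (simp add: p_def add_nonneg_pos)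
  let ?I = "\<lambda>q z. indicator (Q q \<times> Q q) z :: ennreal"
  have dj: "disjoint_family_on (\<lambda>q. Q q \<times> Q q) G"
    unfolding disjoint_family_on_def using disj by fastforce
  have meas[measurable]: "Q q \<times> Q q \<in> sets (lborel \<Otimes>\<^sub>M lborel)" if "q \<in> G" for q using Q[OF that] by simp
  have "(\<Sum>q\<in>G. \<integral>\<^sup>+x. \<integral>\<^sup>+y. ennreal ((v x - v y)\<^sup>2) * ?I q (x, y) \<partial>lborel \<partial>lborel)
      = (\<Sum>q\<in>G. \<integral>\<^sup>+z. ennreal ((v (fst z) - v (snd z))\<^sup>2) * ?I q z \<partial>(lborel \<Otimes>\<^sub>M lborel))"
  proof (intro sum.cong refl)
    fix q assume "q \<in> G"
    then have [measurable]: "Q q \<times> Q q \<in> sets (lborel \<Otimes>\<^sub>M lborel)" by (rule meas)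
    show "(\<integral>\<^sup>+x. \<integral>\<^sup>+y. ennreal ((v x - v y)\<^sup>2) * ?I q (x, y) \<partial>lborel \<partial>lborel)
      = (\<integral>\<^sup>+z. ennreal ((v (fst z) - v (snd z))\<^sup>2) * ?I q z \<partial>(lborel \<Otimes>\<^sub>M lborel))"
      by (subst lborel.nn_integral_fst[symmetric]) simp_all
  qed
  also have "\<dots> = (\<integral>\<^sup>+z. (\<Sum>q\<in>G. ennreal ((v (fst z) - v (snd z))\<^sup>2) * ?I q z) \<partial>(lborel \<Otimes>\<^sub>M lborel))"
    by (intro nn_integral_sum[symmetric]) (use meas in measurable)
  also have "\<dots> \<le> (\<integral>\<^sup>+z. ennreal (l powr p / c\<^sub>\<alpha>) * ennreal (stable_integrand \<alpha> v v z) \<partial>(lborel \<Otimes>\<^sub>M lborel))"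
  proof (rule nn_integral_mono)
    fix z :: "'a \<times> 'a"
    obtain x y where z: "z = (x, y)" by (cases z)
    have "(\<Sum>q\<in>G. ennreal ((v (fst z) - v (snd z))\<^sup>2) * ?I q z)
        = ennreal ((v (fst z) - v (snd z))\<^sup>2) * indicator (\<Union>q\<in>G. Q q \<times> Q q) z"
      by (subst indicator_UN_disjoint[OF G dj]) (simp add: sum_distrib_left)
    also have "\<dots> \<le> ennreal (l powr p / c\<^sub>\<alpha>) * ennreal (stable_integrand \<alpha> v v z)"
    \<comment> \<open>On the diagonal the kernel has the default value 0 of a division by 0, so it
      gives no lower bound; but there the increment vanishes too.\<close>
    proof (cases "z \<in> (\<Union>q\<in>G. Q q \<times> Q q) \<and> x \<noteq> y")
      case True
      then have xy: "norm (x - y) \<le> l" "norm (x - y) > 0" using diam by (auto simp: z)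
      have "(v x - v y)\<^sup>2 = (norm (x - y) powr p / c\<^sub>\<alpha>) * stable_integrand \<alpha> v v z"
        using xy c_pos by (simp add: z stable_integrand_eq p_def power2_eq_square)
      also have "\<dots> \<le> (l powr p / c\<^sub>\<alpha>) * stable_integrand \<alpha> v v z"
        using xy p c_pos by (intro mult_right_mono divide_right_mono powr_mono2 stable_integrand_nonneg) auto
      finally have "ennreal ((v x - v y)\<^sup>2) \<le> ennreal (l powr p / c\<^sub>\<alpha>) * ennreal (stable_integrand \<alpha> v v z)"
        using c_pos by (subst ennreal_mult[symmetric]) (auto simp: stable_integrand_nonneg intro: ennreal_leI)
      then show ?thesis using True by (simp add: z)
    next
      case False
      then have "z \<notin> (\<Union>q\<in>G. Q q \<times> Q q) \<or> x = y" by blast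
      then show ?thesis by (auto simp: z)
    qed
    finally show "(\<Sum>q\<in>G. ennreal ((v (fst z) - v (snd z))\<^sup>2) * ?I q z)
      \<le> ennreal (l powr p / c\<^sub>\<alpha>) * ennreal (stable_integrand \<alpha> v v z)" .
  qed
  also have "\<dots> = ennreal (l powr p / c\<^sub>\<alpha>) * energy \<alpha> v"
    unfolding energy_def by (rule nn_integral_cmult) measurable
  finally show ?thesis by (simp only: p_def)
qed

end

context weighted_stable
begin

lemma
  assumes "finite G" "\<And>q. q \<in> G \<Longrightarrow> f q \<in> L2 \<mu>"
  shows L2_\<mu>_sum: "(\<lambda>x. \<Sum>q\<in>G. c q * f q x) \<in> L2 \<mu>"
    and \<Phi>_sum: "\<Phi> (\<lambda>x. \<Sum>q\<in>G. c q * f q x) = (\<Sum>q\<in>G. c q *\<^sub>R \<Phi> (f q))"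
proof -
  have "(\<lambda>x. \<Sum>q\<in>G. c q * f q x) \<in> L2 \<mu> \<and> \<Phi> (\<lambda>x. \<Sum>q\<in>G. c q * f q x) = (\<Sum>q\<in>G. c q *\<^sub>R \<Phi> (f q))"
    using assms
  proof (induction G rule: finite_induct)
    case empty
    then show ?case by (simp add: L2_zero \<Phi>_zero)
  next
    case (insert p G)
    then have IH: "(\<lambda>x. \<Sum>q\<in>G. c q * f q x) \<in> L2 \<mu>" "\<Phi> (\<lambda>x. \<Sum>q\<in>G. c q * f q x) = (\<Sum>q\<in>G. c q *\<^sub>R \<Phi> (f q))"
      and p: "f p \<in> L2 \<mu>" by auto
    have "(\<lambda>x. \<Sum>q\<in>insert p G. c q * f q x) = (\<lambda>x. c p * f p x + 1 * (\<Sum>q\<in>G. c q * f q x))"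
      using insert.hyps by simp
    then show ?case
      using L2_lincomb[OF p IH(1), of "c p" 1] \<Phi>_lincomb[OF p IH(1), of "c p" 1] IH(2) insert.hyps
      by simp
  qed
  then show "(\<lambda>x. \<Sum>q\<in>G. c q * f q x) \<in> L2 \<mu>"
    "\<Phi> (\<lambda>x. \<Sum>q\<in>G. c q * f q x) = (\<Sum>q\<in>G. c q *\<^sub>R \<Phi> (f q))" by auto
qed

lemma l2_inner_\<mu>_nn:
  assumes f: "f \<in> L2 \<mu>"
  shows "ennreal (l2_inner \<mu> f f) = (\<integral>\<^sup>+x. ennreal (1 / W x) * ennreal ((f x)\<^sup>2) \<partial>lborel)"
proof -
  have [measurable]: "f \<in> borel_measurable borel" by (rule L2_\<mu>_measurable[OF f])
  show ?thesis by (subst l2_inner_self_nn[OF f]) (simp add: nn_integral_\<mu>)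
qed

lemma Psi1_tail:
  assumes lim: "(Psi1 \<alpha> W \<longlongrightarrow> 0) at_top" and \<eta>: "\<eta> > 0"
  shows "\<exists>R\<ge>1. \<forall>x. R \<le> norm x \<longrightarrow> 1 / W x \<le> \<eta> * norm x powr - \<alpha>"
proof -
  have "\<forall>\<^sub>F r in at_top. Psi1 \<alpha> W r < ennreal \<eta>"
    using \<eta> by (intro order_tendstoD(2)[OF lim]) simp
  then have "\<forall>\<^sub>F r in at_top. Psi1 \<alpha> W r < ennreal \<eta> \<and> 1 \<le> r"
    using eventually_ge_at_top[of 1] by eventually_elim simp
  then obtain R where R: "Psi1 \<alpha> W R < ennreal \<eta>" "1 \<le> R"
    using eventually_happens trivial_limit_at_top_linorder by blast
  have "1 / W x \<le> \<eta> * norm x powr - \<alpha>" if x: "R \<le> norm x" for x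
  proof -
    have "ennreal (norm x powr \<alpha> / W x) \<le> Psi1 \<alpha> W R"
      unfolding Psi1_def using x by (intro SUP_upper) simp
    also have "\<dots> < ennreal \<eta>" by (rule R(1))
    finally have "norm x powr \<alpha> / W x < \<eta>" using W_pos[of x] by (subst (asm) ennreal_less_iff) (auto simp: less_imp_le)
    moreover have "norm x powr \<alpha> > 0" using x R(2) by auto
    ultimately show ?thesis using W_pos[of x] by (simp add: powr_minus field_simps)
  qed
  then show ?thesis using R(2) by blast
qed

lemma indicator_L2_\<mu>:
  assumes "A \<in> sets borel" "emeasure lborel A < \<infinity>"
  shows "(indicator A :: 'a \<Rightarrow> real) \<in> L2 \<mu>"
proof (rule L2_lborel_subset_\<mu>)
  have [measurable]: "A \<in> sets borel" by fact
  have "(\<integral>\<^sup>+x. ennreal ((indicator A x)\<^sup>2) \<partial>lborel) = (\<integral>\<^sup>+x. indicator A x \<partial>lborel)"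
    by (intro nn_integral_cong) (simp add: indicator_def)
  then show "(indicator A :: 'a \<Rightarrow> real) \<in> L2 lborel" using assms by (subst L2_iff_nn_integral) auto
qed

theorem compact_embedding:
  assumes lim: "(Psi1 \<alpha> W \<longlongrightarrow> 0) at_top"
  shows "compact (closure (\<Phi> ` {f \<in> F. l2_inner \<mu> f f + stable_ext_form \<alpha> f f \<le> C}))"
proof (rule compact_closure_if_approximable)
  fix e :: real assume e: "e > 0"
  \<comment> \<open>\<open>C\<close> may be negative; the bounds below want a nonnegative
    number.\<close>
  define D where "D = max C 0"
  have D: "D \<ge> 0" by (simp add: D_def)
  obtain K where K: "K > 0" and hd: "\<And>u. u \<in> stable_ext_dom \<alpha> \<Longrightarrow>
      (\<integral>\<^sup>+x. ennreal ((u x)\<^sup>2 * norm (x :: 'a) powr - \<alpha>) \<partial>lborel) \<le> ennreal (K * stable_form \<alpha> u u)"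
    using hardy by blast
  \<comment> \<open>Half of the error budget e^2 goes to the tails, where the Hardy integral is at
    most K D; the 1 avoids dividing by 0.\<close>
  define \<eta> where "\<eta> = e\<^sup>2 / 2 / (K * D + 1)"
  have KD: "K * D + 1 > 0" using K D by (simp add: add_nonneg_pos)
  have \<eta>: "\<eta> > 0" using e KD by (simp add: \<eta>_def)
  have \<eta>K: "\<eta> * (K * D) \<le> e\<^sup>2 / 2"
  proof -
    have "\<eta> * (K * D) \<le> \<eta> * (K * D + 1)" using \<eta> by simp
    also have "\<dots> = e\<^sup>2 / 2"
      unfolding \<eta>_def by (rule nonzero_eq_divide_eq[THEN iffD1, OF _ refl, symmetric, symmetric]) (use KD in simp)
    finally show ?thesis .
  qed
  obtain R where R: "R \<ge> 1" and tail: "\<And>x. R \<le> norm x \<Longrightarrow> 1 / W x \<le> \<eta> * norm x powr - \<alpha>"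
    using Psi1_tail[OF lim \<eta>] by blast
  define d where "d = real DIM('a)"
  have d: "d > 0" by (simp add: d_def)
  define B where "B = d powr (d + \<alpha>) / c\<^sub>\<alpha> * (2 * D) + 1"
  have B0: "d powr (d + \<alpha>) / c\<^sub>\<alpha> * (2 * D) \<ge> 0" using D c_pos by simp
  then have B: "B > 0" by (simp add: B_def)
  \<comment> \<open>Solves B \<open>\<delta>\<close>^\<alpha> = e^2 / 2. The deviation from averages
    over cells of side \<open>\<delta>\<close> costs \<open>\<delta>\<close>^-d (d
    \<open>\<delta>\<close>)^(d + \<alpha>) 2 D / \<open>c\<^sub>\<alpha>\<close>, which scales like
    \<open>\<delta>\<close>^\<alpha>.\<close>
  define \<delta> where "\<delta> = (e\<^sup>2 / 2 / B) powr (1 / \<alpha>)"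
  have \<delta>: "\<delta> > 0" using e B by (simp add: \<delta>_def)
  have \<delta>\<alpha>: "\<delta> powr \<alpha> = e\<^sup>2 / 2 / B" using e B \<alpha>_pos by (simp add: \<delta>_def powr_powr)
  have \<delta>small: "1 / \<delta> ^ DIM('a) * ((d * \<delta>) powr (d + \<alpha>) / c\<^sub>\<alpha>) * (2 * D) \<le> e\<^sup>2 / 2"
  proof -
    have "(d * \<delta>) powr (d + \<alpha>) = d powr (d + \<alpha>) * (\<delta> ^ DIM('a) * \<delta> powr \<alpha>)"
    proof -
      have "(d * \<delta>) powr (d + \<alpha>) = d powr (d + \<alpha>) * \<delta> powr (d + \<alpha>)" using d \<delta> by (simp add: powr_mult)
      also have "\<delta> powr (d + \<alpha>) = \<delta> ^ DIM('a) * \<delta> powr \<alpha>" using \<delta> by (simp add: powr_add d_def powr_realpow)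
      finally show ?thesis .
    qed
    then have "1 / \<delta> ^ DIM('a) * ((d * \<delta>) powr (d + \<alpha>) / c\<^sub>\<alpha>) * (2 * D)
        = (d powr (d + \<alpha>) / c\<^sub>\<alpha> * (2 * D)) * \<delta> powr \<alpha>" using \<delta> by simp
    also have "\<dots> \<le> B * \<delta> powr \<alpha>" by (intro mult_right_mono) (simp_all add: B_def)
    also have "\<dots> = e\<^sup>2 / 2" using B by (simp add: \<delta>\<alpha>)
    finally show ?thesis .
  qed
  define G where "G = grid_point \<delta> ` cball (0 :: 'a) R"
  have G: "finite G" unfolding G_def by (rule finite_grid_points[OF \<delta>])
  define Q where "Q = (cell \<delta> :: 'a \<Rightarrow> 'a set)"
  have Qm[measurable]: "Q q \<in> sets borel" for q by (simp add: Q_def)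
  have disj: "Q p \<inter> Q q = {}" if "p \<in> G" "q \<in> G" "p \<noteq> q" for p q
    unfolding Q_def using that by (intro cells_disjoint[OF \<delta>]) (auto simp: G_def)
  have diam: "norm (x - y) \<le> d * \<delta>" if "x \<in> Q q" "y \<in> Q q" for q x y
    using cell_bounds(3)[OF \<delta>] that by (simp add: Q_def d_def)
  have cover: "\<exists>q\<in>G. x \<in> Q q" if "norm x \<le> R" for x
    using mem_cell_grid_point[OF \<delta>, of x] that by (auto simp: G_def Q_def)
  define m where "m q = measure lborel (Q q)" for q
  have Qfin: "emeasure lborel (Q q) < \<infinity>" for q
    unfolding Q_def by (rule emeasure_bounded_finite[OF cell_bounds(1)[OF \<delta>]])
  have mQ: "emeasure lborel (Q q) = ennreal (m q)" for q
    unfolding m_def using Qfin[of q] by (intro emeasure_eq_ennreal_measure) simp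
  have m_ge: "\<delta> ^ DIM('a) \<le> m q" for q
    using cell_bounds(2)[OF \<delta>, of q] unfolding Q_def[symmetric] mQ
    by (subst (asm) ennreal_le_iff) (simp_all add: m_def)
  have \<delta>d: "\<delta> ^ DIM('a) > 0" using \<delta> by simp
  have m_pos: "m q > 0" for q using m_ge[of q] \<delta>d by linarith
  define S where "S = R + d * \<delta>"
  have QS: "norm x \<le> S" if q: "q \<in> G" and x: "x \<in> Q q" for q x
  proof -
    obtain y where y: "norm y \<le> R" "q = grid_point \<delta> y" using q by (auto simp: G_def)
    then have "y \<in> Q q" using mem_cell_grid_point[OF \<delta>, of y] by (simp add: Q_def)
    then have "norm (x - y) \<le> d * \<delta>" using diam x by blast
    then show ?thesis using y norm_triangle_ineq2[of x y] by (simp add: S_def)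
  qed
  have S: "S > 0" using R d \<delta> by (simp add: S_def add_pos_pos)
  \<comment> \<open>The cells used lie in the ball of radius \<open>S\<close>, where |x|^-\<alpha>
    is at least \<open>S\<close>^-\<alpha>; so the Hardy inequality bounds the Lebesgue mass on each
    of them. The norm of L2(mu) would do so only through the values of \<open>W\<close>.\<close>
  define L where "L = S powr \<alpha> * (K * D)"
  have L: "L \<ge> 0" using K D by (simp add: L_def)
  \<comment> \<open>Bounds the averages: a^2 times the volume of a cell, which is at least
    \<open>\<delta>\<close>^d, is at most the mass \<open>L\<close>.\<close>
  define M where "M = sqrt (L / \<delta> ^ DIM('a))"
  define I where "I q = (indicator (Q q) :: 'a \<Rightarrow> real)" for q
  have IL: "I q \<in> L2 \<mu>" for q unfolding I_def by (rule indicator_L2_\<mu>[OF Qm Qfin])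
  define Z where "Z = {\<Sum>q\<in>G. c q *\<^sub>R \<Phi> (I q) | c. \<forall>q\<in>G. \<bar>c q\<bar> \<le> M}"
  have "compact Z" unfolding Z_def by (rule compact_bounded_combinations[OF G])
  have "\<exists>y\<in>Z. dist (\<Phi> v) y \<le> e"
    if vF: "v \<in> F" and vC: "l2_inner \<mu> v v + stable_ext_form \<alpha> v v \<le> C" for v
  proof -
    have vL: "v \<in> L2 \<mu>" and vE: "v \<in> stable_ext_dom \<alpha>" using vF by (auto simp: F_def)
    have vm[measurable]: "v \<in> borel_measurable borel" by (rule L2_\<mu>_measurable[OF vL])
    have "0 \<le> l2_inner \<mu> v v" by (simp add: l2_inner_def)
    then have form: "stable_form \<alpha> v v \<le> D" using vC ext_form_F[OF vF vF] by (simp add: D_def)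
    have hv: "(\<integral>\<^sup>+x. ennreal ((v x)\<^sup>2 * norm x powr - \<alpha>) \<partial>lborel) \<le> ennreal (K * D)"
      using hd[OF vE] form K by (meson ennreal_leI mult_left_mono less_imp_le order_trans)
    have en: "energy \<alpha> v \<le> ennreal (2 * D)"
      unfolding energy_eq_form[OF F_finite_energy[OF vF]] using form by (intro ennreal_leI) simp
    have loc: "(\<integral>\<^sup>+x. ennreal ((v x)\<^sup>2) * indicator (Q q) x \<partial>lborel) \<le> ennreal L" if q: "q \<in> G" for q
    proof -
      have "(\<integral>\<^sup>+x. ennreal ((v x)\<^sup>2) * indicator (Q q) x \<partial>lborel)
          \<le> (\<integral>\<^sup>+x. ennreal (S powr \<alpha>) * ennreal ((v x)\<^sup>2 * norm x powr - \<alpha>) \<partial>lborel)"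
      proof (rule nn_integral_mono_AE, use AE_lborel_nonzero in eventually_elim)
        case (elim x)
        show ?case
        proof (cases "x \<in> Q q")
          case True
          have "1 = norm x powr \<alpha> * norm x powr - \<alpha>" using elim by (simp add: powr_minus)
          also have "\<dots> \<le> S powr \<alpha> * norm x powr - \<alpha>"
            using QS[OF q True] \<alpha>_pos by (intro mult_right_mono powr_mono2) auto
          finally have "(v x)\<^sup>2 * 1 \<le> (v x)\<^sup>2 * (S powr \<alpha> * norm x powr - \<alpha>)" by (intro mult_left_mono) auto
          then have "ennreal ((v x)\<^sup>2) \<le> ennreal (S powr \<alpha> * ((v x)\<^sup>2 * norm x powr - \<alpha>))"
            by (intro ennreal_leI) (simp add: ac_simps)
          also have "\<dots> = ennreal (S powr \<alpha>) * ennreal ((v x)\<^sup>2 * norm x powr - \<alpha>)" by (rule ennreal_mult) auto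
          finally show ?thesis using True by simp
        qed simp
      qed
      also have "\<dots> = ennreal (S powr \<alpha>) * (\<integral>\<^sup>+x. ennreal ((v x)\<^sup>2 * norm x powr - \<alpha>) \<partial>lborel)"
        by (rule nn_integral_cmult) measurable
      also have "\<dots> \<le> ennreal (S powr \<alpha>) * ennreal (K * D)" by (intro mult_left_mono hv) simp
      also have "\<dots> = ennreal L" unfolding L_def using K D by (intro ennreal_mult[symmetric]) auto
      finally show ?thesis .
    qed
    define a where "a q = (LINT x|lborel. v x * indicator (Q q) x) / m q" for q
    have dev: "(\<integral>\<^sup>+x. ennreal ((v x - a q)\<^sup>2) * indicator (Q q) x \<partial>lborel)
        \<le> ennreal (1 / m q) * (\<integral>\<^sup>+x. \<integral>\<^sup>+y. ennreal ((v x - v y)\<^sup>2) * indicator (Q q \<times> Q q) (x, y) \<partial>lborel \<partial>lborel)"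
      and avg: "(a q)\<^sup>2 * m q \<le> enn2real (\<integral>\<^sup>+x. ennreal ((v x)\<^sup>2) * indicator (Q q) x \<partial>lborel)" if q: "q \<in> G" for q
    proof -
      have "(\<integral>\<^sup>+x. ennreal ((v x)\<^sup>2) * indicator (Q q) x \<partial>lborel) < \<infinity>"
        using loc[OF q] by (rule le_less_trans) simp
      note av = average_deviation_le[OF vm Qm mQ m_pos this]
      show "(\<integral>\<^sup>+x. ennreal ((v x - a q)\<^sup>2) * indicator (Q q) x \<partial>lborel)
        \<le> ennreal (1 / m q) * (\<integral>\<^sup>+x. \<integral>\<^sup>+y. ennreal ((v x - v y)\<^sup>2) * indicator (Q q \<times> Q q) (x, y) \<partial>lborel \<partial>lborel)"
        unfolding a_def by (rule av(1))
      show "(a q)\<^sup>2 * m q \<le> enn2real (\<integral>\<^sup>+x. ennreal ((v x)\<^sup>2) * indicator (Q q) x \<partial>lborel)"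
        unfolding a_def by (rule av(2))
    qed
    have aM: "\<bar>a q\<bar> \<le> M" if q: "q \<in> G" for q
    proof -
      have "(a q)\<^sup>2 * \<delta> ^ DIM('a) \<le> (a q)\<^sup>2 * m q" by (intro mult_left_mono m_ge) simp
      also have "\<dots> \<le> enn2real (\<integral>\<^sup>+x. ennreal ((v x)\<^sup>2) * indicator (Q q) x \<partial>lborel)" by (rule avg[OF q])
      also have "\<dots> \<le> enn2real (ennreal L)" by (intro enn2real_mono loc q) simp
      also have "\<dots> = L" using L by simp
      finally have "(a q)\<^sup>2 \<le> L / \<delta> ^ DIM('a)" using \<delta>d by (simp add: pos_le_divide_eq)
      then show ?thesis unfolding M_def by (rule real_le_rsqrt[of "\<bar>a q\<bar>", simplified])
    qed
    define w where "w x = (\<Sum>q\<in>G. a q * I q x)" for x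
    have wL: "w \<in> L2 \<mu>" and \<Phi>w: "\<Phi> w = (\<Sum>q\<in>G. a q *\<^sub>R \<Phi> (I q))"
      unfolding w_def[abs_def] using L2_\<mu>_sum[OF G IL] \<Phi>_sum[OF G IL] by auto
    have w_eq: "w x = a q" if q: "q \<in> G" and x: "x \<in> Q q" for q x
    proof -
      have "w x = (\<Sum>p\<in>G. if p = q then a q else 0)"
        unfolding w_def I_def using disj[OF _ q] x by (intro sum.cong refl) (auto simp: indicator_def)
      then show ?thesis using G q by simp
    qed
    have w_0: "w x = 0" if "\<And>q. q \<in> G \<Longrightarrow> x \<notin> Q q" for x
      unfolding w_def I_def using that by (intro sum.neutral) simp
    \<comment> \<open>On the cells 1 / W is at most 1 and the cell average is subtracted; off the
      cells w vanishes and the point lies outside the ball of radius \<open>R\<close>, where the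
      tail estimate holds.\<close>
    have pt: "ennreal (1 / W x) * ennreal ((v x - w x)\<^sup>2)
        \<le> (\<Sum>q\<in>G. ennreal ((v x - a q)\<^sup>2) * indicator (Q q) x) + ennreal \<eta> * ennreal ((v x)\<^sup>2 * norm x powr - \<alpha>)" for x
    proof (cases "\<exists>q\<in>G. x \<in> Q q")
      case True
      then obtain q where q: "q \<in> G" "x \<in> Q q" by blast
      have "ennreal (1 / W x) * ennreal ((v x - w x)\<^sup>2) \<le> 1 * ennreal ((v x - w x)\<^sup>2)"
        using W_ge_1[of x] by (intro mult_right_mono) (auto simp: divide_le_eq_1)
      also have "\<dots> = (\<Sum>q\<in>{q}. ennreal ((v x - a q)\<^sup>2) * indicator (Q q) x)" using q by (simp add: w_eq)
      also have "\<dots> \<le> (\<Sum>q\<in>G. ennreal ((v x - a q)\<^sup>2) * indicator (Q q) x)"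
        using q G by (intro sum_mono2) auto
      also have "\<dots> \<le> \<dots> + ennreal \<eta> * ennreal ((v x)\<^sup>2 * norm x powr - \<alpha>)" by simp
      finally show ?thesis .
    next
      case False
      then have "R \<le> norm x" using cover[of x] by force
      then have "1 / W x * (v x)\<^sup>2 \<le> \<eta> * norm x powr - \<alpha> * (v x)\<^sup>2" by (intro mult_right_mono tail) auto
      then have "ennreal (1 / W x * (v x)\<^sup>2) \<le> ennreal (\<eta> * ((v x)\<^sup>2 * norm x powr - \<alpha>))"
        by (intro ennreal_leI) (simp add: ac_simps)
      moreover have "ennreal (1 / W x * (v x)\<^sup>2) = ennreal (1 / W x) * ennreal ((v x)\<^sup>2)"
        using W_pos[of x] by (intro ennreal_mult) auto
      moreover have "ennreal (\<eta> * ((v x)\<^sup>2 * norm x powr - \<alpha>)) = ennreal \<eta> * ennreal ((v x)\<^sup>2 * norm x powr - \<alpha>)"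
        using \<eta> by (intro ennreal_mult) auto
      moreover have "w x = 0" using False by (intro w_0) blast
      ultimately show ?thesis by (simp add: add_increasing)
    qed
    have vw: "(\<lambda>x. v x - w x) \<in> L2 \<mu>" by (rule L2_diff[OF vL wL])
    have "ennreal (l2_inner \<mu> (\<lambda>x. v x - w x) (\<lambda>x. v x - w x))
        \<le> (\<integral>\<^sup>+x. (\<Sum>q\<in>G. ennreal ((v x - a q)\<^sup>2) * indicator (Q q) x) + ennreal \<eta> * ennreal ((v x)\<^sup>2 * norm x powr - \<alpha>) \<partial>lborel)"
      unfolding l2_inner_\<mu>_nn[OF vw] by (intro nn_integral_mono pt)
    also have "\<dots> = (\<Sum>q\<in>G. \<integral>\<^sup>+x. ennreal ((v x - a q)\<^sup>2) * indicator (Q q) x \<partial>lborel)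
        + ennreal \<eta> * (\<integral>\<^sup>+x. ennreal ((v x)\<^sup>2 * norm x powr - \<alpha>) \<partial>lborel)"
      by (simp add: nn_integral_add nn_integral_sum nn_integral_cmult)
    also have "\<dots> \<le> ennreal (e\<^sup>2 / 2) + ennreal (e\<^sup>2 / 2)"
    proof (rule add_mono)
      have "(\<Sum>q\<in>G. \<integral>\<^sup>+x. ennreal ((v x - a q)\<^sup>2) * indicator (Q q) x \<partial>lborel)
          \<le> (\<Sum>q\<in>G. ennreal (1 / \<delta> ^ DIM('a)) * (\<integral>\<^sup>+x. \<integral>\<^sup>+y. ennreal ((v x - v y)\<^sup>2) * indicator (Q q \<times> Q q) (x, y) \<partial>lborel \<partial>lborel))"
      proof (rule sum_mono)
        fix q assume q: "q \<in> G"
        have "1 / m q \<le> 1 / \<delta> ^ DIM('a)" by (intro divide_left_mono m_ge mult_pos_pos m_pos \<delta>d) simp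
        then show "(\<integral>\<^sup>+x. ennreal ((v x - a q)\<^sup>2) * indicator (Q q) x \<partial>lborel)
          \<le> ennreal (1 / \<delta> ^ DIM('a)) * (\<integral>\<^sup>+x. \<integral>\<^sup>+y. ennreal ((v x - v y)\<^sup>2) * indicator (Q q \<times> Q q) (x, y) \<partial>lborel \<partial>lborel)"
          using dev[OF q] by (meson ennreal_leI mult_right_mono order_trans zero_le)
      qed
      also have "\<dots> = ennreal (1 / \<delta> ^ DIM('a)) * (\<Sum>q\<in>G. \<integral>\<^sup>+x. \<integral>\<^sup>+y. ennreal ((v x - v y)\<^sup>2) * indicator (Q q \<times> Q q) (x, y) \<partial>lborel \<partial>lborel)"
        by (simp add: sum_distrib_left)
      also have "\<dots> \<le> ennreal (1 / \<delta> ^ DIM('a)) * (ennreal ((d * \<delta>) powr (d + \<alpha>) / c\<^sub>\<alpha>) * ennreal (2 * D))"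
      proof (rule mult_left_mono)
        have "(\<Sum>q\<in>G. \<integral>\<^sup>+x. \<integral>\<^sup>+y. ennreal ((v x - v y)\<^sup>2) * indicator (Q q \<times> Q q) (x, y) \<partial>lborel \<partial>lborel)
            \<le> ennreal ((d * \<delta>) powr (d + \<alpha>) / c\<^sub>\<alpha>) * energy \<alpha> v"
          unfolding d_def
        proof (rule local_energy_bound[OF vm G])
          show "norm (x - y) \<le> real DIM('a) * \<delta>" if "x \<in> Q q" "y \<in> Q q" for q x y
            using diam[OF that] unfolding d_def .
        qed (use disj in auto)
        also have "\<dots> \<le> ennreal ((d * \<delta>) powr (d + \<alpha>) / c\<^sub>\<alpha>) * ennreal (2 * D)"
          by (intro mult_left_mono en) simp
        finally show "(\<Sum>q\<in>G. \<integral>\<^sup>+x. \<integral>\<^sup>+y. ennreal ((v x - v y)\<^sup>2) * indicator (Q q \<times> Q q) (x, y) \<partial>lborel \<partial>lborel)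
            \<le> ennreal ((d * \<delta>) powr (d + \<alpha>) / c\<^sub>\<alpha>) * ennreal (2 * D)" .
      qed simp
      also have "\<dots> = ennreal (1 / \<delta> ^ DIM('a) * ((d * \<delta>) powr (d + \<alpha>) / c\<^sub>\<alpha>) * (2 * D))"
      proof -
        have "0 \<le> 1 / \<delta> ^ DIM('a)" "0 \<le> (d * \<delta>) powr (d + \<alpha>) / c\<^sub>\<alpha>" "0 \<le> 2 * D"
          using \<delta>d c_pos D by auto
        then show ?thesis by (simp only: ennreal_mult mult_nonneg_nonneg mult.assoc)
      qed
      also have "\<dots> \<le> ennreal (e\<^sup>2 / 2)" by (rule ennreal_leI[OF \<delta>small])
      finally show "(\<Sum>q\<in>G. \<integral>\<^sup>+x. ennreal ((v x - a q)\<^sup>2) * indicator (Q q) x \<partial>lborel) \<le> ennreal (e\<^sup>2 / 2)" .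
      have "ennreal \<eta> * (\<integral>\<^sup>+x. ennreal ((v x)\<^sup>2 * norm x powr - \<alpha>) \<partial>lborel) \<le> ennreal \<eta> * ennreal (K * D)"
        by (intro mult_left_mono hv) simp
      also have "\<dots> = ennreal (\<eta> * (K * D))" using \<eta> K D by (intro ennreal_mult[symmetric]) auto
      also have "\<dots> \<le> ennreal (e\<^sup>2 / 2)" by (rule ennreal_leI[OF \<eta>K])
      finally show "ennreal \<eta> * (\<integral>\<^sup>+x. ennreal ((v x)\<^sup>2 * norm x powr - \<alpha>) \<partial>lborel) \<le> ennreal (e\<^sup>2 / 2)" .
    qed
    also have "\<dots> = ennreal (e\<^sup>2)" by (subst ennreal_plus[symmetric]) auto
    finally have "l2_inner \<mu> (\<lambda>x. v x - w x) (\<lambda>x. v x - w x) \<le> e\<^sup>2" by (subst (asm) ennreal_le_iff) auto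
    then have "(dist (\<Phi> v) (\<Phi> w))\<^sup>2 \<le> e\<^sup>2"
      using \<Phi>_inner[OF vw vw] by (simp add: dist_norm power2_norm_eq_inner \<Phi>_diff[OF vL wL])
    then have "dist (\<Phi> v) (\<Phi> w) \<le> e" by (rule power2_le_imp_le) (use e in simp)
    moreover have "\<Phi> w \<in> Z" unfolding \<Phi>w Z_def using aM by (intro CollectI exI[of _ a]) simp
    ultimately show ?thesis by (rule bexI)
  qed
  then have "\<forall>x\<in>\<Phi> ` {f \<in> F. l2_inner \<mu> f f + stable_ext_form \<alpha> f f \<le> C}. \<exists>y\<in>Z. dist x y \<le> e" by auto
  with \<open>compact Z\<close> show "\<exists>Z. compact Z \<and> (\<forall>x\<in>\<Phi> ` {f \<in> F. l2_inner \<mu> f f + stable_ext_form \<alpha> f f \<le> C}. \<exists>y\<in>Z. dist x y \<le> e)"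
    by (intro exI[of _ Z] conjI)
qed

subsection \<open>Failure of compactness\<close>

text \<open>A hat function of |x| centred at 3 2^n with half-width 2^n: it lives in
  \<open>shell (2 ^ Suc n)\<close>, so distinct bumps have disjoint supports, and its Lipschitz
  constant is at most 2^-n.\<close>

definition annular_bump :: "nat \<Rightarrow> 'a \<Rightarrow> real" where
  "annular_bump n x = max 0 (1 - \<bar>norm x - 3 * 2 ^ n\<bar> / 2 ^ n)"

lemma annular_bump_measurable [measurable]: "annular_bump n \<in> borel_measurable borel"
  unfolding annular_bump_def by measurable

lemma annular_bump_support:
  assumes "annular_bump n x \<noteq> 0"
  shows "x \<in> shell (2 ^ Suc n)"
proof -
  have "\<bar>norm x - 3 * 2 ^ n\<bar> / 2 ^ n < 1" using assms by (auto simp: annular_bump_def max_def split: if_splits)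
  then have "\<bar>norm x - 3 * 2 ^ n\<bar> < 2 ^ n" by (simp add: divide_less_eq)
  then show ?thesis by (auto simp: shell_def abs_less_iff)
qed

lemma
  shows annular_bump_stable_dom: "annular_bump n \<in> stable_dom \<alpha>"
    and annular_bump_energy: "energy \<alpha> (annular_bump n) \<le>
      ennreal (8 * (2 ^ n) powr - \<alpha> * levy_mass) * emeasure lborel (shell (2 ^ Suc n) :: 'a set)"
proof -
  have b: "\<bar>annular_bump n x\<bar> \<le> 1" for x by (simp add: annular_bump_def max_def)
  have l: "\<bar>annular_bump n x - annular_bump n y\<bar> \<le> norm (x - y) / 2 ^ n" for x y
  proof -
    have max: "\<bar>max 0 s - max 0 t\<bar> \<le> \<bar>s - t\<bar>" for s t :: real by (auto simp: max_def)
    have "\<bar>annular_bump n x - annular_bump n y\<bar> \<le> \<bar>\<bar>norm y - 3 * 2 ^ n\<bar> / 2 ^ n - \<bar>norm x - 3 * 2 ^ n\<bar> / 2 ^ n\<bar>"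
      unfolding annular_bump_def by (rule order_trans[OF max]) simp
    also have "\<dots> = \<bar>\<bar>norm y - 3 * 2 ^ n\<bar> - \<bar>norm x - 3 * 2 ^ n\<bar>\<bar> / 2 ^ n" by (simp add: diff_divide_distrib[symmetric])
    also have "\<dots> \<le> norm (x - y) / 2 ^ n"
      using norm_triangle_ineq3[of x y] by (intro divide_right_mono) auto
    finally show ?thesis .
  qed
  have s: "annular_bump n x = 0" if "x \<notin> shell (2 ^ Suc n)" for x using annular_bump_support that by blast
  show "annular_bump n \<in> stable_dom \<alpha>"
    by (rule bump_stable_dom[OF _ _ b l bounded_shell _ s]) auto
  show "energy \<alpha> (annular_bump n) \<le>
      ennreal (8 * (2 ^ n) powr - \<alpha> * levy_mass) * emeasure lborel (shell (2 ^ Suc n) :: 'a set)"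
    by (rule bump_energy_le[OF _ _ b l _ s]) auto
qed

text \<open>The volume of the shell grows like 2^(n d), while the energy per volume at length scale
  2^n is of order 2^(-n \<alpha>).\<close>

lemma annular_bump_form_le:
  "\<exists>A. \<forall>n. stable_form \<alpha> (annular_bump n) (annular_bump n) \<le> A * ((2 ^ n) ^ DIM('a) * (2 ^ n) powr - \<alpha>)"
proof -
  define v where "v = shell_volume TYPE('a)"
  have v: "v > 0" unfolding v_def by (rule shell_volume_pos)
  have lm: "levy_mass \<ge> 0" by (simp add: levy_mass_def)
  have "stable_form \<alpha> (annular_bump n) (annular_bump n) \<le> (4 * levy_mass * 2 ^ DIM('a) * v) * ((2 ^ n) ^ DIM('a) * (2 ^ n) powr - \<alpha>)" for n
  proof -
    have fin: "annular_bump n \<in> finite_energy \<alpha>" using annular_bump_stable_dom by (simp add: stable_dom_iff)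
    have "ennreal (2 * stable_form \<alpha> (annular_bump n) (annular_bump n))
        \<le> ennreal (8 * (2 ^ n) powr - \<alpha> * levy_mass) * ennreal ((2 ^ Suc n) ^ DIM('a) * v)"
      using annular_bump_energy[of n] unfolding energy_eq_form[OF fin] v_def
      by (subst (asm) emeasure_shell) simp_all
    also have "\<dots> = ennreal ((8 * (2 ^ n) powr - \<alpha> * levy_mass) * ((2 ^ Suc n) ^ DIM('a) * v))"
      using lm v by (intro ennreal_mult[symmetric]) auto
    finally have "2 * stable_form \<alpha> (annular_bump n) (annular_bump n) \<le> (8 * (2 ^ n) powr - \<alpha> * levy_mass) * ((2 ^ Suc n) ^ DIM('a) * v)"
      using lm v by (subst (asm) ennreal_le_iff) auto
    also have "\<dots> = 2 * ((4 * levy_mass * 2 ^ DIM('a) * v) * ((2 ^ n) ^ DIM('a) * (2 ^ n) powr - \<alpha>))"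
      by (simp add: power_mult_distrib)
    finally show ?thesis by (simp only: mult_le_cancel_left_pos zero_less_numeral)
  qed
  then show ?thesis by blast
qed

text \<open>Growth of \<open>W\<close> of order at most \<alpha> costs the mass the factor 2^(-n
  \<alpha>), exactly the one by which the energy decays; this balance keeps the normalised bumps
  bounded in energy.\<close>

lemma annular_bump_norm_ge:
  assumes W: "\<And>x. W x \<le> C * (1 + norm x) powr \<alpha>"
  shows "\<exists>B>0. \<forall>n. B * ((2 ^ n) ^ DIM('a) * (2 ^ n) powr - \<alpha>) \<le> l2_inner \<mu> (annular_bump n) (annular_bump n)"
proof -
  obtain b :: 'a where b: "b \<in> Basis" using nonempty_Basis by blast
  define u where "u = unit_ball_vol (real DIM('a))"
  have u: "u > 0" by (simp add: u_def)
  have C: "C > 0" using W[of 0] W_ge_1[of 0] by simp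
  define B where "B = (1 / 4) * (u * (1 / 2) ^ DIM('a)) / (C * 5 powr \<alpha>)"
  have B: "B > 0" using u C by (simp add: B_def)
  have "B * ((2 ^ n) ^ DIM('a) * (2 ^ n) powr - \<alpha>) \<le> l2_inner \<mu> (annular_bump n) (annular_bump n)" for n
  proof -
    define r :: real where "r = 2 ^ n"
    have r: "r \<ge> 1" by (simp add: r_def)
    \<comment> \<open>A ball of radius r / 2 around a point of norm 3 r: there the bump is at least
      1/2 and 1 + |x| is at most 5 r.\<close>
    define U where "U = ball ((3 * r) *\<^sub>R b) (r / 2)"
    have L: "annular_bump n \<in> L2 \<mu>" using stable_dom_subset_F[OF annular_bump_stable_dom] by (simp add: F_def)
    have low: "1 / (C * (5 * r) powr \<alpha>) * (1 / 4) \<le> 1 / W x * (annular_bump n x)\<^sup>2" if "x \<in> U" for x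
    proof (rule mult_mono)
      have "norm (x - (3 * r) *\<^sub>R b) < r / 2" using that by (simp add: U_def dist_norm norm_minus_commute)
      moreover have nb: "norm ((3 * r) *\<^sub>R b) = 3 * r" using b r by simp
      have "\<bar>norm x - 3 * r\<bar> \<le> norm (x - (3 * r) *\<^sub>R b)"
        using norm_triangle_ineq3[of x "(3 * r) *\<^sub>R b"] unfolding nb .
      ultimately have nx: "\<bar>norm x - 3 * r\<bar> \<le> r / 2" by linarith
      then have "1 + norm x \<le> 5 * r" using r by linarith
      then have "(1 + norm x) powr \<alpha> \<le> (5 * r) powr \<alpha>" using \<alpha>_pos by (intro powr_mono2) auto
      then have "W x \<le> C * (5 * r) powr \<alpha>" using W[of x] C by (meson mult_left_mono less_imp_le order_trans)
      then show "1 / (C * (5 * r) powr \<alpha>) \<le> 1 / W x"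
        using W_pos[of x] C r by (intro divide_left_mono mult_pos_pos) auto
      have "\<bar>norm x - 3 * r\<bar> / r \<le> 1 / 2" using nx r by (simp add: divide_le_eq)
      then have "1 / 2 \<le> 1 - \<bar>norm x - 3 * r\<bar> / r" by linarith
      then have "1 / 2 \<le> annular_bump n x"
        unfolding annular_bump_def r_def[symmetric] by (rule order_trans[OF _ max.cobounded2])
      then have "(1 / 2)\<^sup>2 \<le> (annular_bump n x)\<^sup>2" by (intro power_mono) auto
      then show "1 / 4 \<le> (annular_bump n x)\<^sup>2" by (simp add: power2_eq_square)
    qed (use W_pos[of x] in auto)
    define k where "k = 1 / (C * (5 * r) powr \<alpha>) * (1 / 4)"
    have k: "k \<ge> 0" using C by (simp add: k_def)
    have "ennreal k * emeasure lborel U = (\<integral>\<^sup>+x. ennreal k * indicator U x \<partial>lborel)"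
      by (subst nn_integral_cmult_indicator) (simp_all add: U_def)
    also have "\<dots> \<le> ennreal (l2_inner \<mu> (annular_bump n) (annular_bump n))"
      unfolding l2_inner_\<mu>_nn[OF L]
    proof (rule nn_integral_mono)
      fix x
      show "ennreal k * indicator U x \<le> ennreal (1 / W x) * ennreal ((annular_bump n x)\<^sup>2)"
      proof (cases "x \<in> U")
        case True
        have "ennreal k \<le> ennreal (1 / W x * (annular_bump n x)\<^sup>2)"
          unfolding k_def by (rule ennreal_leI[OF low[OF True]])
        also have "\<dots> = ennreal (1 / W x) * ennreal ((annular_bump n x)\<^sup>2)"
          using W_pos[of x] by (intro ennreal_mult) auto
        finally show ?thesis using True by simp
      qed simp
    qed
    also have "emeasure lborel U = ennreal (u * (r / 2) ^ DIM('a))"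
      unfolding U_def u_def using r by (subst emeasure_ball) simp_all
    finally have "ennreal (k * (u * (r / 2) ^ DIM('a))) \<le> ennreal (l2_inner \<mu> (annular_bump n) (annular_bump n))"
      using k u r by (subst ennreal_mult) auto
    then have "k * (u * (r / 2) ^ DIM('a)) \<le> l2_inner \<mu> (annular_bump n) (annular_bump n)"
      by (subst (asm) ennreal_le_iff) (simp_all add: l2_inner_def)
    moreover have "k * (u * (r / 2) ^ DIM('a)) = B * (r ^ DIM('a) * r powr - \<alpha>)"
    proof -
      have "(5 * r) powr \<alpha> = 5 powr \<alpha> * r powr \<alpha>" using r by (simp add: powr_mult)
      moreover have "r powr - \<alpha> = 1 / r powr \<alpha>" by (simp add: powr_minus divide_inverse)
      moreover have "(r / 2) ^ DIM('a) = r ^ DIM('a) * (1 / 2) ^ DIM('a)" by (simp add: power_divide)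
      ultimately show ?thesis unfolding k_def B_def by (simp only: times_divide_eq_left times_divide_eq_right divide_divide_eq_left mult_1_left mult_1_right ac_simps)
    qed
    ultimately show ?thesis by (simp add: r_def)
  qed
  then show ?thesis using B by blast
qed

theorem not_compact:
  assumes sup: "(SUP x. ennreal (W x / (1 + norm x) powr \<alpha>)) < \<infinity>"
    and P: "generates_semigroup \<mu> (form_generator \<mu> F (stable_ext_form \<alpha>)) P"
  shows "\<not> compact_semigroup \<mu> P \<and> \<not> has_compact_resolvent \<mu> (form_generator \<mu> F (stable_ext_form \<alpha>))"
proof -
  define C where "C = enn2real (SUP x. ennreal (W x / (1 + norm x) powr \<alpha>))"
  have "W x \<le> C * (1 + norm x) powr \<alpha>" for x
  proof -
    have "ennreal (W x / (1 + norm x) powr \<alpha>) \<le> (SUP x. ennreal (W x / (1 + norm x) powr \<alpha>))"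
      by (intro SUP_upper) simp
    also have "\<dots> = ennreal C" using sup by (simp add: C_def)
    finally have "W x / (1 + norm x) powr \<alpha> \<le> C" by (subst (asm) ennreal_le_iff) (simp_all add: C_def)
    moreover have "(1 + norm x) powr \<alpha> > 0" by (simp add: add_pos_nonneg less_imp_neq[THEN not_sym])
    ultimately show ?thesis by (simp add: pos_divide_le_eq)
  qed
  then obtain B where B: "B > 0" and lower: "\<And>n. B * ((2 ^ n) ^ DIM('a) * (2 ^ n) powr - \<alpha>) \<le> l2_inner \<mu> (annular_bump n) (annular_bump n)"
    using annular_bump_norm_ge by blast
  obtain A where upper: "\<And>n. stable_form \<alpha> (annular_bump n) (annular_bump n) \<le> A * ((2 ^ n) ^ DIM('a) * (2 ^ n) powr - \<alpha>)"
    using annular_bump_form_le by blast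
  define N where "N n = l2_inner \<mu> (annular_bump n) (annular_bump n)" for n
  \<comment> \<open>The common scale 2^(n (d - \<alpha>)) of mass and energy, which cancels and
    leaves the bound A / B.\<close>
  define t where "t n = ((2::real) ^ n) ^ DIM('a) * (2 ^ n) powr - \<alpha>" for n
  have t: "t n > 0" for n by (simp add: t_def)
  have N: "N n > 0" for n
    using lower[of n] mult_pos_pos[OF B t[of n]] by (simp add: N_def t_def)
  define g where "g n x = (1 / sqrt (N n)) * annular_bump n x" for n x
  have bF: "annular_bump n \<in> F" for n by (rule stable_dom_subset_F[OF annular_bump_stable_dom])
  have gF: "g n \<in> F" for n using F_lincomb[OF bF[of n] bF[of n], of "1 / sqrt (N n)" 0] by (simp add: g_def[abs_def])
  have sq: "1 / sqrt (N n) * (1 / sqrt (N n)) = 1 / N n" for n using N[of n] by simp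
  show ?thesis
  proof (rule not_compact_if_orthonormal[of g "A / B", OF gF _ _ _ P])
    show "l2_inner \<mu> (g n) (g n) = 1" for n
    proof -
      have "g n x * g n x = (1 / N n) * (annular_bump n x * annular_bump n x)" for x
        unfolding g_def sq[symmetric] by (simp only: ac_simps)
      then have "l2_inner \<mu> (g n) (g n) = (1 / N n) * N n"
        unfolding l2_inner_def N_def by simp
      then show ?thesis using N[of n] by simp
    qed
    show "l2_inner \<mu> (g i) (g j) = 0" if "i \<noteq> j" for i j
    proof -
      have "Suc i \<noteq> Suc j" using that by simp
      then have "shell (2 ^ Suc i) \<inter> shell (2 ^ Suc j) = ({} :: 'a set)"
        using shell_disjoint[of 1 "Suc i" "Suc j"] by simp
      then have "annular_bump i x * annular_bump j x = 0" for x
        using annular_bump_support[of i x] annular_bump_support[of j x] by fastforce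
      then have "(\<lambda>x. g i x * g j x) = (\<lambda>x. 0)" by (simp add: g_def fun_eq_iff)
      then show ?thesis unfolding l2_inner_def by simp
    qed
    show "stable_ext_form \<alpha> (g n) (g n) \<le> A / B" for n
    proof -
      have fe: "annular_bump n \<in> finite_energy \<alpha>" "g n \<in> finite_energy \<alpha>" using F_finite_energy bF gF by auto
      have left: "stable_form \<alpha> (g n) h = 1 / sqrt (N n) * stable_form \<alpha> (annular_bump n) h" if "h \<in> finite_energy \<alpha>" for h
        using stable_form_lincomb[OF fe(1,1) that, of "1 / sqrt (N n)" 0] by (simp add: g_def[abs_def])
      have "stable_form \<alpha> (g n) (g n) = 1 / sqrt (N n) * (1 / sqrt (N n) * stable_form \<alpha> (annular_bump n) (annular_bump n))"
        unfolding left[OF fe(2)] stable_form_sym[of "annular_bump n" "g n"] left[OF fe(1)] ..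
      also have "\<dots> = (1 / N n) * stable_form \<alpha> (annular_bump n) (annular_bump n)"
        unfolding sq[symmetric] by (simp only: mult.assoc)
      also have "\<dots> \<le> (1 / N n) * (A * t n)" using upper[of n] N[of n] by (intro mult_left_mono) (auto simp: t_def)
      also have "\<dots> \<le> A / B"
      proof -
        have A: "0 \<le> A * t n" using order_trans[OF stable_form_nonneg upper[of n]] by (simp add: t_def)
        have "A * t n * B \<le> A * N n"
        proof -
          have "A \<ge> 0" using A t[of n] by (simp add: zero_le_mult_iff)
          then have "A * (B * t n) \<le> A * N n" using lower[of n] by (intro mult_left_mono) (auto simp: N_def t_def)
          then show ?thesis by (simp add: ac_simps)
        qed
        then show ?thesis using N[of n] B by (simp add: field_simps)
      qed
      finally show ?thesis by (simp add: ext_form_F gF)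
    qed
  qed
qed

end

theorem theorem2p2:
  fixes \<alpha> :: real and W :: "real ^ 'n \<Rightarrow> real"
  assumes "0 < \<alpha>" and "\<alpha> < 2" and "\<alpha> < real CARD('n)"
    and "W \<in> borel_measurable borel" and "\<And>x. 1 \<le> W x"
  defines "\<mu> \<equiv> weighted_measure W"
    and "L \<equiv> time_changed_operator \<alpha> W"
  shows "(\<exists>P. generates_semigroup \<mu> L P) \<and>
    (\<forall>P. generates_semigroup \<mu> L P \<longrightarrow>
      (\<forall>c1>0. \<forall>c2>0.
         (Psi1 \<alpha> W \<longlongrightarrow> 0) at_top \<and>
         (\<forall>\<^sub>F s in at_top.
            (\<integral>\<^sup>+ r\<in>{s..}. (rate_inverse (beta0 \<alpha> W c1 c2) (ennreal r) / ennreal r) \<partial>lborel) < \<infinity>)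
         \<longrightarrow> compact_semigroup \<mu> P \<and> has_compact_resolvent \<mu> L) \<and>
      ((SUP x. ennreal (W x / (1 + norm x) powr \<alpha>)) < \<infinity>
         \<longrightarrow> \<not> compact_semigroup \<mu> P \<and> \<not> has_compact_resolvent \<mu> L))"
proof -
  interpret S: weighted_stable \<alpha> "TYPE(real ^ 'n)" W
  proof
    show "0 < \<alpha>" "\<alpha> < 2" "W \<in> borel_measurable borel" by fact+
    show "\<alpha> < real DIM(real ^ 'n)" using assms(3) by simp
    show "1 \<le> W x" for x by fact
  qed
  have \<mu>: "\<mu> = S.\<mu>" and L: "L = form_generator S.\<mu> S.F (stable_ext_form \<alpha>)"
    by (simp_all add: \<mu>_def S.\<mu>_def L_def S.time_changed_operator_eq)
  show ?thesis
    unfolding \<mu> L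
  proof (intro conjI allI impI)
    show "\<exists>P. generates_semigroup S.\<mu> (form_generator S.\<mu> S.F (stable_ext_form \<alpha>)) P"
      by (rule S.semigroup_exists)
    fix P assume P: "generates_semigroup S.\<mu> (form_generator S.\<mu> S.F (stable_ext_form \<alpha>)) P"
    show "compact_semigroup S.\<mu> P" "has_compact_resolvent S.\<mu> (form_generator S.\<mu> S.F (stable_ext_form \<alpha>))"
      if "(Psi1 \<alpha> W \<longlongrightarrow> 0) at_top \<and> R" for R
      using S.compact_if_compactly_embedded[OF S.compact_embedding P] that by auto
    show "\<not> compact_semigroup S.\<mu> P" "\<not> has_compact_resolvent S.\<mu> (form_generator S.\<mu> S.F (stable_ext_form \<alpha>))"
      if "(SUP x. ennreal (W x / (1 + norm x) powr \<alpha>)) < \<infinity>"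
      using S.not_compact[OF that P] by auto
  qed
qed

end
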